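(* Fix $\hbar>0$ and $\beta\in\mathbb{R}$. If the bounded plane domain $D$ has rotational symmetry of order greater than or equal to $3$, then $$\sum_{j=1}^{n}\lambda_j\Big(T(D),\frac{\sqrt{2}}{\lVert T^{-1}\rVert_{HS}}\hbar,\frac{\sqrt{2}}{\lVert T^{-1}\rVert_{HS}}\frac{\beta}{|\det T|}\Big)\le\sum_{j=1}^{n}\lambda_j(D,\hbar,\beta)$$ for each $n\ge 1$ and each invertible linear transformation $T$ of $\mathbb{R}^2$. Equality holds if $T$ is a scalar multiple of an orthogonal transformation. If $\beta\neq 0$, equality holds for the first eigenvalue ($n=1$) if and only if $T$ is a scalar multiple of an orthogonal transformation. If in addition $D$ has Lipschitz boundary, the same results hold with the Dirichlet eigenvalues $\lambda_j$ replaced throughout by the Neumann eigenvalues $\mu_j$.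
   Context: A plane domain has rotational symmetry of order $N$ if it is mapped onto itself by rotation through angle $2\pi/N$ about some point. The Hilbert--Schmidt norm of a matrix $M$ is $\lVert M\rVert_{HS}=\big(\sum_{j,k}|M_{jk}|^2\big)^{1/2}$. For a bounded plane domain $\Omega$, $\hbar>0$ and $\beta\in\mathbb{R}$, let $F(x)=\frac{\beta}{2}(-x_2,x_1)$ (a vector potential for the constant transverse magnetic field $\nabla\times F=(0,0,\beta)$), and define the Rayleigh quotient $$R[u]=\frac{\int_\Omega|(i\hbar\nabla+F)u|^2\,dx}{\int_\Omega|u|^2\,dx},\qquad u\not\equiv 0.$$ The Dirichlet eigenvalues $\lambda_1(\Omega,\hbar,\beta)\le\lambda_2(\Omega,\hbar,\beta)\le\dots\to\infty$ are those determined from $R$ with trial functions $u\in H^1_0(\Omega;\mathbb{C})$ by the usual minimax principle, i.e. $\lambda_j=\min_{S}\max_{u\in S\setminus\{0\}}R[u]$, with $S$ ranging over $j$-dimensional complex subspaces of the trial space. When $\Omega$ has Lipschitz boundary, the Neumann eigenvalues $\mu_j(\Omega,\hbar,\beta)$ are defined in the same way with trial space $H^1(\Omega;\mathbb{C})$. *)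

theory Defs
  imports "HOL-Analysis.Analysis"
begin

section \<open>Plane geometry\<close>

definition plane_domain :: "(real^2) set \<Rightarrow> bool" where
  "plane_domain \<Omega> \<longleftrightarrow> open \<Omega> \<and> connected \<Omega> \<and> \<Omega> \<noteq> {}"

definition rotation_about :: "real^2 \<Rightarrow> real \<Rightarrow> real^2 \<Rightarrow> real^2" where
  "rotation_about p \<theta> x =
     p + vector [cos \<theta> * (x - p)$1 - sin \<theta> * (x - p)$2,
                 sin \<theta> * (x - p)$1 + cos \<theta> * (x - p)$2]"

definition rotational_symmetry :: "(real^2) set \<Rightarrow> nat \<Rightarrow> bool" where
  "rotational_symmetry \<Omega> N \<longleftrightarrow> (\<exists>p. rotation_about p (2 * pi / real N) ` \<Omega> = \<Omega>)"

definition hs_norm :: "real^'n^'m \<Rightarrow> real" where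
  "hs_norm M = sqrt (\<Sum>j\<in>UNIV. \<Sum>k\<in>UNIV. \<bar>M$j$k\<bar>\<^sup>2)"

definition scalar_multiple_of_orthogonal :: "(real^2 \<Rightarrow> real^2) \<Rightarrow> bool" where
  "scalar_multiple_of_orthogonal T \<longleftrightarrow>
     (\<exists>c Q. orthogonal_transformation Q \<and> T = (\<lambda>x. c *\<^sub>R Q x))"

text \<open>Near each boundary point, after a rigid change of coordinates, the domain is the part of a
  ball lying strictly above the graph of a Lipschitz function.\<close>

definition lipschitz_boundary :: "(real^2) set \<Rightarrow> bool" where
  "lipschitz_boundary \<Omega> \<longleftrightarrow>
     (\<forall>p\<in>frontier \<Omega>. \<exists>r>0. \<exists>(Q :: real^2 \<Rightarrow> real^2) (\<gamma> :: real \<Rightarrow> real) L.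
        orthogonal_transformation Q \<and> L-lipschitz_on UNIV \<gamma> \<and>
        \<Omega> \<inter> ball p r = {x \<in> ball p r. \<gamma> (Q (x - p) $ 1) < Q (x - p) $ 2})"

section \<open>Sobolev spaces\<close>

text \<open>Functions on \<open>\<Omega>\<close> are total functions on the plane; only their values almost everywhere on
  \<open>\<Omega>\<close> matter below, except for test functions, which vanish identically outside \<open>\<Omega>\<close>.\<close>

primrec C_k :: "nat \<Rightarrow> ('a::real_normed_vector \<Rightarrow> 'b::real_normed_vector) \<Rightarrow> bool" where
  "C_k 0 f \<longleftrightarrow> continuous_on UNIV f"
| "C_k (Suc n) f \<longleftrightarrow>
     (\<exists>f'. (\<forall>x. (f has_derivative f' x) (at x)) \<and> (\<forall>v. C_k n (\<lambda>x. f' x v)))"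

definition test_function :: "(real^2) set \<Rightarrow> (real^2 \<Rightarrow> complex) \<Rightarrow> bool" where
  "test_function \<Omega> \<phi> \<longleftrightarrow>
     (\<forall>n. C_k n \<phi>) \<and> compact (closure {x. \<phi> x \<noteq> 0}) \<and> closure {x. \<phi> x \<noteq> 0} \<subseteq> \<Omega>"

definition L2 :: "(real^2) set \<Rightarrow> (real^2 \<Rightarrow> 'b::euclidean_space) \<Rightarrow> bool" where
  "L2 \<Omega> f \<longleftrightarrow> f \<in> borel_measurable (lebesgue_on \<Omega>) \<and>
     integrable (lebesgue_on \<Omega>) (\<lambda>x. (norm (f x))\<^sup>2)"

definition is_weak_gradient ::
    "(real^2) set \<Rightarrow> (real^2 \<Rightarrow> complex) \<Rightarrow> (real^2 \<Rightarrow> complex^2) \<Rightarrow> bool" where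
  "is_weak_gradient \<Omega> u g \<longleftrightarrow> L2 \<Omega> g \<and>
     (\<forall>\<phi> k. test_function \<Omega> \<phi> \<longrightarrow>
        (\<integral>x. u x * frechet_derivative \<phi> (at x) (axis k 1) \<partial>lebesgue_on \<Omega>)
          = - (\<integral>x. g x $ k * \<phi> x \<partial>lebesgue_on \<Omega>))"

definition H1 :: "(real^2) set \<Rightarrow> (real^2 \<Rightarrow> complex) set" where
  "H1 \<Omega> = {u. L2 \<Omega> u \<and> (\<exists>g. is_weak_gradient \<Omega> u g)}"

text \<open>For \<open>u \<in> H1 \<Omega>\<close> the weak gradient is determined up to null sets, so the choice below does not
  affect any of the integrals in which it occurs.\<close>

definition weak_gradient :: "(real^2) set \<Rightarrow> (real^2 \<Rightarrow> complex) \<Rightarrow> real^2 \<Rightarrow> complex^2" where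
  "weak_gradient \<Omega> u = (SOME g. is_weak_gradient \<Omega> u g)"

definition H1_norm :: "(real^2) set \<Rightarrow> (real^2 \<Rightarrow> complex) \<Rightarrow> real" where
  "H1_norm \<Omega> u = sqrt ((\<integral>x. (norm (u x))\<^sup>2 \<partial>lebesgue_on \<Omega>)
                     + (\<integral>x. (norm (weak_gradient \<Omega> u x))\<^sup>2 \<partial>lebesgue_on \<Omega>))"

definition H1_0 :: "(real^2) set \<Rightarrow> (real^2 \<Rightarrow> complex) set" where
  "H1_0 \<Omega> = {u \<in> H1 \<Omega>. \<exists>\<phi>. (\<forall>n. test_function \<Omega> (\<phi> n)) \<and>
                 (\<lambda>n::nat. H1_norm \<Omega> (\<lambda>x. u x - \<phi> n x)) \<longlonglongrightarrow> 0}"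

section \<open>Eigenvalues of the magnetic Laplacian\<close>

definition vector_potential :: "real \<Rightarrow> real^2 \<Rightarrow> real^2" where
  "vector_potential \<beta> x = (\<beta> / 2) *\<^sub>R vector [- (x$2), x$1]"

definition magnetic_gradient ::
    "(real^2) set \<Rightarrow> real \<Rightarrow> real \<Rightarrow> (real^2 \<Rightarrow> complex) \<Rightarrow> real^2 \<Rightarrow> complex^2" where
  "magnetic_gradient \<Omega> h \<beta> u x =
     (\<chi> k. \<i> * of_real h * weak_gradient \<Omega> u x $ k + of_real (vector_potential \<beta> x $ k) * u x)"

definition rayleigh :: "(real^2) set \<Rightarrow> real \<Rightarrow> real \<Rightarrow> (real^2 \<Rightarrow> complex) \<Rightarrow> real" where
  "rayleigh \<Omega> h \<beta> u =
     (\<integral>x. (norm (magnetic_gradient \<Omega> h \<beta> u x))\<^sup>2 \<partial>lebesgue_on \<Omega>)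
       / (\<integral>x. (norm (u x))\<^sup>2 \<partial>lebesgue_on \<Omega>)"

definition ae_zero :: "(real^2) set \<Rightarrow> (real^2 \<Rightarrow> complex) \<Rightarrow> bool" where
  "ae_zero \<Omega> u \<longleftrightarrow> (AE x in lebesgue_on \<Omega>. u x = 0)"

text \<open>\<open>S\<close> is the set of complex linear combinations of \<open>j\<close> representatives whose classes modulo
  equality almost everywhere on \<open>\<Omega>\<close> are linearly independent; thus \<open>S\<close> represents a
  \<open>j\<close>-dimensional subspace of the trial space \<open>V\<close>, and every such subspace is so represented.\<close>

definition trial_subspace ::
    "(real^2) set \<Rightarrow> (real^2 \<Rightarrow> complex) set \<Rightarrow> nat \<Rightarrow> (real^2 \<Rightarrow> complex) set \<Rightarrow> bool" where
  "trial_subspace \<Omega> V j S \<longleftrightarrow>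
     (\<exists>u :: nat \<Rightarrow> real^2 \<Rightarrow> complex.
        (\<forall>k<j. u k \<in> V) \<and>
        (\<forall>c :: nat \<Rightarrow> complex. ae_zero \<Omega> (\<lambda>x. \<Sum>k<j. c k * u k x) \<longrightarrow> (\<forall>k<j. c k = 0)) \<and>
        S = {\<lambda>x. \<Sum>k<j. c k * u k x | c :: nat \<Rightarrow> complex. True})"

text \<open>Infimum and supremum agree with minimum and maximum whenever these exist; the supremum over
  a nonzero finite-dimensional subspace is always attained.  Eigenvalues are indexed from \<open>j = 1\<close>.\<close>

definition minimax_eigenvalue ::
    "(real^2) set \<Rightarrow> (real^2 \<Rightarrow> complex) set \<Rightarrow> real \<Rightarrow> real \<Rightarrow> nat \<Rightarrow> real" where
  "minimax_eigenvalue \<Omega> V h \<beta> j =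
     (INF S \<in> {S. trial_subspace \<Omega> V j S}. SUP u \<in> {u \<in> S. \<not> ae_zero \<Omega> u}. rayleigh \<Omega> h \<beta> u)"

definition dirichlet_eigenvalue :: "(real^2) set \<Rightarrow> real \<Rightarrow> real \<Rightarrow> nat \<Rightarrow> real" where
  "dirichlet_eigenvalue \<Omega> h \<beta> j = minimax_eigenvalue \<Omega> (H1_0 \<Omega>) h \<beta> j"

definition neumann_eigenvalue :: "(real^2) set \<Rightarrow> real \<Rightarrow> real \<Rightarrow> nat \<Rightarrow> real" where
  "neumann_eigenvalue \<Omega> h \<beta> j = minimax_eigenvalue \<Omega> (H1 \<Omega>) h \<beta> j"

end

theory Submission
  imports Defs
begin

text \<open>Move the centre of symmetry to the origin. The substitution \<open>y = T x\<close>, combined with a gauge transformation and,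
  if \<open>det T < 0\<close>, a complex conjugation, turns the Rayleigh quotient on \<open>T D\<close> into one on \<open>D\<close> for the form
  \<open>\<integral> A z \<cdot> z\<close>, where \<open>z\<close> is the magnetic gradient and \<open>A\<close> is a multiple of \<open>T\<^sup>-\<^sup>1 (T\<^sup>-\<^sup>1)\<^sup>T\<close> normalized to have trace 2.
  Averaging this form over the rotations of \<open>D\<close> replaces \<open>A\<close> by the identity. Since the sum of the first \<open>n\<close> minimax
  values is at most the trace of the form over any orthonormal \<open>n\<close>-tuple, rotating a nearly optimal \<open>n\<close>-tuple for
  the identity gives the inequality.

  Suppose equality holds for \<open>n = 1\<close> with common value \<open>\<lambda>\<close> and \<open>A\<close> is not the identity. A minimizing sequence
  \<open>u\<^sub>k\<close> for the identity is also minimizing for \<open>A\<close>, so Cauchy--Schwarz for the two nonnegative forms shows that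
  \<open>\<langle>u\<^sub>k, L v\<rangle> \<rightarrow> 0\<close> for every test function \<open>v\<close>, where \<open>L\<close> is \<open>X\<^sup>2 + Y\<^sup>2 - \<lambda>\<close> or a nonzero traceless quadratic
  expression in the magnetic derivatives \<open>X\<close> and \<open>Y\<close>. Their commutator is a nonzero constant because \<open>\<beta> \<noteq> 0\<close>, and
  algebra alone then yields \<open>\<langle>u\<^sub>k, v\<rangle> \<rightarrow> 0\<close>. By Rellich's theorem the norms of the \<open>u\<^sub>k\<close> tend to 0, although they are 1.
  No eigenfunction has to be found. Rellich's theorem follows from the inequality
  \<open>\<parallel>u(\<cdot> + z) - u\<parallel> \<le> |z| \<parallel>\<nabla>u\<parallel>\<close>, which compares \<open>u\<close> with its averages over small boxes; near a Lipschitz boundary one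
  first shifts into the domain.\<close>

section \<open>Smooth functions\<close>

text \<open>Under rotation through \<phi> a quadratic form in the gradient splits into its mean,
  half the trace, and terms in \<open>cos (2 * \<phi>)\<close> and \<open>sin (2 * \<phi>)\<close>.
  The doubled angle is the reason for order at least 3: with \<open>N = 2\<close> these terms are
  invariant. The factor \<open>sqrt 2 / hs_norm (matrix (inv T))\<close> is exactly what makes the
  trace 2. The values are infima of suprema, and attainment would require spectral theory. So the
  arguments work up to an arbitrary error, and Cauchy--Schwarz for the energy minus \<lambda> times
  the squared norm replaces the eigenvalue equation. In the algebra, with commutator
  \<open>c\<close>, the last division is by \<open>l\<^sup>2 - 3 * c\<^sup>2\<close>; since
  \<open>c = \<i> * h * \<beta>\<close> is imaginary, this is
  \<open>l\<^sup>2 + 3 * h\<^sup>2 * \<beta>\<^sup>2 > 0\<close>, whatever the value of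
  \<open>l\<close>. A weak gradient is a choice, fixed only up to null sets, so computations carry
  an arbitrary gradient as an argument; the chosen one enters through almost everywhere
  equality.\<close>

lemma C_k_SucI:
  assumes "\<And>x. (f has_derivative f' x) (at x)" and "\<And>v. C_k n (\<lambda>x. f' x v)"
  shows "C_k (Suc n) f"
  using assms by auto

lemma C_k_const: "C_k n (\<lambda>x. c)"
  by (induction n arbitrary: c) (auto intro!: exI[of _ "\<lambda>_ _. 0"])

lemma C_k_SucD: "C_k (Suc n) f \<Longrightarrow> C_k n f"
proof (induction n arbitrary: f)
  case 0
  then obtain f' where f': "\<And>x. (f has_derivative f' x) (at x)" by auto
  have "continuous (at x) f" for x by (rule has_derivative_continuous[OF f'])
  then show ?case by (simp add: continuous_at_imp_continuous_on)
next
  case (Suc n)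
  then obtain f' where f': "\<And>x. (f has_derivative f' x) (at x)" "\<And>v. C_k (Suc n) (\<lambda>x. f' x v)"
    by (metis C_k.simps(2))
  then show ?case by (intro C_k_SucI[of f f'] Suc.IH)
qed

lemma C_k_bounded_linear: "bounded_linear L \<Longrightarrow> C_k n L"
  by (cases n) (auto intro: C_k_SucI[of _ "\<lambda>_. L"] C_k_const linear_continuous_on
      bounded_linear_imp_has_derivative simp del: C_k.simps(2))

lemma C_k_bounded_linear_comp:
  assumes "bounded_linear L" and "C_k n f"
  shows "C_k n (\<lambda>x. L (f x))"
  using assms(2)
proof (induction n arbitrary: f)
  case 0
  then show ?case by (simp add: assms(1) bounded_linear.continuous_on)
next
  case (Suc n)
  then obtain f' where f': "\<And>x. (f has_derivative f' x) (at x)" "\<And>v. C_k n (\<lambda>x. f' x v)"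
    by auto
  show ?case
    by (rule C_k_SucI[OF bounded_linear.has_derivative[OF assms(1) f'(1)]]) (intro Suc.IH f')
qed

lemma C_k_add: "C_k n f \<Longrightarrow> C_k n g \<Longrightarrow> C_k n (\<lambda>x. f x + g x)"
proof (induction n arbitrary: f g)
  case 0
  then show ?case by (auto intro!: continuous_intros)
next
  case (Suc n)
  then obtain f' g' where f': "\<And>x. (f has_derivative f' x) (at x)" "\<And>v. C_k n (\<lambda>x. f' x v)"
    and g': "\<And>x. (g has_derivative g' x) (at x)" "\<And>v. C_k n (\<lambda>x. g' x v)"
    by auto
  show ?case
    by (rule C_k_SucI[OF has_derivative_add[OF f'(1) g'(1)]]) (intro Suc.IH f' g')
qed

lemma C_k_bilinear:
  assumes B: "bounded_bilinear B"
  shows "C_k n f \<Longrightarrow> C_k n g \<Longrightarrow> C_k n (\<lambda>x. B (f x) (g x))"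
proof (induction n arbitrary: f g)
  case 0
  then show ?case using bounded_bilinear.continuous_on[OF B, of UNIV f g] by simp
next
  case (Suc n)
  then obtain f' g' where f': "\<And>x. (f has_derivative f' x) (at x)" "\<And>v. C_k n (\<lambda>x. f' x v)"
    and g': "\<And>x. (g has_derivative g' x) (at x)" "\<And>v. C_k n (\<lambda>x. g' x v)"
    by auto
  have "((\<lambda>x. B (f x) (g x)) has_derivative (\<lambda>v. B (f x) (g' x v) + B (f' x v) (g x))) (at x)" for x
    using bounded_bilinear.FDERIV[OF B f'(1) g'(1)] .
  moreover have "C_k n (\<lambda>x. B (f x) (g' x v) + B (f' x v) (g x))" for v
    by (rule C_k_add[OF Suc.IH[OF C_k_SucD[OF Suc.prems(1)] g'(2)] Suc.IH[OF f'(2) C_k_SucD[OF Suc.prems(2)]]])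
  ultimately show ?case by (rule C_k_SucI)
qed

lemmas C_k_mult = C_k_bilinear[OF bounded_bilinear_mult]

lemma C_k_cmult: "C_k n f \<Longrightarrow> C_k n (\<lambda>x. (c::'a::real_normed_algebra) * f x)"
  by (rule C_k_mult[OF C_k_const])

lemma has_derivative_linear_plus:
  assumes "bounded_linear L" shows "((\<lambda>x. L x + c) has_derivative L) (at x)"
  using has_derivative_add[OF bounded_linear_imp_has_derivative[OF assms] has_derivative_const[of c]]
  by simp

lemma C_k_affine_comp:
  assumes L: "bounded_linear L"
  shows "C_k n f \<Longrightarrow> C_k n (\<lambda>x. f (L x + c))"
proof (induction n arbitrary: f)
  case 0
  then show ?case
    by (auto intro!: continuous_on_compose2[of UNIV f] continuous_intros bounded_linear.continuous_on[OF L])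
next
  case (Suc n)
  then obtain f' where f': "\<And>x. (f has_derivative f' x) (at x)" "\<And>v. C_k n (\<lambda>x. f' x v)"
    by auto
  have "((\<lambda>x. f (L x + c)) has_derivative (\<lambda>v. f' (L x + c) (L v))) (at x)" for x
    by (rule has_derivative_compose[where g = f, OF has_derivative_linear_plus[OF L] f'(1)])
  then show ?case
    by (rule C_k_SucI) (intro Suc.IH f')
qed

text \<open>Differentiation in the direction \<open>v\<close> only multiplies the constant
  \<open>c\<close> by \<open>\<i> * L v\<close>, so the statement for all constants closes under
  induction. Gauge factors are of this form.\<close>

lemma C_k_cis_linear:
  assumes L: "bounded_linear (L :: 'a::real_normed_vector \<Rightarrow> real)"
  shows "C_k n (\<lambda>x. c * exp (\<i> * of_real (L x)))"
proof (induction n arbitrary: c)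
  case 0
  then show ?case by (auto intro!: continuous_intros bounded_linear.continuous_on[OF L])
next
  case (Suc n)
  have "((\<lambda>x. c * exp (\<i> * of_real (L x))) has_derivative
      (\<lambda>v. (c * \<i> * of_real (L v)) * exp (\<i> * of_real (L x)))) (at x)" for x
  proof -
    have "bounded_linear (\<lambda>x. \<i> * complex_of_real (L x))"
      by (intro bounded_linear_compose[OF bounded_linear_mult_right]
          bounded_linear_compose[OF bounded_linear_of_real] L)
    then have "((\<lambda>x. \<i> * complex_of_real (L x)) has_derivative (\<lambda>x. \<i> * complex_of_real (L x))) (at x)"
      by (rule bounded_linear_imp_has_derivative)
    from has_derivative_mult_right[OF has_derivative_compose[OF this
          DERIV_exp[unfolded has_field_derivative_def]], of c]
    show ?thesis by (rule has_derivative_eq_rhs) (simp add: mult_ac)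
  qed
  then show ?case
    by (rule C_k_SucI) (rule Suc)
qed

section \<open>Smooth bump functions and their limits\<close>

definition flat :: "nat \<Rightarrow> real \<Rightarrow> real" where
  "flat k t = (if t > 0 then inverse t ^ k * exp (- inverse t) else 0)"

lemma flat_tendsto_0: "(flat k \<longlongrightarrow> 0) (at 0)"
proof (rule filterlim_split_at)
  have "eventually (\<lambda>t. t < (0::real)) (at_left 0)"
    by (simp add: eventually_at_filter)
  then show "(flat k \<longlongrightarrow> 0) (at_left 0)"
    by (intro tendsto_eventually) (auto simp: flat_def elim!: eventually_mono)
  have "((\<lambda>t::real. inverse t ^ k / exp (inverse t)) \<longlongrightarrow> 0) (at_right 0)"
    by (rule filterlim_compose[OF tendsto_power_div_exp_0 filterlim_inverse_at_top_right])
  moreover have "eventually (\<lambda>t. inverse t ^ k / exp (inverse t) = flat k t) (at_right 0)"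
    by (auto simp: eventually_at_filter flat_def exp_minus field_simps)
  ultimately show "(flat k \<longlongrightarrow> 0) (at_right 0)"
    by (rule Lim_transform_eventually)
qed

text \<open>The power \<open>inverse t ^ k\<close> in \<open>flat\<close> is there for this formula:
  derivatives stay within the linear span of the family, and one induction over all \<open>k\<close>
  gives smoothness. At 0 the difference quotient of \<open>flat k\<close> is
  \<open>flat (k + 1)\<close>, which tends to 0 because the exponential beats every power.\<close>

lemma flat_DERIV: "(flat k has_real_derivative (flat (k + 2) t - real k * flat (k + 1) t)) (at t)"
proof -
  consider "t > 0" | "t < 0" | "t = 0" by linarith
  then show ?thesis
  proof cases
    case 1
    have "((\<lambda>t. inverse t ^ k * exp (- inverse t)) has_real_derivative
        (flat (k + 2) t - real k * flat (k + 1) t)) (at t)"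
      using 1
      apply (auto intro!: derivative_eq_intros simp: flat_def)
      apply (cases k)
       apply (auto simp: field_simps power2_eq_square)
      done
    then show ?thesis
      by (rule DERIV_cong_ev[THEN iffD1, rotated -1])
         (use eventually_nhds_in_open[of "{0<..}" t] 1 in \<open>auto simp: flat_def elim!: eventually_mono\<close>)
  next
    case 2
    have "((\<lambda>t. 0) has_real_derivative (flat (k + 2) t - real k * flat (k + 1) t)) (at t)"
      using 2 by (auto simp: flat_def)
    then show ?thesis
      by (rule DERIV_cong_ev[THEN iffD1, rotated -1])
         (use eventually_nhds_in_open[of "{..<0}" t] 2 in \<open>auto simp: flat_def elim!: eventually_mono\<close>)
  next
    case 3
    have "flat k h / h = flat (k + 1) h" for h
      by (auto simp: flat_def field_simps)
    then have "(\<lambda>h. (flat k (0 + h) - flat k 0) / h) = flat (k + 1)"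
      by (auto simp: flat_def)
    then show ?thesis
      using flat_tendsto_0[of "k + 1"] unfolding 3 DERIV_def by (simp add: flat_def)
  qed
qed

lemma C_k_flat: "C_k n (flat k)"
proof (induction n arbitrary: k)
  case 0
  then show ?case
    using flat_DERIV by (auto intro!: continuous_at_imp_continuous_on DERIV_isCont)
next
  case (Suc n)
  have "C_k n (\<lambda>t. v * (flat (k + 2) t + (- real k) * flat (k + 1) t))" for v
    by (intro C_k_cmult C_k_add Suc)
  then have "C_k n (\<lambda>t. (flat (k + 2) t - real k * flat (k + 1) t) * v)" for v
    by (simp add: mult.commute)
  then show ?case
    using flat_DERIV[of k, unfolded has_field_derivative_def] unfolding C_k.simps by (intro exI conjI allI)
qed

lemma flat_0_bounds: "0 \<le> flat 0 t" "flat 0 t \<le> 1"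
  by (auto simp: flat_def)

text \<open>The parameter \<open>n\<close> sharpens both flanks while the support stays fixed. The
  functions are bounded by 1 and tend pointwise to the indicator of the open interval, which gives
  density of test functions without convolution.\<close>

definition bump :: "nat \<Rightarrow> real \<Rightarrow> real \<Rightarrow> real \<Rightarrow> real" where
  "bump n a b t = flat 0 (real (Suc n) * (t - a)) * flat 0 (real (Suc n) * (b - t))"

lemma bump_bounds: "0 \<le> bump n a b t" "bump n a b t \<le> 1"
  by (auto simp: bump_def flat_0_bounds mult_le_one)

lemma bump_nonzero_iff: "bump n a b t \<noteq> 0 \<longleftrightarrow> a < t \<and> t < b"
  by (auto simp: bump_def flat_def zero_less_mult_iff)

lemma flat_scaled_tendsto:
  assumes "t > 0" shows "(\<lambda>n. flat 0 (real (Suc n) * t)) \<longlonglongrightarrow> 1"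
proof -
  have "(\<lambda>n. exp (- (inverse (real (Suc n)) * inverse t))) \<longlonglongrightarrow> exp (- (0 * inverse t))"
    by (intro tendsto_intros LIMSEQ_inverse_real_of_nat)
  then show ?thesis using assms by (simp add: flat_def)
qed

lemma bump_tendsto: "(\<lambda>n. bump n a b t) \<longlonglongrightarrow> (if a < t \<and> t < b then 1 else 0)"
proof (cases "a < t \<and> t < b")
  case True
  then have "(\<lambda>n. bump n a b t) \<longlonglongrightarrow> 1 * 1"
    unfolding bump_def by (intro tendsto_mult flat_scaled_tendsto) auto
  with True show ?thesis by simp
next
  case False
  then have "bump n a b t = 0" for n using bump_nonzero_iff by blast
  with False show ?thesis by auto
qed

lemma C_k_bump: "C_k m (bump n a b)"
proof -
  have "C_k m (\<lambda>t. flat 0 (real (Suc n) * t + - real (Suc n) * a) * flat 0 (- real (Suc n) * t + real (Suc n) * b))"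
    by (intro C_k_mult C_k_affine_comp C_k_flat bounded_linear_mult_right)
  then show ?thesis unfolding bump_def by (simp add: algebra_simps)
qed

definition box_bump :: "nat \<Rightarrow> real^2 \<Rightarrow> real^2 \<Rightarrow> real^2 \<Rightarrow> complex" where
  "box_bump n a b x = of_real (bump n (a$1) (b$1) (x$1) * bump n (a$2) (b$2) (x$2))"

lemma box_bump_norm_le: "norm (box_bump n a b x) \<le> 1"
  unfolding box_bump_def by (simp add: norm_mult bump_bounds mult_le_one del: of_real_mult)

lemma mem_box_2: "x \<in> box a b \<longleftrightarrow> a$1 < x$1 \<and> x$1 < b$1 \<and> a$2 < x$2 \<and> x$2 < (b::real^2)$2"
  by (auto simp: mem_box_cart forall_2)

lemma mem_cbox_2: "x \<in> cbox a b \<longleftrightarrow> a$1 \<le> x$1 \<and> x$1 \<le> b$1 \<and> a$2 \<le> x$2 \<and> x$2 \<le> (b::real^2)$2"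
  by (auto simp: mem_box_cart forall_2)

lemma box_bump_nonzero_iff: "box_bump n a b x \<noteq> 0 \<longleftrightarrow> x \<in> box a b"
  using bump_nonzero_iff[of n "a$1" "b$1" "x$1"] bump_nonzero_iff[of n "a$2" "b$2" "x$2"]
  by (auto simp: box_bump_def mem_box_2)

lemma box_bump_tendsto: "(\<lambda>n. box_bump n a b x) \<longlonglongrightarrow> indicator (box a b) x"
proof -
  have "(\<lambda>n. box_bump n a b x) \<longlonglongrightarrow> of_real ((if a$1 < x$1 \<and> x$1 < b$1 then 1 else 0) *
      (if a$2 < x$2 \<and> x$2 < b$2 then 1 else 0))"
    unfolding box_bump_def by (intro tendsto_of_real tendsto_mult bump_tendsto)
  then show ?thesis by (auto simp: indicator_def mem_box_2)
qed

lemma C_k_box_bump: "C_k m (box_bump n a b)"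
proof -
  have "C_k m (\<lambda>x::real^2. bump n a' b' (x$i + 0))" for a' b' i
    by (intro C_k_affine_comp[OF bounded_linear_vec_nth] C_k_bump)
  then show ?thesis
    unfolding box_bump_def
    by (intro C_k_bounded_linear_comp[OF bounded_linear_of_real] C_k_mult) simp_all
qed

lemma test_functionI:
  assumes C: "\<And>n. C_k n \<phi>" and K: "compact K" "K \<subseteq> \<Omega>" and *: "\<And>x. \<phi> x \<noteq> 0 \<Longrightarrow> x \<in> K"
  shows "test_function \<Omega> \<phi>"
proof -
  have cl: "closure {x. \<phi> x \<noteq> 0} \<subseteq> K"
    using * K(1) by (intro closure_minimal compact_imp_closed) auto
  have "compact (K \<inter> closure {x. \<phi> x \<noteq> 0})"
    by (rule compact_Int_closed[OF K(1) closed_closure])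
  moreover have "K \<inter> closure {x. \<phi> x \<noteq> 0} = closure {x. \<phi> x \<noteq> 0}"
    using cl by (rule Int_absorb1)
  ultimately show ?thesis
    using C cl K(2) by (simp add: test_function_def)
qed

lemma test_function_support:
  assumes "test_function \<Omega> \<phi>"
  obtains K where "compact K" "K \<subseteq> \<Omega>" "\<And>x. \<phi> x \<noteq> 0 \<Longrightarrow> x \<in> K" "K = closure {x. \<phi> x \<noteq> 0}"
  using assms closure_subset[of "{x. \<phi> x \<noteq> 0}"] by (auto simp: test_function_def)

lemma test_function_box_bump:
  assumes "cbox a b \<subseteq> \<Omega>" shows "test_function \<Omega> (box_bump n a b)"
  using assms box_subset_cbox[of a b]
  by (intro test_functionI[of _ "cbox a b"] C_k_box_bump compact_cbox) (auto simp: box_bump_nonzero_iff)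

subsection \<open>Test functions\<close>

lemma test_function_nonzero_subset:
  assumes "test_function \<Omega> \<phi>" and "\<And>x. \<phi> x = 0 \<Longrightarrow> \<psi> x = 0" and "\<And>n. C_k n \<psi>"
  shows "test_function \<Omega> \<psi>"
  using assms(1)
  by (rule test_function_support) (use assms(2,3) in \<open>blast intro: test_functionI\<close>)

lemma test_function_C_k: "test_function \<Omega> \<phi> \<Longrightarrow> C_k n \<phi>"
  by (simp add: test_function_def)

lemma test_function_zero: "test_function \<Omega> (\<lambda>x. 0)"
  by (simp add: test_function_def C_k_const)

lemma test_function_add:
  assumes \<phi>: "test_function \<Omega> \<phi>" and \<psi>: "test_function \<Omega> \<psi>"
  shows "test_function \<Omega> (\<lambda>x. \<phi> x + \<psi> x)"
proof -
  obtain K where K: "compact K" "K \<subseteq> \<Omega>" "\<And>x. \<phi> x \<noteq> 0 \<Longrightarrow> x \<in> K"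
    using test_function_support[OF \<phi>] by blast
  obtain K' where K': "compact K'" "K' \<subseteq> \<Omega>" "\<And>x. \<psi> x \<noteq> 0 \<Longrightarrow> x \<in> K'"
    using test_function_support[OF \<psi>] by blast
  have "x \<in> K \<union> K'" if "\<phi> x + \<psi> x \<noteq> 0" for x
    using that K(3)[of x] K'(3)[of x] by (cases "\<phi> x = 0") auto
  then show ?thesis
    using K K' by (intro test_functionI[of _ "K \<union> K'"] C_k_add test_function_C_k[OF \<phi>]
        test_function_C_k[OF \<psi>] compact_Un) auto
qed

lemma test_function_mult:
  "test_function \<Omega> \<phi> \<Longrightarrow> (\<And>n. C_k n \<psi>) \<Longrightarrow> test_function \<Omega> (\<lambda>x. \<psi> x * \<phi> x)"
  by (rule test_function_nonzero_subset[of \<Omega> \<phi>])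
     (auto intro: C_k_mult test_function_C_k[of \<Omega> \<phi>])

lemma test_function_cmult: "test_function \<Omega> \<phi> \<Longrightarrow> test_function \<Omega> (\<lambda>x. c * \<phi> x)"
  by (rule test_function_mult) (auto intro: C_k_const)

lemma test_function_cnj: "test_function \<Omega> \<phi> \<Longrightarrow> test_function \<Omega> (\<lambda>x. cnj (\<phi> x))"
  by (rule test_function_nonzero_subset[of \<Omega> \<phi>])
     (auto intro: C_k_bounded_linear_comp[OF bounded_linear_cnj] test_function_C_k[of \<Omega> \<phi>])

lemma test_function_outside: "test_function \<Omega> \<phi> \<Longrightarrow> x \<notin> \<Omega> \<Longrightarrow> \<phi> x = 0"
  using closure_subset[of "{x. \<phi> x \<noteq> 0}"] by (auto simp: test_function_def)

lemma C_k_has_frechet_derivative: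
  assumes "C_k (Suc n) f" shows "(f has_derivative frechet_derivative f (at x)) (at x)"
  using assms by (meson C_k.simps(2) differentiableI frechet_derivative_works)

lemma C_k_frechet_derivative:
  assumes "C_k (Suc n) f" shows "C_k n (\<lambda>x. frechet_derivative f (at x) v)"
proof -
  obtain f' where f': "\<And>x. (f has_derivative f' x) (at x)" "\<And>v. C_k n (\<lambda>x. f' x v)"
    using assms by auto
  have "frechet_derivative f (at x) = f' x" for x
    using f'(1) frechet_derivative_at by metis
  with f' show ?thesis by simp
qed

lemma test_function_has_derivative:
  "test_function \<Omega> \<phi> \<Longrightarrow> (\<phi> has_derivative frechet_derivative \<phi> (at x)) (at x)"
  using C_k_has_frechet_derivative test_function_C_k by blast

text \<open>Off the closed support the function is locally zero, so the derivative lives on the same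
  compact set.\<close>

lemma test_function_derivative:
  assumes "test_function \<Omega> \<phi>" shows "test_function \<Omega> (\<lambda>x. frechet_derivative \<phi> (at x) v)"
proof -
  have "frechet_derivative \<phi> (at x) v = 0" if "x \<notin> closure {x. \<phi> x \<noteq> 0}" for x
  proof -
    have "eventually (\<lambda>y. y \<in> - closure {x. \<phi> x \<noteq> 0}) (nhds x)"
      using that by (intro eventually_nhds_in_open) auto
    then have "eventually (\<lambda>y. 0 = \<phi> y) (at x)"
      using closure_subset[of "{x. \<phi> x \<noteq> 0}"]
      by (auto simp: eventually_at_filter elim!: eventually_mono)
    moreover have "\<phi> x = 0"
      using that closure_subset[of "{x. \<phi> x \<noteq> 0}"] by auto
    ultimately have "(\<phi> has_derivative (\<lambda>v. 0)) (at x)"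
      using has_derivative_transform_eventually[of "\<lambda>x. 0" "\<lambda>v. 0" x UNIV \<phi>] by simp
    then show ?thesis
      by (metis frechet_derivative_at)
  qed
  moreover have "compact (closure {x. \<phi> x \<noteq> 0})" "closure {x. \<phi> x \<noteq> 0} \<subseteq> \<Omega>"
    using assms by (auto simp: test_function_def)
  ultimately show ?thesis
    using assms by (intro test_functionI[of _ "closure {x. \<phi> x \<noteq> 0}"] C_k_frechet_derivative)
      (auto simp del: C_k.simps intro: test_function_C_k)
qed

lemma test_function_continuous: "test_function \<Omega> \<phi> \<Longrightarrow> continuous_on UNIV \<phi>"
  using test_function_C_k[of \<Omega> \<phi> 0] by simp

lemma test_function_bounded:
  assumes "test_function \<Omega> \<phi>" obtains B where "B \<ge> 0" "\<And>x. norm (\<phi> x) \<le> B"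
proof -
  let ?K = "closure {x. \<phi> x \<noteq> 0}"
  have "compact (\<phi> ` ?K)"
    using assms test_function_continuous[OF assms]
    by (intro compact_continuous_image) (auto simp: test_function_def intro: continuous_on_subset)
  then have "bounded (\<phi> ` ?K)" by (rule compact_imp_bounded)
  then obtain B where B: "\<forall>y\<in>\<phi> ` ?K. norm y \<le> B"
    unfolding bounded_iff by blast
  have "norm (\<phi> x) \<le> max B 0" for x
  proof (cases "\<phi> x = 0")
    case False
    then have "x \<in> ?K" using closure_subset[of "{x. \<phi> x \<noteq> 0}"] by blast
    with B show ?thesis by (simp add: le_max_iff_disj)
  qed simp
  then show ?thesis using that[of "max B 0"] by auto
qed

text \<open>Only the preimage of \<Omega> has to lie in \<open>\<Omega>'\<close>; this serves
  translations of a support into a larger domain as well as bijective changes of domain.\<close>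

lemma test_function_affine:
  assumes \<phi>: "test_function \<Omega> \<phi>" and L: "linear L" "bij L"
    and im: "\<And>x. L x + c \<in> \<Omega> \<Longrightarrow> x \<in> \<Omega>'"
  shows "test_function \<Omega>' (\<lambda>x. \<phi> (L x + (c :: real^2)))"
proof -
  let ?S = "\<lambda>x. L x + c" and ?R = "\<lambda>y. inv L (y - c)"
  let ?K = "closure {x. \<phi> x \<noteq> 0}"
  have bl: "bounded_linear L" by (rule linear_conv_bounded_linear[THEN iffD1, OF L(1)])
  have RS: "?R (?S x) = x" for x using L by (simp add: bij_is_inj)
  have SR: "?S (?R x) = x" for x using L by (simp add: bij_is_surj surj_f_inv_f)
  have bli: "bounded_linear (inv L)"
    by (rule inj_linear_imp_inv_bounded_linear[OF bl bij_is_inj[OF L(2)]])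
  obtain K where K: "compact K" "K \<subseteq> \<Omega>" "\<And>x. \<phi> x \<noteq> 0 \<Longrightarrow> x \<in> K"
    using test_function_support[OF \<phi>] by blast
  have c: "compact (?R ` K)"
    by (intro compact_continuous_image continuous_intros bounded_linear.continuous_on[OF bli] K)
  have "?R ` K \<subseteq> \<Omega>'"
    using im K(2) SR by force
  moreover have "x \<in> ?R ` K" if "\<phi> (L x + c) \<noteq> 0" for x
    using K(3)[OF that] RS[of x] by (metis image_eqI)
  ultimately show ?thesis
    using c by (intro test_functionI[of _ "?R ` K"] C_k_affine_comp[OF bl] test_function_C_k[OF \<phi>])
qed

lemma linear_inv:
  assumes "linear (L :: real^2 \<Rightarrow> real^2)" "bij L" shows "linear (inv L)"
  by (rule inj_linear_imp_inv_linear[OF assms(1) bij_is_inj[OF assms(2)]])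

lemma frechet_derivative_eqI:
  "(f has_derivative f') (at x) \<Longrightarrow> frechet_derivative f (at x) v = f' v"
  using frechet_derivative_at[of f f' x] by simp

lemma frechet_derivative_affine:
  assumes \<phi>: "test_function \<Omega> \<phi>" and L: "linear (L :: real^2 \<Rightarrow> real^2)"
  shows "frechet_derivative (\<lambda>x. \<phi> (L x + c)) (at x) v = frechet_derivative \<phi> (at (L x + c)) (L v)"
proof -
  have bl: "bounded_linear L" by (rule linear_conv_bounded_linear[THEN iffD1, OF L])
  show ?thesis
    by (rule frechet_derivative_eqI[OF has_derivative_compose[where g = \<phi>,
      OF has_derivative_linear_plus[OF bl] test_function_has_derivative[OF \<phi>]]])
qed

lemma frechet_derivative_add_test:
  assumes \<phi>: "test_function \<Omega> \<phi>" and \<psi>: "test_function \<Omega>' \<psi>"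
  shows "frechet_derivative (\<lambda>x. \<phi> x + \<psi> x) (at x) v
           = frechet_derivative \<phi> (at x) v + frechet_derivative \<psi> (at x) v"
  by (rule frechet_derivative_eqI[OF has_derivative_add[OF test_function_has_derivative[OF \<phi>]
        test_function_has_derivative[OF \<psi>]]])

lemma frechet_derivative_cmult_test:
  assumes \<phi>: "test_function \<Omega> \<phi>"
  shows "frechet_derivative (\<lambda>x. c * \<phi> x) (at x) v = c * frechet_derivative \<phi> (at x) v"
  by (rule frechet_derivative_eqI[OF has_derivative_mult_right[OF test_function_has_derivative[OF \<phi>]]])

lemma frechet_derivative_cnj_test:
  assumes \<phi>: "test_function \<Omega> \<phi>"
  shows "frechet_derivative (\<lambda>x. cnj (\<phi> x)) (at x) v = cnj (frechet_derivative \<phi> (at x) v)"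
  by (rule frechet_derivative_eqI[OF bounded_linear.has_derivative[OF bounded_linear_cnj
        test_function_has_derivative[OF \<phi>]]])

lemma frechet_derivative_mult_test:
  assumes \<phi>: "test_function \<Omega> \<phi>" and f: "C_k 1 f"
  shows "frechet_derivative (\<lambda>x. f x * \<phi> x) (at x) v
           = f x * frechet_derivative \<phi> (at x) v + frechet_derivative f (at x) v * \<phi> x"
  by (rule frechet_derivative_eqI[OF has_derivative_mult[OF
      C_k_has_frechet_derivative[OF f[unfolded One_nat_def]] test_function_has_derivative[OF \<phi>]]])

section \<open>Square integrable functions\<close>

lemma sq_norm_add_le:
  fixes a b :: "'a::real_normed_vector"
  shows "(norm (a + b))\<^sup>2 \<le> 2 * (norm a)\<^sup>2 + 2 * (norm b)\<^sup>2"
proof -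
  have "(norm (a + b))\<^sup>2 \<le> (norm a + norm b)\<^sup>2"
    by (intro power_mono norm_triangle_ineq norm_ge_zero)
  also have "\<dots> \<le> 2 * (norm a)\<^sup>2 + 2 * (norm b)\<^sup>2"
    using zero_le_power2[of "norm a - norm b"] by (simp add: power2_eq_square algebra_simps)
  finally show ?thesis .
qed

lemma L2_measurable: "L2 \<Omega> f \<Longrightarrow> f \<in> borel_measurable (lebesgue_on \<Omega>)"
  by (simp add: L2_def)

lemma L2_integrable: "L2 \<Omega> f \<Longrightarrow> integrable (lebesgue_on \<Omega>) (\<lambda>x. (norm (f x))\<^sup>2)"
  by (simp add: L2_def)

lemma L2_boundI:
  assumes "f \<in> borel_measurable (lebesgue_on \<Omega>)" and "integrable (lebesgue_on \<Omega>) g"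
    and "AE x in lebesgue_on \<Omega>. (norm (f x))\<^sup>2 \<le> g x"
  shows "L2 \<Omega> f"
  unfolding L2_def
proof
  show "integrable (lebesgue_on \<Omega>) (\<lambda>x. (norm (f x))\<^sup>2)"
    using assms(3) by (intro Bochner_Integration.integrable_bound[OF assms(2)])
      (use assms(1) in \<open>measurable, auto elim!: eventually_mono\<close>)
qed (rule assms)

lemma L2_zero: "L2 \<Omega> (\<lambda>x. 0)"
  by (simp add: L2_def)

lemma L2_add:
  assumes "L2 \<Omega> f" "L2 \<Omega> g" shows "L2 \<Omega> (\<lambda>x. f x + g x)"
proof (rule L2_boundI)
  show "(\<lambda>x. f x + g x) \<in> borel_measurable (lebesgue_on \<Omega>)"
    using assms by (auto simp: L2_def)
  show "integrable (lebesgue_on \<Omega>) (\<lambda>x. 2 * (norm (f x))\<^sup>2 + 2 * (norm (g x))\<^sup>2)"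
    using assms by (auto simp: L2_def)
qed (simp add: sq_norm_add_le)

lemma L2_mult_bounded:
  fixes f :: "real^2 \<Rightarrow> complex"
  assumes "L2 \<Omega> f" and "g \<in> borel_measurable (lebesgue_on \<Omega>)" and "\<And>x. x \<in> \<Omega> \<Longrightarrow> norm (g x) \<le> B"
  shows "L2 \<Omega> (\<lambda>x. g x * f x)"
proof (rule L2_boundI)
  show "(\<lambda>x. g x * f x) \<in> borel_measurable (lebesgue_on \<Omega>)"
    using assms by (auto simp: L2_def)
  show "integrable (lebesgue_on \<Omega>) (\<lambda>x. B\<^sup>2 * (norm (f x))\<^sup>2)"
    using assms by (auto simp: L2_def)
  have "(norm (g x * f x))\<^sup>2 \<le> B\<^sup>2 * (norm (f x))\<^sup>2" if "x \<in> \<Omega>" for x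
    using power_mono[OF assms(3)[OF that] norm_ge_zero, of 2]
    by (simp add: norm_mult power_mult_distrib mult_right_mono)
  then show "AE x in lebesgue_on \<Omega>. (norm (g x * f x))\<^sup>2 \<le> B\<^sup>2 * (norm (f x))\<^sup>2"
    by (intro AE_I2) simp
qed

lemma L2_cmult: "L2 \<Omega> f \<Longrightarrow> L2 \<Omega> (\<lambda>x. (c::complex) * f x)"
  by (rule L2_mult_bounded[where B = "norm c"]) auto

lemma L2_diff:
  assumes "L2 \<Omega> f" "L2 \<Omega> g" shows "L2 \<Omega> (\<lambda>x. f x - (g x :: complex))"
  using L2_add[OF assms(1) L2_cmult[OF assms(2), of "-1"]] by simp

lemma L2_cnj:
  assumes "L2 \<Omega> f" shows "L2 \<Omega> (\<lambda>x. cnj (f x))"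
proof (rule L2_boundI[OF _ L2_integrable[OF assms]])
  have "cnj \<in> borel_measurable borel" by (intro borel_measurable_continuous_onI continuous_intros)
  then show "(\<lambda>x. cnj (f x)) \<in> borel_measurable (lebesgue_on \<Omega>)"
    by (rule measurable_compose[OF L2_measurable[OF assms]])
qed simp

lemma L2_AE:
  assumes "L2 \<Omega> f" and "AE x in lebesgue_on \<Omega>. f x = g x" and "g \<in> borel_measurable (lebesgue_on \<Omega>)"
  shows "L2 \<Omega> g"
  by (rule L2_boundI[OF assms(3) L2_integrable[OF assms(1)]])
     (use assms(2) in \<open>auto elim!: eventually_mono\<close>)

lemma norm_vec2: "(norm (z :: complex^2))\<^sup>2 = (norm (z$1))\<^sup>2 + (norm (z$2))\<^sup>2"
  by (simp add: norm_vec_def L2_set_def sum_2)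

lemma L2_vec_nth:
  assumes "L2 \<Omega> g" shows "L2 \<Omega> (\<lambda>x. (g x :: complex^2) $ k)"
proof (rule L2_boundI[OF _ L2_integrable[OF assms]])
  have "(\<lambda>z::complex^2. z $ k) \<in> borel_measurable borel"
    by (intro borel_measurable_continuous_onI continuous_intros)
  then show "(\<lambda>x. g x $ k) \<in> borel_measurable (lebesgue_on \<Omega>)"
    by (rule measurable_compose[OF L2_measurable[OF assms]])
qed (simp add: power_mono Finite_Cartesian_Product.norm_nth_le)

lemma L2_vecI:
  assumes "\<And>k. L2 \<Omega> (\<lambda>x. (g x :: complex^2) $ k)" shows "L2 \<Omega> g"
proof (rule L2_boundI[of _ _ "\<lambda>x. (norm (g x $ 1))\<^sup>2 + (norm (g x $ 2))\<^sup>2"])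
  have "(\<lambda>x. g x \<bullet> axis k b) \<in> borel_measurable (lebesgue_on \<Omega>)" for k b
    unfolding inner_axis using L2_measurable[OF assms, of k] by measurable
  then show "g \<in> borel_measurable (lebesgue_on \<Omega>)"
    by (subst borel_measurable_euclidean_space) (auto simp: Basis_vec_def)
  show "integrable (lebesgue_on \<Omega>) (\<lambda>x. (norm (g x $ 1))\<^sup>2 + (norm (g x $ 2))\<^sup>2)"
    using assms by (auto simp: L2_def)
qed (simp add: norm_vec2)

lemma L2_mult_integrable:
  assumes "L2 \<Omega> f" "L2 \<Omega> g" shows "integrable (lebesgue_on \<Omega>) (\<lambda>x. f x * (g x :: complex))"
proof (rule Bochner_Integration.integrable_bound)
  show "integrable (lebesgue_on \<Omega>) (\<lambda>x. (norm (f x))\<^sup>2 + (norm (g x))\<^sup>2)"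
    using assms by (auto simp: L2_def)
  have "norm (f x * g x) \<le> norm ((norm (f x))\<^sup>2 + (norm (g x))\<^sup>2)" for x
  proof -
    have "0 \<le> (norm (f x) - norm (g x))\<^sup>2" "0 \<le> norm (f x) * norm (g x)" by simp_all
    then have "norm (f x) * norm (g x) \<le> (norm (f x))\<^sup>2 + (norm (g x))\<^sup>2"
      unfolding power2_diff by linarith
    then show ?thesis by (simp add: norm_mult)
  qed
  then show "AE x in lebesgue_on \<Omega>. norm (f x * g x) \<le> norm ((norm (f x))\<^sup>2 + (norm (g x))\<^sup>2)" by simp
qed (use assms in \<open>auto simp: L2_def\<close>)

lemma integrable_on_indicator:
  assumes "A \<in> lmeasurable" "\<Omega> \<in> sets lebesgue"
  shows "integrable (lebesgue_on \<Omega>) (indicator A :: real^2 \<Rightarrow> real)"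
proof -
  have "integrable lebesgue (indicator A :: real^2 \<Rightarrow> real)"
    using assms(1) by (simp only: lmeasurable_iff_integrable)
  from integrable_mult_indicator[OF assms(2) this] show ?thesis
    using assms(2) by (subst integrable_restrict_space) simp_all
qed

lemma L2_bounded_set_indicator:
  assumes "A \<in> sets lebesgue" "bounded A" "\<Omega> \<in> sets lebesgue"
  shows "L2 \<Omega> (indicator A :: real^2 \<Rightarrow> complex)"
proof (rule L2_boundI)
  have "A \<in> lmeasurable" using assms by (simp add: bounded_set_imp_lmeasurable)
  then show "integrable (lebesgue_on \<Omega>) (indicator A :: real^2 \<Rightarrow> real)"
    by (rule integrable_on_indicator[OF _ assms(3)])
  show "(indicator A :: real^2 \<Rightarrow> complex) \<in> borel_measurable (lebesgue_on \<Omega>)"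
    using assms(1) by (intro measurable_restrict_space1 borel_measurable_indicator)
qed (auto simp: indicator_def)

lemma L2_continuous_support:
  assumes "continuous_on UNIV \<phi>" "\<And>x. norm (\<phi> x) \<le> B" "\<And>x. \<phi> x \<noteq> 0 \<Longrightarrow> x \<in> K" "compact K"
    and "\<Omega> \<in> sets lebesgue"
  shows "L2 \<Omega> (\<phi> :: real^2 \<Rightarrow> complex)"
proof -
  have K: "K \<in> sets lebesgue" using assms(4) by (simp add: borel_closed compact_imp_closed sets_completionI_sets)
  have "\<phi> \<in> borel_measurable (lebesgue_on \<Omega>)"
    by (intro measurable_restrict_space1 measurable_completion)
       (simp add: borel_measurable_continuous_onI assms(1))
  then have "L2 \<Omega> (\<lambda>x. \<phi> x * indicator K x)"
    by (rule L2_mult_bounded[OF L2_bounded_set_indicator[OF K compact_imp_bounded[OF assms(4)] assms(5)]])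
       (rule assms(2))
  moreover have "\<phi> x * indicator K x = \<phi> x" for x
    using assms(3)[of x] by (auto simp: indicator_def)
  ultimately show ?thesis by simp
qed

lemma test_function_L2:
  assumes "test_function \<Omega>' \<phi>" "\<Omega> \<in> sets lebesgue"
  shows "L2 \<Omega> \<phi>"
proof -
  obtain B where B: "\<And>x. norm (\<phi> x) \<le> B" using test_function_bounded[OF assms(1)] by blast
  obtain K where K: "compact K" "\<And>x. \<phi> x \<noteq> 0 \<Longrightarrow> x \<in> K"
    using test_function_support[OF assms(1)] by blast
  show ?thesis
    by (rule L2_continuous_support[OF test_function_continuous[OF assms(1)] B K(2) K(1) assms(2)])
qed

subsection \<open>Density of test functions\<close>

text \<open>The class is shown to contain indicators of boxes and to be closed under sums, multiples
  and dominated limits, until it is seen to contain every square integrable function.\<close>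

definition approximable :: "(real^2) set \<Rightarrow> (real^2 \<Rightarrow> complex) \<Rightarrow> bool" where
  "approximable \<Omega> f \<longleftrightarrow> L2 \<Omega> f \<and>
     (\<forall>e>0. \<exists>\<phi>. test_function \<Omega> \<phi> \<and> (\<integral>x. (norm (f x - \<phi> x))\<^sup>2 \<partial>lebesgue_on \<Omega>) < e)"

lemma L2_dist_add_le:
  assumes "L2 \<Omega> f" "L2 \<Omega> g"
  shows "(\<integral>x. (norm (f x + g x))\<^sup>2 \<partial>lebesgue_on \<Omega>)
    \<le> 2 * (\<integral>x. (norm (f x))\<^sup>2 \<partial>lebesgue_on \<Omega>) + 2 * (\<integral>x. (norm (g x))\<^sup>2 \<partial>lebesgue_on \<Omega>)"
proof -
  have "(\<integral>x. (norm (f x + g x))\<^sup>2 \<partial>lebesgue_on \<Omega>)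
      \<le> (\<integral>x. 2 * (norm (f x))\<^sup>2 + 2 * (norm (g x))\<^sup>2 \<partial>lebesgue_on \<Omega>)"
    using assms L2_add[OF assms] by (intro integral_mono) (auto simp: L2_def sq_norm_add_le)
  also have "\<dots> = 2 * (\<integral>x. (norm (f x))\<^sup>2 \<partial>lebesgue_on \<Omega>) + 2 * (\<integral>x. (norm (g x))\<^sup>2 \<partial>lebesgue_on \<Omega>)"
    using assms by (simp add: L2_def)
  finally show ?thesis .
qed

context
  fixes \<Omega> :: "(real^2) set"
  assumes op: "open \<Omega>"
begin

lemma open_sets_lebesgue: "\<Omega> \<in> sets lebesgue"
  using op by (simp add: borel_open sets_completionI_sets)

lemma approximable_limit:
  assumes f: "L2 \<Omega> f"
    and *: "\<And>e. e > 0 \<Longrightarrow> \<exists>g. approximable \<Omega> g \<and> (\<integral>x. (norm (f x - g x))\<^sup>2 \<partial>lebesgue_on \<Omega>) < e"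
  shows "approximable \<Omega> f"
  unfolding approximable_def
proof (intro conjI f allI impI)
  fix e :: real assume e: "e > 0"
  obtain g where g: "approximable \<Omega> g" "(\<integral>x. (norm (f x - g x))\<^sup>2 \<partial>lebesgue_on \<Omega>) < e / 4"
    using *[of "e / 4"] e by auto
  obtain \<phi> where \<phi>: "test_function \<Omega> \<phi>" "(\<integral>x. (norm (g x - \<phi> x))\<^sup>2 \<partial>lebesgue_on \<Omega>) < e / 4"
    using g(1) e unfolding approximable_def by (meson divide_pos_pos zero_less_numeral)
  have "(\<integral>x. (norm ((f x - g x) + (g x - \<phi> x)))\<^sup>2 \<partial>lebesgue_on \<Omega>) < e"
    using L2_dist_add_le[of \<Omega> "\<lambda>x. f x - g x" "\<lambda>x. g x - \<phi> x"] g \<phi> f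
      test_function_L2[OF \<phi>(1) open_sets_lebesgue]
    by (auto simp: approximable_def L2_diff)
  then show "\<exists>\<phi>. test_function \<Omega> \<phi> \<and> (\<integral>x. (norm (f x - \<phi> x))\<^sup>2 \<partial>lebesgue_on \<Omega>) < e"
    using \<phi>(1) by auto
qed

lemma approximable_test: "test_function \<Omega> \<phi> \<Longrightarrow> approximable \<Omega> \<phi>"
  unfolding approximable_def
  using test_function_L2[OF _ open_sets_lebesgue, of \<Omega> \<phi>] by (auto intro!: exI[of _ \<phi>])

lemma approximable_add:
  assumes f: "approximable \<Omega> f" and g: "approximable \<Omega> g"
  shows "approximable \<Omega> (\<lambda>x. f x + g x)"
  unfolding approximable_def
proof (intro conjI allI impI)
  show "L2 \<Omega> (\<lambda>x. f x + g x)" using f g by (simp add: approximable_def L2_add)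
  fix e :: real assume e: "e > 0"
  obtain \<phi> where \<phi>: "test_function \<Omega> \<phi>" "(\<integral>x. (norm (f x - \<phi> x))\<^sup>2 \<partial>lebesgue_on \<Omega>) < e / 4"
    using f e unfolding approximable_def by (meson divide_pos_pos zero_less_numeral)
  obtain \<psi> where \<psi>: "test_function \<Omega> \<psi>" "(\<integral>x. (norm (g x - \<psi> x))\<^sup>2 \<partial>lebesgue_on \<Omega>) < e / 4"
    using g e unfolding approximable_def by (meson divide_pos_pos zero_less_numeral)
  have "(\<integral>x. (norm ((f x - \<phi> x) + (g x - \<psi> x)))\<^sup>2 \<partial>lebesgue_on \<Omega>) < e"
    using L2_dist_add_le[of \<Omega> "\<lambda>x. f x - \<phi> x" "\<lambda>x. g x - \<psi> x"] f g \<phi> \<psi>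
      test_function_L2[OF \<phi>(1) open_sets_lebesgue] test_function_L2[OF \<psi>(1) open_sets_lebesgue]
    by (auto simp: approximable_def L2_diff)
  moreover have "(f x - \<phi> x) + (g x - \<psi> x) = f x + g x - (\<phi> x + \<psi> x)" for x by simp
  ultimately show "\<exists>\<phi>. test_function \<Omega> \<phi> \<and> (\<integral>x. (norm (f x + g x - \<phi> x))\<^sup>2 \<partial>lebesgue_on \<Omega>) < e"
    using test_function_add[OF \<phi>(1) \<psi>(1)] by (intro exI[of _ "\<lambda>x. \<phi> x + \<psi> x"]) simp
qed

lemma approximable_cmult:
  assumes f: "approximable \<Omega> f" shows "approximable \<Omega> (\<lambda>x. c * f x)"
  unfolding approximable_def
proof (intro conjI allI impI)
  show "L2 \<Omega> (\<lambda>x. c * f x)" using f by (simp add: approximable_def L2_cmult)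
  fix e :: real assume e: "e > 0"
  have "e / ((norm c)\<^sup>2 + 1) > 0" using e by (simp add: add_nonneg_pos)
  then obtain \<phi> where \<phi>: "test_function \<Omega> \<phi>"
      "(\<integral>x. (norm (f x - \<phi> x))\<^sup>2 \<partial>lebesgue_on \<Omega>) < e / ((norm c)\<^sup>2 + 1)"
    using f unfolding approximable_def by meson
  have "(norm (c * f x - c * \<phi> x))\<^sup>2 = (norm c)\<^sup>2 * (norm (f x - \<phi> x))\<^sup>2" for x
    by (simp add: right_diff_distrib[symmetric] norm_mult power_mult_distrib)
  then have "(\<integral>x. (norm (c * f x - c * \<phi> x))\<^sup>2 \<partial>lebesgue_on \<Omega>)
      = (norm c)\<^sup>2 * (\<integral>x. (norm (f x - \<phi> x))\<^sup>2 \<partial>lebesgue_on \<Omega>)" by simp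
  also have "\<dots> \<le> ((norm c)\<^sup>2 + 1) * (\<integral>x. (norm (f x - \<phi> x))\<^sup>2 \<partial>lebesgue_on \<Omega>)"
    by (intro mult_right_mono) auto
  also have "\<dots> < e"
    using \<phi>(2) add_nonneg_pos[OF zero_le_power2[of "norm c"] zero_less_one]
    by (simp add: pos_less_divide_eq mult.commute)
  finally show "\<exists>\<phi>. test_function \<Omega> \<phi> \<and> (\<integral>x. (norm (c * f x - \<phi> x))\<^sup>2 \<partial>lebesgue_on \<Omega>) < e"
    using test_function_cmult[OF \<phi>(1), of c] by blast
qed

lemma approximable_sum:
  assumes "finite I" "\<And>i. i \<in> I \<Longrightarrow> approximable \<Omega> (f i)"
  shows "approximable \<Omega> (\<lambda>x. \<Sum>i\<in>I. f i x)"
  using assms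
proof (induction I rule: finite_induct)
  case empty
  then show ?case using approximable_test[OF test_function_zero] by simp
next
  case (insert i I)
  then show ?case using approximable_add[of "f i" "\<lambda>x. \<Sum>i\<in>I. f i x"] by simp
qed

text \<open>A square integrable majorant turns pointwise into mean square convergence; this is how
  box indicators, countable unions and simple functions pass to their limits.\<close>

lemma approximable_sequence:
  assumes f: "\<And>n. approximable \<Omega> (f n)"
    and lim: "\<And>x. x \<in> \<Omega> \<Longrightarrow> (\<lambda>n. f n x) \<longlonglongrightarrow> g x"
    and dom: "\<And>n x. x \<in> \<Omega> \<Longrightarrow> norm (f n x) \<le> w x"
    and w: "integrable (lebesgue_on \<Omega>) (\<lambda>x. (w x)\<^sup>2)"
  shows "approximable \<Omega> g"
proof (rule approximable_limit)
  have fm: "f n \<in> borel_measurable (lebesgue_on \<Omega>)" for n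
    using f[of n] by (simp add: approximable_def L2_def)
  have gm: "g \<in> borel_measurable (lebesgue_on \<Omega>)"
    by (rule borel_measurable_LIMSEQ_metric[where f = f]) (use fm lim in auto)
  have gw: "norm (g x) \<le> w x" if "x \<in> \<Omega>" for x
    by (rule LIMSEQ_le_const2[OF tendsto_norm[OF lim[OF that]]]) (use dom[OF that] in auto)
  show "L2 \<Omega> g"
    by (rule L2_boundI[OF gm w]) (auto intro!: AE_I2 power_mono gw)
  have "(\<lambda>n. \<integral>x. (norm (g x - f n x))\<^sup>2 \<partial>lebesgue_on \<Omega>) \<longlonglongrightarrow> (\<integral>x. 0 \<partial>lebesgue_on \<Omega>)"
  proof (rule integral_dominated_convergence)
    show "integrable (lebesgue_on \<Omega>) (\<lambda>x. 4 * (w x)\<^sup>2)" using w by simp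
    show "(\<lambda>x. (norm (g x - f n x))\<^sup>2) \<in> borel_measurable (lebesgue_on \<Omega>)" for n
      using gm fm by measurable
    have "(\<lambda>n. (norm (g x - f n x))\<^sup>2) \<longlonglongrightarrow> (norm (g x - g x))\<^sup>2" if "x \<in> \<Omega>" for x
      by (intro tendsto_intros lim that)
    then show "AE x in lebesgue_on \<Omega>. (\<lambda>n. (norm (g x - f n x))\<^sup>2) \<longlonglongrightarrow> 0"
      by (intro AE_I2) simp
    have "(norm (g x - f n x))\<^sup>2 \<le> 4 * (w x)\<^sup>2" if "x \<in> \<Omega>" for x n
    proof -
      have "norm (g x - f n x) \<le> 2 * w x"
        using norm_triangle_ineq4[of "g x" "f n x"] gw[OF that] dom[OF that, of n] by linarith
      then have "(norm (g x - f n x))\<^sup>2 \<le> (2 * w x)\<^sup>2" by (intro power_mono) auto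
      then show ?thesis by (simp add: power_mult_distrib)
    qed
    then show "AE x in lebesgue_on \<Omega>. norm ((norm (g x - f n x))\<^sup>2) \<le> 4 * (w x)\<^sup>2" for n
      by (intro AE_I2) simp
  qed auto
  then have l0: "(\<lambda>n. \<integral>x. (norm (g x - f n x))\<^sup>2 \<partial>lebesgue_on \<Omega>) \<longlonglongrightarrow> 0" by simp
  fix e :: real assume "e > 0"
  from order_tendstoD(2)[OF l0 this] obtain n where "(\<integral>x. (norm (g x - f n x))\<^sup>2 \<partial>lebesgue_on \<Omega>) < e"
    unfolding eventually_sequentially by blast
  then show "\<exists>h. approximable \<Omega> h \<and> (\<integral>x. (norm (g x - h x))\<^sup>2 \<partial>lebesgue_on \<Omega>) < e"
    using f by blast
qed

lemma indicator_sq_integrable: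
  assumes "A \<in> lmeasurable"
  shows "integrable (lebesgue_on \<Omega>) (\<lambda>x. (indicator A x :: real)\<^sup>2)"
proof -
  have "integrable (lebesgue_on \<Omega>) (indicator A :: real^2 \<Rightarrow> real)"
    by (rule integrable_on_indicator[OF assms open_sets_lebesgue])
  moreover have "(indicator A x :: real)\<^sup>2 = indicator A x" for x by (auto simp: indicator_def)
  ultimately show ?thesis by simp
qed

lemma approximable_box:
  assumes "cbox a b \<subseteq> \<Omega>" shows "approximable \<Omega> (indicator (box a b))"
proof (rule approximable_sequence)
  show "approximable \<Omega> (box_bump n a b)" for n
    by (intro approximable_test test_function_box_bump assms)
  show "norm (box_bump n a b x) \<le> indicator (box a b) x" for n x
    using box_bump_norm_le[of n a b x] box_bump_nonzero_iff[of n a b x] by (auto simp: indicator_def)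
  show "integrable (lebesgue_on \<Omega>) (\<lambda>x. (indicator (box a b) x :: real)\<^sup>2)"
    by (intro indicator_sq_integrable lmeasurable_box)
qed (rule box_bump_tendsto)

text \<open>The sets with this property form a Dynkin class containing the boxes. Cutting with a
  fixed box keeps every measure finite, so that complements and disjoint countable unions stay in
  the class.\<close>

lemma approximable_borel_box:
  assumes ab: "cbox a b \<subseteq> \<Omega>" and A: "A \<in> sets borel"
  shows "approximable \<Omega> (indicator (A \<inter> box a b))"
proof -
  have "Int_stable (range (\<lambda>(a, b). box a (b::real^2)))"
    by (auto simp: Int_stable_def box_Int_box)
  moreover have "range (\<lambda>(a, b). box a (b::real^2)) \<subseteq> Pow UNIV" by simp
  moreover have "A \<in> sigma_sets UNIV (range (\<lambda>(a, b). box a b))"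
    using A unfolding borel_eq_box by simp
  ultimately show ?thesis
  proof (induction rule: sigma_sets_induct_disjoint)
    case (basic A)
    then obtain c d where "A = box c d" by auto
    then obtain p q where pq: "A \<inter> box a b = box p q"
      by (auto simp: box_Int_box)
    show ?case
    proof (cases "box p q = {}")
      case True
      then show ?thesis using approximable_test[OF test_function_zero] by (simp add: pq)
    next
      case False
      \<comment> \<open>A test function needs its compact support inside \<Omega>, so the closed box
        is recovered from the open one as its closure, which is valid for nonempty boxes
        only.\<close>
      have "box p q \<subseteq> cbox a b" using pq box_subset_cbox by blast
      then have "closure (box p q) \<subseteq> cbox a b" by (rule closure_minimal[OF _ closed_cbox])
      then have "cbox p q \<subseteq> \<Omega>" using False ab by (simp add: closure_box)
      then show ?thesis unfolding pq by (rule approximable_box)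
    qed
  next
    case empty
    then show ?case using approximable_test[OF test_function_zero] by simp
  next
    case (compl A)
    have "approximable \<Omega> (\<lambda>x. indicator (box a b) x + (-1) * indicator (A \<inter> box a b) x)"
      by (intro approximable_add approximable_cmult approximable_box ab compl)
    moreover have "indicator (box a b) x + (-1) * indicator (A \<inter> box a b) x
        = (indicator ((UNIV - A) \<inter> box a b) x :: complex)" for x
      by (auto simp: indicator_def)
    ultimately show ?case by simp
  next
    case (union A)
    show ?case
    proof (rule approximable_sequence)
      show "approximable \<Omega> (\<lambda>x. \<Sum>i<n. indicator (A i \<inter> box a b) x)" for n
        by (intro approximable_sum union) auto
      have eq: "(\<Sum>i<n. indicator (A i \<inter> box a b) x) = (indicator ((\<Union>i<n. A i) \<inter> box a b) x :: complex)" for n x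
      proof (induction n)
        case (Suc n)
        have "A i \<inter> A n = {}" if "i < n" for i
          using union(1) that by (simp add: disjoint_family_on_def)
        then have "x \<notin> (\<Union>i<n. A i)" if "x \<in> A n" using that by blast
        then show ?case using Suc by (auto simp: indicator_def less_Suc_eq)
      qed simp
      show "(\<lambda>n. \<Sum>i<n. indicator (A i \<inter> box a b) x :: complex) \<longlonglongrightarrow> indicator (\<Union> (range A) \<inter> box a b) x" for x
      proof (rule tendsto_eventually)
        show "\<forall>\<^sub>F n in sequentially. (\<Sum>i<n. indicator (A i \<inter> box a b) x)
            = (indicator (\<Union> (range A) \<inter> box a b) x :: complex)"
        proof (cases "x \<in> \<Union> (range A)")
          case True
          then obtain i where i: "x \<in> A i" by auto
          show ?thesis unfolding eq
            by (rule eventually_sequentiallyI[of "Suc i"]) (use i in \<open>auto simp: indicator_def\<close>)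
        next
          case False
          then show ?thesis unfolding eq by (auto simp: indicator_def)
        qed
      qed
      show "norm (\<Sum>i<n. indicator (A i \<inter> box a b) x :: complex) \<le> indicator (box a b) x" for n x
        unfolding eq by (auto simp: indicator_def)
      show "integrable (lebesgue_on \<Omega>) (\<lambda>x. (indicator (box a b) x :: real)\<^sup>2)"
        by (intro indicator_sq_integrable lmeasurable_box)
    qed
  qed
qed

lemma approximable_AE:
  assumes "approximable \<Omega> f" "AE x in lebesgue_on \<Omega>. f x = g x" "g \<in> borel_measurable (lebesgue_on \<Omega>)"
  shows "approximable \<Omega> g"
proof (rule approximable_limit)
  have f: "L2 \<Omega> f" using assms(1) by (simp add: approximable_def)
  show g: "L2 \<Omega> g" by (rule L2_AE[OF f assms(2,3)])
  have "(\<integral>x. (norm (g x - f x))\<^sup>2 \<partial>lebesgue_on \<Omega>) = (\<integral>x. 0 \<partial>lebesgue_on \<Omega>)"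
    by (rule integral_cong_AE) (use assms(2) f g in \<open>auto simp: L2_def elim!: eventually_mono\<close>)
  then show "\<exists>h. approximable \<Omega> h \<and> (\<integral>x. (norm (g x - h x))\<^sup>2 \<partial>lebesgue_on \<Omega>) < e" if "e > 0" for e
    using assms(1) that by auto
qed

text \<open>A Lebesgue set is a Borel set up to a null set, and \<Omega> is a countable union of
  boxes whose closures lie in \<Omega>. The Borel part is built up box by box, with the indicator of
  \<open>A\<close> as majorant.\<close>

lemma approximable_set:
  assumes A: "A \<in> sets lebesgue" "A \<subseteq> \<Omega>" and L2A: "L2 \<Omega> (indicator A :: real^2 \<Rightarrow> complex)"
  shows "approximable \<Omega> (indicator A)"
proof -
  obtain C Z Z' where CZ: "A = C \<union> Z" "Z \<subseteq> Z'" "Z' \<in> null_sets lborel" "C \<in> sets lborel"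
    using A(1) by (rule sets_completionE)
  have Cb: "C \<in> sets borel" using CZ(4) by simp
  let ?F = "{box a b |a b. cbox a b \<subseteq> \<Omega>}"
  obtain \<D> where D: "\<D> \<subseteq> ?F" "countable \<D>" "\<Union>\<D> = \<Union>?F"
    by (rule Lindelof[of ?F]) (auto intro: open_box)
  have "x \<in> \<Union>?F" if "x \<in> \<Omega>" for x
    by (rule open_contains_cbox[OF op that]) blast
  then have cover: "\<Union>\<D> = \<Omega>" using D(3) box_subset_cbox by blast
  have zero: "approximable \<Omega> (indicator {})"
  proof -
    have "(indicator {} :: real^2 \<Rightarrow> complex) = (\<lambda>x. 0)" by (rule ext) simp
    then show ?thesis using approximable_test[OF test_function_zero] by (simp only:)
  qed
  show ?thesis
  proof (cases "\<D> = {}")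
    case True
    then have "A = {}" using A(2) cover by auto
    show ?thesis unfolding \<open>A = {}\<close> by (rule zero)
  next
    case False
    define B where "B = from_nat_into \<D>"
    have rB: "range B = \<D>" unfolding B_def by (rule range_from_nat_into[OF False D(2)])
    have B: "\<exists>a b. B n = box a b \<and> cbox a b \<subseteq> \<Omega>" for n
      using rB D(1) by blast
    have oB: "open (B n)" for n using B[of n] by (auto intro: open_box)
    have fin: "approximable \<Omega> (indicator (C \<inter> (\<Union>i<n. B i)))" for n
    proof (induction n)
      case 0
      show ?case using zero by (simp only: lessThan_0 UN_empty Int_empty_right)
    next
      case (Suc n)
      obtain a b where ab: "B n = box a b" "cbox a b \<subseteq> \<Omega>" using B by blast
      \<comment> \<open>Only the new part of the next box is added, so that the two indicators sum
        to that of the union.\<close>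
      have "C - (\<Union>i<n. B i) \<in> sets borel"
        by (intro sets.Diff[OF Cb] borel_open open_UN ballI oB)
      then have "approximable \<Omega> (\<lambda>x. indicator (C \<inter> (\<Union>i<n. B i)) x + indicator ((C - (\<Union>i<n. B i)) \<inter> B n) x)"
        unfolding ab(1) by (intro approximable_add Suc approximable_borel_box ab(2))
      moreover have "indicator (C \<inter> (\<Union>i<n. B i)) x + indicator ((C - (\<Union>i<n. B i)) \<inter> B n) x
          = (indicator (C \<inter> (\<Union>i<Suc n. B i)) x :: complex)" for x
        by (auto simp: indicator_def less_Suc_eq)
      ultimately show ?case by simp
    qed
    have C: "approximable \<Omega> (indicator C)"
    proof (rule approximable_sequence[OF fin])
      fix x assume "x \<in> \<Omega>"
      then obtain i where i: "x \<in> B i" using cover rB by blast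
      show "(\<lambda>n. indicator (C \<inter> (\<Union>i<n. B i)) x :: complex) \<longlonglongrightarrow> indicator C x"
        by (rule tendsto_eventually, rule eventually_sequentiallyI[of "Suc i"])
          (use i in \<open>auto simp: indicator_def\<close>)
      show "norm (indicator (C \<inter> (\<Union>i<n. B i)) x :: complex) \<le> norm (indicator A x :: complex)" for n
        using CZ(1) by (auto simp: indicator_def)
    qed (rule L2_integrable[OF L2A])
    have "AE x in lebesgue. x \<notin> Z'" by (rule AE_completion[OF AE_not_in[OF CZ(3)]])
    then have "AE x in lebesgue_on \<Omega>. indicator C x = (indicator A x :: complex)"
      using open_sets_lebesgue CZ(1,2)
      by (subst AE_restrict_space_iff) (auto simp: indicator_def elim!: eventually_mono)
    then show ?thesis
      by (rule approximable_AE[OF C]) (rule L2_measurable[OF L2A])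
  qed
qed

lemma approximable_simple:
  assumes s: "simple_function (lebesgue_on \<Omega>) s" and L2s: "L2 \<Omega> s"
  shows "approximable \<Omega> s"
proof -
  define A where "A y = {x \<in> \<Omega>. s x = y}" for y
  have sp: "space (lebesgue_on \<Omega>) = \<Omega>" by simp
  have fin: "finite (s ` \<Omega>)" using simple_functionD(1)[OF s] by simp
  have Am: "A y \<in> sets (lebesgue_on \<Omega>)" for y
    using simple_functionD(2)[OF s, of "{y}"] by (simp add: A_def vimage_def Int_def conj_commute)
  have Al: "A y \<in> sets lebesgue" for y
    using Am[of y] open_sets_lebesgue by (simp add: sets_restrict_space_iff)
  have "approximable \<Omega> (\<lambda>x. \<Sum>y\<in>s ` \<Omega>. y * indicator (A y) x)"
  proof (intro approximable_sum fin)
    fix y :: complex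
    show "approximable \<Omega> (\<lambda>x. y * indicator (A y) x)"
    proof (cases "y = 0")
      case True
      then show ?thesis using approximable_test[OF test_function_zero] by simp
    next
      case False
      have "L2 \<Omega> (indicator (A y) :: real^2 \<Rightarrow> complex)"
      proof (rule L2_boundI)
        show "integrable (lebesgue_on \<Omega>) (\<lambda>x. (norm (s x))\<^sup>2 / (norm y)\<^sup>2)"
          using L2s by (simp add: L2_def)
        show "(indicator (A y) :: real^2 \<Rightarrow> complex) \<in> borel_measurable (lebesgue_on \<Omega>)"
          by (intro borel_measurable_indicator Am)
      qed (use False in \<open>auto simp: indicator_def A_def\<close>)
      then show ?thesis
        by (intro approximable_cmult approximable_set Al) (auto simp: A_def)
    qed
  qed
  moreover have "(\<Sum>y\<in>s ` \<Omega>. y * indicator (A y) x) = s x" if "x \<in> \<Omega>" for x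
  proof -
    have "(\<Sum>y\<in>s ` \<Omega>. y * indicator (A y) x) = (\<Sum>y\<in>s ` \<Omega>. if y = s x then y else 0)"
      using that by (intro sum.cong refl) (auto simp: A_def indicator_def)
    then show ?thesis using fin that by simp
  qed
  then have "AE x in lebesgue_on \<Omega>. (\<Sum>y\<in>s ` \<Omega>. y * indicator (A y) x) = s x"
    by (intro AE_I2) simp
  ultimately show ?thesis
    by (rule approximable_AE) (rule L2_measurable[OF L2s])
qed

text \<open>Simple functions approximate \<open>f\<close> pointwise and can be chosen bounded by
  \<open>2 * norm (f x)\<close>, which is the required majorant.\<close>

lemma L2_approximable:
  assumes f: "L2 \<Omega> f" shows "approximable \<Omega> f"
proof -
  obtain s where s: "\<And>i. simple_function (lebesgue_on \<Omega>) (s i)"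
    "\<And>x. x \<in> space (lebesgue_on \<Omega>) \<Longrightarrow> (\<lambda>i. s i x) \<longlonglongrightarrow> f x"
    "\<And>i x. x \<in> space (lebesgue_on \<Omega>) \<Longrightarrow> dist (s i x) 0 \<le> 2 * dist (f x) 0"
    using borel_measurable_implies_sequence_metric[OF L2_measurable[OF f], of 0] by blast
  note s = s[unfolded space_lebesgue_on dist_0_norm dist_commute[of _ 0]]
  have w: "integrable (lebesgue_on \<Omega>) (\<lambda>x. (2 * norm (f x))\<^sup>2)"
    using f by (simp add: L2_def power_mult_distrib)
  have "(norm (s i x))\<^sup>2 \<le> (2 * norm (f x))\<^sup>2" if "x \<in> \<Omega>" for i x
    by (rule power_mono[OF s(3)[OF that] norm_ge_zero])
  then have "L2 \<Omega> (s i)" for i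
    by (intro L2_boundI[OF borel_measurable_simple_function[OF s(1)] w] AE_I2) simp
  then show ?thesis
    by (intro approximable_sequence[OF approximable_simple[OF s(1)] s(2) s(3) w])
qed

end

theorem test_functions_dense:
  assumes "open \<Omega>" "L2 \<Omega> f" "e > 0"
  obtains \<phi> where "test_function \<Omega> \<phi>" "(\<integral>x. (norm (f x - \<phi> x))\<^sup>2 \<partial>lebesgue_on \<Omega>) < e"
  using L2_approximable[OF assms(1,2)] assms(3) unfolding approximable_def by blast

section \<open>Minimax values of Hermitian forms\<close>

definition lincomb :: "nat \<Rightarrow> (nat \<Rightarrow> complex) \<Rightarrow> (nat \<Rightarrow> 'x \<Rightarrow> complex) \<Rightarrow> 'x \<Rightarrow> complex" where
  "lincomb n c u = (\<lambda>x. \<Sum>k<n. c k * u k x)"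

definition span_of :: "nat \<Rightarrow> (nat \<Rightarrow> 'x \<Rightarrow> complex) \<Rightarrow> ('x \<Rightarrow> complex) set" where
  "span_of n u = {lincomb n c u | c. True}"

lemma lincomb_0: "lincomb 0 c u = (\<lambda>x. 0)"
  by (simp add: lincomb_def)

lemma lincomb_Suc: "lincomb (Suc n) c u = (\<lambda>x. lincomb n c u x + c n * u n x)"
  by (simp add: lincomb_def)

lemma lincomb_cong:
  "(\<And>k. k < n \<Longrightarrow> c k = d k) \<Longrightarrow> (\<And>k. k < n \<Longrightarrow> u k = v k) \<Longrightarrow> lincomb n c u = lincomb n d v"
  by (auto simp: lincomb_def intro!: sum.cong)

lemma lincomb_in_span: "lincomb n c u \<in> span_of n u"
  by (auto simp: span_of_def)

lemma span_of_add: "f \<in> span_of n u \<Longrightarrow> g \<in> span_of n u \<Longrightarrow> (\<lambda>x. f x + g x) \<in> span_of n u"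
proof -
  assume "f \<in> span_of n u" "g \<in> span_of n u"
  then obtain c d where "f = lincomb n c u" "g = lincomb n d u" by (auto simp: span_of_def)
  then have "(\<lambda>x. f x + g x) = lincomb n (\<lambda>k. c k + d k) u"
    by (simp add: lincomb_def sum.distrib ring_distribs)
  then show ?thesis by (simp add: lincomb_in_span)
qed

lemma lincomb_cmult: "(\<lambda>x. a * lincomb n c u x) = lincomb n (\<lambda>k. a * c k) u"
  by (simp add: lincomb_def sum_distrib_left mult.assoc)

lemma span_of_cmult: "f \<in> span_of n u \<Longrightarrow> (\<lambda>x. a * f x) \<in> span_of n u"
  using lincomb_cmult by (fastforce simp: span_of_def)

lemma span_of_nth: "k < n \<Longrightarrow> u k \<in> span_of n u"
proof -
  assume "k < n"
  then have "u k = lincomb n (\<lambda>i. if i = k then 1 else 0) u"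
    by (simp add: lincomb_def fun_eq_iff if_distrib[of "\<lambda>c. c * _"] cong: if_cong)
  then show ?thesis by (metis lincomb_in_span)
qed

lemma lincomb_span_of: "(\<And>k. k < m \<Longrightarrow> v k \<in> span_of n u) \<Longrightarrow> lincomb m d v \<in> span_of n u"
proof (induction m)
  case 0
  show ?case using lincomb_in_span[of n "\<lambda>_. 0" u] by (simp add: lincomb_def)
next
  case (Suc m)
  then show ?case unfolding lincomb_Suc by (intro span_of_add span_of_cmult) auto
qed

lemma span_of_mono:
  assumes v: "\<And>k. k < m \<Longrightarrow> v k \<in> span_of n u" shows "span_of m v \<subseteq> span_of n u"
proof
  fix f assume "f \<in> span_of m v"
  then obtain c where f: "f = lincomb m c v" by (auto simp: span_of_def)
  show "f \<in> span_of n u" unfolding f by (rule lincomb_span_of[OF v])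
qed

section \<open>Two tools from complex linear algebra\<close>

lemma homogeneous_system:
  fixes M :: "nat \<Rightarrow> nat \<Rightarrow> complex"
  shows "\<exists>c. (\<exists>k\<le>m. c k \<noteq> 0) \<and> (\<forall>i<m. (\<Sum>k\<le>m. M i k * c k) = 0)"
proof (induction m arbitrary: M)
  case 0
  show ?case by (auto intro!: exI[of _ "\<lambda>_. 1"])
next
  case (Suc m)
  show ?case
  proof (cases "\<exists>p\<le>Suc m. M m p \<noteq> 0")
    case False
    then obtain c where c: "\<exists>k\<le>m. c k \<noteq> 0" "\<forall>i<m. (\<Sum>k\<le>m. M i k * c k) = 0"
      using Suc.IH[of M] by auto
    let ?c = "c(Suc m := 0)"
    have "(\<Sum>k\<le>Suc m. M i k * ?c k) = (\<Sum>k\<le>m. M i k * c k)" for i by simp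
    then have "(\<Sum>k\<le>Suc m. M i k * ?c k) = 0" if "i < Suc m" for i
      using that c(2) False by (cases "i = m") (auto intro!: sum.neutral)
    moreover obtain k where "k \<le> m" "c k \<noteq> 0" using c(1) by auto
    then have "k \<le> Suc m" "?c k \<noteq> 0" by auto
    ultimately show ?thesis by blast
  next
    case True
    then obtain p where p: "p \<le> Suc m" "M m p \<noteq> 0" by auto
    \<comment> \<open>\<open>p\<close> is a pivot of the last equation and \<tau> enumerates the
      other unknowns. After elimination of the pivot, \<open>m\<close> equations in
      \<open>m + 1\<close> unknowns remain for the induction hypothesis.\<close>
    define \<tau> where "\<tau> = (\<lambda>k. if k < p then k else Suc k)"
    have inj: "inj_on \<tau> {..m}" by (auto simp: \<tau>_def inj_on_def split: if_splits)
    have im: "\<tau> ` {..m} = {..Suc m} - {p}"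
    proof (intro equalityI subsetI)
      fix k assume k: "k \<in> {..Suc m} - {p}"
      then have "k = \<tau> (if k < p then k else k - 1)" by (auto simp: \<tau>_def)
      moreover have "(if k < p then k else k - 1) \<in> {..m}" using k p(1) by auto
      ultimately show "k \<in> \<tau> ` {..m}" by blast
    qed (use p(1) in \<open>auto simp: \<tau>_def\<close>)
    obtain d where d: "\<exists>k\<le>m. d k \<noteq> 0"
      "\<forall>i<m. (\<Sum>k\<le>m. (M i (\<tau> k) - M i p / M m p * M m (\<tau> k)) * d k) = 0"
      using Suc.IH[of "\<lambda>i k. M i (\<tau> k) - M i p / M m p * M m (\<tau> k)"] by auto
    \<comment> \<open>The pivot unknown takes the value that the last equation then demands.\<close>
    define s where "s = - (\<Sum>k\<le>m. M m (\<tau> k) * d k) / M m p"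
    define c where "c = (\<lambda>k. if k = p then s else d (the_inv_into {..m} \<tau> k))"
    have c\<tau>: "c (\<tau> k) = d k" if "k \<le> m" for k
    proof -
      have "\<tau> k \<noteq> p" by (auto simp: \<tau>_def)
      then show ?thesis using that by (simp add: c_def the_inv_into_f_f[OF inj])
    qed
    have sum: "(\<Sum>k\<le>Suc m. M i k * c k) = M i p * s + (\<Sum>k\<le>m. M i (\<tau> k) * d k)" for i
    proof -
      have "(\<Sum>k\<le>Suc m. M i k * c k) = M i p * c p + (\<Sum>k\<in>{..Suc m} - {p}. M i k * c k)"
        using p(1) by (intro sum.remove) auto
      also have "(\<Sum>k\<in>{..Suc m} - {p}. M i k * c k) = (\<Sum>k\<le>m. M i (\<tau> k) * c (\<tau> k))"
        unfolding im[symmetric] by (simp add: sum.reindex[OF inj])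
      also have "\<dots> = (\<Sum>k\<le>m. M i (\<tau> k) * d k)" by (intro sum.cong) (auto simp: c\<tau>)
      finally show ?thesis by (simp add: c_def)
    qed
    have "(\<Sum>k\<le>Suc m. M i k * c k) = 0" if "i < Suc m" for i
    proof (cases "i = m")
      case True
      show ?thesis unfolding sum s_def True using p(2) by simp
    next
      case False
      with that have "i < m" by simp
      with d(2) have "(\<Sum>k\<le>m. M i (\<tau> k) * d k) - M i p / M m p * (\<Sum>k\<le>m. M m (\<tau> k) * d k) = 0"
        by (simp add: left_diff_distrib sum_subtractf sum_distrib_left mult.assoc)
      then show ?thesis unfolding sum s_def by simp
    qed
    moreover have "\<exists>k\<le>Suc m. c k \<noteq> 0"
      using d(1) c\<tau> im by (metis DiffD1 atMost_iff image_eqI)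
    ultimately show ?thesis by blast
  qed
qed

text \<open>The reflection along \<open>w\<close>, the difference of \<open>c\<close> and the last
  unit vector, exchanges the two. A complex reflection can do so only if their inner product is
  real, whence the condition on \<open>c n\<close>. This extends a unit vector to a unitary matrix
  by an explicit formula.\<close>

lemma householder:
  fixes c :: "nat \<Rightarrow> complex"
  assumes unit: "(\<Sum>k\<le>n. (cmod (c k))\<^sup>2) = 1" and real: "Im (c n) = 0"
  obtains U :: "nat \<Rightarrow> nat \<Rightarrow> complex"
  where "\<And>k. k \<le> n \<Longrightarrow> U n k = c k"
    and "\<And>i j. i \<le> n \<Longrightarrow> j \<le> n \<Longrightarrow> (\<Sum>k\<le>n. U i k * cnj (U j k)) = (if i = j then 1 else 0)"
    and "\<And>i j. i \<le> n \<Longrightarrow> j \<le> n \<Longrightarrow> (\<Sum>k\<le>n. U k i * cnj (U k j)) = (if i = j then 1 else 0)"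
proof -
  define \<delta> :: "nat \<Rightarrow> nat \<Rightarrow> complex" where "\<delta> i k = (if i = k then 1 else 0)" for i k
  define w where "w = (\<lambda>k. c k - \<delta> k n)"
  define s where "s = (\<Sum>k\<le>n. (cmod (w k))\<^sup>2)"
  \<comment> \<open>If \<open>c\<close> is the last unit vector, then \<open>s = 0\<close> and
    division by zero gives \<open>t = 0\<close>, so \<open>U\<close> is the identity, as it should
    be.\<close>
  define t where "t = 2 / s"
  define U where "U = (\<lambda>i k. \<delta> i k - of_real t * cnj (w i) * w k)"
  have cn: "c n = of_real (Re (c n))" using real by (simp add: complex_eq_iff)
  have "s = (\<Sum>k\<le>n. (cmod (c k))\<^sup>2 + (if k = n then 1 - 2 * Re (c n) else 0))"
    unfolding s_def
  proof (intro sum.cong refl)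
    fix k
    show "(cmod (w k))\<^sup>2 = (cmod (c k))\<^sup>2 + (if k = n then 1 - 2 * Re (c n) else 0)"
      by (cases "k = n") (simp_all add: w_def \<delta>_def cmod_power2 power2_diff)
  qed
  then have s: "s = 2 - 2 * Re (c n)" using unit by (simp add: sum.distrib)
  have row: "U n k = c k" if "k \<le> n" for k
  proof (cases "s = 0")
    case True
    then have "w k = 0" using that unfolding s_def by (subst (asm) sum_nonneg_eq_0_iff) auto
    then show ?thesis by (auto simp: U_def w_def \<delta>_def)
  next
    case False
    have "cnj (w n) = of_real (- s / 2)" unfolding w_def \<delta>_def s by (subst cn) simp
    then have "of_real t * cnj (w n) = -1" using False by (simp add: t_def)
    then have "U n k = \<delta> n k + w k" unfolding U_def by simp
    then show ?thesis by (auto simp: w_def \<delta>_def)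
  qed
  have ww: "(\<Sum>k\<le>n. w k * cnj (w k)) = of_real s"
    unfolding s_def of_real_sum by (intro sum.cong refl complex_norm_square[symmetric])
  have rows: "(\<Sum>k\<le>n. U i k * cnj (U j k)) = \<delta> i j" if "i \<le> n" "j \<le> n" for i j
  proof -
    have "(\<Sum>k\<le>n. U i k * cnj (U j k)) =
      (\<Sum>k\<le>n. \<delta> i k * \<delta> j k - of_real t * w j * (\<delta> i k * cnj (w k))
          - of_real t * cnj (w i) * (\<delta> j k * w k) + of_real t * of_real t * cnj (w i) * w j * (w k * cnj (w k)))"
      unfolding U_def by (intro sum.cong refl) (auto simp: \<delta>_def algebra_simps)
    also have "\<dots> = (\<Sum>k\<le>n. \<delta> i k * \<delta> j k) - of_real t * w j * (\<Sum>k\<le>n. \<delta> i k * cnj (w k))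
          - of_real t * cnj (w i) * (\<Sum>k\<le>n. \<delta> j k * w k)
          + of_real t * of_real t * cnj (w i) * w j * (\<Sum>k\<le>n. w k * cnj (w k))"
      by (simp add: sum.distrib sum_subtractf sum_distrib_left)
    also have "(\<Sum>k\<le>n. \<delta> i k * cnj (w k)) = cnj (w i)"
      using that by (simp add: \<delta>_def if_distrib[of "\<lambda>c. c * _"] cong: if_cong)
    also have "(\<Sum>k\<le>n. \<delta> j k * w k) = w j"
      using that by (simp add: \<delta>_def if_distrib[of "\<lambda>c. c * _"] cong: if_cong)
    also have "(\<Sum>k\<le>n. \<delta> i k * \<delta> j k) = \<delta> i j"
      using that by (auto simp: \<delta>_def if_distrib[of "\<lambda>c. c * _"] cong: if_cong)
    also have "of_real t * of_real t * cnj (w i) * w j * (\<Sum>k\<le>n. w k * cnj (w k))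
        = 2 * (of_real t * cnj (w i) * w j)"
    proof (cases "s = 0")
      case False
      then have "of_real t * complex_of_real s = 2" by (simp add: t_def)
      then show ?thesis unfolding ww by (simp add: algebra_simps)
    qed (simp add: t_def)
    finally show ?thesis by (simp add: algebra_simps)
  qed
  have herm: "U k i = cnj (U i k)" for i k
    by (simp add: U_def \<delta>_def mult_ac)
  have cols: "(\<Sum>k\<le>n. U k i * cnj (U k j)) = \<delta> i j" if "i \<le> n" "j \<le> n" for i j
  proof -
    have "(\<Sum>k\<le>n. U k i * cnj (U k j)) = (\<Sum>k\<le>n. U j k * cnj (U i k))"
      by (intro sum.cong refl) (metis herm mult.commute)
    then show ?thesis using rows[OF that(2,1)] by (simp add: \<delta>_def eq_commute)
  qed
  show ?thesis
    using that[of U] row rows cols unfolding \<delta>_def by blast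
qed

text \<open>Functions are not identified almost everywhere, and an energy shifted by its lowest
  value may vanish on further vectors; hence the diagonal is nonnegative rather than
  positive.\<close>

locale hermitian_form =
  fixes V :: "('x \<Rightarrow> complex) set" and a :: "('x \<Rightarrow> complex) \<Rightarrow> ('x \<Rightarrow> complex) \<Rightarrow> complex"
  assumes V_zero: "(\<lambda>x. 0) \<in> V"
    and V_add: "u \<in> V \<Longrightarrow> v \<in> V \<Longrightarrow> (\<lambda>x. u x + v x) \<in> V"
    and V_cmult: "u \<in> V \<Longrightarrow> (\<lambda>x. c * u x) \<in> V"
    and form_add: "u \<in> V \<Longrightarrow> v \<in> V \<Longrightarrow> w \<in> V \<Longrightarrow> a (\<lambda>x. u x + v x) w = a u w + a v w"
    and form_cmult: "u \<in> V \<Longrightarrow> w \<in> V \<Longrightarrow> a (\<lambda>x. c * u x) w = c * a u w"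
    and form_sym: "u \<in> V \<Longrightarrow> v \<in> V \<Longrightarrow> a v u = cnj (a u v)"
    and form_nonneg: "u \<in> V \<Longrightarrow> 0 \<le> Re (a u u)"
begin

lemma form_add_right: "u \<in> V \<Longrightarrow> v \<in> V \<Longrightarrow> w \<in> V \<Longrightarrow> a w (\<lambda>x. u x + v x) = a w u + a w v"
  by (subst (1 2 3) form_sym) (auto simp: V_add form_add)

lemma form_cmult_right: "u \<in> V \<Longrightarrow> w \<in> V \<Longrightarrow> a w (\<lambda>x. c * u x) = cnj c * a w u"
  by (subst (1 2) form_sym) (auto simp: V_cmult form_cmult)

lemma form_diag: "u \<in> V \<Longrightarrow> a u u = of_real (Re (a u u))"
  using form_sym[of u u] by (simp add: complex_eq_iff)

lemma lincomb_V: "(\<And>k. k < n \<Longrightarrow> u k \<in> V) \<Longrightarrow> lincomb n c u \<in> V"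
  by (induction n) (auto simp: lincomb_0 lincomb_Suc V_zero V_add V_cmult)

lemma form_zero_left: "w \<in> V \<Longrightarrow> a (\<lambda>x. 0) w = 0"
  using form_cmult[OF V_zero, of w 0] by simp

lemma form_lincomb_left:
  "(\<And>k. k < n \<Longrightarrow> u k \<in> V) \<Longrightarrow> w \<in> V \<Longrightarrow> a (lincomb n c u) w = (\<Sum>k<n. c k * a (u k) w)"
  by (induction n) (auto simp: lincomb_0 lincomb_Suc form_zero_left form_add form_cmult V_cmult lincomb_V)

lemma form_lincomb_right:
  assumes "\<And>k. k < n \<Longrightarrow> u k \<in> V" "w \<in> V"
  shows "a w (lincomb n c u) = (\<Sum>k<n. cnj (c k) * a w (u k))"
proof -
  have "a w (lincomb n c u) = cnj (a (lincomb n c u) w)"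
    by (rule form_sym) (auto intro: assms lincomb_V)
  also have "\<dots> = (\<Sum>k<n. cnj (c k) * cnj (a (u k) w))"
    by (simp add: form_lincomb_left assms)
  also have "\<dots> = (\<Sum>k<n. cnj (c k) * a w (u k))"
    by (intro sum.cong refl) (use form_sym[OF assms(1) assms(2)] in auto)
  finally show ?thesis .
qed

lemma form_lincomb:
  assumes "\<And>k. k < n \<Longrightarrow> u k \<in> V" "\<And>k. k < n' \<Longrightarrow> v k \<in> V"
  shows "a (lincomb n c u) (lincomb n' d v) = (\<Sum>i<n. \<Sum>j<n'. c i * cnj (d j) * a (u i) (v j))"
proof -
  have "a (u i) (lincomb n' d v) = (\<Sum>j<n'. cnj (d j) * a (u i) (v j))" if "i < n" for i
    by (rule form_lincomb_right) (use that assms in auto)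
  then show ?thesis
    using form_lincomb_left[of n u "lincomb n' d v" c] lincomb_V[of n' v d] assms
    by (simp add: sum_distrib_left mult.assoc)
qed

text \<open>The form is nonnegative at \<open>u + t * a u v * v\<close> for every real
  \<open>t\<close>; the complex factor \<open>a u v\<close> makes the term linear in
  \<open>t\<close> real.\<close>

lemma form_Cauchy_Schwarz:
  assumes u: "u \<in> V" and v: "v \<in> V"
  shows "(cmod (a u v))\<^sup>2 \<le> Re (a u u) * Re (a v v)"
proof -
  define z where "z = a u v"
  have vu: "a v u = cnj z" unfolding z_def by (rule form_sym[OF u v])
  have q: "0 \<le> Re (a u u) + 2 * t * (cmod z)\<^sup>2 + t\<^sup>2 * (cmod z)\<^sup>2 * Re (a v v)" for t :: real
  proof -
    let ?w = "\<lambda>x. u x + (of_real t * z) * v x"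
    have V: "(\<lambda>x. (of_real t * z) * v x) \<in> V" using v by (rule V_cmult)
    have "a ?w ?w = a u u + cnj (of_real t * z) * z + (of_real t * z) * cnj z
        + (of_real t * z) * cnj (of_real t * z) * a v v"
      unfolding form_add[OF u V V_add[OF u V]] form_add_right[OF u V u] form_add_right[OF u V V]
        form_cmult[OF v u] form_cmult[OF v V] form_cmult_right[OF v u] form_cmult_right[OF v v] vu
      by (simp add: z_def[symmetric])
    also have "\<dots> = a u u + of_real (2 * t * (cmod z)\<^sup>2) + of_real (t\<^sup>2 * (cmod z)\<^sup>2) * a v v"
    proof -
      define W where "W = complex_of_real ((cmod z)\<^sup>2)"
      have zz: "z * cnj z = W" unfolding W_def by (rule complex_norm_square[symmetric])
      have e: "cnj (of_real t * z) * z = of_real t * W" "(of_real t * z) * cnj z = of_real t * W"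
        "(of_real t * z) * cnj (of_real t * z) = of_real (t\<^sup>2) * W"
        by (simp_all add: zz[symmetric] power2_eq_square mult_ac)
      show ?thesis unfolding e of_real_mult W_def[symmetric] by simp
    qed
    finally have "Re (a ?w ?w) = Re (a u u) + 2 * t * (cmod z)\<^sup>2 + t\<^sup>2 * (cmod z)\<^sup>2 * Re (a v v)"
      by (simp only: plus_complex.sel Re_complex_of_real) simp
    then show ?thesis using form_nonneg[OF V_add[OF u V]] by simp
  qed
  show ?thesis
  proof (cases "Re (a v v) = 0")
    case True
    \<comment> \<open>Without a quadratic term the inequality \<open>q\<close> is linear in
      \<open>t\<close> and fails for very negative \<open>t\<close> unless its slope
      vanishes.\<close>
    have "z = 0"
    proof (rule ccontr)
      assume "z \<noteq> 0"
      then have "2 * (- (Re (a u u) + 1) / (cmod z)\<^sup>2) * (cmod z)\<^sup>2 = - 2 * (Re (a u u) + 1)" by simp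
      then show False
        using q[of "- (Re (a u u) + 1) / (cmod z)\<^sup>2"] form_nonneg[OF u] by (simp add: True)
    qed
    then show ?thesis using True z_def by simp
  next
    case False
    then have pos: "Re (a v v) > 0" using form_nonneg[OF v] by simp
    \<comment> \<open>The quadratic in \<open>t\<close> takes its minimum at
      \<open>- 1 / Re (a v v)\<close>.\<close>
    have "0 \<le> (Re (a u u) + 2 * (- 1 / Re (a v v)) * (cmod z)\<^sup>2
        + (- 1 / Re (a v v))\<^sup>2 * (cmod z)\<^sup>2 * Re (a v v)) * Re (a v v)"
      by (rule mult_nonneg_nonneg[OF q[of "- 1 / Re (a v v)"] less_imp_le[OF pos]])
    also have "\<dots> = Re (a u u) * Re (a v v) - (cmod z)\<^sup>2"
      using pos by (simp add: field_simps power2_eq_square)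
    finally show ?thesis by (simp add: z_def)
  qed
qed

lemma form_triangle:
  assumes u: "u \<in> V" and v: "v \<in> V"
  shows "sqrt (Re (a (\<lambda>x. u x + v x) (\<lambda>x. u x + v x))) \<le> sqrt (Re (a u u)) + sqrt (Re (a v v))"
proof (rule real_le_lsqrt)
  have "a (\<lambda>x. u x + v x) (\<lambda>x. u x + v x) = a u u + a u v + cnj (a u v) + a v v"
    using form_sym[OF u v] by (simp add: form_add[OF u v V_add[OF u v]] form_add_right u v)
  then have "Re (a (\<lambda>x. u x + v x) (\<lambda>x. u x + v x)) = Re (a u u) + 2 * Re (a u v) + Re (a v v)"
    by simp
  moreover have "Re (a u v) \<le> sqrt (Re (a u u)) * sqrt (Re (a v v))"
  proof -
    have "cmod (a u v) \<le> sqrt (Re (a u u) * Re (a v v))"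
      by (rule real_le_rsqrt[OF form_Cauchy_Schwarz[OF u v]])
    then show ?thesis using complex_Re_le_cmod[of "a u v"] by (simp add: real_sqrt_mult)
  qed
  ultimately show "Re (a (\<lambda>x. u x + v x) (\<lambda>x. u x + v x)) \<le> (sqrt (Re (a u u)) + sqrt (Re (a v v)))\<^sup>2"
    using form_nonneg[OF u] form_nonneg[OF v] by (simp add: power2_sum)
  show "0 \<le> sqrt (Re (a u u)) + sqrt (Re (a v v))"
    using form_nonneg[OF u] form_nonneg[OF v] by simp
qed

end

section \<open>Minimax values over abstract trial spaces\<close>

definition trial :: "(('x \<Rightarrow> complex) \<Rightarrow> bool) \<Rightarrow> ('x \<Rightarrow> complex) set \<Rightarrow> nat \<Rightarrow> ('x \<Rightarrow> complex) set \<Rightarrow> bool" where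
  "trial Z V j S \<longleftrightarrow> (\<exists>u. (\<forall>k<j. u k \<in> V) \<and> (\<forall>c. Z (lincomb j c u) \<longrightarrow> (\<forall>k<j. c k = 0)) \<and> S = span_of j u)"

definition minimax ::
    "(('x \<Rightarrow> complex) \<Rightarrow> bool) \<Rightarrow> ('x \<Rightarrow> complex) set \<Rightarrow> (('x \<Rightarrow> complex) \<Rightarrow> real) \<Rightarrow> nat \<Rightarrow> real" where
  "minimax Z V R j = (INF S \<in> {S. trial Z V j S}. SUP u \<in> {u \<in> S. \<not> Z u}. R u)"

lemma minimax_eigenvalue_eq: "minimax_eigenvalue \<Omega> V h \<beta> j = minimax (ae_zero \<Omega>) V (rayleigh \<Omega> h \<beta>) j"
  by (simp add: minimax_eigenvalue_def minimax_def trial_def trial_subspace_def span_of_def lincomb_def)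

text \<open>The coefficient map \<open>\<sigma>\<close> allows for antilinear \<open>\<Phi>\<close>.\<close>

lemma minimax_transfer_subset:
  assumes V: "\<And>u. u \<in> V \<Longrightarrow> \<Phi> u \<in> V'"
    and lin: "\<And>n c u. \<Phi> (lincomb n c u) = lincomb n (\<lambda>k. \<sigma> (c k)) (\<lambda>k. \<Phi> (u k))"
    and \<sigma>: "\<And>z. \<sigma> (\<sigma> z) = z" "\<sigma> 0 = 0"
    and Vl: "\<And>n c u. (\<And>k. k < n \<Longrightarrow> u k \<in> V) \<Longrightarrow> lincomb n c u \<in> V"
    and Z: "\<And>u. u \<in> V \<Longrightarrow> Z' (\<Phi> u) \<longleftrightarrow> Z u"
    and R: "\<And>u. u \<in> V \<Longrightarrow> R' (\<Phi> u) = R u"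
  shows "(\<lambda>S. SUP u \<in> {u \<in> S. \<not> Z u}. R u) ` {S. trial Z V j S}
    \<subseteq> (\<lambda>S. SUP u \<in> {u \<in> S. \<not> Z' u}. R' u) ` {S. trial Z' V' j S}"
proof clarify
  fix S assume "trial Z V j S"
  then obtain u where u: "\<forall>k<j. u k \<in> V" "\<forall>c. Z (lincomb j c u) \<longrightarrow> (\<forall>k<j. c k = 0)" "S = span_of j u"
    by (auto simp: trial_def)
  have SV: "S \<subseteq> V" using u(1,3) Vl by (auto simp: span_of_def)
  have eq: "lincomb j c (\<lambda>k. \<Phi> (u k)) = \<Phi> (lincomb j (\<lambda>k. \<sigma> (c k)) u)" for c
    by (simp add: lin \<sigma>)
  have im: "span_of j (\<lambda>k. \<Phi> (u k)) = \<Phi> ` S"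
  proof (intro equalityI subsetI)
    fix f assume "f \<in> span_of j (\<lambda>k. \<Phi> (u k))"
    then obtain c where "f = \<Phi> (lincomb j (\<lambda>k. \<sigma> (c k)) u)" by (auto simp: span_of_def eq)
    then show "f \<in> \<Phi> ` S" by (auto simp: u(3) lincomb_in_span)
  next
    fix f assume "f \<in> \<Phi> ` S"
    then obtain c where "f = \<Phi> (lincomb j c u)" by (auto simp: u(3) span_of_def)
    then show "f \<in> span_of j (\<lambda>k. \<Phi> (u k))" by (simp add: lin lincomb_in_span)
  qed
  have "trial Z' V' j (\<Phi> ` S)"
    unfolding trial_def
  proof (intro exI[of _ "\<lambda>k. \<Phi> (u k)"] conjI allI impI)
    fix c k assume "Z' (lincomb j c (\<lambda>k. \<Phi> (u k)))" "k < j"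
    moreover have "lincomb j (\<lambda>k. \<sigma> (c k)) u \<in> V" by (intro Vl) (use u(1) in auto)
    ultimately have "Z (lincomb j (\<lambda>k. \<sigma> (c k)) u)" by (simp add: eq Z)
    then have "\<sigma> (c k) = 0"
      using u(2)[rule_format, of "\<lambda>k. \<sigma> (c k)" k] \<open>k < j\<close> by simp
    then show "c k = 0" using \<sigma> by metis
  qed (use u(1) V im in auto)
  moreover have "{v \<in> \<Phi> ` S. \<not> Z' v} = \<Phi> ` {u \<in> S. \<not> Z u}"
    using SV Z by auto
  then have "(SUP v \<in> {v \<in> \<Phi> ` S. \<not> Z' v}. R' v) = (SUP u \<in> {u \<in> S. \<not> Z u}. R u)"
  proof -
    have "R' ` \<Phi> ` {u \<in> S. \<not> Z u} = R ` {u \<in> S. \<not> Z u}"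
      unfolding image_image by (intro image_cong refl R) (use SV in auto)
    then show ?thesis using \<open>{v \<in> \<Phi> ` S. \<not> Z' v} = \<Phi> ` {u \<in> S. \<not> Z u}\<close> by simp
  qed
  ultimately show "(SUP u \<in> {u \<in> S. \<not> Z u}. R u)
      \<in> (\<lambda>S. SUP u \<in> {u \<in> S. \<not> Z' u}. R' u) ` {S. trial Z' V' j S}"
    by (intro image_eqI[of _ _ "\<Phi> ` S"]) simp_all
qed

section \<open>Orthonormal tuples and trace inequalities\<close>

locale form_pair = m: hermitian_form V m + a: hermitian_form V a
  for V :: "('x \<Rightarrow> complex) set" and m a +
  fixes Z R
  assumes Z_iff: "u \<in> V \<Longrightarrow> Z u \<longleftrightarrow> Re (m u u) = 0"
    and R_eq: "u \<in> V \<Longrightarrow> R u = Re (a u u) / Re (m u u)"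
begin

abbreviation ev :: "nat \<Rightarrow> real" where "ev \<equiv> minimax Z V R"

definition orthonormal :: "nat \<Rightarrow> (nat \<Rightarrow> 'x \<Rightarrow> complex) \<Rightarrow> bool" where
  "orthonormal n u \<longleftrightarrow> (\<forall>i<n. u i \<in> V) \<and> (\<forall>i<n. \<forall>j<n. m (u i) (u j) = (if i = j then 1 else 0))"

lemma orthonormalD: "orthonormal n u \<Longrightarrow> i < n \<Longrightarrow> u i \<in> V"
  "orthonormal n u \<Longrightarrow> i < n \<Longrightarrow> j < n \<Longrightarrow> m (u i) (u j) = (if i = j then 1 else 0)"
  by (auto simp: orthonormal_def)

lemma orthonormal_form:
  assumes "orthonormal n u"
  shows "m (lincomb n c u) (lincomb n d u) = (\<Sum>k<n. c k * cnj (d k))"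
proof -
  have "m (lincomb n c u) (lincomb n d u) = (\<Sum>i<n. \<Sum>j<n. c i * cnj (d j) * m (u i) (u j))"
    by (rule m.form_lincomb) (auto intro: orthonormalD assms)
  also have "\<dots> = (\<Sum>i<n. \<Sum>j<n. if i = j then c i * cnj (d j) else 0)"
    by (intro sum.cong refl) (auto simp: orthonormalD[OF assms])
  also have "\<dots> = (\<Sum>k<n. c k * cnj (d k))" by simp
  finally show ?thesis .
qed

lemma orthonormal_norm:
  "orthonormal n u \<Longrightarrow> Re (m (lincomb n c u) (lincomb n c u)) = (\<Sum>k<n. (cmod (c k))\<^sup>2)"
  by (simp add: orthonormal_form complex_mult_cnj cmod_power2)

lemma orthonormal_trial:
  assumes "orthonormal n u" shows "trial Z V n (span_of n u)"
  unfolding trial_def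
proof (intro exI[of _ u] conjI allI impI)
  fix c k assume Z: "Z (lincomb n c u)" and k: "k < n"
  have "lincomb n c u \<in> V" by (intro m.lincomb_V orthonormalD[OF assms])
  then have "(\<Sum>k<n. (cmod (c k))\<^sup>2) = 0" using Z Z_iff orthonormal_norm[OF assms] by simp
  then have "(cmod (c k))\<^sup>2 = 0" using k by (subst (asm) sum_nonneg_eq_0_iff) auto
  then show "c k = 0" by simp
qed (auto intro: orthonormalD[OF assms])

lemma normalize:
  assumes u: "u \<in> V" "\<not> Z u"
  defines "r \<equiv> inverse (sqrt (Re (m u u)))"
  shows "m (\<lambda>x. of_real r * u x) (\<lambda>x. of_real r * u x) = 1"
    and "Re (a (\<lambda>x. of_real r * u x) (\<lambda>x. of_real r * u x)) = R u"
    and "r > 0"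
proof -
  have pos: "Re (m u u) > 0" using u Z_iff m.form_nonneg[of u] by force
  then show "r > 0" by (simp add: r_def)
  have r2: "r * r = inverse (Re (m u u))" using pos by (simp add: r_def flip: inverse_mult_distrib)
  have "m (\<lambda>x. of_real r * u x) (\<lambda>x. of_real r * u x) = of_real (r * r) * m u u"
    using u by (simp add: m.form_cmult m.form_cmult_right m.V_cmult mult.assoc)
  also have "\<dots> = of_real (r * r * Re (m u u))"
    using m.form_diag[OF u(1)] by (metis of_real_mult)
  finally show "m (\<lambda>x. of_real r * u x) (\<lambda>x. of_real r * u x) = 1" using r2 pos by simp
  have "a (\<lambda>x. of_real r * u x) (\<lambda>x. of_real r * u x) = of_real (r * r) * a u u"
    using u by (simp add: a.form_cmult a.form_cmult_right a.V_cmult mult.assoc)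
  then have "Re (a (\<lambda>x. of_real r * u x) (\<lambda>x. of_real r * u x)) = r * r * Re (a u u)" by simp
  also have "\<dots> = R u" using R_eq[OF u(1)] unfolding r2 by (simp add: field_simps)
  finally show "Re (a (\<lambda>x. of_real r * u x) (\<lambda>x. of_real r * u x)) = R u" .
qed

text \<open>Independence is required modulo \<open>Z\<close> because a vector of norm zero cannot be
  normalized, even if it is a nonzero function.\<close>

lemma gram_schmidt:
  assumes "\<And>k. k < n \<Longrightarrow> u k \<in> V" and "\<And>c. Z (lincomb n c u) \<Longrightarrow> \<forall>k<n. c k = 0"
  shows "\<exists>e. orthonormal n e \<and> span_of n e = span_of n u"
  using assms
proof (induction n)
  case 0
  show ?case by (auto simp: orthonormal_def span_of_def lincomb_0)
next
  case (Suc n)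
  have "\<forall>k<n. c k = 0" if "Z (lincomb n c u)" for c
  proof -
    have "lincomb (Suc n) (c(n := 0)) u = lincomb n c u"
      by (auto simp: lincomb_Suc intro!: lincomb_cong)
    then have "\<forall>k<Suc n. (c(n := 0)) k = 0" using Suc.prems(2) that by metis
    then show ?thesis by (metis fun_upd_other less_SucI nat_neq_iff)
  qed
  then obtain e where e: "orthonormal n e" "span_of n e = span_of n u"
    using Suc by (metis less_SucI)
  \<comment> \<open>Minus the orthogonal projection of \<open>u n\<close> onto the earlier vectors.
    As \<open>u n\<close> enters \<open>w\<close> with coefficient 1, independence keeps
    \<open>w\<close> from having norm zero.\<close>
  define p where "p = lincomb n (\<lambda>k. - m (u n) (e k)) e"
  define w where "w = (\<lambda>x. p x + u n x)"
  have pV: "p \<in> V" unfolding p_def by (intro m.lincomb_V orthonormalD[OF e(1)])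
  have un: "u n \<in> V" using Suc.prems by simp
  have wV: "w \<in> V" unfolding w_def by (intro m.V_add pV un)
  obtain d where d: "p = lincomb n d u"
    using lincomb_in_span[of n "\<lambda>k. - m (u n) (e k)" e] unfolding e(2) p_def[symmetric]
    by (auto simp: span_of_def)
  have "w = lincomb (Suc n) (d(n := 1)) u"
    unfolding w_def d by (auto simp: lincomb_Suc fun_eq_iff intro!: fun_cong[OF lincomb_cong])
  note w_eq = this
  have nZ: "\<not> Z w"
  proof
    assume "Z w"
    then have "\<forall>k<Suc n. (d(n := 1)) k = 0" unfolding w_eq by (rule Suc.prems(2))
    then have "(d(n := 1)) n = 0" by blast
    then show False by simp
  qed
  define r where "r = inverse (sqrt (Re (m w w)))"
  define e' where "e' = e(n := (\<lambda>x. of_real r * w x))"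
  note nr = normalize[OF wV nZ, folded r_def]
  have orth: "m w (e i) = 0" if "i < n" for i
  proof -
    have "m p (e i) = (\<Sum>k<n. - m (u n) (e k) * m (e k) (e i))"
      unfolding p_def by (intro m.form_lincomb_left orthonormalD[OF e(1)] that)
    also have "\<dots> = (\<Sum>k<n. if k = i then - m (u n) (e k) else 0)"
      by (intro sum.cong refl) (simp add: orthonormalD[OF e(1)] that)
    also have "\<dots> = - m (u n) (e i)" using that by simp
    finally show ?thesis
      unfolding w_def using m.form_add[OF pV un orthonormalD(1)[OF e(1) that]] by simp
  qed
  have orth': "m (e i) w = 0" if "i < n" for i
    using m.form_sym[OF wV orthonormalD(1)[OF e(1) that]] orth[OF that] by simp
  have "orthonormal (Suc n) e'"
    unfolding orthonormal_def
  proof (intro conjI allI impI)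
    fix i assume "i < Suc n"
    then show "e' i \<in> V" using orthonormalD(1)[OF e(1)] wV by (auto simp: e'_def m.V_cmult less_Suc_eq)
  next
    fix i j assume "i < Suc n" "j < Suc n"
    then consider "i < n" "j < n" | "i < n" "j = n" | "i = n" "j < n" | "i = n" "j = n" by linarith
    then show "m (e' i) (e' j) = (if i = j then 1 else 0)"
    proof cases
      case 1 then show ?thesis by (simp add: e'_def orthonormalD[OF e(1)])
    next
      case 2 then show ?thesis
        by (simp add: e'_def m.form_cmult_right[OF wV orthonormalD(1)[OF e(1)]] orth')
    next
      case 3 then show ?thesis
        by (simp add: e'_def m.form_cmult[OF wV orthonormalD(1)[OF e(1)]] orth)
    next
      case 4 then show ?thesis using nr(1) by (simp add: e'_def)
    qed
  qed
  moreover have "span_of (Suc n) e' = span_of (Suc n) u"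
  proof (intro equalityI span_of_mono)
    have sub: "span_of n u \<subseteq> span_of (Suc n) u"
      by (intro span_of_mono span_of_nth) simp
    have w_span: "w \<in> span_of (Suc n) u"
      unfolding w_eq by (rule lincomb_in_span)
    fix k assume "k < Suc n"
    then show "e' k \<in> span_of (Suc n) u"
      using sub e(2) span_of_nth[of k n e] w_span by (auto simp: e'_def less_Suc_eq span_of_cmult)
  next
    have "span_of n e \<subseteq> span_of (Suc n) e'"
      by (intro span_of_mono) (metis e'_def fun_upd_other less_SucI nat_neq_iff span_of_nth)
    then have sub: "span_of n u \<subseteq> span_of (Suc n) e'" and pS: "p \<in> span_of (Suc n) e'"
      using e(2) by (auto simp: p_def lincomb_in_span)
    have "(\<lambda>x. (1 / of_real r) * e' n x + (-1) * p x) \<in> span_of (Suc n) e'"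
      by (intro span_of_add span_of_cmult span_of_nth pS) simp
    moreover have "(\<lambda>x. (1 / of_real r) * e' n x + (-1) * p x) = u n"
      using nr(3) by (auto simp: e'_def w_def)
    ultimately have "u n \<in> span_of (Suc n) e'" by simp
    moreover fix k assume "k < Suc n"
    ultimately show "u k \<in> span_of (Suc n) e'"
      using sub span_of_nth[of k n u] by (auto simp: less_Suc_eq)
  qed
  ultimately show ?case by blast
qed

lemma trial_orthonormal:
  assumes "trial Z V n S" obtains e where "orthonormal n e" "S = span_of n e"
  using assms gram_schmidt[of n] unfolding trial_def by metis

lemma R_nonneg: "u \<in> V \<Longrightarrow> 0 \<le> R u"
  using a.form_nonneg m.form_nonneg by (simp add: R_eq)

text \<open>Makes the suprema in \<open>minimax\<close> genuine: on an unbounded set of reals a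
  supremum would be an unspecified value. A crude bound by the sum of all matrix entries is
  enough.\<close>

lemma trial_bounded:
  assumes "trial Z V n S" shows "bdd_above (R ` {u \<in> S. \<not> Z u})"
proof -
  obtain e where e: "orthonormal n e" "S = span_of n e" using trial_orthonormal[OF assms] by blast
  define B where "B = (\<Sum>i<n. \<Sum>j<n. cmod (a (e i) (e j)))"
  have "R u \<le> B" if uS: "u \<in> S" and uZ: "\<not> Z u" for u
  proof -
    obtain c where c: "u = lincomb n c e"
      using uS unfolding e(2) span_of_def by blast
    have uV: "u \<in> V" unfolding c by (intro m.lincomb_V orthonormalD[OF e(1)])
    define s where "s = (\<Sum>k<n. (cmod (c k))\<^sup>2)"
    have mu: "Re (m u u) = s" unfolding c s_def by (rule orthonormal_norm[OF e(1)])
    have pos: "s > 0" using uZ Z_iff[OF uV] m.form_nonneg[OF uV] by (simp add: mu)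
    have cc: "cmod (c i) * cmod (c j) \<le> s" if "i < n" "j < n" for i j
    proof -
      have "(cmod (c i))\<^sup>2 \<le> s" "(cmod (c j))\<^sup>2 \<le> s"
        unfolding s_def using that by (auto intro!: member_le_sum)
      then show ?thesis
        using zero_le_power2[of "cmod (c i) - cmod (c j)"] by (simp add: power2_eq_square algebra_simps)
    qed
    have "Re (a u u) \<le> cmod (a u u)" by (rule complex_Re_le_cmod)
    also have "cmod (a u u) = cmod (\<Sum>i<n. \<Sum>j<n. c i * cnj (c j) * a (e i) (e j))"
      unfolding c by (intro arg_cong[of _ _ cmod] a.form_lincomb) (auto intro: orthonormalD[OF e(1)])
    also have "\<dots> \<le> (\<Sum>i<n. \<Sum>j<n. s * cmod (a (e i) (e j)))"
      by (intro order_trans[OF norm_sum] sum_mono) (auto simp: norm_mult cc intro!: mult_right_mono)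
    also have "\<dots> = s * B" by (simp add: B_def sum_distrib_left)
    finally show ?thesis using pos by (simp add: R_eq[OF uV] mu field_simps)
  qed
  then show ?thesis by (intro bdd_aboveI[of _ B]) auto
qed

text \<open>The infimum must be known to be bounded below, here by 0. The condition
  \<open>n \<ge> 1\<close> provides a basis vector \<open>e 0\<close>; for \<open>n = 0\<close> the
  supremum would run over the empty set.\<close>

lemma ev_le_SUP:
  assumes "trial Z V n S" "n \<ge> 1" shows "ev n \<le> (SUP u \<in> {u \<in> S. \<not> Z u}. R u)"
  unfolding minimax_def
proof (rule cINF_lower)
  show "S \<in> {S. trial Z V n S}" using assms(1) by simp
  have "0 \<le> (SUP u \<in> {u \<in> S. \<not> Z u}. R u)" if S: "trial Z V n S" for S
  proof -
    obtain e where e: "orthonormal n e" "S = span_of n e" using trial_orthonormal[OF S] by blast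
    have e0: "e 0 \<in> S" "e 0 \<in> V" "m (e 0) (e 0) = 1"
      using assms(2) span_of_nth[of 0 n e] orthonormalD[OF e(1), of 0] e(2) by auto
    then have "e 0 \<in> {u \<in> S. \<not> Z u}" using Z_iff by simp
    then show ?thesis
      using cSUP_upper[OF _ trial_bounded[OF S]] R_nonneg[OF e0(2)] by (meson order_trans)
  qed
  then show "bdd_below ((\<lambda>S. SUP u \<in> {u \<in> S. \<not> Z u}. R u) ` {S. trial Z V n S})"
    by (intro bdd_belowI[of _ 0]) auto
qed

text \<open>The trace of the form on a finite-dimensional space does not depend on the orthonormal basis,
  so one may split off a vector almost maximizing \<open>R\<close> and apply the induction hypothesis to its
  orthogonal complement.\<close>

lemma sum_ev_le_trace:
  "orthonormal n v \<Longrightarrow> (\<Sum>j=1..n. ev j) \<le> (\<Sum>k<n. Re (a (v k) (v k)))"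
proof (induction n arbitrary: v)
  case 0
  then show ?case by simp
next
  case (Suc n)
  let ?S = "span_of (Suc n) v"
  have tr: "trial Z V (Suc n) ?S" by (rule orthonormal_trial[OF Suc.prems])
  have vV: "v k \<in> V" if "k < Suc n" for k using orthonormalD(1)[OF Suc.prems that] .
  show ?case
  proof (rule field_le_epsilon)
    fix e :: real assume e: "e > 0"
    have "v 0 \<in> {u \<in> ?S. \<not> Z u}"
      using orthonormalD(2)[OF Suc.prems, of 0 0] Z_iff[OF vV[of 0]] by (simp add: span_of_nth)
    then have "{u \<in> ?S. \<not> Z u} \<noteq> {}" by blast
    from less_cSUP_iff[OF this trial_bounded[OF tr], of "(SUP u \<in> {u \<in> ?S. \<not> Z u}. R u) - e"]
    obtain u where u: "u \<in> ?S" "\<not> Z u" "(SUP u \<in> {u \<in> ?S. \<not> Z u}. R u) - e < R u"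
      using e by auto
    obtain c where c: "u = lincomb (Suc n) c v" using u(1) by (auto simp: span_of_def)
    have uV: "u \<in> V" unfolding c by (intro m.lincomb_V vV)
    define r where "r = inverse (sqrt (Re (m u u)))"
    note nr = normalize[OF uV u(2), folded r_def]
    \<comment> \<open>\<open>householder\<close> asks for a real last coefficient. Multiplying the
      near maximizer by a number of modulus 1 achieves this and changes neither form on the
      diagonal.\<close>
    define \<theta> where "\<theta> = (if c n = 0 then 1 else cnj (c n) / of_real (cmod (c n)))"
    have \<theta>: "\<theta> * cnj \<theta> = 1" "Im (\<theta> * c n) = 0"
    proof -
      have zz: "cnj (c n) * c n = of_real (cmod (c n)) * of_real (cmod (c n))"
        using complex_norm_square[of "c n"] by (simp add: power2_eq_square mult.commute)
      have "\<theta> * cnj \<theta> = 1 \<and> \<theta> * c n = of_real (cmod (c n))"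
      proof (cases "c n = 0")
        case False
        then have "of_real (cmod (c n)) \<noteq> (0::complex)" by simp
        then show ?thesis using False zz by (simp add: \<theta>_def field_simps)
      qed (simp add: \<theta>_def)
      then show "\<theta> * cnj \<theta> = 1" "Im (\<theta> * c n) = 0" by auto
    qed
    define d where "d = (\<lambda>k. \<theta> * of_real r * c k)"
    define y where "y = lincomb (Suc n) d v"
    have y: "y = (\<lambda>x. \<theta> * (of_real r * u x))"
      unfolding y_def c d_def by (simp add: lincomb_def sum_distrib_left ring_distribs mult.assoc)
    have ruV: "(\<lambda>x. of_real r * u x) \<in> V" by (intro m.V_cmult uV)
    have "m y y = (\<theta> * cnj \<theta>) * m (\<lambda>x. of_real r * u x) (\<lambda>x. of_real r * u x)"
      unfolding y by (simp only: m.form_cmult[OF ruV m.V_cmult[OF ruV]] m.form_cmult_right[OF ruV ruV] mult.assoc)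
    then have my: "m y y = 1" using nr(1) \<theta>(1) by simp
    have "a y y = (\<theta> * cnj \<theta>) * a (\<lambda>x. of_real r * u x) (\<lambda>x. of_real r * u x)"
      unfolding y by (simp only: a.form_cmult[OF ruV a.V_cmult[OF ruV]] a.form_cmult_right[OF ruV ruV] mult.assoc)
    then have ay: "Re (a y y) = R u" using nr(2) \<theta>(1) by simp
    have d1: "(\<Sum>k\<le>n. (cmod (d k))\<^sup>2) = 1"
      using orthonormal_norm[OF Suc.prems, of d] my by (simp add: y_def lessThan_Suc_atMost)
    have d2: "Im (d n) = 0"
    proof -
      have "d n = of_real r * (\<theta> * c n)" by (simp add: d_def)
      then show ?thesis using \<theta>(2) by simp
    qed
    obtain U where U: "\<And>k. k \<le> n \<Longrightarrow> U n k = d k"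
      "\<And>i j. i \<le> n \<Longrightarrow> j \<le> n \<Longrightarrow> (\<Sum>k\<le>n. U i k * cnj (U j k)) = (if i = j then 1 else 0)"
      "\<And>i j. i \<le> n \<Longrightarrow> j \<le> n \<Longrightarrow> (\<Sum>k\<le>n. U k i * cnj (U k j)) = (if i = j then 1 else 0)"
      using householder[OF d1 d2] by blast
    define w where "w = (\<lambda>i. lincomb (Suc n) (U i) v)"
    have wn: "w n = y" unfolding w_def y_def by (intro lincomb_cong) (auto simp: U(1))
    have wV: "w i \<in> V" for i unfolding w_def by (intro m.lincomb_V vV)
    have w_on: "orthonormal n w"
      unfolding orthonormal_def
      by (auto simp: wV) (auto simp: w_def orthonormal_form[OF Suc.prems] lessThan_Suc_atMost U(2))
    have "(\<Sum>i\<le>n. a (w i) (w i)) = (\<Sum>i\<le>n. \<Sum>j\<le>n. \<Sum>k\<le>n. U i j * cnj (U i k) * a (v j) (v k))"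
      unfolding w_def by (simp only: a.form_lincomb[OF vV vV] lessThan_Suc_atMost)
    also have "\<dots> = (\<Sum>j\<le>n. \<Sum>k\<le>n. \<Sum>i\<le>n. U i j * cnj (U i k) * a (v j) (v k))"
      by (subst sum.swap) (intro sum.cong refl sum.swap)
    also have "\<dots> = (\<Sum>j\<le>n. \<Sum>k\<le>n. (if j = k then 1 else 0) * a (v j) (v k))"
      by (intro sum.cong refl) (simp add: U(3) flip: sum_distrib_right)
    also have "\<dots> = (\<Sum>j\<le>n. a (v j) (v j))"
      by (simp add: if_distrib[of "\<lambda>c. c * _"] cong: if_cong)
    finally have "Re (\<Sum>i\<le>n. a (w i) (w i)) = Re (\<Sum>j\<le>n. a (v j) (v j))" by simp
    then have trace: "(\<Sum>i<n. Re (a (w i) (w i))) + R u = (\<Sum>k<Suc n. Re (a (v k) (v k)))"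
      unfolding Re_sum lessThan_Suc_atMost[symmetric] sum.lessThan_Suc[of _ n] wn using ay by simp
    have "(\<Sum>j=1..Suc n. ev j) = (\<Sum>j=1..n. ev j) + ev (Suc n)" by simp
    also have "\<dots> \<le> (\<Sum>i<n. Re (a (w i) (w i))) + (R u + e)"
      using Suc.IH[OF w_on] ev_le_SUP[OF tr] u(3) by simp
    finally show "(\<Sum>j=1..Suc n. ev j) \<le> (\<Sum>k<Suc n. Re (a (v k) (v k))) + e"
      using trace by simp
  qed
qed

text \<open>The converse of \<open>sum_ev_le_trace\<close>, up to an error. A nearly optimal trial
  space of dimension \<open>n + 1\<close> contains a nonzero vector orthogonal to the
  \<open>n\<close> vectors already found, and every vector of that space has a quotient below
  \<open>ev (Suc n)\<close> plus the error. The assumption \<open>ne\<close> excludes infima over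
  the empty set.\<close>

lemma exists_orthonormal_trace_le:
  assumes ne: "\<And>j. \<exists>S. trial Z V j S" and e: "e > 0"
  shows "\<exists>u. orthonormal n u \<and> (\<Sum>k<n. Re (a (u k) (u k))) \<le> (\<Sum>j=1..n. ev j) + e"
  using e
proof (induction n arbitrary: e)
  case 0
  then show ?case by (auto simp: orthonormal_def)
next
  case (Suc n)
  obtain u where u: "orthonormal n u" "(\<Sum>k<n. Re (a (u k) (u k))) \<le> (\<Sum>j=1..n. ev j) + e / 2"
    using Suc.IH[of "e / 2"] Suc.prems by auto
  have "(\<lambda>S. SUP u \<in> {u \<in> S. \<not> Z u}. R u) ` {S. trial Z V (Suc n) S} \<noteq> {}"
    using ne by auto
  moreover have "ev (Suc n) < ev (Suc n) + e / 2" using Suc.prems by simp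
  ultimately obtain S where S: "trial Z V (Suc n) S" "(SUP u \<in> {u \<in> S. \<not> Z u}. R u) < ev (Suc n) + e / 2"
    unfolding minimax_def using cInf_lessD by (smt (verit, best) imageE mem_Collect_eq)
  obtain b where b: "orthonormal (Suc n) b" "S = span_of (Suc n) b" using trial_orthonormal[OF S(1)] by blast
  obtain c where c: "\<exists>k\<le>n. c k \<noteq> 0" "\<forall>i<n. (\<Sum>k\<le>n. m (b k) (u i) * c k) = 0"
    using homogeneous_system[of n "\<lambda>i k. m (b k) (u i)"] by blast
  define w where "w = lincomb (Suc n) c b"
  have wV: "w \<in> V" unfolding w_def by (intro m.lincomb_V orthonormalD[OF b(1)])
  have orth: "m w (u i) = 0" if "i < n" for i
    unfolding w_def using c(2) that
    by (subst m.form_lincomb_left[OF orthonormalD(1)[OF b(1)] orthonormalD(1)[OF u(1)]])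
       (auto simp: lessThan_Suc_atMost mult.commute)
  have orth': "m (u i) w = 0" if "i < n" for i
    using m.form_sym[OF wV orthonormalD(1)[OF u(1) that]] orth[OF that] by simp
  have nZ: "\<not> Z w"
  proof
    assume "Z w"
    then have "(\<Sum>k<Suc n. (cmod (c k))\<^sup>2) = 0"
      using Z_iff[OF wV] orthonormal_norm[OF b(1), of c] by (simp add: w_def)
    then have "\<forall>k<Suc n. (cmod (c k))\<^sup>2 = 0" by (subst (asm) sum_nonneg_eq_0_iff) auto
    then show False using c(1) by auto
  qed
  have "w \<in> S" unfolding w_def b(2) by (rule lincomb_in_span)
  then have Rw: "R w \<le> ev (Suc n) + e / 2"
    using cSUP_upper[OF _ trial_bounded[OF S(1)], of w] nZ S(2) by force
  define r where "r = inverse (sqrt (Re (m w w)))"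
  note nr = normalize[OF wV nZ, folded r_def]
  define u' where "u' = u(n := (\<lambda>x. of_real r * w x))"
  have "orthonormal (Suc n) u'"
    unfolding orthonormal_def
  proof (intro conjI allI impI)
    fix i assume "i < Suc n"
    then show "u' i \<in> V" using orthonormalD(1)[OF u(1)] wV by (auto simp: u'_def m.V_cmult less_Suc_eq)
  next
    fix i j assume "i < Suc n" "j < Suc n"
    then consider "i < n" "j < n" | "i < n" "j = n" | "i = n" "j < n" | "i = n" "j = n" by linarith
    then show "m (u' i) (u' j) = (if i = j then 1 else 0)"
    proof cases
      case 1 then show ?thesis by (simp add: u'_def orthonormalD[OF u(1)])
    next
      case 2 then show ?thesis
        by (simp add: u'_def m.form_cmult_right[OF wV orthonormalD(1)[OF u(1)]] orth')
    next
      case 3 then show ?thesis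
        by (simp add: u'_def m.form_cmult[OF wV orthonormalD(1)[OF u(1)]] orth)
    next
      case 4 then show ?thesis using nr(1) by (simp add: u'_def)
    qed
  qed
  moreover have "(\<Sum>k<Suc n. Re (a (u' k) (u' k))) = (\<Sum>k<n. Re (a (u k) (u k))) + R w"
    using nr(2) by (simp add: u'_def)
  then have "(\<Sum>k<Suc n. Re (a (u' k) (u' k))) \<le> (\<Sum>j=1..Suc n. ev j) + e"
    using u(2) Rw by simp
  ultimately show ?case by blast
qed

end

section \<open>Integrals over plane domains\<close>

subsection \<open>Affine changes of variables\<close>

context
  fixes T :: "real^2 \<Rightarrow> real^2" and q :: "real^2"
  assumes lin: "linear T" and bij: "bij T"
begin

lemma det_pos: "\<bar>det (matrix T)\<bar> > 0"
  using lin bij by (simp add: bij_is_inj det_nz_iff_inj)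

lemma affine_inv: "inv T (T x + q - q) = x" "T (inv T (y - q)) + q = y"
  using bij by (auto simp: bij_is_inj bij_is_surj surj_f_inv_f)

lemma affine_image_iff: "y \<in> (\<lambda>x. T x + q) ` A \<longleftrightarrow> inv T (y - q) \<in> A"
proof
  assume "y \<in> (\<lambda>x. T x + q) ` A"
  then obtain x where "x \<in> A" "y = T x + q" by auto
  then show "inv T (y - q) \<in> A" using affine_inv(1)[of x] by simp
next
  assume "inv T (y - q) \<in> A"
  then show "y \<in> (\<lambda>x. T x + q) ` A" using affine_inv(2)[of y] by (metis (no_types, lifting) image_eqI)
qed

text \<open>Sets of infinite measure are reached as increasing unions of their intersections with
  balls.\<close>

lemma affine_image_emeasure:
  assumes "A \<in> sets lebesgue"
  shows "(\<lambda>x. T x + q) ` A \<in> sets lebesgue"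
    and "emeasure lebesgue ((\<lambda>x. T x + q) ` A) = ennreal \<bar>det (matrix T)\<bar> * emeasure lebesgue A"
proof -
  let ?S = "\<lambda>x. T x + q"
  have lm: "?S ` B \<in> lmeasurable \<and> measure lebesgue (?S ` B) = \<bar>det (matrix T)\<bar> * measure lebesgue B"
    if "B \<in> lmeasurable" for B
  proof -
    have "?S ` B = (+) q ` (T ` B)" by (auto simp: image_image add.commute)
    then show ?thesis
      using measurable_linear_image[OF lin that] measure_linear_image[OF lin that]
      by (simp add: measurable_translation measure_translation)
  qed
  define B where "B n = A \<inter> cball 0 (real n)" for n :: nat
  have B: "B n \<in> lmeasurable" for n
    using assms unfolding B_def by (intro bounded_set_imp_lmeasurable) (auto simp: bounded_Int)
  have inc: "incseq B" by (auto simp: incseq_def B_def)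
  have A: "A = (\<Union>n. B n)"
  proof -
    have "\<exists>n. norm x \<le> real n" for x :: "real^2" using real_arch_simple by blast
    then show ?thesis by (auto simp: B_def)
  qed
  have SA: "?S ` A = (\<Union>n. ?S ` B n)" unfolding A by (simp add: image_UN)
  show "?S ` A \<in> sets lebesgue"
    unfolding SA using lm[OF B] by (intro sets.countable_UN) (auto dest: fmeasurableD)
  have "emeasure lebesgue (?S ` A) = (SUP n. emeasure lebesgue (?S ` B n))"
    unfolding SA
    by (rule SUP_emeasure_incseq[symmetric])
       (use lm[OF B] inc in \<open>auto dest: fmeasurableD simp: incseq_def intro!: image_mono\<close>)
  also have "\<dots> = (SUP n. ennreal \<bar>det (matrix T)\<bar> * emeasure lebesgue (B n))"
    using lm[OF B] B by (simp add: emeasure_eq_measure2 ennreal_mult)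
  also have "\<dots> = ennreal \<bar>det (matrix T)\<bar> * (SUP n. emeasure lebesgue (B n))"
    by (rule SUP_mult_left_ennreal[symmetric])
  also have "(SUP n. emeasure lebesgue (B n)) = emeasure lebesgue A"
    unfolding A by (rule SUP_emeasure_incseq) (use B inc in \<open>auto dest: fmeasurableD\<close>)
  finally show "emeasure lebesgue (?S ` A) = ennreal \<bar>det (matrix T)\<bar> * emeasure lebesgue A" .
qed

lemma affine_inv_measurable: "(\<lambda>y. inv T (y - q)) \<in> lebesgue \<rightarrow>\<^sub>M lebesgue"
proof (rule measurableI)
  fix A :: "(real^2) set" assume "A \<in> sets lebesgue"
  moreover have "(\<lambda>y. inv T (y - q)) -` A \<inter> space lebesgue = (\<lambda>x. T x + q) ` A"
    using affine_image_iff by auto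
  ultimately show "(\<lambda>y. inv T (y - q)) -` A \<inter> space lebesgue \<in> sets lebesgue"
    using affine_image_emeasure(1) by simp
qed simp

text \<open>The substitution rule at the level of measures, so that integrability and integrals of
  arbitrary integrands transform together.\<close>

lemma distr_lebesgue_affine:
  "distr lebesgue lebesgue (\<lambda>y. inv T (y - q)) = density lebesgue (\<lambda>_. ennreal \<bar>det (matrix T)\<bar>)"
proof (rule measure_eqI)
  fix A assume "A \<in> sets (distr lebesgue lebesgue (\<lambda>y. inv T (y - q)))"
  then have A: "A \<in> sets lebesgue" by simp
  have "(\<lambda>y. inv T (y - q)) -` A \<inter> space lebesgue = (\<lambda>x. T x + q) ` A"
    using affine_image_iff by auto
  then show "emeasure (distr lebesgue lebesgue (\<lambda>y. inv T (y - q))) A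
      = emeasure (density lebesgue (\<lambda>_. ennreal \<bar>det (matrix T)\<bar>)) A"
    using A affine_image_emeasure(2)[OF A]
    by (simp add: emeasure_distr affine_inv_measurable emeasure_density_const)
qed simp

lemma indicator_affine_image:
  "indicator ((\<lambda>x. T x + q) ` \<Omega>) y = (indicator \<Omega> (inv T (y - q)) :: real)"
  using affine_image_iff[of y \<Omega>] by (simp add: indicator_def)

context
  fixes \<Omega> :: "(real^2) set" and f :: "real^2 \<Rightarrow> 'b::euclidean_space"
  assumes \<Omega>: "\<Omega> \<in> sets lebesgue" and f: "f \<in> borel_measurable (lebesgue_on \<Omega>)"
begin

lemma measurable_affine: "(\<lambda>y. f (inv T (y - q))) \<in> borel_measurable (lebesgue_on ((\<lambda>x. T x + q) ` \<Omega>))"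
proof -
  have "(\<lambda>x. indicator \<Omega> x *\<^sub>R f x) \<in> borel_measurable lebesgue"
    using f \<Omega> by (simp add: borel_measurable_restrict_space_iff)
  from measurable_compose[OF affine_inv_measurable this]
  show ?thesis
    using affine_image_emeasure(1)[OF \<Omega>]
    by (simp add: borel_measurable_restrict_space_iff indicator_affine_image)
qed

lemma integral_affine:
  "(\<integral>y. f (inv T (y - q)) \<partial>lebesgue_on ((\<lambda>x. T x + q) ` \<Omega>)) = \<bar>det (matrix T)\<bar> *\<^sub>R (\<integral>x. f x \<partial>lebesgue_on \<Omega>)"
proof -
  have m: "(\<lambda>x. indicator \<Omega> x *\<^sub>R f x) \<in> borel_measurable lebesgue"
    using f \<Omega> by (simp add: borel_measurable_restrict_space_iff)
  have "(\<integral>y. f (inv T (y - q)) \<partial>lebesgue_on ((\<lambda>x. T x + q) ` \<Omega>))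
      = (\<integral>y. indicator \<Omega> (inv T (y - q)) *\<^sub>R f (inv T (y - q)) \<partial>lebesgue)"
    using affine_image_emeasure(1)[OF \<Omega>] by (simp add: integral_restrict_space indicator_affine_image)
  also have "\<dots> = (\<integral>x. indicator \<Omega> x *\<^sub>R f x \<partial>distr lebesgue lebesgue (\<lambda>y. inv T (y - q)))"
    by (rule integral_distr[OF affine_inv_measurable m, symmetric])
  also have "\<dots> = \<bar>det (matrix T)\<bar> *\<^sub>R (\<integral>x. indicator \<Omega> x *\<^sub>R f x \<partial>lebesgue)"
    unfolding distr_lebesgue_affine using m
    by (subst integral_density) (simp_all del: scaleR_scaleR)
  also have "(\<integral>x. indicator \<Omega> x *\<^sub>R f x \<partial>lebesgue) = (\<integral>x. f x \<partial>lebesgue_on \<Omega>)"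
    using \<Omega> by (simp add: integral_restrict_space)
  finally show ?thesis .
qed

lemma integrable_affine:
  assumes "integrable (lebesgue_on \<Omega>) f"
  shows "integrable (lebesgue_on ((\<lambda>x. T x + q) ` \<Omega>)) (\<lambda>y. f (inv T (y - q)))"
proof -
  have i: "integrable lebesgue (\<lambda>x. indicator \<Omega> x *\<^sub>R f x)"
    using assms \<Omega> by (simp add: integrable_restrict_space)
  then have m: "(\<lambda>x. indicator \<Omega> x *\<^sub>R f x) \<in> borel_measurable lebesgue" by simp
  have "integrable (distr lebesgue lebesgue (\<lambda>y. inv T (y - q))) (\<lambda>x. indicator \<Omega> x *\<^sub>R f x)"
    unfolding distr_lebesgue_affine using m i
    by (subst integrable_density) (simp_all del: scaleR_scaleR)
  then have "integrable lebesgue (\<lambda>y. indicator \<Omega> (inv T (y - q)) *\<^sub>R f (inv T (y - q)))"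
    by (simp add: integrable_distr_eq[OF affine_inv_measurable m])
  then show ?thesis
    using affine_image_emeasure(1)[OF \<Omega>] by (simp add: integrable_restrict_space indicator_affine_image)
qed

end

lemma L2_affine:
  assumes "\<Omega> \<in> sets lebesgue" "L2 \<Omega> f"
  shows "L2 ((\<lambda>x. T x + q) ` \<Omega>) (\<lambda>y. f (inv T (y - q)))"
  using measurable_affine[OF assms(1) L2_measurable[OF assms(2)]]
    integrable_affine[OF assms(1) _ L2_integrable[OF assms(2)]] assms(2)
  by (auto simp: L2_def)

lemma integral_sq_norm_affine:
  assumes "\<Omega> \<in> sets lebesgue" "L2 \<Omega> f"
  shows "(\<integral>y. (norm (f (inv T (y - q))))\<^sup>2 \<partial>lebesgue_on ((\<lambda>x. T x + q) ` \<Omega>))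
    = \<bar>det (matrix T)\<bar> * (\<integral>x. (norm (f x))\<^sup>2 \<partial>lebesgue_on \<Omega>)"
  using integral_affine[OF assms(1), of "\<lambda>x. (norm (f x))\<^sup>2"] L2_integrable[OF assms(2)] by simp

end

subsection \<open>The inner product and the dual characterization of the norm\<close>

definition ip :: "(real^2) set \<Rightarrow> (real^2 \<Rightarrow> complex) \<Rightarrow> (real^2 \<Rightarrow> complex) \<Rightarrow> complex" where
  "ip \<Omega> u v = (\<integral>x. u x * cnj (v x) \<partial>lebesgue_on \<Omega>)"

lemma ip_integrable: "L2 \<Omega> u \<Longrightarrow> L2 \<Omega> v \<Longrightarrow> integrable (lebesgue_on \<Omega>) (\<lambda>x. u x * cnj (v x))"
  by (rule L2_mult_integrable[OF _ L2_cnj])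

lemma ip_self: "ip \<Omega> u u = of_real (\<integral>x. (norm (u x))\<^sup>2 \<partial>lebesgue_on \<Omega>)"
  unfolding ip_def by (simp add: complex_norm_square[symmetric] flip: of_real_power)

lemma Re_ip_self: "Re (ip \<Omega> u u) = (\<integral>x. (norm (u x))\<^sup>2 \<partial>lebesgue_on \<Omega>)"
  by (simp add: ip_self)

interpretation L2: hermitian_form "{u. L2 \<Omega> u}" "ip \<Omega>" for \<Omega>
proof
  fix u v w :: "real^2 \<Rightarrow> complex" and c :: complex
  show "(\<lambda>x. 0) \<in> {u. L2 \<Omega> u}" by (simp add: L2_zero)
  assume u: "u \<in> {u. L2 \<Omega> u}"
  then show "(\<lambda>x. c * u x) \<in> {u. L2 \<Omega> u}" by (simp add: L2_cmult)
  show "0 \<le> Re (ip \<Omega> u u)" by (simp add: ip_self)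
  { assume v: "v \<in> {u. L2 \<Omega> u}"
    then show "(\<lambda>x. u x + v x) \<in> {u. L2 \<Omega> u}" using u by (simp add: L2_add)
    have "ip \<Omega> v u = (\<integral>x. cnj (u x * cnj (v x)) \<partial>lebesgue_on \<Omega>)"
      unfolding ip_def by (simp add: mult.commute)
    then show "ip \<Omega> v u = cnj (ip \<Omega> u v)" unfolding ip_def by (simp only: Bochner_Integration.integral_cnj)
    assume w: "w \<in> {u. L2 \<Omega> u}"
    then show "ip \<Omega> (\<lambda>x. u x + v x) w = ip \<Omega> u w + ip \<Omega> v w"
      unfolding ip_def using u v ip_integrable by (simp add: ring_distribs) }
  assume w: "w \<in> {u. L2 \<Omega> u}"
  show "ip \<Omega> (\<lambda>x. c * u x) w = c * ip \<Omega> u w"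
    unfolding ip_def by (simp add: mult.assoc)
qed

text \<open>The norm of \<open>w\<close> is its norm as a functional on test functions: test with an
  approximation of the conjugate of \<open>w\<close>. With \<open>M = 0\<close> this yields
  uniqueness of weak gradients; in \<open>translation_inequality\<close> it lets all derivatives
  fall on test functions.\<close>

lemma integral_sq_norm_dual:
  assumes op: "open \<Omega>" and w: "L2 \<Omega> w" and M: "M \<ge> 0"
    and *: "\<And>\<phi>. test_function \<Omega> \<phi> \<Longrightarrow>
      norm (\<integral>x. w x * \<phi> x \<partial>lebesgue_on \<Omega>) \<le> M * sqrt (\<integral>x. (norm (\<phi> x))\<^sup>2 \<partial>lebesgue_on \<Omega>)"
  shows "(\<integral>x. (norm (w x))\<^sup>2 \<partial>lebesgue_on \<Omega>) \<le> M\<^sup>2"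
proof -
  define s where "s = sqrt (\<integral>x. (norm (w x))\<^sup>2 \<partial>lebesgue_on \<Omega>)"
  have s: "s \<ge> 0" "s\<^sup>2 = (\<integral>x. (norm (w x))\<^sup>2 \<partial>lebesgue_on \<Omega>)" by (auto simp: s_def)
  \<comment> \<open>\<open>d\<close> is the distance from the conjugate of \<open>w\<close> to the
    test function; as it tends to 0 the error term disappears, and division by \<open>s\<close>
    gives the bound.\<close>
  have bound: "s\<^sup>2 \<le> M * s + (M + s) * d" if d: "d > 0" for d
  proof -
    obtain \<phi> where \<phi>: "test_function \<Omega> \<phi>" "(\<integral>x. (norm (cnj (w x) - \<phi> x))\<^sup>2 \<partial>lebesgue_on \<Omega>) < d\<^sup>2"
      by (rule test_functions_dense[OF op L2_cnj[OF w], of "d\<^sup>2"]) (use d in auto)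
    have L: "L2 \<Omega> \<phi>" by (rule test_function_L2[OF \<phi>(1) open_sets_lebesgue[OF op]])
    define r where "r = (\<lambda>x. cnj (w x) - \<phi> x)"
    have Lr: "L2 \<Omega> r" unfolding r_def by (intro L2_diff L2_cnj w L)
    have rd: "sqrt (\<integral>x. (norm (r x))\<^sup>2 \<partial>lebesgue_on \<Omega>) \<le> d"
      using \<phi>(2) d by (intro real_le_lsqrt) (auto simp: r_def)
    have "s\<^sup>2 = Re (\<integral>x. w x * cnj (w x) \<partial>lebesgue_on \<Omega>)"
      using Re_ip_self[of \<Omega> w] s(2) by (simp add: ip_def)
    also have "(\<integral>x. w x * cnj (w x) \<partial>lebesgue_on \<Omega>)
        = (\<integral>x. w x * \<phi> x \<partial>lebesgue_on \<Omega>) + (\<integral>x. w x * r x \<partial>lebesgue_on \<Omega>)"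
      using L2_mult_integrable[OF w L] L2_mult_integrable[OF w Lr]
      by (simp add: r_def ring_distribs flip: Bochner_Integration.integral_add)
    also have "Re \<dots> \<le> norm (\<integral>x. w x * \<phi> x \<partial>lebesgue_on \<Omega>) + norm (\<integral>x. w x * r x \<partial>lebesgue_on \<Omega>)"
      by (rule order_trans[OF complex_Re_le_cmod norm_triangle_ineq])
    also have "norm (\<integral>x. w x * \<phi> x \<partial>lebesgue_on \<Omega>) \<le> M * (s + d)"
    proof -
      have "sqrt (Re (ip \<Omega> (\<lambda>x. cnj (w x) + (-1) * r x) (\<lambda>x. cnj (w x) + (-1) * r x)))
          \<le> sqrt (Re (ip \<Omega> (\<lambda>x. cnj (w x)) (\<lambda>x. cnj (w x)))) + sqrt (Re (ip \<Omega> (\<lambda>x. (-1) * r x) (\<lambda>x. (-1) * r x)))"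
        using L2_cnj[OF w] L2_cmult[OF Lr, of "-1"] by (intro L2.form_triangle) auto
      then have "sqrt (\<integral>x. (norm (\<phi> x))\<^sup>2 \<partial>lebesgue_on \<Omega>) \<le> s + d"
        using rd unfolding Re_ip_self
        by (simp add: r_def s_def norm_minus_commute[of "\<phi> x" "cnj (w x)" for x])
      then show ?thesis using *[OF \<phi>(1)] M by (meson mult_left_mono order_trans)
    qed
    also have "norm (\<integral>x. w x * r x \<partial>lebesgue_on \<Omega>) \<le> s * d"
    proof -
      have "(cmod (ip \<Omega> w (\<lambda>x. cnj (r x))))\<^sup>2 \<le> Re (ip \<Omega> w w) * Re (ip \<Omega> (\<lambda>x. cnj (r x)) (\<lambda>x. cnj (r x)))"
        using w Lr by (intro L2.form_Cauchy_Schwarz) (auto intro: L2_cnj)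
      then have CS: "(cmod (ip \<Omega> w (\<lambda>x. cnj (r x))))\<^sup>2
          \<le> (\<integral>x. (norm (w x))\<^sup>2 \<partial>lebesgue_on \<Omega>) * (\<integral>x. (norm (r x))\<^sup>2 \<partial>lebesgue_on \<Omega>)"
        unfolding Re_ip_self by simp
      have "ip \<Omega> w (\<lambda>x. cnj (r x)) = (\<integral>x. w x * r x \<partial>lebesgue_on \<Omega>)" by (simp add: ip_def)
      with CS have "norm (\<integral>x. w x * r x \<partial>lebesgue_on \<Omega>) \<le> s * sqrt (\<integral>x. (norm (r x))\<^sup>2 \<partial>lebesgue_on \<Omega>)"
        unfolding s_def real_sqrt_mult[symmetric] by (intro real_le_rsqrt) simp
      then show ?thesis using rd s(1) by (meson mult_left_mono order_trans)
    qed
    finally show ?thesis by (simp add: algebra_simps)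
  qed
  have "s\<^sup>2 \<le> M * s"
  proof (rule field_le_epsilon)
    fix e :: real assume e: "e > 0"
    have pos: "M + s + 1 > 0" using M s(1) by simp
    have "(M + s) * (e / (M + s + 1)) \<le> (M + s + 1) * (e / (M + s + 1))"
      using e pos by (intro mult_right_mono) auto
    also have "\<dots> = e" using pos by simp
    finally show "s\<^sup>2 \<le> M * s + e" using bound[of "e / (M + s + 1)"] e pos by simp
  qed
  then have "s \<le> M" using s(1) M by (cases "s = 0") (auto simp: power2_eq_square)
  then show ?thesis using s by (metis power_mono)
qed

lemma integral_sq_norm_eq_0_AE:
  assumes "L2 \<Omega> w" "(\<integral>x. (norm (w x))\<^sup>2 \<partial>lebesgue_on \<Omega>) = 0"
  shows "AE x in lebesgue_on \<Omega>. w x = 0"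
  using integral_nonneg_eq_0_iff_AE[OF L2_integrable[OF assms(1)]] assms(2) by simp

subsection \<open>Integration by parts\<close>

lemma integral_on_eq_integral:
  fixes f :: "real^2 \<Rightarrow> complex"
  assumes "\<Omega> \<in> sets lebesgue" "\<And>x. x \<notin> \<Omega> \<Longrightarrow> f x = 0"
  shows "(\<integral>x. f x \<partial>lebesgue_on \<Omega>) = (\<integral>x. f x \<partial>lebesgue)"
proof -
  have "indicator \<Omega> x *\<^sub>R f x = f x" for x using assms(2) by (simp add: indicator_def)
  then show ?thesis using assms(1) by (simp add: integral_restrict_space)
qed

lemma test_function_integrable:
  assumes "test_function \<Omega> \<phi>" shows "integrable lebesgue \<phi>"
proof -
  obtain K where K: "compact K" "\<And>x. \<phi> x \<noteq> 0 \<Longrightarrow> x \<in> K"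
    using test_function_support[OF assms] by blast
  have "L2 UNIV (indicator K :: real^2 \<Rightarrow> complex)"
    using K(1) by (intro L2_bounded_set_indicator compact_imp_bounded)
      (auto simp: borel_closed compact_imp_closed sets_completionI_sets)
  from L2_mult_integrable[OF test_function_L2[OF assms, of UNIV] this]
  have "integrable lebesgue (\<lambda>x. \<phi> x * indicator K x)" by (simp add: lebesgue_on_UNIV_eq)
  moreover have "\<phi> x * indicator K x = \<phi> x" for x using K(2)[of x] by (auto simp: indicator_def)
  ultimately show ?thesis by simp
qed

lemma lebesgue_integral_translate:
  assumes "integrable lebesgue (f :: real^2 \<Rightarrow> complex)"
  shows "integrable lebesgue (\<lambda>x. f (x + v))" "(\<integral>x. f (x + v) \<partial>lebesgue) = (\<integral>x. f x \<partial>lebesgue)"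
proof -
  have id: "linear (\<lambda>x::real^2. x)" "bij (\<lambda>x::real^2. x)" by (auto intro: linearI simp: bij_id[unfolded id_def])
  have S: "(\<lambda>x. x + - v) ` UNIV = UNIV" using surj_plus_right by blast
  have inv: "inv (\<lambda>x::real^2. x) = (\<lambda>x. x)" using inv_id by (simp add: id_def)
  have m: "matrix (\<lambda>x::real^2. x) = mat 1" using matrix_id_mat_1 by (simp add: id_def)
  have f: "integrable (lebesgue_on UNIV) f" "f \<in> borel_measurable (lebesgue_on UNIV)"
    using assms by (simp_all add: lebesgue_on_UNIV_eq)
  show "integrable lebesgue (\<lambda>x. f (x + v))"
    using integrable_affine[OF id _ f(2,1), where q = "- v"] unfolding S by (simp add: inv lebesgue_on_UNIV_eq)
  show "(\<integral>x. f (x + v) \<partial>lebesgue) = (\<integral>x. f x \<partial>lebesgue)"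
    using integral_affine[OF id _ f(2), where q = "- v"] unfolding S by (simp add: inv m lebesgue_on_UNIV_eq)
qed

lemma test_function_line_derivative:
  assumes \<phi>: "test_function \<Omega> \<phi>"
  shows "((\<lambda>s. \<phi> (x + s *\<^sub>R v)) has_derivative (\<lambda>r. r *\<^sub>R frechet_derivative \<phi> (at (x + s *\<^sub>R v)) v)) (at s)"
proof -
  have l: "((\<lambda>s. x + s *\<^sub>R v) has_derivative (\<lambda>r. r *\<^sub>R v)) (at s)"
    by (auto intro!: derivative_eq_intros)
  have "linear (frechet_derivative \<phi> (at (x + s *\<^sub>R v)))"
    using has_derivative_linear[OF test_function_has_derivative[OF \<phi>]] .
  then show ?thesis
    using has_derivative_compose[OF l test_function_has_derivative[OF \<phi>]] by (simp add: linear_scale)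
qed

lemma test_function_increment_bound:
  assumes \<phi>: "test_function \<Omega> \<phi>" and B: "\<And>x. norm (frechet_derivative \<phi> (at x) v) \<le> B"
  shows "norm (\<phi> (x + t *\<^sub>R v) - \<phi> x) \<le> B * \<bar>t\<bar>"
proof -
  have "norm (\<phi> (x + t *\<^sub>R v) - \<phi> (x + 0 *\<^sub>R v)) \<le> B * norm (t - 0)"
  proof (rule differentiable_bound[of UNIV])
    fix s :: real
    show "((\<lambda>s. \<phi> (x + s *\<^sub>R v)) has_derivative
        (\<lambda>r. r *\<^sub>R frechet_derivative \<phi> (at (x + s *\<^sub>R v)) v)) (at s within UNIV)"
      using test_function_line_derivative[OF \<phi>] by simp
    show "onorm (\<lambda>r. r *\<^sub>R frechet_derivative \<phi> (at (x + s *\<^sub>R v)) v) \<le> B"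
      using B[of "x + s *\<^sub>R v"] by (simp add: onorm_scaleR_left onorm_id)
  qed auto
  then show ?thesis by simp
qed

lemma difference_quotient_tendsto:
  assumes \<phi>: "test_function \<Omega> \<phi>" and t: "t \<longlonglongrightarrow> 0" "\<And>n. t n \<noteq> 0"
  shows "(\<lambda>n. (\<phi> (x + t n *\<^sub>R v) - \<phi> x) /\<^sub>R t n) \<longlonglongrightarrow> frechet_derivative \<phi> (at x) v"
proof -
  let ?D = "frechet_derivative \<phi> (at x) v"
  have "((\<lambda>h. norm (\<phi> (x + h *\<^sub>R v) - \<phi> x - h *\<^sub>R ?D) / norm h) \<longlongrightarrow> 0) (at 0)"
    using test_function_line_derivative[OF \<phi>, of x v 0] unfolding has_derivative_at by simp
  then have "(\<lambda>n. norm (\<phi> (x + t n *\<^sub>R v) - \<phi> x - t n *\<^sub>R ?D) / norm (t n)) \<longlonglongrightarrow> 0"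
    using t by (auto simp: tendsto_at_iff_sequentially o_def)
  moreover have "norm (\<phi> (x + t n *\<^sub>R v) - \<phi> x - t n *\<^sub>R ?D) / norm (t n)
      = norm ((\<phi> (x + t n *\<^sub>R v) - \<phi> x) /\<^sub>R t n - ?D)" for n
  proof -
    have "(\<phi> (x + t n *\<^sub>R v) - \<phi> x) /\<^sub>R t n - ?D = (\<phi> (x + t n *\<^sub>R v) - \<phi> x - t n *\<^sub>R ?D) /\<^sub>R t n"
      using t(2)[of n] by (simp add: scaleR_diff_right)
    then show ?thesis by (simp add: divide_inverse mult.commute)
  qed
  ultimately show ?thesis by (simp add: LIM_zero_iff tendsto_norm_zero_iff)
qed

lemma continuous_lebesgue_on: "continuous_on UNIV f \<Longrightarrow> f \<in> borel_measurable (lebesgue_on \<Omega>)"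
  by (intro measurable_restrict_space1 measurable_completion) (simp add: borel_measurable_continuous_onI)

text \<open>Differentiation under the integral. The difference quotients are uniformly bounded and
  vanish outside a ball containing the support and all its shifts. Integrability of \<open>u\<close>
  on balls therefore suffices, which covers the constant 1 as well as square integrable
  functions.\<close>

lemma integral_difference_quotient_tendsto:
  fixes u :: "real^2 \<Rightarrow> complex"
  assumes \<phi>: "test_function \<Omega>' \<phi>" and u: "u \<in> borel_measurable (lebesgue_on \<Omega>)"
    and loc: "\<And>R. integrable (lebesgue_on \<Omega>) (\<lambda>x. u x * indicator (cball 0 R) x)"
    and t: "t \<longlonglongrightarrow> 0" "\<And>n. t n \<noteq> 0"
  shows "(\<lambda>n. \<integral>x. u x * ((\<phi> (x + t n *\<^sub>R v) - \<phi> x) /\<^sub>R t n) \<partial>lebesgue_on \<Omega>)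
    \<longlonglongrightarrow> (\<integral>x. u x * frechet_derivative \<phi> (at x) v \<partial>lebesgue_on \<Omega>)"
proof -
  obtain B where B: "\<And>x. norm (frechet_derivative \<phi> (at x) v) \<le> B" "B \<ge> 0"
    using test_function_bounded[OF test_function_derivative[OF \<phi>]] by blast
  obtain K where K: "compact K" "\<And>x. \<phi> x \<noteq> 0 \<Longrightarrow> x \<in> K"
    using test_function_support[OF \<phi>] by blast
  obtain r where r: "\<And>x. x \<in> K \<Longrightarrow> norm x \<le> r"
    using compact_imp_bounded[OF K(1)] unfolding bounded_iff by blast
  obtain \<tau> where \<tau>: "\<And>n. norm (t n) \<le> \<tau>"
    using convergent_imp_Bseq[OF convergentI[OF t(1)]] unfolding Bseq_def by blast
  \<comment> \<open>The support lies in the ball of radius \<open>r\<close>, and no shift is longer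
    than \<open>\<tau> * norm v\<close>.\<close>
  let ?R = "r + \<tau> * norm v"
  have c\<phi>: "continuous_on UNIV \<phi>" by (rule test_function_continuous[OF \<phi>])
  show ?thesis
  proof (rule integral_dominated_convergence[where w = "\<lambda>x. B * norm (u x * indicator (cball 0 ?R) x)"])
    show "(\<lambda>x. u x * frechet_derivative \<phi> (at x) v) \<in> borel_measurable (lebesgue_on \<Omega>)"
      using u continuous_lebesgue_on[OF test_function_continuous[OF test_function_derivative[OF \<phi>]]]
      by measurable
    have "continuous_on UNIV (\<lambda>x. (\<phi> (x + t n *\<^sub>R v) - \<phi> x) /\<^sub>R t n)" for n
      by (intro continuous_intros continuous_on_compose2[OF c\<phi>]) auto
    from borel_measurable_times[OF u continuous_lebesgue_on[OF this]]
    show "(\<lambda>x. u x * ((\<phi> (x + t n *\<^sub>R v) - \<phi> x) /\<^sub>R t n)) \<in> borel_measurable (lebesgue_on \<Omega>)" for n .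
    show "integrable (lebesgue_on \<Omega>) (\<lambda>x. B * norm (u x * indicator (cball 0 ?R) x))"
      using loc by (intro integrable_mult_right integrable_norm)
    show "AE x in lebesgue_on \<Omega>. (\<lambda>n. u x * ((\<phi> (x + t n *\<^sub>R v) - \<phi> x) /\<^sub>R t n))
        \<longlonglongrightarrow> u x * frechet_derivative \<phi> (at x) v"
      by (intro AE_I2 tendsto_mult tendsto_const difference_quotient_tendsto[OF \<phi> t])
    fix n
    have "norm (u x * ((\<phi> (x + t n *\<^sub>R v) - \<phi> x) /\<^sub>R t n)) \<le> B * norm (u x * indicator (cball 0 ?R) x)" for x
    proof (cases "x \<in> cball 0 ?R")
      case True
      have "norm (\<phi> (x + t n *\<^sub>R v) - \<phi> x) / \<bar>t n\<bar> \<le> B"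
        using test_function_increment_bound[OF \<phi> B(1), of x "t n"] t(2)[of n] by (simp add: field_simps)
      then show ?thesis
        using True mult_right_mono[of "norm (\<phi> (x + t n *\<^sub>R v) - \<phi> x) / \<bar>t n\<bar>" B "norm (u x)"]
        by (simp add: norm_mult divide_inverse mult_ac)
    next
      case False
      have \<tau>0: "0 \<le> \<tau>" using \<tau>[of 0] norm_ge_zero[of "t 0"] by linarith
      then have "norm x > r" using False by (simp add: dist_norm) (smt (verit) mult_nonneg_nonneg norm_ge_zero)
      then have "\<phi> x = 0" using K(2) r by force
      moreover have "norm (t n *\<^sub>R v) \<le> \<tau> * norm v" using \<tau>[of n] by (simp add: mult_right_mono)
      then have "norm (x + t n *\<^sub>R v) > r"
        using False norm_triangle_ineq4[of "x + t n *\<^sub>R v" "t n *\<^sub>R v"] by simp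
      then have "\<phi> (x + t n *\<^sub>R v) = 0" using K(2) r by force
      ultimately show ?thesis using False by simp
    qed
    then show "AE x in lebesgue_on \<Omega>. norm (u x * ((\<phi> (x + t n *\<^sub>R v) - \<phi> x) /\<^sub>R t n))
        \<le> B * norm (u x * indicator (cball 0 ?R) x)" by simp
  qed
qed

text \<open>All difference quotients integrate to 0 by translation invariance; then the step tends
  to 0.\<close>

lemma integral_test_derivative_eq_0:
  assumes \<phi>: "test_function \<Omega> \<phi>"
  shows "(\<integral>x. frechet_derivative \<phi> (at x) v \<partial>lebesgue) = 0"
proof -
  define t where "t = (\<lambda>n. inverse (real (Suc n)))"
  have t: "t \<longlonglongrightarrow> 0" "\<And>n. t n \<noteq> 0"
    using LIMSEQ_inverse_real_of_nat by (simp_all add: t_def)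
  have i: "integrable (lebesgue_on UNIV) (\<lambda>x. 1 * (indicator (cball (0::real^2) R) x :: complex))" for R :: real
  proof -
    have "integrable lebesgue (indicator (cball (0::real^2) R) :: real^2 \<Rightarrow> real)"
      using lmeasurable_cball by (simp only: lmeasurable_iff_integrable)
    then have "integrable lebesgue (\<lambda>x. complex_of_real (indicator (cball (0::real^2) R) x))" by (rule integrable_of_real)
    moreover have "(\<lambda>x. complex_of_real (indicator (cball (0::real^2) R) x)) = (\<lambda>x. 1 * indicator (cball 0 R) x)"
      by (auto simp: indicator_def)
    ultimately show ?thesis by (simp only: lebesgue_on_UNIV_eq)
  qed
  have z: "(\<integral>x. 1 * ((\<phi> (x + t n *\<^sub>R v) - \<phi> x) /\<^sub>R t n) \<partial>lebesgue) = 0" for n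
    using lebesgue_integral_translate[OF test_function_integrable[OF \<phi>], of "t n *\<^sub>R v"]
      test_function_integrable[OF \<phi>] by simp
  have "(\<lambda>n. 0) \<longlonglongrightarrow> (\<integral>x. 1 * frechet_derivative \<phi> (at x) v \<partial>lebesgue)"
    using integral_difference_quotient_tendsto[OF \<phi> _ i t, of v] unfolding lebesgue_on_UNIV_eq z by simp
  then show ?thesis by (simp add: LIMSEQ_const_iff)
qed

lemma integration_by_parts:
  assumes f: "\<And>n. C_k n f" and \<psi>: "test_function \<Omega> \<psi>" and \<Omega>: "\<Omega> \<in> sets lebesgue"
  shows "(\<integral>x. f x * frechet_derivative \<psi> (at x) v \<partial>lebesgue_on \<Omega>)
    = - (\<integral>x. frechet_derivative f (at x) v * \<psi> x \<partial>lebesgue_on \<Omega>)"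
proof -
  have f': "C_k n (\<lambda>x. frechet_derivative f (at x) v)" for n
    by (rule C_k_frechet_derivative[OF f])
  have t1: "test_function \<Omega> (\<lambda>x. f x * frechet_derivative \<psi> (at x) v)"
    by (rule test_function_mult[OF test_function_derivative[OF \<psi>] f])
  have t2: "test_function \<Omega> (\<lambda>x. frechet_derivative f (at x) v * \<psi> x)"
    by (rule test_function_mult[OF \<psi> f'])
  have "(\<integral>x. f x * frechet_derivative \<psi> (at x) v + frechet_derivative f (at x) v * \<psi> x \<partial>lebesgue) = 0"
    using integral_test_derivative_eq_0[OF test_function_mult[OF \<psi> f], of v]
    by (simp add: frechet_derivative_mult_test[OF \<psi> f])
  then have "(\<integral>x. f x * frechet_derivative \<psi> (at x) v \<partial>lebesgue)
      + (\<integral>x. frechet_derivative f (at x) v * \<psi> x \<partial>lebesgue) = 0"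
    using test_function_integrable[OF t1] test_function_integrable[OF t2] by simp
  then show ?thesis
    using integral_on_eq_integral[OF \<Omega>, of "\<lambda>x. f x * frechet_derivative \<psi> (at x) v"]
      integral_on_eq_integral[OF \<Omega>, of "\<lambda>x. frechet_derivative f (at x) v * \<psi> x"]
      test_function_outside[OF t1] test_function_outside[OF t2] by (simp add: eq_neg_iff_add_eq_0)
qed

section \<open>Weak gradients\<close>

abbreviation pd :: "2 \<Rightarrow> (real^2 \<Rightarrow> complex) \<Rightarrow> real^2 \<Rightarrow> complex" where
  "pd k \<phi> x \<equiv> frechet_derivative \<phi> (at x) (axis k 1)"

lemma is_weak_gradientD:
  assumes "is_weak_gradient \<Omega> u g"
  shows "L2 \<Omega> g" "L2 \<Omega> (\<lambda>x. g x $ k)"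
    "test_function \<Omega> \<phi> \<Longrightarrow>
      (\<integral>x. u x * pd k \<phi> x \<partial>lebesgue_on \<Omega>) = - (\<integral>x. g x $ k * \<phi> x \<partial>lebesgue_on \<Omega>)"
  using assms L2_vec_nth by (auto simp: is_weak_gradient_def)

lemma is_weak_gradient_test:
  assumes \<phi>: "test_function \<Omega>' \<phi>" and op: "open \<Omega>"
  shows "is_weak_gradient \<Omega> \<phi> (\<lambda>x. \<chi> k. pd k \<phi> x)"
  unfolding is_weak_gradient_def
proof (intro conjI allI impI)
  show "L2 \<Omega> (\<lambda>x. \<chi> k. pd k \<phi> x)"
    by (intro L2_vecI) (simp add: test_function_L2[OF test_function_derivative[OF \<phi>] open_sets_lebesgue[OF op]])
  fix \<psi> k assume "test_function \<Omega> \<psi>"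
  from integration_by_parts[OF test_function_C_k[OF \<phi>] this open_sets_lebesgue[OF op]]
  show "(\<integral>x. \<phi> x * pd k \<psi> x \<partial>lebesgue_on \<Omega>) = - (\<integral>x. (\<chi> k. pd k \<phi> x) $ k * \<psi> x \<partial>lebesgue_on \<Omega>)"
    by simp
qed

lemma vec2_eq_iff: "(x :: 'a^2) = y \<longleftrightarrow> x $ 1 = y $ 1 \<and> x $ 2 = y $ 2"
  by (simp add: vec_eq_iff forall_2)

text \<open>Lets any known weak gradient stand for the one selected by \<open>weak_gradient\<close>,
  almost everywhere. The difference of two candidates annihilates all test functions.\<close>

lemma weak_gradient_unique:
  assumes op: "open \<Omega>" and g: "is_weak_gradient \<Omega> u g" and g': "is_weak_gradient \<Omega> u g'"
  shows "AE x in lebesgue_on \<Omega>. g x = g' x"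
proof -
  have "AE x in lebesgue_on \<Omega>. g x $ k - g' x $ k = 0" for k
  proof (rule integral_sq_norm_eq_0_AE)
    show L: "L2 \<Omega> (\<lambda>x. g x $ k - g' x $ k)"
      by (intro L2_diff is_weak_gradientD(2)[OF g] is_weak_gradientD(2)[OF g'])
    have "norm (\<integral>x. (g x $ k - g' x $ k) * \<phi> x \<partial>lebesgue_on \<Omega>)
        \<le> 0 * sqrt (\<integral>x. (norm (\<phi> x))\<^sup>2 \<partial>lebesgue_on \<Omega>)" if \<phi>: "test_function \<Omega> \<phi>" for \<phi>
    proof -
      have "L2 \<Omega> \<phi>" by (rule test_function_L2[OF \<phi> open_sets_lebesgue[OF op]])
      then have "(\<integral>x. (g x $ k - g' x $ k) * \<phi> x \<partial>lebesgue_on \<Omega>)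
          = (\<integral>x. g x $ k * \<phi> x \<partial>lebesgue_on \<Omega>) - (\<integral>x. g' x $ k * \<phi> x \<partial>lebesgue_on \<Omega>)"
        using L2_mult_integrable[OF is_weak_gradientD(2)[OF g]] L2_mult_integrable[OF is_weak_gradientD(2)[OF g']]
        by (simp add: left_diff_distrib)
      then show ?thesis
        using is_weak_gradientD(3)[OF g \<phi>, of k] is_weak_gradientD(3)[OF g' \<phi>, of k] by simp
    qed
    from integral_sq_norm_dual[OF op L _ this]
    show "(\<integral>x. (norm (g x $ k - g' x $ k))\<^sup>2 \<partial>lebesgue_on \<Omega>) = 0"
      by (simp add: antisym)
  qed
  then have "AE x in lebesgue_on \<Omega>. g x $ 1 - g' x $ 1 = 0 \<and> g x $ 2 - g' x $ 2 = 0"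
    by (intro AE_conjI)
  then show ?thesis by (rule AE_mp) (simp add: vec2_eq_iff)
qed

lemma is_weak_gradient_add:
  assumes op: "open \<Omega>" and u: "L2 \<Omega> u" "is_weak_gradient \<Omega> u g" and v: "L2 \<Omega> v" "is_weak_gradient \<Omega> v g'"
  shows "is_weak_gradient \<Omega> (\<lambda>x. u x + v x) (\<lambda>x. g x + g' x)"
  unfolding is_weak_gradient_def
proof (intro conjI allI impI)
  show "L2 \<Omega> (\<lambda>x. g x + g' x)" using u v by (intro L2_add is_weak_gradientD)
  fix \<phi> k assume \<phi>: "test_function \<Omega> \<phi>"
  have L: "L2 \<Omega> \<phi>" "L2 \<Omega> (pd k \<phi>)"
    using test_function_L2[OF _ open_sets_lebesgue[OF op]] test_function_derivative \<phi> by blast+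
  show "(\<integral>x. (u x + v x) * pd k \<phi> x \<partial>lebesgue_on \<Omega>) = - (\<integral>x. (g x + g' x) $ k * \<phi> x \<partial>lebesgue_on \<Omega>)"
    using L2_mult_integrable[OF u(1) L(2)] L2_mult_integrable[OF v(1) L(2)]
      L2_mult_integrable[OF is_weak_gradientD(2)[OF u(2)] L(1)] L2_mult_integrable[OF is_weak_gradientD(2)[OF v(2)] L(1)]
      is_weak_gradientD(3)[OF u(2) \<phi>, of k] is_weak_gradientD(3)[OF v(2) \<phi>, of k]
    by (simp add: ring_distribs)
qed

lemma is_weak_gradient_cmult:
  assumes u: "is_weak_gradient \<Omega> u g"
  shows "is_weak_gradient \<Omega> (\<lambda>x. c * u x) (\<lambda>x. \<chi> k. c * g x $ k)"
  unfolding is_weak_gradient_def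
proof (intro conjI allI impI)
  show "L2 \<Omega> (\<lambda>x. \<chi> k. c * g x $ k)"
    by (intro L2_vecI) (simp add: L2_cmult is_weak_gradientD(2)[OF u])
  fix \<phi> k assume "test_function \<Omega> \<phi>"
  from is_weak_gradientD(3)[OF u this, of k]
  show "(\<integral>x. (c * u x) * pd k \<phi> x \<partial>lebesgue_on \<Omega>) = - (\<integral>x. (\<chi> k. c * g x $ k) $ k * \<phi> x \<partial>lebesgue_on \<Omega>)"
    by (simp add: mult.assoc)
qed

lemma H1_L2: "u \<in> H1 \<Omega> \<Longrightarrow> L2 \<Omega> u"
  by (simp add: H1_def)

lemma H1I: "L2 \<Omega> u \<Longrightarrow> is_weak_gradient \<Omega> u g \<Longrightarrow> u \<in> H1 \<Omega>"
  by (auto simp: H1_def)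

lemma is_weak_gradient_weak_gradient:
  "is_weak_gradient \<Omega> u g \<Longrightarrow> is_weak_gradient \<Omega> u (weak_gradient \<Omega> u)"
  unfolding weak_gradient_def by (rule someI[where P = "is_weak_gradient \<Omega> u"])

lemma H1_weak_gradient: "u \<in> H1 \<Omega> \<Longrightarrow> is_weak_gradient \<Omega> u (weak_gradient \<Omega> u)"
  unfolding H1_def using is_weak_gradient_weak_gradient by blast

lemma weak_gradient_AE:
  assumes "open \<Omega>" "is_weak_gradient \<Omega> u g"
  shows "AE x in lebesgue_on \<Omega>. weak_gradient \<Omega> u x = g x"
proof -
  have "is_weak_gradient \<Omega> u (weak_gradient \<Omega> u)"
    by (rule is_weak_gradient_weak_gradient[OF assms(2)])
  from weak_gradient_unique[OF assms(1) this assms(2)] show ?thesis .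
qed

lemma H1_add: "open \<Omega> \<Longrightarrow> u \<in> H1 \<Omega> \<Longrightarrow> v \<in> H1 \<Omega> \<Longrightarrow> (\<lambda>x. u x + v x) \<in> H1 \<Omega>"
  by (rule H1I[OF L2_add is_weak_gradient_add]) (auto intro: H1_L2 H1_weak_gradient)

lemma H1_cmult: "u \<in> H1 \<Omega> \<Longrightarrow> (\<lambda>x. c * u x) \<in> H1 \<Omega>"
  by (rule H1I[OF L2_cmult is_weak_gradient_cmult]) (auto intro: H1_L2 H1_weak_gradient)

lemma H1_diff: "open \<Omega> \<Longrightarrow> u \<in> H1 \<Omega> \<Longrightarrow> v \<in> H1 \<Omega> \<Longrightarrow> (\<lambda>x. u x - v x) \<in> H1 \<Omega>"
  using H1_add[of \<Omega> u "\<lambda>x. -1 * v x"] H1_cmult[of v \<Omega> "-1"] by simp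

lemma H1_test: "test_function \<Omega>' \<phi> \<Longrightarrow> open \<Omega> \<Longrightarrow> \<phi> \<in> H1 \<Omega>"
  by (rule H1I[OF test_function_L2 is_weak_gradient_test]) (auto intro: open_sets_lebesgue)

lemma H1_norm_eq:
  assumes "open \<Omega>" "is_weak_gradient \<Omega> u g"
  shows "(H1_norm \<Omega> u)\<^sup>2 = (\<integral>x. (norm (u x))\<^sup>2 \<partial>lebesgue_on \<Omega>) + (\<integral>x. (norm (g x))\<^sup>2 \<partial>lebesgue_on \<Omega>)"
proof -
  have w: "is_weak_gradient \<Omega> u (weak_gradient \<Omega> u)"
    by (rule is_weak_gradient_weak_gradient[OF assms(2)])
  have "(\<integral>x. (norm (weak_gradient \<Omega> u x))\<^sup>2 \<partial>lebesgue_on \<Omega>) = (\<integral>x. (norm (g x))\<^sup>2 \<partial>lebesgue_on \<Omega>)"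
    using weak_gradient_AE[OF assms] L2_integrable[OF is_weak_gradientD(1)[OF w]]
      L2_integrable[OF is_weak_gradientD(1)[OF assms(2)]]
    by (intro integral_cong_AE) (auto elim!: eventually_mono)
  then show ?thesis by (simp add: H1_norm_def)
qed

section \<open>Restriction to smaller sets\<close>

lemma integral_subset_eq:
  fixes f :: "real^2 \<Rightarrow> complex"
  assumes "G \<subseteq> \<Omega>" "G \<in> sets lebesgue" "\<Omega> \<in> sets lebesgue" "\<And>x. x \<notin> G \<Longrightarrow> f x = 0"
  shows "(\<integral>x. f x \<partial>lebesgue_on G) = (\<integral>x. f x \<partial>lebesgue_on \<Omega>)"
proof -
  have "f x = 0" if "x \<notin> \<Omega>" for x using that assms(1,4) by blast
  then show ?thesis
    using integral_on_eq_integral[OF assms(2), of f] integral_on_eq_integral[OF assms(3), of f] assms(4) by simp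
qed

lemma indicator_scaleR_subset:
  assumes "G \<subseteq> \<Omega>"
  shows "indicator G x *\<^sub>R (indicator \<Omega> x *\<^sub>R f x) = (indicator G x :: real) *\<^sub>R (f x :: 'b::real_vector)"
  using assms by (auto simp: indicator_def)

lemma measurable_lebesgue_on_subset:
  fixes f :: "real^2 \<Rightarrow> 'b::euclidean_space"
  assumes "f \<in> borel_measurable (lebesgue_on \<Omega>)" "G \<subseteq> \<Omega>" "G \<in> sets lebesgue" "\<Omega> \<in> sets lebesgue"
  shows "f \<in> borel_measurable (lebesgue_on G)"
proof -
  have "(\<lambda>x. indicator \<Omega> x *\<^sub>R f x) \<in> borel_measurable lebesgue"
    using assms by (simp add: borel_measurable_restrict_space_iff)
  then have "(\<lambda>x. indicator G x *\<^sub>R (indicator \<Omega> x *\<^sub>R f x)) \<in> borel_measurable lebesgue"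
    using assms(3) by measurable
  then show ?thesis
    unfolding indicator_scaleR_subset[OF assms(2)] using assms(3)
    by (simp add: borel_measurable_restrict_space_iff)
qed

lemma integrable_lebesgue_on_subset:
  fixes f :: "real^2 \<Rightarrow> 'b::euclidean_space"
  assumes "integrable (lebesgue_on \<Omega>) f" "G \<subseteq> \<Omega>" "G \<in> sets lebesgue" "\<Omega> \<in> sets lebesgue"
  shows "integrable (lebesgue_on G) f"
proof -
  have "integrable lebesgue (\<lambda>x. indicator \<Omega> x *\<^sub>R f x)"
    using assms by (simp add: integrable_restrict_space)
  from integrable_mult_indicator[OF assms(3) this]
  show ?thesis
    unfolding indicator_scaleR_subset[OF assms(2)] using assms(3)
    by (simp add: integrable_restrict_space)
qed

lemma L2_subset:
  assumes "L2 \<Omega> f" "G \<subseteq> \<Omega>" "G \<in> sets lebesgue" "\<Omega> \<in> sets lebesgue"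
  shows "L2 G f"
  using measurable_lebesgue_on_subset[OF L2_measurable[OF assms(1)] assms(2-4)]
    integrable_lebesgue_on_subset[OF L2_integrable[OF assms(1)] assms(2-4)]
  unfolding L2_def by blast

section \<open>Transformation of Sobolev spaces\<close>

lemma linear_vec2_expand:
  assumes "linear (L :: real^2 \<Rightarrow> 'b::real_vector)"
  shows "L v = (v$1) *\<^sub>R L (axis 1 1) + (v$2) *\<^sub>R L (axis 2 1)"
proof -
  have "v = (v$1) *\<^sub>R axis 1 1 + (v$2) *\<^sub>R axis 2 (1::real)"
    by (simp add: vec2_eq_iff axis_def)
  then have "L v = L ((v$1) *\<^sub>R axis 1 1 + (v$2) *\<^sub>R axis 2 1)" by simp
  then show ?thesis using assms by (simp add: linear_add linear_scale)
qed

lemma linear_vec_nth: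
  assumes "linear (L :: real^2 \<Rightarrow> real^2)"
  shows "L v $ k = matrix L $ k $ 1 * v$1 + matrix L $ k $ 2 * v$2"
  using linear_vec2_expand[OF assms, of v] by (simp add: matrix_def mult.commute)

text \<open>The substitution is carried out on the test function, where the chain rule is classical.
  The columns of \<open>B\<close> appear because a gradient transforms with the transposed
  inverse.\<close>

lemma is_weak_gradient_affine:
  assumes op: "open \<Omega>" and T: "linear T" "bij T" and u: "L2 \<Omega> u" "is_weak_gradient \<Omega> u g"
  defines "B \<equiv> matrix (inv T)"
  shows "is_weak_gradient ((\<lambda>x. T x + q) ` \<Omega>) (\<lambda>y. u (inv T (y - q)))
    (\<lambda>y. \<chi> k. of_real (B$1$k) * g (inv T (y - q)) $ 1 + of_real (B$2$k) * g (inv T (y - q)) $ 2)"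
  unfolding is_weak_gradient_def
proof (intro conjI allI impI)
  note \<Omega> = open_sets_lebesgue[OF op]
  have gL: "L2 \<Omega> (\<lambda>x. g x $ k)" for k by (rule is_weak_gradientD(2)[OF u(2)])
  show "L2 ((\<lambda>x. T x + q) ` \<Omega>)
      (\<lambda>y. \<chi> k. of_real (B$1$k) * g (inv T (y - q)) $ 1 + of_real (B$2$k) * g (inv T (y - q)) $ 2)"
    by (intro L2_vecI, simp) (intro L2_add L2_cmult L2_affine[OF T \<Omega> gL])
  fix \<phi> k assume \<phi>: "test_function ((\<lambda>x. T x + q) ` \<Omega>) \<phi>"
  define \<psi> where "\<psi> = (\<lambda>x. \<phi> (T x + q))"
  have \<psi>: "test_function \<Omega> \<psi>" unfolding \<psi>_def
  proof (rule test_function_affine[OF \<phi> T])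
    fix x assume "T x + q \<in> (\<lambda>x. T x + q) ` \<Omega>"
    then show "x \<in> \<Omega>" using affine_image_iff[OF T, of "T x + q" q \<Omega>] affine_inv(1)[OF T, of x q] by simp
  qed
  have d\<psi>: "pd j \<psi> x = frechet_derivative \<phi> (at (T x + q)) (T (axis j 1))" for j x
    unfolding \<psi>_def by (rule frechet_derivative_affine[OF \<phi> T(1)])
  have d\<phi>: "pd k \<phi> (T x + q) = of_real (B$1$k) * pd 1 \<psi> x + of_real (B$2$k) * pd 2 \<psi> x" for x
  proof -
    have lf: "linear (frechet_derivative \<phi> (at (T x + q)))"
      using has_derivative_linear[OF test_function_has_derivative[OF \<phi>]] .
    have "axis k 1 = T (inv T (axis k 1))" using T(2) by (simp add: bij_is_surj surj_f_inv_f)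
    also have "\<dots> = (B$1$k) *\<^sub>R T (axis 1 1) + (B$2$k) *\<^sub>R T (axis 2 1)"
      using linear_vec2_expand[OF T(1), of "inv T (axis k 1)"] by (simp add: B_def matrix_def)
    finally have "axis k (1::real) = (B$1$k) *\<^sub>R T (axis 1 1) + (B$2$k) *\<^sub>R T (axis 2 1)" .
    then have "pd k \<phi> (T x + q) = (B$1$k) *\<^sub>R frechet_derivative \<phi> (at (T x + q)) (T (axis 1 1))
        + (B$2$k) *\<^sub>R frechet_derivative \<phi> (at (T x + q)) (T (axis 2 1))"
      by (metis linear_add[OF lf] linear_scale[OF lf])
    then show ?thesis unfolding d\<psi> scaleR_conv_of_real .
  qed
  have LD: "L2 \<Omega> (pd j \<psi>)" "L2 \<Omega> \<psi>" for j
    using test_function_L2[OF _ \<Omega>] test_function_derivative \<psi> by blast+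
  have sub: "pd k \<phi> y = of_real (B$1$k) * pd 1 \<psi> (inv T (y - q)) + of_real (B$2$k) * pd 2 \<psi> (inv T (y - q))"
    "\<phi> y = \<psi> (inv T (y - q))" for y
    using d\<phi>[of "inv T (y - q)"] unfolding affine_inv(2)[OF T] by (simp_all add: \<psi>_def affine_inv(2)[OF T])
  have i: "integrable (lebesgue_on \<Omega>) (\<lambda>x. u x * pd j \<psi> x)" "integrable (lebesgue_on \<Omega>) (\<lambda>x. g x $ j * \<psi> x)" for j
    by (rule L2_mult_integrable[OF u(1) LD(1)], rule L2_mult_integrable[OF gL LD(2)])
  let ?f = "\<lambda>x. u x * (of_real (B$1$k) * pd 1 \<psi> x + of_real (B$2$k) * pd 2 \<psi> x)"
  let ?f' = "\<lambda>x. (of_real (B$1$k) * g x $ 1 + of_real (B$2$k) * g x $ 2) * \<psi> x"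
  have "(\<integral>x. ?f x \<partial>lebesgue_on \<Omega>)
      = (\<integral>x. of_real (B$1$k) * (u x * pd 1 \<psi> x) + of_real (B$2$k) * (u x * pd 2 \<psi> x) \<partial>lebesgue_on \<Omega>)"
    by (intro Bochner_Integration.integral_cong refl) (simp add: algebra_simps)
  also have "\<dots> = of_real (B$1$k) * (\<integral>x. u x * pd 1 \<psi> x \<partial>lebesgue_on \<Omega>) + of_real (B$2$k) * (\<integral>x. u x * pd 2 \<psi> x \<partial>lebesgue_on \<Omega>)"
    using i by simp
  also have "\<dots> = - (of_real (B$1$k) * (\<integral>x. g x $ 1 * \<psi> x \<partial>lebesgue_on \<Omega>)
      + of_real (B$2$k) * (\<integral>x. g x $ 2 * \<psi> x \<partial>lebesgue_on \<Omega>))"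
    unfolding is_weak_gradientD(3)[OF u(2) \<psi>] by simp
  also have "\<dots> = - (\<integral>x. ?f' x \<partial>lebesgue_on \<Omega>)"
    using i by (simp add: ring_distribs mult.assoc)
  finally have eq: "(\<integral>x. ?f x \<partial>lebesgue_on \<Omega>) = - (\<integral>x. ?f' x \<partial>lebesgue_on \<Omega>)" .
  have m: "?f \<in> borel_measurable (lebesgue_on \<Omega>)" "?f' \<in> borel_measurable (lebesgue_on \<Omega>)"
    using L2_measurable[OF u(1)] L2_measurable[OF LD(1)] L2_measurable[OF LD(2)] L2_measurable[OF gL]
    by measurable
  show "(\<integral>y. u (inv T (y - q)) * pd k \<phi> y \<partial>lebesgue_on ((\<lambda>x. T x + q) ` \<Omega>))
    = - (\<integral>y. (\<chi> k. of_real (B$1$k) * g (inv T (y - q)) $ 1 + of_real (B$2$k) * g (inv T (y - q)) $ 2) $ k * \<phi> y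
        \<partial>lebesgue_on ((\<lambda>x. T x + q) ` \<Omega>))"
    unfolding sub vec_lambda_beta using integral_affine[OF T \<Omega> m(1)] integral_affine[OF T \<Omega> m(2)] eq by simp
qed

lemma is_weak_gradient_cnj:
  assumes "is_weak_gradient \<Omega> u g"
  shows "is_weak_gradient \<Omega> (\<lambda>x. cnj (u x)) (\<lambda>x. \<chi> k. cnj (g x $ k))"
  unfolding is_weak_gradient_def
proof (intro conjI allI impI)
  show "L2 \<Omega> (\<lambda>x. \<chi> k. cnj (g x $ k))"
    by (intro L2_vecI) (simp add: L2_cnj is_weak_gradientD(2)[OF assms])
  fix \<phi> k assume \<phi>: "test_function \<Omega> \<phi>"
  have "(\<integral>x. cnj (u x) * pd k \<phi> x \<partial>lebesgue_on \<Omega>) = (\<integral>x. cnj (u x * pd k (\<lambda>x. cnj (\<phi> x)) x) \<partial>lebesgue_on \<Omega>)"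
    by (simp add: frechet_derivative_cnj_test[OF \<phi>])
  also have "\<dots> = cnj (- (\<integral>x. g x $ k * cnj (\<phi> x) \<partial>lebesgue_on \<Omega>))"
    unfolding Bochner_Integration.integral_cnj is_weak_gradientD(3)[OF assms test_function_cnj[OF \<phi>]] ..
  also have "\<dots> = - (\<integral>x. cnj (g x $ k * cnj (\<phi> x)) \<partial>lebesgue_on \<Omega>)"
    unfolding Bochner_Integration.integral_cnj by simp
  finally show "(\<integral>x. cnj (u x) * pd k \<phi> x \<partial>lebesgue_on \<Omega>) = - (\<integral>x. (\<chi> k. cnj (g x $ k)) $ k * \<phi> x \<partial>lebesgue_on \<Omega>)"
    by simp
qed

definition phase :: "real^2 \<Rightarrow> real^2 \<Rightarrow> complex" where
  "phase p y = exp (\<i> * of_real (p \<bullet> y))"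

lemma norm_phase: "norm (phase p y) = 1"
  by (simp add: phase_def)

lemma phase_0: "phase 0 y = 1"
  by (simp add: phase_def)

lemma phase_add: "phase p (x + y) = phase p x * phase p y"
  by (simp add: phase_def inner_add_right ring_distribs exp_add)

lemma cnj_phase: "cnj (phase p y) = phase (- p) y"
  by (simp add: phase_def exp_cnj)

lemma phase_minus: "phase p y * phase (- p) y = 1"
  by (simp add: phase_def flip: exp_add)

lemma C_k_phase: "C_k n (phase p)"
  using C_k_cis_linear[OF bounded_linear_inner_right[of p], of n 1] by (simp add: phase_def[abs_def])

lemma pd_phase: "pd k (phase p) x = \<i> * of_real (p $ k) * phase p x"
proof -
  have "((\<lambda>x. \<i> * complex_of_real (p \<bullet> x)) has_derivative (\<lambda>v. \<i> * complex_of_real (p \<bullet> v))) (at x)"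
    by (intro bounded_linear_imp_has_derivative bounded_linear_compose[OF bounded_linear_mult_right]
          bounded_linear_compose[OF bounded_linear_of_real] bounded_linear_inner_right)
  from has_derivative_compose[OF this DERIV_exp[unfolded has_field_derivative_def]]
  have "(phase p has_derivative (\<lambda>v. phase p x * (\<i> * of_real (p \<bullet> v)))) (at x)"
    by (simp add: phase_def[abs_def])
  from frechet_derivative_eqI[OF this] show ?thesis by (simp add: inner_axis mult.commute)
qed

lemma phase_measurable: "phase p \<in> borel_measurable (lebesgue_on \<Omega>)"
  using C_k_phase[of 0 p] by (simp add: continuous_lebesgue_on)

lemma L2_phase: "L2 \<Omega> f \<Longrightarrow> L2 \<Omega> (\<lambda>x. phase p x * f x)"
  by (rule L2_mult_bounded[where B = 1 and g = "phase p"]) (simp_all add: norm_phase phase_measurable)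

text \<open>The product rule, obtained by moving the factor onto the test function so that
  \<open>u\<close> itself is never differentiated.\<close>

lemma is_weak_gradient_phase:
  assumes op: "open \<Omega>" and u: "L2 \<Omega> u" "is_weak_gradient \<Omega> u g"
  shows "is_weak_gradient \<Omega> (\<lambda>x. phase p x * u x)
    (\<lambda>x. \<chi> k. phase p x * (g x $ k + \<i> * of_real (p $ k) * u x))"
  unfolding is_weak_gradient_def
proof (intro conjI allI impI)
  note \<Omega> = open_sets_lebesgue[OF op]
  have gL: "L2 \<Omega> (\<lambda>x. g x $ k)" for k by (rule is_weak_gradientD(2)[OF u(2)])
  have L: "L2 \<Omega> (\<lambda>x. g x $ k + \<i> * of_real (p $ k) * u x)" for k
    by (intro L2_add gL L2_cmult u)
  show "L2 \<Omega> (\<lambda>x. \<chi> k. phase p x * (g x $ k + \<i> * of_real (p $ k) * u x))"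
    by (intro L2_vecI, simp) (intro L2_phase L)
  fix \<phi> k assume \<phi>: "test_function \<Omega> \<phi>"
  let ?\<psi> = "\<lambda>x. phase p x * \<phi> x"
  have \<psi>: "test_function \<Omega> ?\<psi>" by (rule test_function_mult[OF \<phi> C_k_phase])
  have d: "pd k ?\<psi> x = phase p x * pd k \<phi> x + \<i> * of_real (p $ k) * ?\<psi> x" for x
    using frechet_derivative_mult_test[OF \<phi> C_k_phase, of p x "axis k 1"] by (simp add: pd_phase)
  have LD: "L2 \<Omega> (pd k ?\<psi>)" "L2 \<Omega> ?\<psi>"
    using test_function_L2[OF _ \<Omega>] test_function_derivative \<psi> by blast+
  have i: "integrable (lebesgue_on \<Omega>) (\<lambda>x. u x * pd k ?\<psi> x)" "integrable (lebesgue_on \<Omega>) (\<lambda>x. g x $ k * ?\<psi> x)"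
    "integrable (lebesgue_on \<Omega>) (\<lambda>x. u x * ?\<psi> x)"
    by (rule L2_mult_integrable[OF u(1) LD(1)], rule L2_mult_integrable[OF gL LD(2)],
        rule L2_mult_integrable[OF u(1) LD(2)])
  have "(\<integral>x. phase p x * u x * pd k \<phi> x \<partial>lebesgue_on \<Omega>)
      = (\<integral>x. u x * pd k ?\<psi> x - \<i> * of_real (p $ k) * (u x * ?\<psi> x) \<partial>lebesgue_on \<Omega>)"
    unfolding d by (intro Bochner_Integration.integral_cong refl) (simp add: algebra_simps)
  also have "\<dots> = - (\<integral>x. g x $ k * ?\<psi> x \<partial>lebesgue_on \<Omega>) - \<i> * of_real (p $ k) * (\<integral>x. u x * ?\<psi> x \<partial>lebesgue_on \<Omega>)"
    using i is_weak_gradientD(3)[OF u(2) \<psi>, of k] by simp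
  also have "\<dots> = - (\<integral>x. g x $ k * ?\<psi> x + \<i> * of_real (p $ k) * (u x * ?\<psi> x) \<partial>lebesgue_on \<Omega>)"
    using i by simp
  also have "\<dots> = - (\<integral>x. (\<chi> k. phase p x * (g x $ k + \<i> * of_real (p $ k) * u x)) $ k * \<phi> x \<partial>lebesgue_on \<Omega>)"
    by (intro arg_cong[of _ _ uminus] Bochner_Integration.integral_cong refl) (simp add: algebra_simps)
  finally show "(\<integral>x. phase p x * u x * pd k \<phi> x \<partial>lebesgue_on \<Omega>)
      = - (\<integral>x. (\<chi> k. phase p x * (g x $ k + \<i> * of_real (p $ k) * u x)) $ k * \<phi> x \<partial>lebesgue_on \<Omega>)" .
qed

subsection \<open>Gauge and coordinate transformations\<close>

definition conj_if :: "bool \<Rightarrow> complex \<Rightarrow> complex" where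
  "conj_if b z = (if b then cnj z else z)"

lemma conj_if_simps [simp]:
  "conj_if b (x + y) = conj_if b x + conj_if b y" "conj_if b (x - y) = conj_if b x - conj_if b y"
  "conj_if b (x * y) = conj_if b x * conj_if b y" "conj_if b (conj_if b x) = x"
  "norm (conj_if b x) = norm x" "conj_if b (of_real r) = of_real r" "conj_if b 0 = 0" "conj_if b 1 = 1"
  "conj_if b x = 0 \<longleftrightarrow> x = 0"
  by (auto simp: conj_if_def)

lemma conj_if_sum: "conj_if b (\<Sum>k\<in>I. f k) = (\<Sum>k\<in>I. conj_if b (f k))"
  by (auto simp: conj_if_def)

text \<open>The affine map \<open>x \<mapsto> T x + q\<close> shifts the vector potential by a constant, which the phase compensates, and
  reverses the orientation when \<open>det T < 0\<close>, which complex conjugation compensates.\<close>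

definition transform :: "complex \<Rightarrow> real^2 \<Rightarrow> bool \<Rightarrow> (real^2 \<Rightarrow> real^2) \<Rightarrow> real^2 \<Rightarrow> (real^2 \<Rightarrow> complex) \<Rightarrow> real^2 \<Rightarrow> complex" where
  "transform c p b T q u y = c * (phase p y * conj_if b (u (inv T (y - q))))"

definition transform_grad :: "complex \<Rightarrow> real^2 \<Rightarrow> bool \<Rightarrow> (real^2 \<Rightarrow> real^2) \<Rightarrow> real^2 \<Rightarrow> (real^2 \<Rightarrow> complex)
    \<Rightarrow> (real^2 \<Rightarrow> complex^2) \<Rightarrow> real^2 \<Rightarrow> complex^2" where
  "transform_grad c p b T q u g y = (\<chi> k. c * (phase p y *
     (of_real (matrix (inv T)$1$k) * conj_if b (g (inv T (y - q)) $ 1)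
       + of_real (matrix (inv T)$2$k) * conj_if b (g (inv T (y - q)) $ 2)
       + \<i> * of_real (p $ k) * conj_if b (u (inv T (y - q))))))"

lemma L2_conj_if: "L2 \<Omega> u \<Longrightarrow> L2 \<Omega> (\<lambda>x. conj_if b (u x))"
  by (cases b) (simp_all add: conj_if_def L2_cnj)

lemma open_affine_image:
  assumes "open \<Omega>" "linear T" "bij T" shows "open ((\<lambda>x. T x + (q::real^2)) ` (\<Omega> :: (real^2) set))"
proof -
  have "(\<lambda>x. T x + q) ` \<Omega> = (+) q ` (T ` \<Omega>)" by (auto simp: image_image add.commute)
  then show ?thesis
    using open_surjective_linear_image[OF assms(1,2) bij_is_surj[OF assms(3)]] by (simp add: open_translation)
qed

context
  fixes \<Omega> :: "(real^2) set" and T :: "real^2 \<Rightarrow> real^2" and p q :: "real^2" and c :: complex and b :: bool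
  assumes op: "open \<Omega>" and T: "linear T" "bij T"
begin

abbreviation "\<Omega>T \<equiv> (\<lambda>x. T x + q) ` \<Omega>"

lemma open_\<Omega>T: "open \<Omega>T"
  by (rule open_affine_image[OF op T])

lemma L2_transform: "L2 \<Omega> u \<Longrightarrow> L2 \<Omega>T (transform c p b T q u)"
  unfolding transform_def[abs_def]
  by (intro L2_cmult L2_phase L2_affine[OF T open_sets_lebesgue[OF op]] L2_conj_if)

lemma is_weak_gradient_transform:
  assumes u: "L2 \<Omega> u" "is_weak_gradient \<Omega> u g"
  shows "is_weak_gradient \<Omega>T (transform c p b T q u) (transform_grad c p b T q u g)"
proof -
  have 1: "is_weak_gradient \<Omega> (\<lambda>x. conj_if b (u x)) (\<lambda>x. \<chi> k. conj_if b (g x $ k))"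
    using is_weak_gradient_cnj[OF u(2)] u(2) by (cases b) (simp_all add: conj_if_def)
  note 2 = is_weak_gradient_affine[OF op T L2_conj_if[OF u(1)] 1, of q]
  note 3 = is_weak_gradient_phase[OF open_\<Omega>T L2_affine[OF T open_sets_lebesgue[OF op] L2_conj_if[OF u(1)], of q b] 2, of p]
  note 4 = is_weak_gradient_cmult[OF 3, of c]
  then show ?thesis
    unfolding transform_def[abs_def] transform_grad_def[abs_def] by simp
qed

lemma H1_transform: "u \<in> H1 \<Omega> \<Longrightarrow> transform c p b T q u \<in> H1 \<Omega>T"
  using is_weak_gradient_transform[of u "weak_gradient \<Omega> u"] L2_transform[of u] H1_L2 H1_weak_gradient
  by (blast intro: H1I)

lemma test_function_transform:
  assumes \<phi>: "test_function \<Omega> \<phi>" shows "test_function \<Omega>T (transform c p b T q \<phi>)"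
proof -
  have bi: "bij (inv T)" by (rule bij_imp_bij_inv[OF T(2)])
  have li: "linear (inv T)" by (rule linear_inv[OF T])
  have e: "inv T (y - q) = inv T y + - inv T q" for y using linear_diff[OF li] by simp
  have "test_function \<Omega>T (\<lambda>y. \<phi> (inv T y + - inv T q))"
    by (rule test_function_affine[OF \<phi> li bi]) (simp add: affine_image_iff[OF T] e)
  then have "test_function \<Omega>T (\<lambda>y. conj_if b (\<phi> (inv T (y - q))))"
    unfolding e by (cases b) (simp_all add: conj_if_def test_function_cnj)
  from test_function_cmult[OF test_function_mult[OF this C_k_phase], of c p]
  show ?thesis unfolding transform_def[abs_def] .
qed

text \<open>Only the existence of some \<open>C\<close> matters: a bounded map that preserves test
  functions also preserves limits of test functions, hence \<open>H1_0\<close>.\<close>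

lemma H1_norm_transform_le:
  obtains C where "C \<ge> 0" "\<And>u. u \<in> H1 \<Omega> \<Longrightarrow> H1_norm \<Omega>T (transform c p b T q u) \<le> C * H1_norm \<Omega> u"
proof -
  note \<Omega> = open_sets_lebesgue[OF op]
  let ?B = "matrix (inv T)"
  define b0 where "b0 = \<bar>?B$1$1\<bar> + \<bar>?B$1$2\<bar> + \<bar>?B$2$1\<bar> + \<bar>?B$2$2\<bar> + \<bar>p$1\<bar> + \<bar>p$2\<bar>"
  \<comment> \<open>The 6 is a 3 from the square of a sum of three terms, doubled for the two
    components; the 1 accounts for the function itself.\<close>
  define K where "K = (norm c)\<^sup>2 * (6 * b0\<^sup>2 + 1) * \<bar>det (matrix T)\<bar>"
  have K0: "K \<ge> 0" by (simp add: K_def)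
  have "(H1_norm \<Omega>T (transform c p b T q u))\<^sup>2 \<le> K * (H1_norm \<Omega> u)\<^sup>2" if u: "u \<in> H1 \<Omega>" for u
  proof -
    define g where "g = weak_gradient \<Omega> u"
    have g: "is_weak_gradient \<Omega> u g" unfolding g_def by (rule H1_weak_gradient[OF u])
    have uL: "L2 \<Omega> u" by (rule H1_L2[OF u])
    note G = is_weak_gradient_transform[OF uL g]
    define R where "R = (\<lambda>y. inv T (y - q))"
    let ?e = "\<lambda>y. (norm (g (R y)))\<^sup>2 + (norm (u (R y)))\<^sup>2"
    have b0: "b0 \<ge> 0" by (simp add: b0_def)
    have comp: "(norm (transform_grad c p b T q u g y $ k))\<^sup>2 \<le> (norm c)\<^sup>2 * (3 * b0\<^sup>2 * ?e y)" for y k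
    proof -
      have k: "k = 1 \<or> k = 2" by (rule exhaust_2)
      have bb: "\<bar>?B$1$k\<bar> \<le> b0" "\<bar>?B$2$k\<bar> \<le> b0" "\<bar>p$k\<bar> \<le> b0"
        using k by (auto simp: b0_def)
      let ?x = "norm (g (R y) $ 1)" and ?y = "norm (g (R y) $ 2)" and ?z = "norm (u (R y))"
      have "norm (transform_grad c p b T q u g y $ k) = norm c * norm (of_real (?B$1$k) * conj_if b (g (R y) $ 1)
        + of_real (?B$2$k) * conj_if b (g (R y) $ 2) + \<i> * of_real (p $ k) * conj_if b (u (R y)))"
        by (simp add: transform_grad_def norm_mult norm_phase R_def)
      also have "\<dots> \<le> norm c * (\<bar>?B$1$k\<bar> * ?x + \<bar>?B$2$k\<bar> * ?y + \<bar>p$k\<bar> * ?z)"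
        by (intro mult_left_mono order_trans[OF norm_triangle_ineq] add_mono) (auto simp: norm_mult)
      also have "\<dots> \<le> norm c * (b0 * ?x + b0 * ?y + b0 * ?z)"
        by (intro mult_left_mono add_mono mult_right_mono bb) auto
      finally have le0: "norm (transform_grad c p b T q u g y $ k) \<le> norm c * (b0 * (?x + ?y + ?z))"
        by (simp add: ring_distribs)
      have sq: "(?x + ?y + ?z)\<^sup>2 \<le> 3 * ?e y"
        using zero_le_power2[of "?x - ?y"] zero_le_power2[of "?x - ?z"] zero_le_power2[of "?y - ?z"]
        unfolding norm_vec2 by (simp add: power2_eq_square algebra_simps)
      from power_mono[OF le0 norm_ge_zero, of 2]
      have "(norm (transform_grad c p b T q u g y $ k))\<^sup>2 \<le> (norm c)\<^sup>2 * (b0\<^sup>2 * (?x + ?y + ?z)\<^sup>2)"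
        by (simp add: power_mult_distrib)
      also have "\<dots> \<le> (norm c)\<^sup>2 * (b0\<^sup>2 * (3 * ?e y))"
        by (intro mult_left_mono sq) auto
      finally show ?thesis by (simp only: mult_ac)
    qed
    have le: "(norm (transform_grad c p b T q u g y))\<^sup>2 \<le> (norm c)\<^sup>2 * (6 * b0\<^sup>2 * ?e y)" for y
      using comp[of y 1] comp[of y 2] by (simp add: norm_vec2)
    have i: "integrable (lebesgue_on \<Omega>T) (\<lambda>y. (norm (g (R y)))\<^sup>2)" "integrable (lebesgue_on \<Omega>T) (\<lambda>y. (norm (u (R y)))\<^sup>2)"
      using L2_integrable[OF L2_affine[OF T \<Omega> is_weak_gradientD(1)[OF g]]] L2_integrable[OF L2_affine[OF T \<Omega> uL]]
      by (simp_all add: R_def)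
    have I: "(\<integral>y. ?e y \<partial>lebesgue_on \<Omega>T) = \<bar>det (matrix T)\<bar> * (H1_norm \<Omega> u)\<^sup>2"
      using i integral_sq_norm_affine[OF T \<Omega> uL] integral_sq_norm_affine[OF T \<Omega> is_weak_gradientD(1)[OF g]]
      by (simp add: R_def H1_norm_eq[OF op g] ring_distribs)
    have I1: "(\<integral>y. (norm (transform_grad c p b T q u g y))\<^sup>2 \<partial>lebesgue_on \<Omega>T)
        \<le> (\<integral>y. (norm c)\<^sup>2 * (6 * b0\<^sup>2 * ?e y) \<partial>lebesgue_on \<Omega>T)"
      using i L2_integrable[OF is_weak_gradientD(1)[OF G]] by (intro integral_mono le) auto
    have I2: "(\<integral>y. (norm (transform c p b T q u y))\<^sup>2 \<partial>lebesgue_on \<Omega>T)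
        \<le> (\<integral>y. (norm c)\<^sup>2 * ?e y \<partial>lebesgue_on \<Omega>T)"
      using i L2_integrable[OF L2_transform[OF uL]]
      by (intro integral_mono) (auto simp: transform_def norm_mult norm_phase power_mult_distrib R_def intro!: mult_left_mono)
    have "(H1_norm \<Omega>T (transform c p b T q u))\<^sup>2 \<le> (norm c)\<^sup>2 * (\<integral>y. ?e y \<partial>lebesgue_on \<Omega>T)
        + (norm c)\<^sup>2 * (6 * b0\<^sup>2 * (\<integral>y. ?e y \<partial>lebesgue_on \<Omega>T))"
      using I1 I2 by (simp add: H1_norm_eq[OF open_\<Omega>T G])
    also have "\<dots> = K * (H1_norm \<Omega> u)\<^sup>2"
      unfolding I by (simp add: K_def algebra_simps)
    finally show ?thesis .
  qed
  then have "H1_norm \<Omega>T (transform c p b T q u) \<le> sqrt K * H1_norm \<Omega> u" if "u \<in> H1 \<Omega>" for u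
    using that K0 by (intro power2_le_imp_le[OF _ mult_nonneg_nonneg]) (auto simp: power_mult_distrib H1_norm_def)
  then show ?thesis using that[of "sqrt K"] K0 by simp
qed

lemma H1_0_transform:
  assumes "u \<in> H1_0 \<Omega>" shows "transform c p b T q u \<in> H1_0 \<Omega>T"
proof -
  obtain \<phi> where u: "u \<in> H1 \<Omega>" and \<phi>: "\<And>n. test_function \<Omega> (\<phi> n)"
    and lim: "(\<lambda>n::nat. H1_norm \<Omega> (\<lambda>x. u x - \<phi> n x)) \<longlonglongrightarrow> 0"
    using assms by (auto simp: H1_0_def)
  obtain C where C: "C \<ge> 0" "\<And>u. u \<in> H1 \<Omega> \<Longrightarrow> H1_norm \<Omega>T (transform c p b T q u) \<le> C * H1_norm \<Omega> u"
    using H1_norm_transform_le by blast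
  have eq: "(\<lambda>x. transform c p b T q u x - transform c p b T q (\<phi> n) x) = transform c p b T q (\<lambda>x. u x - \<phi> n x)" for n
    by (simp add: transform_def[abs_def] right_diff_distrib)
  have "(\<lambda>n. H1_norm \<Omega>T (\<lambda>x. transform c p b T q u x - transform c p b T q (\<phi> n) x)) \<longlonglongrightarrow> 0"
  proof (rule tendsto_sandwich[OF _ _ tendsto_const])
    show "\<forall>\<^sub>F n in sequentially. 0 \<le> H1_norm \<Omega>T (\<lambda>x. transform c p b T q u x - transform c p b T q (\<phi> n) x)"
      by (simp add: H1_norm_def)
    show "\<forall>\<^sub>F n in sequentially. H1_norm \<Omega>T (\<lambda>x. transform c p b T q u x - transform c p b T q (\<phi> n) x)
        \<le> C * H1_norm \<Omega> (\<lambda>x. u x - \<phi> n x)"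
      unfolding eq using C(2)[OF H1_diff[OF op u H1_test[OF \<phi> op]]] by simp
    show "(\<lambda>n. C * H1_norm \<Omega> (\<lambda>x. u x - \<phi> n x)) \<longlonglongrightarrow> 0"
      using tendsto_mult_right_zero[OF lim] .
  qed
  then show ?thesis
    using H1_transform[OF u] test_function_transform[OF \<phi>]
    by (auto simp: H1_0_def intro!: exI[of _ "\<lambda>n. transform c p b T q (\<phi> n)"])
qed

end

lemma transform_inverse:
  assumes T: "linear T" "bij T"
  shows "transform c p b T q (\<lambda>x. conj_if b (phase (- p) (T x + q) * v (T x + q))) = (\<lambda>y. c * v y)"
proof
  fix y
  have "transform c p b T q (\<lambda>x. conj_if b (phase (- p) (T x + q) * v (T x + q))) y
    = c * ((phase p y * phase (- p) y) * v y)"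
    unfolding transform_def affine_inv(2)[OF T] by (simp add: mult.assoc del: conj_if_simps(3))
  then show "transform c p b T q (\<lambda>x. conj_if b (phase (- p) (T x + q) * v (T x + q))) y = c * v y"
    by (simp add: phase_minus)
qed

text \<open>The inverse of a transformation is again a transformation and so preserves both trial
  spaces. Conjugation reverses the sign of a phase, whence the two cases; the value of the phase at
  \<open>q\<close> splits off as a constant.\<close>

lemma transform_inverse_eq:
  assumes T: "linear T" "bij T"
  shows "(\<lambda>x. conj_if b (phase (- p) (T x + q) * v (T x + q)))
    = transform (conj_if b (phase (- p) q)) ((if b then 1 else - 1) *\<^sub>R adjoint T p) b (inv T) (- inv T q) v"
proof
  fix x
  have li: "linear (inv T)" by (rule linear_inv[OF T])
  have ii: "inv (inv T) = T" using T(2) by (rule inv_inv_eq)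
  have 1: "inv (inv T) (x - - inv T q) = T x + q"
    unfolding ii using T by (simp add: linear_add bij_is_surj surj_f_inv_f)
  have 2: "conj_if b (phase (- p) (T x)) = phase ((if b then 1 else - 1) *\<^sub>R adjoint T p) x"
    using adjoint_works[OF T(1), of x p] by (simp add: conj_if_def cnj_phase) (simp add: phase_def inner_commute)
  show "conj_if b (phase (- p) (T x + q) * v (T x + q))
    = transform (conj_if b (phase (- p) q)) ((if b then 1 else - 1) *\<^sub>R adjoint T p) b (inv T) (- inv T q) v x"
    unfolding transform_def 1 2[symmetric] phase_add by (simp add: mult_ac)
qed

lemma transform_lincomb:
  "transform c p b T q (lincomb n d u) = lincomb n (\<lambda>k. conj_if b (d k)) (\<lambda>k. transform c p b T q (u k))"
  by (simp add: transform_def[abs_def] lincomb_def conj_if_sum sum_distrib_left mult_ac)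

section \<open>The magnetic form\<close>

text \<open>The gradient is an argument, so that transformation rules can be computed pointwise with
  explicit gradients.\<close>

definition mgrad :: "real \<Rightarrow> real \<Rightarrow> (real^2 \<Rightarrow> complex) \<Rightarrow> (real^2 \<Rightarrow> complex^2) \<Rightarrow> real^2 \<Rightarrow> complex^2" where
  "mgrad h \<beta> u g x = (\<chi> k. \<i> * of_real h * g x $ k + of_real (vector_potential \<beta> x $ k) * u x)"

lemma magnetic_gradient_mgrad: "magnetic_gradient \<Omega> h \<beta> u = mgrad h \<beta> u (weak_gradient \<Omega> u)"
  by (simp add: fun_eq_iff magnetic_gradient_def mgrad_def)

lemma vector_potential_nth:
  "vector_potential \<beta> x $ 1 = - (\<beta> / 2) * x$2" "vector_potential \<beta> x $ 2 = \<beta> / 2 * x$1"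
  by (simp_all add: vector_potential_def)

lemma continuous_vector_potential: "continuous_on UNIV (\<lambda>x. complex_of_real (vector_potential \<beta> x $ k))"
proof -
  have "continuous_on UNIV (\<lambda>x. complex_of_real (vector_potential \<beta> x $ 1))"
    "continuous_on UNIV (\<lambda>x. complex_of_real (vector_potential \<beta> x $ 2))"
    unfolding vector_potential_nth by (intro continuous_intros)+
  then show ?thesis using exhaust_2[of k] by blast
qed

lemma vector_potential_bound: "\<bar>vector_potential \<beta> x $ k\<bar> \<le> \<bar>\<beta>\<bar> * norm x"
proof -
  have "\<bar>\<beta>\<bar> / 2 * \<bar>x $ i\<bar> \<le> \<bar>\<beta>\<bar> * norm x" for i
    using component_le_norm_cart[of x i] norm_ge_zero[of x]
    by (intro mult_mono) auto
  then show ?thesis using exhaust_2[of k] by (auto simp: vector_potential_nth abs_mult)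
qed

lemma mgrad_AE:
  assumes "open \<Omega>" "is_weak_gradient \<Omega> u g"
  shows "AE x in lebesgue_on \<Omega>. magnetic_gradient \<Omega> h \<beta> u x = mgrad h \<beta> u g x"
  using weak_gradient_AE[OF assms] by (rule AE_mp) (simp add: magnetic_gradient_mgrad mgrad_def)

lemma L2_mgrad:
  assumes "open \<Omega>" "bounded \<Omega>" "L2 \<Omega> u" "is_weak_gradient \<Omega> u g"
  shows "L2 \<Omega> (\<lambda>x. mgrad h \<beta> u g x $ k)"
proof -
  obtain r where r: "\<And>x. x \<in> \<Omega> \<Longrightarrow> norm x \<le> r" using assms(2) by (auto simp: bounded_iff)
  have "norm (complex_of_real (vector_potential \<beta> x $ k)) \<le> \<bar>\<beta>\<bar> * r" if "x \<in> \<Omega>" for x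
    using vector_potential_bound[of \<beta> x k] mult_left_mono[OF r[OF that], of "\<bar>\<beta>\<bar>"] by simp
  then have "L2 \<Omega> (\<lambda>x. of_real (vector_potential \<beta> x $ k) * u x)"
    by (intro L2_mult_bounded[OF assms(3) continuous_lebesgue_on[OF continuous_vector_potential]])
  then show ?thesis
    unfolding mgrad_def vec_lambda_beta
    by (intro L2_add L2_cmult[of _ "\<lambda>x. g x $ k"] is_weak_gradientD(2)[OF assms(4)])
qed

lemma L2_magnetic_gradient:
  assumes "open \<Omega>" "bounded \<Omega>" "u \<in> H1 \<Omega>"
  shows "L2 \<Omega> (\<lambda>x. magnetic_gradient \<Omega> h \<beta> u x $ k)"
  unfolding magnetic_gradient_mgrad
  by (rule L2_mgrad[OF assms(1,2) H1_L2[OF assms(3)] H1_weak_gradient[OF assms(3)]])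

lemma magnetic_gradient_add:
  assumes "open \<Omega>" "u \<in> H1 \<Omega>" "v \<in> H1 \<Omega>"
  shows "AE x in lebesgue_on \<Omega>. magnetic_gradient \<Omega> h \<beta> (\<lambda>x. u x + v x) x
    = magnetic_gradient \<Omega> h \<beta> u x + magnetic_gradient \<Omega> h \<beta> v x"
  using mgrad_AE[OF assms(1) is_weak_gradient_add[OF assms(1) H1_L2[OF assms(2)] H1_weak_gradient[OF assms(2)]
      H1_L2[OF assms(3)] H1_weak_gradient[OF assms(3)]], of h \<beta>]
  by (rule AE_mp) (simp add: magnetic_gradient_mgrad mgrad_def vec2_eq_iff algebra_simps)

lemma magnetic_gradient_cmult:
  assumes "open \<Omega>" "u \<in> H1 \<Omega>"
  shows "AE x in lebesgue_on \<Omega>. \<forall>k. magnetic_gradient \<Omega> h \<beta> (\<lambda>x. c * u x) x $ k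
    = c * magnetic_gradient \<Omega> h \<beta> u x $ k"
  using mgrad_AE[OF assms(1) is_weak_gradient_cmult[OF H1_weak_gradient[OF assms(2)]], of h \<beta> c]
  by (rule AE_mp) (simp add: magnetic_gradient_mgrad mgrad_def algebra_simps)

text \<open>The sesquilinear form of the real symmetric matrix with rows \<open>(a, b)\<close> and
  \<open>(b, d)\<close>.\<close>

definition qform :: "real \<Rightarrow> real \<Rightarrow> real \<Rightarrow> complex^2 \<Rightarrow> complex^2 \<Rightarrow> complex" where
  "qform a b d z w = of_real a * (z$1 * cnj (w$1)) + of_real b * (z$1 * cnj (w$2) + z$2 * cnj (w$1))
     + of_real d * (z$2 * cnj (w$2))"

lemma Re_qform:
  "Re (qform a b d z z) = a * (norm (z$1))\<^sup>2 + 2 * b * Re (z$1 * cnj (z$2)) + d * (norm (z$2))\<^sup>2"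
  unfolding cmod_power2 qform_def by (simp add: power2_eq_square algebra_simps)

lemma Re_qform_id: "Re (qform 1 0 1 z z) = (norm z)\<^sup>2"
  by (simp add: Re_qform norm_vec2)

definition psd :: "real \<Rightarrow> real \<Rightarrow> real \<Rightarrow> bool" where
  "psd a b d \<longleftrightarrow> (\<forall>z. 0 \<le> Re (qform a b d z z))"

definition mform :: "(real^2) set \<Rightarrow> real \<Rightarrow> real \<Rightarrow> real \<Rightarrow> real \<Rightarrow> real \<Rightarrow> (real^2 \<Rightarrow> complex) \<Rightarrow> (real^2 \<Rightarrow> complex) \<Rightarrow> complex" where
  "mform \<Omega> h \<beta> a b d u v =
     (\<integral>x. qform a b d (magnetic_gradient \<Omega> h \<beta> u x) (magnetic_gradient \<Omega> h \<beta> v x) \<partial>lebesgue_on \<Omega>)"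

lemma qform_integrable:
  assumes "\<And>k. L2 \<Omega> (\<lambda>x. z x $ k)" "\<And>k. L2 \<Omega> (\<lambda>x. w x $ k)"
  shows "integrable (lebesgue_on \<Omega>) (\<lambda>x. qform a b d (z x) (w x))"
  unfolding qform_def
  by (intro Bochner_Integration.integrable_add integrable_mult_right ip_integrable assms)

lemma mform_integrable:
  assumes "open \<Omega>" "bounded \<Omega>" "u \<in> H1 \<Omega>" "v \<in> H1 \<Omega>"
  shows "integrable (lebesgue_on \<Omega>) (\<lambda>x. qform a b d (magnetic_gradient \<Omega> h \<beta> u x) (magnetic_gradient \<Omega> h \<beta> v x))"
  by (intro qform_integrable L2_magnetic_gradient assms)

lemma hermitian_form_mform:
  assumes op: "open \<Omega>" and bd: "bounded \<Omega>" and sub: "V \<subseteq> H1 \<Omega>" and psd: "psd a b d"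
    and V: "(\<lambda>x. 0) \<in> V" "\<And>u v. u \<in> V \<Longrightarrow> v \<in> V \<Longrightarrow> (\<lambda>x. u x + v x) \<in> V" "\<And>u c. u \<in> V \<Longrightarrow> (\<lambda>x. c * u x) \<in> V"
  shows "hermitian_form V (mform \<Omega> h \<beta> a b d)"
proof
  note int = mform_integrable[OF op bd]
  have m: "(\<lambda>x. qform a b d (magnetic_gradient \<Omega> h \<beta> u x) (magnetic_gradient \<Omega> h \<beta> v x)) \<in> borel_measurable (lebesgue_on \<Omega>)"
    if "u \<in> V" "v \<in> V" for u v
    by (rule borel_measurable_integrable[OF int]) (use that sub in auto)
  fix u v w c assume u: "u \<in> V"
  show "0 \<le> Re (mform \<Omega> h \<beta> a b d u u)"
  proof -
    have "Re (mform \<Omega> h \<beta> a b d u u)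
        = (\<integral>x. Re (qform a b d (magnetic_gradient \<Omega> h \<beta> u x) (magnetic_gradient \<Omega> h \<beta> u x)) \<partial>lebesgue_on \<Omega>)"
      unfolding mform_def using int[of u u] u sub by (subst integral_Re) auto
    also have "\<dots> \<ge> 0" using psd by (intro integral_nonneg_AE AE_I2) (simp add: psd_def)
    finally show ?thesis .
  qed
  { assume v: "v \<in> V"
    show "mform \<Omega> h \<beta> a b d v u = cnj (mform \<Omega> h \<beta> a b d u v)"
      unfolding mform_def Bochner_Integration.integral_cnj[symmetric]
      by (intro Bochner_Integration.integral_cong refl) (simp add: qform_def algebra_simps)
    assume w: "w \<in> V"
    have "mform \<Omega> h \<beta> a b d (\<lambda>x. u x + v x) w
      = (\<integral>x. qform a b d (magnetic_gradient \<Omega> h \<beta> u x) (magnetic_gradient \<Omega> h \<beta> w x)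
          + qform a b d (magnetic_gradient \<Omega> h \<beta> v x) (magnetic_gradient \<Omega> h \<beta> w x) \<partial>lebesgue_on \<Omega>)"
      unfolding mform_def
    proof (rule integral_cong_AE)
      show "AE x in lebesgue_on \<Omega>. qform a b d (magnetic_gradient \<Omega> h \<beta> (\<lambda>x. u x + v x) x) (magnetic_gradient \<Omega> h \<beta> w x)
        = qform a b d (magnetic_gradient \<Omega> h \<beta> u x) (magnetic_gradient \<Omega> h \<beta> w x)
          + qform a b d (magnetic_gradient \<Omega> h \<beta> v x) (magnetic_gradient \<Omega> h \<beta> w x)"
        using magnetic_gradient_add[OF op subsetD[OF sub u] subsetD[OF sub v], of h \<beta>]
        by (rule AE_mp) (simp add: qform_def algebra_simps)
    qed (use m[OF V(2)[OF u v] w] m[OF u w] m[OF v w] in auto)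
    then show "mform \<Omega> h \<beta> a b d (\<lambda>x. u x + v x) w = mform \<Omega> h \<beta> a b d u w + mform \<Omega> h \<beta> a b d v w"
      unfolding mform_def using int[of u w] int[of v w] u v w sub by (simp add: subset_iff) }
  assume w: "w \<in> V"
  have "mform \<Omega> h \<beta> a b d (\<lambda>x. c * u x) w
    = (\<integral>x. c * qform a b d (magnetic_gradient \<Omega> h \<beta> u x) (magnetic_gradient \<Omega> h \<beta> w x) \<partial>lebesgue_on \<Omega>)"
    unfolding mform_def
  proof (rule integral_cong_AE)
    show "AE x in lebesgue_on \<Omega>. qform a b d (magnetic_gradient \<Omega> h \<beta> (\<lambda>x. c * u x) x) (magnetic_gradient \<Omega> h \<beta> w x)
      = c * qform a b d (magnetic_gradient \<Omega> h \<beta> u x) (magnetic_gradient \<Omega> h \<beta> w x)"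
      using magnetic_gradient_cmult[OF op subsetD[OF sub u], of h \<beta> c]
      by (rule AE_mp) (simp add: qform_def algebra_simps)
  qed (use m[OF V(3)[OF u] w] m[OF u w] in auto)
  then show "mform \<Omega> h \<beta> a b d (\<lambda>x. c * u x) w = c * mform \<Omega> h \<beta> a b d u w"
    unfolding mform_def by simp
qed (use V in auto)

lemma hermitian_form_ip:
  assumes "V \<subseteq> H1 \<Omega>"
    and "(\<lambda>x. 0) \<in> V" "\<And>u v. u \<in> V \<Longrightarrow> v \<in> V \<Longrightarrow> (\<lambda>x. u x + v x) \<in> V" "\<And>u c. u \<in> V \<Longrightarrow> (\<lambda>x. c * u x) \<in> V"
  shows "hermitian_form V (ip \<Omega>)"
proof -
  have L: "u \<in> {u. L2 \<Omega> u}" if "u \<in> V" for u using that assms(1) H1_L2 by auto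
  show ?thesis
    by unfold_locales
      (auto intro: assms L2.form_add[OF L L L] L2.form_cmult[OF L L] L2.form_sym[OF L L] L2.form_nonneg[OF L])
qed

lemma ae_zero_iff:
  assumes "L2 \<Omega> u" shows "ae_zero \<Omega> u \<longleftrightarrow> Re (ip \<Omega> u u) = 0"
  unfolding ae_zero_def Re_ip_self
  using integral_nonneg_eq_0_iff_AE[OF L2_integrable[OF assms]] by simp

text \<open>Lets one argument serve the Dirichlet and Neumann problems up to the compactness
  theorem, where the two spaces are treated differently.\<close>

definition trial_space :: "((real^2) set \<Rightarrow> (real^2 \<Rightarrow> complex) set) \<Rightarrow> bool" where
  "trial_space W \<longleftrightarrow> W = H1 \<or> W = H1_0"

lemma H1_zero: "open \<Omega> \<Longrightarrow> (\<lambda>x. 0) \<in> H1 \<Omega>"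
  using H1_test[OF test_function_zero] by blast

lemma H1_norm_add_le:
  assumes op: "open \<Omega>" and u: "u \<in> H1 \<Omega>" and v: "v \<in> H1 \<Omega>"
  shows "(H1_norm \<Omega> (\<lambda>x. u x + v x))\<^sup>2 \<le> 2 * (H1_norm \<Omega> u)\<^sup>2 + 2 * (H1_norm \<Omega> v)\<^sup>2"
  unfolding H1_norm_eq[OF op is_weak_gradient_add[OF op H1_L2[OF u] H1_weak_gradient[OF u] H1_L2[OF v] H1_weak_gradient[OF v]]]
    H1_norm_eq[OF op H1_weak_gradient[OF u]] H1_norm_eq[OF op H1_weak_gradient[OF v]]
  using L2_dist_add_le[OF H1_L2[OF u] H1_L2[OF v]]
    L2_dist_add_le[OF is_weak_gradientD(1)[OF H1_weak_gradient[OF u]] is_weak_gradientD(1)[OF H1_weak_gradient[OF v]]]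
  by simp

lemma H1_norm_cmult:
  assumes op: "open \<Omega>" and u: "u \<in> H1 \<Omega>"
  shows "(H1_norm \<Omega> (\<lambda>x. c * u x))\<^sup>2 = (norm c)\<^sup>2 * (H1_norm \<Omega> u)\<^sup>2"
proof -
  have e: "(norm (\<chi> k. c * z $ k))\<^sup>2 = (norm c)\<^sup>2 * (norm z)\<^sup>2" for z :: "complex^2"
    by (simp add: norm_vec2 norm_mult power_mult_distrib ring_distribs)
  show ?thesis
    unfolding H1_norm_eq[OF op is_weak_gradient_cmult[OF H1_weak_gradient[OF u]]] H1_norm_eq[OF op H1_weak_gradient[OF u]]
    by (simp add: e norm_mult power_mult_distrib ring_distribs)
qed

lemma H1_norm_nonneg: "0 \<le> H1_norm \<Omega> u"
  by (simp add: H1_norm_def)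

lemma H1_0_sub: "H1_0 \<Omega> \<subseteq> H1 \<Omega>"
  by (auto simp: H1_0_def)

lemma H1_0_test:
  assumes "test_function \<Omega> \<phi>" "open \<Omega>" shows "\<phi> \<in> H1_0 \<Omega>"
proof -
  have "H1_norm \<Omega> (\<lambda>x. \<phi> x - \<phi> x) = 0"
    using H1_norm_cmult[OF assms(2) H1_zero[OF assms(2)], of 0] by simp
  then show ?thesis
    unfolding H1_0_def using assms H1_test by (auto intro!: exI[of _ "\<lambda>_. \<phi>"])
qed

lemma H1_0_add:
  assumes op: "open \<Omega>" and u: "u \<in> H1_0 \<Omega>" and v: "v \<in> H1_0 \<Omega>"
  shows "(\<lambda>x. u x + v x) \<in> H1_0 \<Omega>"
proof -
  obtain \<phi> where \<phi>: "\<And>n. test_function \<Omega> (\<phi> n)" "(\<lambda>n::nat. H1_norm \<Omega> (\<lambda>x. u x - \<phi> n x)) \<longlonglongrightarrow> 0"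
    using u by (auto simp: H1_0_def)
  obtain \<psi> where \<psi>: "\<And>n. test_function \<Omega> (\<psi> n)" "(\<lambda>n::nat. H1_norm \<Omega> (\<lambda>x. v x - \<psi> n x)) \<longlonglongrightarrow> 0"
    using v by (auto simp: H1_0_def)
  have uH: "u \<in> H1 \<Omega>" and vH: "v \<in> H1 \<Omega>" using u v H1_0_sub by blast+
  have e: "(\<lambda>x. (u x - \<phi> n x) + (v x - \<psi> n x)) = (\<lambda>x. u x + v x - (\<phi> n x + \<psi> n x))" for n by auto
  have "(\<lambda>n. (H1_norm \<Omega> (\<lambda>x. u x + v x - (\<phi> n x + \<psi> n x)))\<^sup>2) \<longlonglongrightarrow> 0"
  proof (rule tendsto_sandwich[OF _ _ tendsto_const])
    show "\<forall>\<^sub>F n in sequentially. (H1_norm \<Omega> (\<lambda>x. u x + v x - (\<phi> n x + \<psi> n x)))\<^sup>2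
        \<le> 2 * (H1_norm \<Omega> (\<lambda>x. u x - \<phi> n x))\<^sup>2 + 2 * (H1_norm \<Omega> (\<lambda>x. v x - \<psi> n x))\<^sup>2"
      unfolding e[symmetric]
      by (intro always_eventually allI H1_norm_add_le op H1_diff uH vH H1_test[OF \<phi>(1)] H1_test[OF \<psi>(1)])
    have "(\<lambda>n. 2 * (H1_norm \<Omega> (\<lambda>x. u x - \<phi> n x))\<^sup>2 + 2 * (H1_norm \<Omega> (\<lambda>x. v x - \<psi> n x))\<^sup>2)
        \<longlonglongrightarrow> 2 * 0\<^sup>2 + 2 * 0\<^sup>2"
      by (intro tendsto_intros \<phi> \<psi>)
    then show "(\<lambda>n. 2 * (H1_norm \<Omega> (\<lambda>x. u x - \<phi> n x))\<^sup>2 + 2 * (H1_norm \<Omega> (\<lambda>x. v x - \<psi> n x))\<^sup>2)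
        \<longlonglongrightarrow> 0" by simp
  qed simp
  then have "(\<lambda>n. sqrt ((H1_norm \<Omega> (\<lambda>x. u x + v x - (\<phi> n x + \<psi> n x)))\<^sup>2)) \<longlonglongrightarrow> sqrt 0"
    by (rule tendsto_real_sqrt)
  then have "(\<lambda>n. H1_norm \<Omega> (\<lambda>x. u x + v x - (\<phi> n x + \<psi> n x))) \<longlonglongrightarrow> 0"
    by (simp add: H1_norm_nonneg)
  then show ?thesis
    unfolding H1_0_def using H1_add[OF op uH vH] test_function_add[OF \<phi>(1) \<psi>(1)]
    by (auto intro!: exI[of _ "\<lambda>n x. \<phi> n x + \<psi> n x"])
qed

text \<open>Multiplication by \<open>c\<close> is a \<open>transform\<close> with the identity map
  and trivial phase, so the closure property is inherited.\<close>

lemma H1_0_cmult: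
  assumes op: "open \<Omega>" and u: "u \<in> H1_0 \<Omega>" shows "(\<lambda>x. c * u x) \<in> H1_0 \<Omega>"
proof -
  have id: "linear (\<lambda>x::real^2. x)" "bij (\<lambda>x::real^2. x)" by (auto intro: linearI simp: bij_id[unfolded id_def])
  have inv: "inv (\<lambda>x::real^2. x) = (\<lambda>x. x)" using inv_id by (simp add: id_def)
  show ?thesis
    using H1_0_transform[OF op id u, where q = 0 and c = c and p = 0 and b = False]
    by (simp add: transform_def[abs_def] phase_0 conj_if_def inv)
qed

lemma trial_space_facts:
  assumes W: "trial_space W" and op: "open \<Omega>"
  shows "W \<Omega> \<subseteq> H1 \<Omega>" "(\<lambda>x. 0) \<in> W \<Omega>" "u \<in> W \<Omega> \<Longrightarrow> v \<in> W \<Omega> \<Longrightarrow> (\<lambda>x. u x + v x) \<in> W \<Omega>"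
    "u \<in> W \<Omega> \<Longrightarrow> (\<lambda>x. c * u x) \<in> W \<Omega>" "test_function \<Omega> \<phi> \<Longrightarrow> \<phi> \<in> W \<Omega>"
  using W[unfolded trial_space_def]
  by (elim disjE; simp add: H1_0_sub H1_zero[OF op] H1_0_test[OF test_function_zero op] H1_add[OF op] H1_0_add[OF op]
    H1_cmult H1_0_cmult[OF op] H1_test[OF _ op] H1_0_test[OF _ op])+

lemma trial_space_transform:
  assumes "trial_space W" "open \<Omega>" "linear T" "bij T" "u \<in> W \<Omega>"
  shows "transform c p b T q u \<in> W ((\<lambda>x. T x + q) ` \<Omega>)"
  using assms H1_transform[OF assms(2-4)] H1_0_transform[OF assms(2-4)] by (auto simp: trial_space_def)

definition mquot :: "(real^2) set \<Rightarrow> real \<Rightarrow> real \<Rightarrow> real \<Rightarrow> real \<Rightarrow> real \<Rightarrow> (real^2 \<Rightarrow> complex) \<Rightarrow> real" where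
  "mquot \<Omega> h \<beta> a b d u = Re (mform \<Omega> h \<beta> a b d u u) / Re (ip \<Omega> u u)"

lemma form_pair_magnetic:
  assumes "trial_space W" "open \<Omega>" "bounded \<Omega>" "psd a b d"
  shows "form_pair (W \<Omega>) (ip \<Omega>) (mform \<Omega> h \<beta> a b d) (ae_zero \<Omega>) (mquot \<Omega> h \<beta> a b d)"
proof -
  note F = trial_space_facts[OF assms(1,2)]
  interpret m: hermitian_form "W \<Omega>" "ip \<Omega>" by (rule hermitian_form_ip[OF F(1-4)])
  interpret a: hermitian_form "W \<Omega>" "mform \<Omega> h \<beta> a b d"
    by (rule hermitian_form_mform[OF assms(2,3) F(1) assms(4) F(2-4)])
  show ?thesis
    by unfold_locales (use F(1) in \<open>auto simp: mquot_def intro!: ae_zero_iff H1_L2\<close>)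
qed

subsection \<open>Transformation of the Rayleigh quotient\<close>

lemma inverse_matrix_2:
  assumes T: "linear (T :: real^2 \<Rightarrow> real^2)" "bij T"
  defines "t \<equiv> matrix T" and "B \<equiv> matrix (inv T)"
  shows "det t * B$1$1 = t$2$2" "det t * B$1$2 = - t$1$2" "det t * B$2$1 = - t$2$1" "det t * B$2$2 = t$1$1"
proof -
  have "inv T (T x) = x" for x using T(2) by (simp add: bij_is_inj)
  then have "inv T (T (axis j 1)) $ i = axis j 1 $ i" for i j by simp
  then have e: "B$i$1 * t$1$j + B$i$2 * t$2$j = (if i = j then 1 else 0)" for i j
    using linear_vec_nth[OF linear_inv[OF T], of "T (axis j 1)" i]
    by (simp add: B_def t_def matrix_def axis_def)
  have d: "det t = t$1$1 * t$2$2 - t$1$2 * t$2$1" by (rule det_2)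
  have e4: "B$1$1 * t$1$1 + B$1$2 * t$2$1 = 1" "B$1$1 * t$1$2 + B$1$2 * t$2$2 = 0"
    "B$2$1 * t$1$1 + B$2$2 * t$2$1 = 0" "B$2$1 * t$1$2 + B$2$2 * t$2$2 = 1"
    using e[of 1 1] e[of 1 2] e[of 2 1] e[of 2 2] by simp_all
  show "det t * B$1$1 = t$2$2" "det t * B$1$2 = - t$1$2" "det t * B$2$1 = - t$2$1" "det t * B$2$2 = t$1$1"
    unfolding d using e4 by algebra+
qed

text \<open>The potential is a multiple of the quarter turn \<open>J\<close>, and the transpose of
  \<open>T\<close> times \<open>J\<close> times \<open>T\<close> is \<open>det T\<close> times
  \<open>J\<close>. Hence \<open>T\<close> turns the potential into one of the same type with
  \<beta> divided by the determinant. The translation adds the constant potential at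
  \<open>q\<close>, which the gradient of the phase cancels. A negative determinant reverses the
  sign of the potential, and conjugation undoes this because it also reverses \<i>.\<close>

lemma mgrad_transform:
  fixes T :: "real^2 \<Rightarrow> real^2" and s h \<beta> :: real and q y :: "real^2"
  assumes T: "linear T" "bij T" and h: "s * h \<noteq> 0"
  defines "B \<equiv> matrix (inv T)" and "h' \<equiv> s * h" and "\<beta>' \<equiv> s * (\<beta> / \<bar>det (matrix T)\<bar>)"
    and "b \<equiv> det (matrix T) < 0"
  defines "p \<equiv> (1 / h') *\<^sub>R vector_potential \<beta>' q"
  defines "x \<equiv> inv T (y - q)"
  shows "mgrad h' \<beta>' (transform c p b T q u) (transform_grad c p b T q u g) y $ k
    = of_real (if b then - s else s) * (c * phase p y)
       * conj_if b (of_real (B$1$k) * mgrad h \<beta> u g x $ 1 + of_real (B$2$k) * mgrad h \<beta> u g x $ 2)"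
proof -
  define t where "t = matrix T"
  have t0: "det t \<noteq> 0" using det_pos[OF T] by (simp add: t_def)
  have y: "y = T x + q" unfolding x_def using affine_inv(2)[OF T] by simp
  have y1: "y$1 = t$1$1 * x$1 + t$1$2 * x$2 + q$1" and y2: "y$2 = t$2$1 * x$1 + t$2$2 * x$2 + q$2"
    unfolding y t_def by (simp_all add: linear_vec_nth[OF T(1)])
  note inv = inverse_matrix_2[OF T, folded t_def B_def]
  define \<sigma> where "\<sigma> = (if b then - 1 else (1::real))"
  have \<beta>': "\<beta>' * det t = s * \<beta> * \<sigma>"
    using t0 by (auto simp: \<beta>'_def \<sigma>_def b_def t_def[symmetric] field_simps abs_if)
  have ph: "h' * p $ k = vector_potential \<beta>' q $ k" using h by (simp add: p_def h'_def)
  \<comment> \<open>The geometric core: Cramer's formulas for the entries of \<open>B\<close>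
    express the transported potential through those of \<open>T\<close>.\<close>
  have "vector_potential \<beta>' y $ k = s * \<sigma> * (B$1$k * vector_potential \<beta> x $ 1 + B$2$k * vector_potential \<beta> x $ 2) + h' * p $ k"
  proof -
    have "s * \<sigma> * (B$1$k * vector_potential \<beta> x $ 1 + B$2$k * vector_potential \<beta> x $ 2)
        = (s * \<beta> * \<sigma>) / 2 * (B$2$k * x$1 - B$1$k * x$2)"
      by (simp add: vector_potential_nth algebra_simps)
    also have "\<dots> = \<beta>' / 2 * ((det t * B$2$k) * x$1 - (det t * B$1$k) * x$2)"
      unfolding \<beta>'[symmetric] by (simp add: algebra_simps)
    also have "\<dots> = vector_potential \<beta>' y $ k - vector_potential \<beta>' q $ k"
    proof -
      consider "k = 1" | "k = 2" using exhaust_2[of k] by blast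
      then show ?thesis
      proof cases
        case 1
        show ?thesis unfolding 1 inv vector_potential_nth y1 y2 by (simp add: algebra_simps)
      next
        case 2
        show ?thesis unfolding 2 inv vector_potential_nth y1 y2 by (simp add: algebra_simps)
      qed
    qed
    finally show ?thesis using ph by simp
  qed
  from arg_cong[OF this, of complex_of_real]
  have F: "complex_of_real (vector_potential \<beta>' y $ k) = of_real s * of_real \<sigma> * (of_real (B$1$k) * of_real (vector_potential \<beta> x $ 1)
      + of_real (B$2$k) * of_real (vector_potential \<beta> x $ 2)) + of_real h' * of_real (p $ k)"
    unfolding of_real_add of_real_mult .
  \<comment> \<open>Conjugation changes the sign of the imaginary unit and \<sigma> that of the
    potential, so the sign comes out as a common factor.\<close>
  have G: "\<i> * of_real h * conj_if b z + of_real \<sigma> * of_real r * conj_if b w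
      = of_real \<sigma> * conj_if b (\<i> * of_real h * z + of_real r * w)" for z w r
    by (auto simp: \<sigma>_def conj_if_def)
  let ?g = "\<lambda>j. conj_if b (g x $ j)" and ?w = "conj_if b (u x)" and ?F = "\<lambda>j. complex_of_real (vector_potential \<beta> x $ j)"
  have "mgrad h' \<beta>' (transform c p b T q u) (transform_grad c p b T q u g) y $ k
    = c * phase p y * (\<i> * of_real h' * (of_real (B$1$k) * ?g 1 + of_real (B$2$k) * ?g 2 + \<i> * of_real (p $ k) * ?w)
       + of_real (vector_potential \<beta>' y $ k) * ?w)"
    by (simp add: mgrad_def transform_def transform_grad_def x_def B_def algebra_simps)
  also have "\<dots> = c * phase p y * (of_real s * (of_real (B$1$k) * (\<i> * of_real h * ?g 1 + of_real \<sigma> * ?F 1 * ?w)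
       + of_real (B$2$k) * (\<i> * of_real h * ?g 2 + of_real \<sigma> * ?F 2 * ?w)))"
    unfolding F h'_def by (simp add: algebra_simps)
  also have "\<dots> = of_real (s * \<sigma>) * (c * phase p y)
       * conj_if b (of_real (B$1$k) * mgrad h \<beta> u g x $ 1 + of_real (B$2$k) * mgrad h \<beta> u g x $ 2)"
    unfolding G mgrad_def by (simp add: algebra_simps)
  also have "s * \<sigma> = (if b then - s else s)" by (simp add: \<sigma>_def)
  finally show ?thesis .
qed

context
  fixes \<Omega> :: "(real^2) set" and T :: "real^2 \<Rightarrow> real^2" and q :: "real^2" and s h \<beta> :: real
  assumes op: "open \<Omega>" and bd: "bounded \<Omega>" and T: "linear T" "bij T" and h: "s * h \<noteq> 0"
begin

abbreviation (input) "BT \<equiv> matrix (inv T)"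
abbreviation (input) "\<Omega>'T \<equiv> (\<lambda>x. T x + q) ` \<Omega>"
abbreviation (input) "h'T \<equiv> s * h"
abbreviation (input) "\<beta>'T \<equiv> s * (\<beta> / \<bar>det (matrix T)\<bar>)"
abbreviation (input) "bT \<equiv> det (matrix T) < 0"
abbreviation (input) "pT \<equiv> (1 / h'T) *\<^sub>R vector_potential \<beta>'T q"
abbreviation (input) "aT \<equiv> s\<^sup>2 * ((BT$1$1)\<^sup>2 + (BT$1$2)\<^sup>2)"
abbreviation (input) "cT \<equiv> s\<^sup>2 * (BT$1$1 * BT$2$1 + BT$1$2 * BT$2$2)"
abbreviation (input) "dT \<equiv> s\<^sup>2 * ((BT$2$1)\<^sup>2 + (BT$2$2)\<^sup>2)"

lemma qform_transform:
  "Re (qform aT cT dT z z) = s\<^sup>2 * ((norm (of_real (BT$1$1) * z$1 + of_real (BT$2$1) * z$2))\<^sup>2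
     + (norm (of_real (BT$1$2) * z$1 + of_real (BT$2$2) * z$2))\<^sup>2)"
  unfolding Re_qform cmod_power2 by (simp add: power2_eq_square algebra_simps)

lemma psd_transform: "psd aT cT dT"
  unfolding psd_def qform_transform by simp

lemma norm_mgrad_transform:
  assumes "norm c = 1"
  shows "(norm (mgrad h'T \<beta>'T (transform c pT bT T q u) (transform_grad c pT bT T q u g) y))\<^sup>2
    = Re (qform aT cT dT (mgrad h \<beta> u g (inv T (y - q))) (mgrad h \<beta> u g (inv T (y - q))))"
proof -
  have "(norm (of_real (if bT then - s else s) * (c * phase pT y) * conj_if bT z))\<^sup>2 = s\<^sup>2 * (norm z)\<^sup>2" for z
    by (simp only: norm_mult conj_if_simps(5) norm_phase assms) (auto simp: power_mult_distrib)
  then show ?thesis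
    unfolding qform_transform norm_vec2[of "mgrad h'T \<beta>'T _ _ _"] mgrad_transform[OF T h]
    by (simp only: ring_distribs)
qed

text \<open>Numerator and denominator pick up the same factor
  \<open>\<bar>det (matrix T)\<bar>\<close>, which cancels; only the matrix of the form remembers
  \<open>T\<close>.\<close>

lemma rayleigh_transform:
  assumes c: "norm c = 1" and u: "u \<in> H1 \<Omega>"
  shows "rayleigh \<Omega>'T h'T \<beta>'T (transform c pT bT T q u) = mquot \<Omega> h \<beta> aT cT dT u"
proof -
  note \<Omega> = open_sets_lebesgue[OF op]
  define g where "g = weak_gradient \<Omega> u"
  have g: "is_weak_gradient \<Omega> u g" unfolding g_def by (rule H1_weak_gradient[OF u])
  have uL: "L2 \<Omega> u" by (rule H1_L2[OF u])
  note G = is_weak_gradient_transform[OF op T uL g, of q c pT bT]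
  note op' = open_affine_image[OF op T, of q]
  let ?f = "\<lambda>x. qform aT cT dT (mgrad h \<beta> u g x) (mgrad h \<beta> u g x)"
  have fi: "integrable (lebesgue_on \<Omega>) ?f"
    by (intro qform_integrable L2_mgrad op bd uL g)
  have Rfi: "(\<lambda>x. Re (?f x)) \<in> borel_measurable (lebesgue_on \<Omega>)" using fi by (auto dest: borel_measurable_integrable)
  have bd': "bounded \<Omega>'T"
  proof -
    have "bounded_linear T" using T(1) by (rule linear_conv_bounded_linear[THEN iffD1])
    then have "bounded ((+) q ` (T ` \<Omega>))" by (intro bounded_translation bounded_linear_image bd)
    then show ?thesis by (simp add: image_image add.commute)
  qed
  have L: "L2 \<Omega>'T (transform c pT bT T q u)" by (rule L2_transform[OF op T uL])
  have "(\<integral>y. (norm (magnetic_gradient \<Omega>'T h'T \<beta>'T (transform c pT bT T q u) y))\<^sup>2 \<partial>lebesgue_on \<Omega>'T)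
      = (\<integral>y. (norm (mgrad h'T \<beta>'T (transform c pT bT T q u) (transform_grad c pT bT T q u g) y))\<^sup>2 \<partial>lebesgue_on \<Omega>'T)"
  proof (rule integral_cong_AE)
    have "L2 \<Omega>'T (magnetic_gradient \<Omega>'T h'T \<beta>'T (transform c pT bT T q u))"
      by (intro L2_vecI L2_magnetic_gradient op' bd' H1I[OF L G])
    then show "(\<lambda>y. (norm (magnetic_gradient \<Omega>'T h'T \<beta>'T (transform c pT bT T q u) y))\<^sup>2) \<in> borel_measurable (lebesgue_on \<Omega>'T)"
      by (blast dest: L2_integrable borel_measurable_integrable)
    have "L2 \<Omega>'T (mgrad h'T \<beta>'T (transform c pT bT T q u) (transform_grad c pT bT T q u g))"
      by (intro L2_vecI L2_mgrad op' bd' L G)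
    then show "(\<lambda>y. (norm (mgrad h'T \<beta>'T (transform c pT bT T q u) (transform_grad c pT bT T q u g) y))\<^sup>2) \<in> borel_measurable (lebesgue_on \<Omega>'T)"
      by (blast dest: L2_integrable borel_measurable_integrable)
    show "AE y in lebesgue_on \<Omega>'T. (norm (magnetic_gradient \<Omega>'T h'T \<beta>'T (transform c pT bT T q u) y))\<^sup>2
        = (norm (mgrad h'T \<beta>'T (transform c pT bT T q u) (transform_grad c pT bT T q u g) y))\<^sup>2"
      using mgrad_AE[OF op' G, of h'T \<beta>'T] by (rule AE_mp) simp
  qed
  also have "\<dots> = \<bar>det (matrix T)\<bar> * (\<integral>x. Re (?f x) \<partial>lebesgue_on \<Omega>)"
    unfolding norm_mgrad_transform[OF c] using integral_affine[OF T \<Omega> Rfi, of q] by simp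
  also have "(\<integral>x. Re (?f x) \<partial>lebesgue_on \<Omega>) = Re (mform \<Omega> h \<beta> aT cT dT u u)"
    unfolding mform_def magnetic_gradient_mgrad g_def[symmetric] by (rule integral_Re[OF fi])
  finally have num: "(\<integral>y. (norm (magnetic_gradient \<Omega>'T h'T \<beta>'T (transform c pT bT T q u) y))\<^sup>2 \<partial>lebesgue_on \<Omega>'T)
      = \<bar>det (matrix T)\<bar> * Re (mform \<Omega> h \<beta> aT cT dT u u)" .
  have den: "(\<integral>y. (norm (transform c pT bT T q u y))\<^sup>2 \<partial>lebesgue_on \<Omega>'T) = \<bar>det (matrix T)\<bar> * Re (ip \<Omega> u u)"
    using integral_sq_norm_affine[OF T \<Omega> uL, of q] c by (simp add: Re_ip_self transform_def norm_mult norm_phase)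
  show ?thesis
    unfolding rayleigh_def num den mquot_def using det_pos[OF T] by simp
qed

lemma ae_zero_transform:
  assumes c: "norm c = 1" and u: "u \<in> H1 \<Omega>"
  shows "ae_zero \<Omega>'T (transform c pT bT T q u) \<longleftrightarrow> ae_zero \<Omega> u"
proof -
  have den: "(\<integral>y. (norm (transform c pT bT T q u y))\<^sup>2 \<partial>lebesgue_on \<Omega>'T) = \<bar>det (matrix T)\<bar> * Re (ip \<Omega> u u)"
    using integral_sq_norm_affine[OF T open_sets_lebesgue[OF op] H1_L2[OF u], of q] c
    by (simp add: Re_ip_self transform_def norm_mult norm_phase)
  show ?thesis
    using ae_zero_iff[OF L2_transform[OF op T H1_L2[OF u]], of q c pT bT] ae_zero_iff[OF H1_L2[OF u]] den det_pos[OF T]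
    by (simp add: Re_ip_self)
qed

text \<open>Both inclusions between the sets of suprema are proved, by \<open>transform\<close> and
  by its inverse. Equality of these sets makes the infima equal without any question of
  boundedness.\<close>

lemma minimax_transform:
  assumes W: "trial_space W"
  shows "minimax_eigenvalue \<Omega>'T (W \<Omega>'T) h'T \<beta>'T j
    = minimax (ae_zero \<Omega>) (W \<Omega>) (mquot \<Omega> h \<beta> aT cT dT) j"
proof -
  note op' = open_affine_image[OF op T, of q]
  note F = trial_space_facts[OF W op] and F' = trial_space_facts[OF W op']
  let ?\<Phi> = "transform 1 pT bT T q"
  let ?\<Psi> = "\<lambda>v x. conj_if bT (phase (- pT) (T x + q) * v (T x + q))"
  have lc: "lincomb n c u \<in> W \<Omega>" if "\<And>k. k < n \<Longrightarrow> u k \<in> W \<Omega>" for n c u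
    using that F(2-4) by (induction n) (auto simp: lincomb_0 lincomb_Suc)
  have lc': "lincomb n c u \<in> W \<Omega>'T" if "\<And>k. k < n \<Longrightarrow> u k \<in> W \<Omega>'T" for n c u
    using that F'(2-4) by (induction n) (auto simp: lincomb_0 lincomb_Suc)
  have \<Psi>W: "?\<Psi> v \<in> W \<Omega>" if "v \<in> W \<Omega>'T" for v
  proof -
    have i: "linear (inv T)" "bij (inv T)" using linear_inv[OF T] bij_imp_bij_inv[OF T(2)] by auto
    have "(\<lambda>y. inv T y + - inv T q) ` \<Omega>'T = \<Omega>"
      using T(2) by (simp add: image_image linear_add[OF i(1)] bij_is_inj)
    then show ?thesis
      using trial_space_transform[OF W op' i that, where q = "- inv T q"] unfolding transform_inverse_eq[OF T] by simp
  qed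
  have \<Phi>\<Psi>: "?\<Phi> (?\<Psi> v) = v" for v using transform_inverse[OF T, of 1 pT bT q v] by simp
  have 1: "(\<lambda>S. SUP u \<in> {u \<in> S. \<not> ae_zero \<Omega> u}. mquot \<Omega> h \<beta> aT cT dT u) ` {S. trial (ae_zero \<Omega>) (W \<Omega>) j S}
    \<subseteq> (\<lambda>S. SUP u \<in> {u \<in> S. \<not> ae_zero \<Omega>'T u}. rayleigh \<Omega>'T h'T \<beta>'T u) ` {S. trial (ae_zero \<Omega>'T) (W \<Omega>'T) j S}"
    by (rule minimax_transfer_subset[where \<Phi> = ?\<Phi> and \<sigma> = "conj_if bT"])
       (use F(1) trial_space_transform[OF W op T] lc ae_zero_transform rayleigh_transform
         in \<open>auto simp: transform_lincomb\<close>)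
  have 2: "(\<lambda>S. SUP u \<in> {u \<in> S. \<not> ae_zero \<Omega>'T u}. rayleigh \<Omega>'T h'T \<beta>'T u) ` {S. trial (ae_zero \<Omega>'T) (W \<Omega>'T) j S}
    \<subseteq> (\<lambda>S. SUP u \<in> {u \<in> S. \<not> ae_zero \<Omega> u}. mquot \<Omega> h \<beta> aT cT dT u) ` {S. trial (ae_zero \<Omega>) (W \<Omega>) j S}"
  proof (rule minimax_transfer_subset[where \<Phi> = ?\<Psi> and \<sigma> = "conj_if bT"])
    show "?\<Psi> (lincomb n c u) = lincomb n (\<lambda>k. conj_if bT (c k)) (\<lambda>k. ?\<Psi> (u k))" for n c u
      unfolding transform_inverse_eq[OF T] by (rule transform_lincomb)
    fix v assume v: "v \<in> W \<Omega>'T"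
    show "ae_zero \<Omega> (?\<Psi> v) \<longleftrightarrow> ae_zero \<Omega>'T v"
      using ae_zero_transform[of 1 "?\<Psi> v"] \<Psi>W[OF v] F(1) unfolding \<Phi>\<Psi> by auto
    show "mquot \<Omega> h \<beta> aT cT dT (?\<Psi> v) = rayleigh \<Omega>'T h'T \<beta>'T v"
      using rayleigh_transform[of 1 "?\<Psi> v"] \<Psi>W[OF v] F(1) unfolding \<Phi>\<Psi> by auto
  qed (use \<Psi>W lc' in auto)
  show ?thesis
    unfolding minimax_eigenvalue_eq minimax_def by (rule arg_cong[where f = Inf, OF subset_antisym[OF 2 1]])
qed

end

section \<open>Averaging over rotations\<close>

definition rot :: "real \<Rightarrow> real^2 \<Rightarrow> real^2" where
  "rot \<phi> x = vector [cos \<phi> * x$1 - sin \<phi> * x$2, sin \<phi> * x$1 + cos \<phi> * x$2]"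

lemma rot_nth [simp]:
  "rot \<phi> x $ 1 = cos \<phi> * x$1 - sin \<phi> * x$2" "rot \<phi> x $ 2 = sin \<phi> * x$1 + cos \<phi> * x$2"
  by (simp_all add: rot_def)

lemma linear_rot: "linear (rot \<phi>)"
  by (rule linearI) (simp_all add: vec2_eq_iff algebra_simps)

lemma rot_rot: "rot \<phi> (rot \<psi> x) = rot (\<phi> + \<psi>) x"
  by (simp add: vec2_eq_iff cos_add sin_add algebra_simps)

lemma rot_0: "rot 0 x = x"
  by (simp add: vec2_eq_iff)

lemma bij_rot: "bij (rot \<phi>)"
  by (rule o_bij[where g = "rot (- \<phi>)"]) (simp_all add: fun_eq_iff rot_rot rot_0)

lemma inv_rot: "inv (rot \<phi>) = rot (- \<phi>)"
  by (rule inv_unique_comp) (simp_all add: fun_eq_iff rot_rot rot_0)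

lemma matrix_rot:
  "matrix (rot \<phi>) $ 1 $ 1 = cos \<phi>" "matrix (rot \<phi>) $ 1 $ 2 = - sin \<phi>"
  "matrix (rot \<phi>) $ 2 $ 1 = sin \<phi>" "matrix (rot \<phi>) $ 2 $ 2 = cos \<phi>"
  by (simp_all add: matrix_def axis_def)

lemma det_rot: "det (matrix (rot \<phi>)) = 1"
  by (simp add: det_2 matrix_rot flip: power2_eq_square)

text \<open>The transpose of \<open>rot \<phi>\<close> acting on complex vectors: this is how the
  gradient of \<open>u\<close> composed with \<open>rot \<phi>\<close> arises from that of
  \<open>u\<close>.\<close>

definition rotv :: "real \<Rightarrow> complex^2 \<Rightarrow> complex^2" where
  "rotv \<phi> z = vector [of_real (cos \<phi>) * z$1 + of_real (sin \<phi>) * z$2, - of_real (sin \<phi>) * z$1 + of_real (cos \<phi>) * z$2]"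

lemma rotv_nth [simp]:
  "rotv \<phi> z $ 1 = of_real (cos \<phi>) * z$1 + of_real (sin \<phi>) * z$2"
  "rotv \<phi> z $ 2 = - of_real (sin \<phi>) * z$1 + of_real (cos \<phi>) * z$2"
  by (simp_all add: rotv_def)

text \<open>A symmetric matrix conjugated by a rotation is a multiple of the identity plus a
  traceless part that turns at twice the angle.\<close>

lemma qform_rotv:
  "Re (qform a b d (rotv \<phi> z) (rotv \<phi> z)) = (a + d) / 2 * (norm z)\<^sup>2
    + cos (2 * \<phi>) * ((a - d) / 2 * ((norm (z$1))\<^sup>2 - (norm (z$2))\<^sup>2) + 2 * b * Re (z$1 * cnj (z$2)))
    + sin (2 * \<phi>) * ((a - d) * Re (z$1 * cnj (z$2)) - b * ((norm (z$1))\<^sup>2 - (norm (z$2))\<^sup>2))"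
proof -
  have c2: "(cos \<phi>)\<^sup>2 = 1 - (sin \<phi>)\<^sup>2" by (simp add: sin_squared_eq)
  define X where "X = (norm (z$1))\<^sup>2"
  define Y where "Y = (norm (z$2))\<^sup>2"
  define P where "P = Re (z$1 * cnj (z$2))"
  have 1: "(norm (rotv \<phi> z $ 1))\<^sup>2 = (cos \<phi>)\<^sup>2 * X + (sin \<phi>)\<^sup>2 * Y + 2 * (sin \<phi> * cos \<phi>) * P"
    unfolding X_def Y_def P_def cmod_power2 rotv_nth by (simp add: power2_eq_square algebra_simps)
  have 2: "(norm (rotv \<phi> z $ 2))\<^sup>2 = (sin \<phi>)\<^sup>2 * X + (cos \<phi>)\<^sup>2 * Y - 2 * (sin \<phi> * cos \<phi>) * P"
    unfolding X_def Y_def P_def cmod_power2 rotv_nth by (simp add: power2_eq_square algebra_simps)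
  have 3: "Re (rotv \<phi> z $ 1 * cnj (rotv \<phi> z $ 2)) = (sin \<phi> * cos \<phi>) * (Y - X) + ((cos \<phi>)\<^sup>2 - (sin \<phi>)\<^sup>2) * P"
    unfolding X_def Y_def P_def cmod_power2 rotv_nth by (simp add: power2_eq_square algebra_simps)
  have s2: "sin (2 * \<phi>) = 2 * (sin \<phi> * cos \<phi>)" by (simp add: sin_double)
  have c2': "cos (2 * \<phi>) = 1 - 2 * (sin \<phi>)\<^sup>2" by (simp add: cos_double c2)
  show ?thesis
    unfolding Re_qform 1 2 3 s2 c2' c2 norm_vec2 X_def[symmetric] Y_def[symmetric] P_def[symmetric]
    by (simp add: field_simps)
qed

text \<open>A geometric sum of powers of \<open>cis (4 * pi / N)\<close>, a root of unity that
  differs from 1 because \<open>N \<ge> 3\<close> puts its angle strictly between 0 and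
  \<open>2 * pi\<close>.\<close>

lemma sum_cis_eq_0:
  fixes N :: nat
  assumes N: "N \<ge> 3"
  shows "(\<Sum>i<N. cos (2 * (real i * (2 * pi / real N)))) = 0" "(\<Sum>i<N. sin (2 * (real i * (2 * pi / real N)))) = 0"
proof -
  let ?\<theta> = "4 * pi / real N"
  have t: "0 < ?\<theta>" "?\<theta> < 2 * pi" using N by (auto simp: field_simps)
  have ne: "cis ?\<theta> \<noteq> 1"
  proof
    assume "cis ?\<theta> = 1"
    then have "cos ?\<theta> = 1" by (simp add: cis.code complex_eq_iff)
    then obtain n :: int where n: "?\<theta> = of_int n * 2 * pi" using cos_one_2pi_int by blast
    then have "0 < real_of_int n" "real_of_int n < 1" using t by (auto simp: zero_less_mult_iff)
    then have "0 < n" "n < 1" by simp_all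
    then show False by simp
  qed
  have "cis ?\<theta> ^ N = cis (real N * ?\<theta>)" by (rule Complex.DeMoivre)
  also have "real N * ?\<theta> = 2 * pi + 2 * pi" using N by simp
  also have "cis (2 * pi + 2 * pi) = 1" by (simp only: cis_mult[symmetric] cis_2pi mult_1)
  finally have "(\<Sum>i<N. cis ?\<theta> ^ i) = 0" using ne by (simp add: geometric_sum)
  moreover have "cis ?\<theta> ^ i = cis (2 * (real i * (2 * pi / real N)))" for i
  proof -
    have "real i * ?\<theta> = 2 * (real i * (2 * pi / real N))" by (simp add: field_simps)
    then show ?thesis by (simp only: Complex.DeMoivre)
  qed
  ultimately have z: "(\<Sum>i<N. cis (2 * (real i * (2 * pi / real N)))) = 0" by simp
  show "(\<Sum>i<N. cos (2 * (real i * (2 * pi / real N)))) = 0" using arg_cong[OF z, of Re] by simp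
  show "(\<Sum>i<N. sin (2 * (real i * (2 * pi / real N)))) = 0" using arg_cong[OF z, of Im] by simp
qed

lemma sum_qform_rotv:
  assumes "N \<ge> 3"
  shows "(\<Sum>i<N. Re (qform a b d (rotv (real i * (2 * pi / real N)) z) (rotv (real i * (2 * pi / real N)) z)))
    = real N * ((a + d) / 2 * (norm z)\<^sup>2)"
  unfolding qform_rotv sum.distrib sum_distrib_right[symmetric] sum_cis_eq_0[OF assms] by simp

section \<open>Rotation of trial functions\<close>

context
  fixes \<Omega> :: "(real^2) set" and h \<beta> :: real
  assumes op: "open \<Omega>" and bd: "bounded \<Omega>" and h: "h > 0"
begin

context
  fixes \<phi> :: real
  assumes inv: "rot (- \<phi>) ` \<Omega> = \<Omega>"
begin

lemma rot_transform: "transform 1 0 False (rot (- \<phi>)) 0 u = (\<lambda>x. u (rot \<phi> x))"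
  by (simp add: transform_def[abs_def] phase_0 conj_if_def inv_rot)

lemma image_rot: "(\<lambda>x. rot (- \<phi>) x + 0) ` \<Omega> = \<Omega>"
  using inv by simp

lemma trial_space_rot: "trial_space W \<Longrightarrow> u \<in> W \<Omega> \<Longrightarrow> (\<lambda>x. u (rot \<phi> x)) \<in> W \<Omega>"
  using trial_space_transform[OF _ op linear_rot bij_rot, of W u 1 0 False "- \<phi>" 0]
  unfolding rot_transform image_rot by blast

lemma integral_rot:
  fixes f :: "real^2 \<Rightarrow> 'b::euclidean_space"
  assumes "f \<in> borel_measurable (lebesgue_on \<Omega>)"
  shows "(\<integral>x. f (rot \<phi> x) \<partial>lebesgue_on \<Omega>) = (\<integral>x. f x \<partial>lebesgue_on \<Omega>)"
  using integral_affine[OF linear_rot bij_rot open_sets_lebesgue[OF op] assms, of "- \<phi>" 0]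
  unfolding image_rot by (simp add: inv_rot det_rot)

lemma ip_rot:
  assumes "L2 \<Omega> u" "L2 \<Omega> v" shows "ip \<Omega> (\<lambda>x. u (rot \<phi> x)) (\<lambda>x. v (rot \<phi> x)) = ip \<Omega> u v"
  unfolding ip_def by (rule integral_rot[OF borel_measurable_integrable[OF ip_integrable[OF assms]]])

text \<open>The case of \<open>rot (- \<phi>)\<close> in the transformation rule. The centre is the
  origin and the determinant is 1, so phase, conjugation and change of parameters all
  disappear.\<close>

lemma mform_rot:
  assumes u: "u \<in> H1 \<Omega>"
  shows "Re (mform \<Omega> h \<beta> a b d (\<lambda>x. u (rot \<phi> x)) (\<lambda>x. u (rot \<phi> x)))
    = (\<integral>x. Re (qform a b d (rotv \<phi> (magnetic_gradient \<Omega> h \<beta> u x)) (rotv \<phi> (magnetic_gradient \<Omega> h \<beta> u x))) \<partial>lebesgue_on \<Omega>)"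
    and "integrable (lebesgue_on \<Omega>) (\<lambda>x. Re (qform a b d (rotv \<phi> (magnetic_gradient \<Omega> h \<beta> u x)) (rotv \<phi> (magnetic_gradient \<Omega> h \<beta> u x))))"
proof -
  define g where "g = weak_gradient \<Omega> u"
  have g: "is_weak_gradient \<Omega> u g" unfolding g_def by (rule H1_weak_gradient[OF u])
  have uL: "L2 \<Omega> u" by (rule H1_L2[OF u])
  let ?\<rho> = "\<lambda>x. u (rot \<phi> x)" and ?G = "transform_grad 1 0 False (rot (- \<phi>)) 0 u g"
  have G: "is_weak_gradient \<Omega> ?\<rho> ?G"
    using is_weak_gradient_transform[OF op linear_rot bij_rot uL g, of "- \<phi>" 0 1 0 False]
    unfolding rot_transform image_rot .
  have \<rho>: "?\<rho> \<in> H1 \<Omega>" using trial_space_rot[of H1] u by (simp add: trial_space_def)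
  have pt: "mgrad h \<beta> ?\<rho> ?G y = rotv \<phi> (mgrad h \<beta> u g (rot \<phi> y))" for y
  proof -
    have v0: "vector_potential \<beta> 0 = 0" by (simp add: vec2_eq_iff vector_potential_nth)
    have "mgrad h \<beta> ?\<rho> ?G y $ k = of_real (matrix (rot \<phi>)$1$k) * mgrad h \<beta> u g (rot \<phi> y) $ 1
        + of_real (matrix (rot \<phi>)$2$k) * mgrad h \<beta> u g (rot \<phi> y) $ 2" for k
      using mgrad_transform[OF linear_rot[of "- \<phi>"] bij_rot[of "- \<phi>"], where s = 1 and h = h and \<beta> = \<beta>
          and c = 1 and q = 0 and u = u and g = g and y = y and k = k] h
      by (simp add: det_rot v0 rot_transform inv_rot phase_0 conj_if_def)
    then show ?thesis by (simp add: vec2_eq_iff matrix_rot)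
  qed
  have Lrot: "L2 \<Omega> (\<lambda>x. rotv \<phi> (mgrad h \<beta> u g x) $ k)" for k
  proof -
    note L = L2_mgrad[OF op bd uL g]
    have "L2 \<Omega> (\<lambda>x. rotv \<phi> (mgrad h \<beta> u g x) $ 1)" "L2 \<Omega> (\<lambda>x. rotv \<phi> (mgrad h \<beta> u g x) $ 2)"
      unfolding rotv_nth by (intro L2_add L2_cmult L)+
    then show ?thesis using exhaust_2[of k] by metis
  qed
  have i: "integrable (lebesgue_on \<Omega>) (\<lambda>x. qform a b d (rotv \<phi> (mgrad h \<beta> u g x)) (rotv \<phi> (mgrad h \<beta> u g x)))"
    by (intro qform_integrable Lrot)
  have i': "integrable (lebesgue_on \<Omega>) (\<lambda>x. qform a b d (mgrad h \<beta> ?\<rho> ?G x) (mgrad h \<beta> ?\<rho> ?G x))"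
    by (intro qform_integrable L2_mgrad op bd H1_L2[OF \<rho>] G)
  have "mform \<Omega> h \<beta> a b d ?\<rho> ?\<rho> = (\<integral>x. qform a b d (mgrad h \<beta> ?\<rho> ?G x) (mgrad h \<beta> ?\<rho> ?G x) \<partial>lebesgue_on \<Omega>)"
    unfolding mform_def
  proof (rule integral_cong_AE)
    show "AE x in lebesgue_on \<Omega>. qform a b d (magnetic_gradient \<Omega> h \<beta> ?\<rho> x) (magnetic_gradient \<Omega> h \<beta> ?\<rho> x)
        = qform a b d (mgrad h \<beta> ?\<rho> ?G x) (mgrad h \<beta> ?\<rho> ?G x)"
      using mgrad_AE[OF op G, of h \<beta>] by (rule AE_mp) simp
  qed (use i' mform_integrable[OF op bd \<rho> \<rho>] in \<open>auto dest: borel_measurable_integrable\<close>)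
  also have "\<dots> = (\<integral>x. qform a b d (rotv \<phi> (mgrad h \<beta> u g x)) (rotv \<phi> (mgrad h \<beta> u g x)) \<partial>lebesgue_on \<Omega>)"
    unfolding pt by (rule integral_rot[OF borel_measurable_integrable[OF i]])
  finally have e: "mform \<Omega> h \<beta> a b d ?\<rho> ?\<rho>
      = (\<integral>x. qform a b d (rotv \<phi> (mgrad h \<beta> u g x)) (rotv \<phi> (mgrad h \<beta> u g x)) \<partial>lebesgue_on \<Omega>)" .
  show "Re (mform \<Omega> h \<beta> a b d ?\<rho> ?\<rho>)
    = (\<integral>x. Re (qform a b d (rotv \<phi> (magnetic_gradient \<Omega> h \<beta> u x)) (rotv \<phi> (magnetic_gradient \<Omega> h \<beta> u x))) \<partial>lebesgue_on \<Omega>)"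
    unfolding e magnetic_gradient_mgrad g_def[symmetric] by (rule integral_Re[OF i, symmetric])
  show "integrable (lebesgue_on \<Omega>) (\<lambda>x. Re (qform a b d (rotv \<phi> (magnetic_gradient \<Omega> h \<beta> u x)) (rotv \<phi> (magnetic_gradient \<Omega> h \<beta> u x))))"
    unfolding magnetic_gradient_mgrad g_def[symmetric] using i by (rule integrable_Re)
qed

end

context
  fixes N :: nat
  assumes N: "N \<ge> 3" and sym: "rot (2 * pi / real N) ` \<Omega> = \<Omega>"
begin

lemma rot_image_multiple: "rot (- (real i * (2 * pi / real N))) ` \<Omega> = \<Omega>"
proof (induction i)
  case 0
  have "rot (- (real 0 * (2 * pi / real N))) ` \<Omega> = (\<lambda>x. x) ` \<Omega>"
    by (intro image_cong refl) (simp add: rot_0)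
  then show ?case by simp
next
  case (Suc i)
  let ?\<theta> = "2 * pi / real N"
  have "rot (- ?\<theta>) ` \<Omega> = (\<lambda>x. rot (- ?\<theta>) (rot ?\<theta> x)) ` \<Omega>"
    by (subst sym[symmetric]) (simp only: image_image)
  then have 1: "rot (- ?\<theta>) ` \<Omega> = \<Omega>" by (simp add: rot_rot rot_0)
  have "rot (- (real (Suc i) * ?\<theta>)) ` \<Omega> = rot (- (real i * ?\<theta>)) ` (rot (- ?\<theta>) ` \<Omega>)"
    unfolding image_image rot_rot by (intro image_cong refl arg_cong2[of _ _ _ _ rot])
       (simp add: add_divide_distrib algebra_simps)
  then show ?case using 1 Suc by simp
qed

definition turn :: "nat \<Rightarrow> (real^2 \<Rightarrow> complex) \<Rightarrow> real^2 \<Rightarrow> complex" where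
  "turn i u = (\<lambda>x. u (rot (real i * (2 * pi / real N)) x))"

lemma sum_mform_turn:
  assumes u: "u \<in> H1 \<Omega>"
  shows "(\<Sum>i<N. Re (mform \<Omega> h \<beta> a b d (turn i u) (turn i u))) = real N * ((a + d) / 2 * Re (mform \<Omega> h \<beta> 1 0 1 u u))"
proof -
  let ?z = "magnetic_gradient \<Omega> h \<beta> u"
  have "(\<Sum>i<N. Re (mform \<Omega> h \<beta> a b d (turn i u) (turn i u)))
      = (\<Sum>i<N. \<integral>x. Re (qform a b d (rotv (real i * (2 * pi / real N)) (?z x)) (rotv (real i * (2 * pi / real N)) (?z x))) \<partial>lebesgue_on \<Omega>)"
    unfolding turn_def by (intro sum.cong refl mform_rot[OF rot_image_multiple u])
  also have "\<dots> = (\<integral>x. (\<Sum>i<N. Re (qform a b d (rotv (real i * (2 * pi / real N)) (?z x)) (rotv (real i * (2 * pi / real N)) (?z x)))) \<partial>lebesgue_on \<Omega>)"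
    by (rule Bochner_Integration.integral_sum[symmetric]) (rule mform_rot(2)[OF rot_image_multiple u])
  also have "\<dots> = real N * ((a + d) / 2 * (\<integral>x. (norm (?z x))\<^sup>2 \<partial>lebesgue_on \<Omega>))"
    unfolding sum_qform_rotv[OF N] by simp
  also have "(\<integral>x. (norm (?z x))\<^sup>2 \<partial>lebesgue_on \<Omega>) = Re (mform \<Omega> h \<beta> 1 0 1 u u)"
    unfolding mform_def using mform_integrable[OF op bd u u, of 1 0 1 h \<beta>]
    by (subst integral_Re[symmetric]) (auto simp: Re_qform_id)
  finally show ?thesis .
qed

lemma turn_0: "turn 0 u = u"
  by (simp add: turn_def rot_0)

text \<open>Guarantees that the infima in the minimax values are not over the empty set. Bump
  functions on disjoint strips of a box are independent, since on its own strip each is the only one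
  not to vanish.\<close>

lemma exists_trial_subspace:
  assumes W: "trial_space W" and ne: "\<Omega> \<noteq> {}"
  shows "\<exists>S. trial (ae_zero \<Omega>) (W \<Omega>) j S"
proof -
  obtain x where "x \<in> \<Omega>" using ne by auto
  then obtain a b where ab: "cbox a b \<subseteq> \<Omega>" "x \<in> box a b" by (rule open_contains_cbox[OF op])
  then have lt: "a$1 < b$1" "a$2 < b$2" by (auto simp: mem_box_2)
  \<comment> \<open>Division by \<open>Suc j\<close> leaves one strip over and keeps the width
    positive for \<open>j = 0\<close>.\<close>
  define w where "w = (b$1 - a$1) / real (Suc j)"
  have w: "w > 0" using lt by (simp add: w_def)
  define lo where "lo k = (vector [a$1 + real k * w, a$2] :: real^2)" for k :: nat
  define hi where "hi k = (vector [a$1 + real (Suc k) * w, b$2] :: real^2)" for k :: nat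
  have nth: "lo k $ 1 = a$1 + real k * w" "lo k $ 2 = a$2" "hi k $ 1 = a$1 + real (Suc k) * w" "hi k $ 2 = b$2" for k
    by (simp_all add: lo_def hi_def)
  have sub: "cbox (lo k) (hi k) \<subseteq> \<Omega>" if "k < j" for k
  proof -
    have "real (Suc k) * w \<le> real (Suc j) * w" using that w by (intro mult_right_mono) auto
    also have "\<dots> = b$1 - a$1" by (simp add: w_def)
    finally have "a$1 + real (Suc k) * w \<le> b$1" by simp
    moreover have "0 \<le> real k * w" using w by simp
    ultimately have "cbox (lo k) (hi k) \<subseteq> cbox a b" by (auto simp: mem_cbox_2 nth)
    then show ?thesis using ab(1) by blast
  qed
  have disj: "x \<notin> box (lo i) (hi i)" if x: "x \<in> box (lo k) (hi k)" and ik: "i \<noteq> k" for i k x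
  proof (cases "i < k")
    case True
    then have "real (Suc i) * w \<le> real k * w" using w by (intro mult_right_mono) auto
    then show ?thesis using x by (auto simp: mem_box_2 nth)
  next
    case False
    then have "real (Suc k) * w \<le> real i * w" using w ik by (intro mult_right_mono) auto
    then show ?thesis using x by (auto simp: mem_box_2 nth)
  qed
  define u where "u k = box_bump 0 (lo k) (hi k)" for k
  have "c k = 0" if Z: "ae_zero \<Omega> (lincomb j c u)" and k: "k < j" for c k
  proof (rule ccontr)
    assume ck: "c k \<noteq> 0"
    have val: "lincomb j c u x \<noteq> 0" if x: "x \<in> box (lo k) (hi k)" for x
    proof -
      have "lincomb j c u x = (\<Sum>i<j. if i = k then c k * u k x else 0)"
        unfolding lincomb_def
      proof (intro sum.cong refl)
        fix i
        show "c i * u i x = (if i = k then c k * u k x else 0)"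
          using disj[OF x, of i] box_bump_nonzero_iff[of 0 "lo i" "hi i" x] by (auto simp: u_def)
      qed
      also have "\<dots> = c k * u k x" using k by simp
      finally show ?thesis using ck x box_bump_nonzero_iff[of 0 "lo k" "hi k" x] by (simp add: u_def)
    qed
    have "AE x in lebesgue. x \<in> \<Omega> \<longrightarrow> lincomb j c u x = 0"
      using Z open_sets_lebesgue[OF op] by (simp add: ae_zero_def AE_restrict_space_iff)
    then have "AE x in lebesgue. x \<notin> box (lo k) (hi k)"
      by (rule AE_mp) (use val order_trans[OF box_subset_cbox sub[OF k]] in \<open>auto intro!: AE_I2\<close>)
    then have "box (lo k) (hi k) \<in> null_sets lebesgue"
      by (subst (asm) AE_iff_null_sets[symmetric]) auto
    then have "negligible (box (lo k) (hi k))" by (simp add: negligible_iff_null_sets)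
    then have "box (lo k) (hi k) = {}" by (simp add: negligible_interval)
    moreover have "(1/2) *\<^sub>R (lo k + hi k) \<in> box (lo k) (hi k)"
      using w lt by (simp add: mem_box_2 nth field_simps)
    ultimately show False by blast
  qed
  then show ?thesis
    unfolding trial_def
    by (intro exI[of _ "span_of j u"] exI[of _ u])
       (auto simp: u_def intro!: trial_space_facts(5)[OF W op] test_function_box_bump sub)
qed

context
  fixes W :: "(real^2) set \<Rightarrow> (real^2 \<Rightarrow> complex) set" and a b d :: real
  assumes W: "trial_space W" and ne: "\<Omega> \<noteq> {}" and psd: "psd a b d" and tr: "a + d = 2"
begin

interpretation A: form_pair "W \<Omega>" "ip \<Omega>" "mform \<Omega> h \<beta> a b d" "ae_zero \<Omega>" "mquot \<Omega> h \<beta> a b d"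
  by (rule form_pair_magnetic[OF W op bd psd])

lemma psd_id: "psd 1 0 1"
  by (simp add: psd_def Re_qform_id)

interpretation I: form_pair "W \<Omega>" "ip \<Omega>" "mform \<Omega> h \<beta> 1 0 1" "ae_zero \<Omega>" "mquot \<Omega> h \<beta> 1 0 1"
  by (rule form_pair_magnetic[OF W op bd psd_id])

lemma W_H1: "u \<in> W \<Omega> \<Longrightarrow> u \<in> H1 \<Omega>"
  using trial_space_facts(1)[OF W op] by blast

theorem sum_minimax_le:
  "(\<Sum>j=1..n. minimax (ae_zero \<Omega>) (W \<Omega>) (mquot \<Omega> h \<beta> a b d) j)
    \<le> (\<Sum>j=1..n. minimax (ae_zero \<Omega>) (W \<Omega>) (mquot \<Omega> h \<beta> 1 0 1) j)"
proof (rule field_le_epsilon)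
  fix e :: real assume "e > 0"
  then obtain u where u: "I.orthonormal n u"
    "(\<Sum>k<n. Re (mform \<Omega> h \<beta> 1 0 1 (u k) (u k))) \<le> (\<Sum>j=1..n. minimax (ae_zero \<Omega>) (W \<Omega>) (mquot \<Omega> h \<beta> 1 0 1) j) + e"
    using I.exists_orthonormal_trace_le[OF exists_trial_subspace[OF W ne]] by blast
  have uW: "u k \<in> W \<Omega>" if "k < n" for k using I.orthonormalD(1)[OF u(1) that] .
  \<comment> \<open>Rotations preserve inner products, so each rotated tuple is again admissible in
    the trace bound.\<close>
  have on: "A.orthonormal n (\<lambda>k. turn i (u k))" for i
    unfolding A.orthonormal_def turn_def
    using trial_space_rot[OF rot_image_multiple W uW] I.orthonormalD(2)[OF u(1)]
      ip_rot[OF rot_image_multiple H1_L2[OF W_H1[OF uW]] H1_L2[OF W_H1[OF uW]]] by simp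
  have "real N * (\<Sum>j=1..n. minimax (ae_zero \<Omega>) (W \<Omega>) (mquot \<Omega> h \<beta> a b d) j)
      = (\<Sum>i<N. \<Sum>j=1..n. minimax (ae_zero \<Omega>) (W \<Omega>) (mquot \<Omega> h \<beta> a b d) j)" by simp
  also have "\<dots> \<le> (\<Sum>i<N. \<Sum>k<n. Re (mform \<Omega> h \<beta> a b d (turn i (u k)) (turn i (u k))))"
    by (intro sum_mono A.sum_ev_le_trace on)
  also have "\<dots> = (\<Sum>k<n. \<Sum>i<N. Re (mform \<Omega> h \<beta> a b d (turn i (u k)) (turn i (u k))))"
    by (rule sum.swap)
  also have "\<dots> = (\<Sum>k<n. real N * Re (mform \<Omega> h \<beta> 1 0 1 (u k) (u k)))"
    by (intro sum.cong refl) (simp add: sum_mform_turn W_H1 uW tr)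
  also have "\<dots> = real N * (\<Sum>k<n. Re (mform \<Omega> h \<beta> 1 0 1 (u k) (u k)))"
    by (simp add: sum_distrib_left)
  also have "\<dots> \<le> real N * ((\<Sum>j=1..n. minimax (ae_zero \<Omega>) (W \<Omega>) (mquot \<Omega> h \<beta> 1 0 1) j) + e)"
    using u(2) by (intro mult_left_mono) auto
  finally show "(\<Sum>j=1..n. minimax (ae_zero \<Omega>) (W \<Omega>) (mquot \<Omega> h \<beta> a b d) j)
    \<le> (\<Sum>j=1..n. minimax (ae_zero \<Omega>) (W \<Omega>) (mquot \<Omega> h \<beta> 1 0 1) j) + e"
    using N by simp
qed

text \<open>The quotient is multiplied out so that functions vanishing almost everywhere are covered
  as well.\<close>

lemma minimax_1_le:
  assumes u: "u \<in> W \<Omega>"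
  shows "minimax (ae_zero \<Omega>) (W \<Omega>) (mquot \<Omega> h \<beta> a b d) 1 * Re (ip \<Omega> u u) \<le> Re (mform \<Omega> h \<beta> a b d u u)"
proof (cases "ae_zero \<Omega> u")
  case True
  then show ?thesis using A.Z_iff[OF u] A.a.form_nonneg[OF u] by simp
next
  case False
  define r where "r = inverse (sqrt (Re (ip \<Omega> u u)))"
  note nr = A.normalize[OF u False, folded r_def]
  have "A.orthonormal 1 (\<lambda>_ x. of_real r * u x)"
    using nr(1) A.m.V_cmult[OF u] by (simp add: A.orthonormal_def)
  from A.sum_ev_le_trace[OF this]
  have "minimax (ae_zero \<Omega>) (W \<Omega>) (mquot \<Omega> h \<beta> a b d) 1 \<le> mquot \<Omega> h \<beta> a b d u" using nr(2) by simp
  moreover have "Re (ip \<Omega> u u) > 0"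
    using False A.Z_iff[OF u] A.m.form_nonneg[OF u] by force
  ultimately show ?thesis by (simp add: mquot_def field_simps)
qed

text \<open>The \<open>N\<close> rotated energies add up to \<open>N\<close> times the isotropic
  one, and each of the other \<open>N - 1\<close> is at least \<open>l\<close> times the squared
  norm. So the excess of the unrotated energy is at most the total excess: a sequence whose
  isotropic excess over \<open>l\<close> tends to 0 also minimizes the anisotropic form.\<close>

lemma minimax_1_gap:
  assumes u: "u \<in> W \<Omega>" and eq: "minimax (ae_zero \<Omega>) (W \<Omega>) (mquot \<Omega> h \<beta> a b d) 1 = l"
  shows "Re (mform \<Omega> h \<beta> a b d u u) - l * Re (ip \<Omega> u u)
    \<le> real N * (Re (mform \<Omega> h \<beta> 1 0 1 u u) - l * Re (ip \<Omega> u u))"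
proof -
  have "l * Re (ip \<Omega> u u) \<le> Re (mform \<Omega> h \<beta> a b d (turn i u) (turn i u))" for i
    using minimax_1_le[OF trial_space_rot[OF rot_image_multiple W u], of i] eq
      ip_rot[OF rot_image_multiple H1_L2[OF W_H1[OF u]] H1_L2[OF W_H1[OF u]], of i] by (simp add: turn_def)
  then have "(\<Sum>i\<in>{..<N} - {0}. l * Re (ip \<Omega> u u)) \<le> (\<Sum>i\<in>{..<N} - {0}. Re (mform \<Omega> h \<beta> a b d (turn i u) (turn i u)))"
    by (intro sum_mono)
  moreover have "(\<Sum>i<N. Re (mform \<Omega> h \<beta> a b d (turn i u) (turn i u)))
      = Re (mform \<Omega> h \<beta> a b d u u) + (\<Sum>i\<in>{..<N} - {0}. Re (mform \<Omega> h \<beta> a b d (turn i u) (turn i u)))"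
    using N by (subst sum.remove[of _ 0]) (auto simp: turn_0)
  moreover have "(\<Sum>i<N. Re (mform \<Omega> h \<beta> a b d (turn i u) (turn i u))) = real N * Re (mform \<Omega> h \<beta> 1 0 1 u u)"
    by (simp add: sum_mform_turn W_H1[OF u] tr)
  ultimately show ?thesis
    using N by (simp add: algebra_simps of_nat_diff)
qed

lemma minimizing_sequence:
  fixes e :: real
  assumes "e > 0"
  obtains u where "u \<in> W \<Omega>" "Re (ip \<Omega> u u) = 1"
    "Re (mform \<Omega> h \<beta> 1 0 1 u u) \<le> minimax (ae_zero \<Omega>) (W \<Omega>) (mquot \<Omega> h \<beta> 1 0 1) 1 + e"
proof -
  obtain u where u: "I.orthonormal 1 u"
    "(\<Sum>k<1. Re (mform \<Omega> h \<beta> 1 0 1 (u k) (u k))) \<le> (\<Sum>j=1..1. minimax (ae_zero \<Omega>) (W \<Omega>) (mquot \<Omega> h \<beta> 1 0 1) j) + e"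
    using I.exists_orthonormal_trace_le[OF exists_trial_subspace[OF W ne] assms] by blast
  then show ?thesis using that[of "u 0"] by (simp add: I.orthonormal_def)
qed

end

end

end

section \<open>Symmetry of second derivatives\<close>

lemma C_k_line_derivative:
  fixes f :: "real^2 \<Rightarrow> real"
  assumes "C_k (Suc n) f"
  shows "((\<lambda>r. f (y + r *\<^sub>R v)) has_real_derivative frechet_derivative f (at (y + r *\<^sub>R v)) v) (at r)"
proof -
  note d = C_k_has_frechet_derivative[OF assms, of "y + r *\<^sub>R v"]
  have l: "((\<lambda>s. y + s *\<^sub>R v) has_derivative (\<lambda>t. t *\<^sub>R v)) (at r)"
    by (auto intro!: derivative_eq_intros)
  show ?thesis
    using has_derivative_compose[OF l d]
    by (simp add: has_field_derivative_def linear_scale[OF has_derivative_linear[OF d]] mult.commute[of _ "frechet_derivative f _ v"])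
qed

text \<open>The mean value theorem in the direction \<open>v\<close> and then in the direction
  \<open>w\<close>. The left side is symmetric in \<open>v\<close> and \<open>w\<close> while the
  right side is not, so letting \<open>s\<close> tend to 0 makes the mixed derivatives
  equal.\<close>

lemma second_difference_quotient:
  fixes f :: "real^2 \<Rightarrow> real"
  assumes f: "C_k 2 f" and s: "s > 0"
  obtains r t where "0 < r" "r < s" "0 < t" "t < s"
    "f (x + s *\<^sub>R v + s *\<^sub>R w) - f (x + s *\<^sub>R v) - f (x + s *\<^sub>R w) + f x
      = s * (s * frechet_derivative (\<lambda>z. frechet_derivative f (at z) v) (at (x + r *\<^sub>R v + t *\<^sub>R w)) w)"
proof -
  have f2: "C_k (Suc (Suc 0)) f" using f by (simp add: numeral_2_eq_2)
  have fv: "C_k (Suc 0) (\<lambda>z. frechet_derivative f (at z) v)" by (rule C_k_frechet_derivative[OF f2])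
  let ?D = "\<lambda>z. frechet_derivative f (at z) v"
  let ?g = "\<lambda>r. f (x + s *\<^sub>R w + r *\<^sub>R v) - f (x + r *\<^sub>R v)"
  have "(?g has_real_derivative ?D (x + s *\<^sub>R w + r *\<^sub>R v) - ?D (x + r *\<^sub>R v)) (at r)" for r
    by (intro DERIV_diff C_k_line_derivative[OF f2])
  from MVT2[OF s this] obtain r where r: "0 < r" "r < s"
    "?g s - ?g 0 = (s - 0) * (?D (x + s *\<^sub>R w + r *\<^sub>R v) - ?D (x + r *\<^sub>R v))" by blast
  have "((\<lambda>t. ?D (x + r *\<^sub>R v + t *\<^sub>R w)) has_real_derivative
      frechet_derivative ?D (at (x + r *\<^sub>R v + t *\<^sub>R w)) w) (at t)" for t
    by (rule C_k_line_derivative[OF fv])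
  from MVT2[OF s this] obtain t where t: "0 < t" "t < s"
    "?D (x + r *\<^sub>R v + s *\<^sub>R w) - ?D (x + r *\<^sub>R v + 0 *\<^sub>R w)
       = (s - 0) * frechet_derivative ?D (at (x + r *\<^sub>R v + t *\<^sub>R w)) w" by blast
  show ?thesis
  proof (rule that[OF r(1,2) t(1,2)])
    have e: "x + s *\<^sub>R w + z = x + z + s *\<^sub>R w" for z by (simp add: algebra_simps)
    show "f (x + s *\<^sub>R v + s *\<^sub>R w) - f (x + s *\<^sub>R v) - f (x + s *\<^sub>R w) + f x
      = s * (s * frechet_derivative ?D (at (x + r *\<^sub>R v + t *\<^sub>R w)) w)"
      using r(3) t(3) unfolding e by simp
  qed
qed

lemma second_derivative_commute_real:
  fixes f :: "real^2 \<Rightarrow> real"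
  assumes f: "C_k 2 f"
  shows "frechet_derivative (\<lambda>z. frechet_derivative f (at z) v) (at x) w
    = frechet_derivative (\<lambda>z. frechet_derivative f (at z) w) (at x) v"
proof -
  let ?D = "\<lambda>v w z. frechet_derivative (\<lambda>z. frechet_derivative f (at z) v) (at z) w"
  define s where "s n = inverse (real (Suc n))" for n
  have s0: "s n > 0" for n by (simp add: s_def)
  have slim: "s \<longlonglongrightarrow> 0" using LIMSEQ_inverse_real_of_nat by (simp add: s_def[abs_def])
  have "\<exists>r t r' t'. \<bar>r\<bar> \<le> s n \<and> \<bar>t\<bar> \<le> s n \<and> \<bar>r'\<bar> \<le> s n \<and> \<bar>t'\<bar> \<le> s n
      \<and> ?D v w (x + r *\<^sub>R v + t *\<^sub>R w) = ?D w v (x + r' *\<^sub>R w + t' *\<^sub>R v)" for n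
  proof -
    obtain r t where 1: "0 < r" "r < s n" "0 < t" "t < s n"
      "f (x + s n *\<^sub>R v + s n *\<^sub>R w) - f (x + s n *\<^sub>R v) - f (x + s n *\<^sub>R w) + f x
        = s n * (s n * ?D v w (x + r *\<^sub>R v + t *\<^sub>R w))"
      by (rule second_difference_quotient[OF f s0])
    obtain r' t' where 2: "0 < r'" "r' < s n" "0 < t'" "t' < s n"
      "f (x + s n *\<^sub>R w + s n *\<^sub>R v) - f (x + s n *\<^sub>R w) - f (x + s n *\<^sub>R v) + f x
        = s n * (s n * ?D w v (x + r' *\<^sub>R w + t' *\<^sub>R v))"
      by (rule second_difference_quotient[OF f s0])
    have "x + s n *\<^sub>R w + s n *\<^sub>R v = x + s n *\<^sub>R v + s n *\<^sub>R w" by simp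
    from 2(5)[unfolded this] 1(5)
    have "s n * (s n * ?D v w (x + r *\<^sub>R v + t *\<^sub>R w)) = s n * (s n * ?D w v (x + r' *\<^sub>R w + t' *\<^sub>R v))"
      by linarith
    then have "?D v w (x + r *\<^sub>R v + t *\<^sub>R w) = ?D w v (x + r' *\<^sub>R w + t' *\<^sub>R v)"
      using s0[of n] by simp
    then show ?thesis using 1 2 by (intro exI[of _ r] exI[of _ t] exI[of _ r'] exI[of _ t']) simp
  qed
  then obtain r t r' t' where b: "\<And>n. \<bar>r n\<bar> \<le> s n" "\<And>n. \<bar>t n\<bar> \<le> s n" "\<And>n. \<bar>r' n\<bar> \<le> s n" "\<And>n. \<bar>t' n\<bar> \<le> s n"
    and eq: "\<And>n. ?D v w (x + r n *\<^sub>R v + t n *\<^sub>R w) = ?D w v (x + r' n *\<^sub>R w + t' n *\<^sub>R v)"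
    by metis
  have lim0: "y \<longlonglongrightarrow> 0" if "\<And>n. \<bar>y n\<bar> \<le> s n" for y
    by (rule Lim_null_comparison[OF _ slim]) (use that in auto)
  have c: "isCont (?D v w) x" for v w
  proof -
    have "C_k 0 (?D v w)"
      by (intro C_k_frechet_derivative) (use f in \<open>simp only: numeral_2_eq_2\<close>)
    then show ?thesis by (simp add: continuous_on_eq_continuous_at)
  qed
  have "(\<lambda>n. x + r n *\<^sub>R v + t n *\<^sub>R w) \<longlonglongrightarrow> x + 0 *\<^sub>R v + 0 *\<^sub>R w"
    by (intro tendsto_intros lim0 b)
  then have 1: "(\<lambda>n. ?D v w (x + r n *\<^sub>R v + t n *\<^sub>R w)) \<longlonglongrightarrow> ?D v w x"
    using isCont_tendsto_compose[OF c] by simp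
  have "(\<lambda>n. x + r' n *\<^sub>R w + t' n *\<^sub>R v) \<longlonglongrightarrow> x + 0 *\<^sub>R w + 0 *\<^sub>R v"
    by (intro tendsto_intros lim0 b)
  then have 2: "(\<lambda>n. ?D w v (x + r' n *\<^sub>R w + t' n *\<^sub>R v)) \<longlonglongrightarrow> ?D w v x"
    using isCont_tendsto_compose[OF c] by simp
  show ?thesis using LIMSEQ_unique[OF 1] 2 unfolding eq by blast
qed

text \<open>The mean value theorem concerns real functions, hence the reduction to real and
  imaginary parts.\<close>

lemma second_derivative_commute:
  fixes f :: "real^2 \<Rightarrow> complex"
  assumes f: "C_k 2 f"
  shows "frechet_derivative (\<lambda>z. frechet_derivative f (at z) v) (at x) w
    = frechet_derivative (\<lambda>z. frechet_derivative f (at z) w) (at x) v"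
proof -
  have f2: "C_k (Suc (Suc 0)) f" using f by (simp only: numeral_2_eq_2)
  have lin: "L (frechet_derivative (\<lambda>z. frechet_derivative f (at z) v) (at x) w)
    = frechet_derivative (\<lambda>z. frechet_derivative (\<lambda>x. L (f x)) (at z) v) (at x) w"
    if L: "bounded_linear (L :: complex \<Rightarrow> real)" for L v w
  proof -
    have 1: "frechet_derivative (\<lambda>x. L (f x)) (at z) v = L (frechet_derivative f (at z) v)" for z
      by (rule frechet_derivative_eqI[OF bounded_linear.has_derivative[OF L C_k_has_frechet_derivative[OF f2]]])
    show ?thesis
      unfolding 1
      by (rule frechet_derivative_eqI[OF bounded_linear.has_derivative[OF L
          C_k_has_frechet_derivative[OF C_k_frechet_derivative[OF f2]]], symmetric])
  qed
  show ?thesis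
    by (rule complex_eqI)
      (simp_all only: lin[OF bounded_linear_Re] lin[OF bounded_linear_Im]
        second_derivative_commute_real[OF C_k_bounded_linear_comp[OF bounded_linear_Re f]]
        second_derivative_commute_real[OF C_k_bounded_linear_comp[OF bounded_linear_Im f], of v x w])
qed

section \<open>The commutation argument\<close>

lemma linear_comb_divide:
  assumes "k \<noteq> 0" "k * w = a * x + b * (y :: complex)"
  shows "w = a / k * x + b / k * y"
proof -
  have "w = (k * w) / k" using assms(1) by simp
  then show ?thesis unfolding assms(2) by (simp add: add_divide_distrib)
qed

text \<open>Here \<open>H\<close> is the isotropic and \<open>K\<close> a traceless quadratic expression in \<open>X\<close> and \<open>Y\<close>. The operators that map
  into the functions satisfying \<open>N\<close> form a right ideal; as \<open>[X, Y] = c \<noteq> 0\<close>, this ideal contains the identity.\<close>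

locale commutation =
  fixes P N :: "('a \<Rightarrow> complex) \<Rightarrow> bool" and X Y :: "('a \<Rightarrow> complex) \<Rightarrow> 'a \<Rightarrow> complex" and c l p q :: complex
  assumes P_add [simp]: "P u \<Longrightarrow> P v \<Longrightarrow> P (\<lambda>x. u x + v x)"
    and P_cmult [simp]: "P u \<Longrightarrow> P (\<lambda>x. k * u x)"
    and P_X [simp]: "P u \<Longrightarrow> P (X u)" and P_Y [simp]: "P u \<Longrightarrow> P (Y u)"
    and X_add [simp]: "P u \<Longrightarrow> P v \<Longrightarrow> X (\<lambda>x. u x + v x) = (\<lambda>x. X u x + X v x)"
    and Y_add [simp]: "P u \<Longrightarrow> P v \<Longrightarrow> Y (\<lambda>x. u x + v x) = (\<lambda>x. Y u x + Y v x)"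
    and X_cmult [simp]: "P u \<Longrightarrow> X (\<lambda>x. k * u x) = (\<lambda>x. k * X u x)"
    and Y_cmult [simp]: "P u \<Longrightarrow> Y (\<lambda>x. k * u x) = (\<lambda>x. k * Y u x)"
    and comm [simp]: "P u \<Longrightarrow> X (Y u) = (\<lambda>x. Y (X u) x + c * u x)"
    and N_add: "P u \<Longrightarrow> P v \<Longrightarrow> N u \<Longrightarrow> N v \<Longrightarrow> N (\<lambda>x. u x + v x)"
    and N_cmult: "P u \<Longrightarrow> N u \<Longrightarrow> N (\<lambda>x. k * u x)"
    and H: "P v \<Longrightarrow> N (\<lambda>x. X (X v) x + (Y (Y v) x + (- l) * v x))"
    and K: "P v \<Longrightarrow> N (\<lambda>x. p * (X (X v) x + (-1) * Y (Y v) x) + q * (X (Y v) x + Y (X v) x))"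
    and ne: "c \<noteq> 0" "p\<^sup>2 + q\<^sup>2 \<noteq> 0" "l\<^sup>2 - 3 * c\<^sup>2 \<noteq> 0"
begin

lemma P_diff [simp]: "P u \<Longrightarrow> P v \<Longrightarrow> P (\<lambda>x. u x - v x)"
  using P_add[OF _ P_cmult[of v "- 1"], of u] by simp

lemma P_divide [simp]: "P u \<Longrightarrow> P (\<lambda>x. u x / k)"
  using P_cmult[of u "1 / k"] by simp

lemma X_diff [simp]: "P u \<Longrightarrow> P v \<Longrightarrow> X (\<lambda>x. u x - v x) = (\<lambda>x. X u x - X v x)"
  using X_add[OF _ P_cmult[of v "- 1"], of u] X_cmult[of v "- 1"] by simp

lemma Y_diff [simp]: "P u \<Longrightarrow> P v \<Longrightarrow> Y (\<lambda>x. u x - v x) = (\<lambda>x. Y u x - Y v x)"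
  using Y_add[OF _ P_cmult[of v "- 1"], of u] Y_cmult[of v "- 1"] by simp

lemma N_comb:
  "P u \<Longrightarrow> P v \<Longrightarrow> N u \<Longrightarrow> N v \<Longrightarrow> (\<And>x. w x = a * u x + b * v x) \<Longrightarrow> N w"
  using N_add[OF P_cmult P_cmult N_cmult N_cmult, of u v a b] by presburger

text \<open>A multiple of the commutator of the expressions in \<open>H\<close> and \<open>K\<close>; it is the expression in \<open>K\<close> with the
  vector \<open>(p, q)\<close> turned by a right angle.\<close>

lemma N_rotated: "P v \<Longrightarrow> N (\<lambda>x. q * (X (X v) x + (-1) * Y (Y v) x) + (- p) * (X (Y v) x + Y (X v) x))"
proof -
  assume v: "P v"
  define Kv where "Kv = (\<lambda>x. p * (X (X v) x + (-1) * Y (Y v) x) + q * (X (Y v) x + Y (X v) x))"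
  define Hv where "Hv = (\<lambda>x. X (X v) x + (Y (Y v) x + (- l) * v x))"
  have PK: "P Kv" and PH: "P Hv" unfolding Kv_def Hv_def using v by simp_all
  have 1: "P (\<lambda>x. X (X Kv) x + (Y (Y Kv) x + (- l) * Kv x))" using PK by simp
  have 2: "P (\<lambda>x. p * (X (X Hv) x + (-1) * Y (Y Hv) x) + q * (X (Y Hv) x + Y (X Hv) x))" using PH by simp
  \<comment> \<open>\<open>H\<close> at \<open>Kv\<close> minus \<open>K\<close> at
    \<open>Hv\<close>: the terms with \<open>l\<close> cancel, and the commutators that remain
    contribute the factor \<open>4 * c\<close>.\<close>
  show ?thesis
  proof (rule N_comb[OF 1 2 H[OF PK] K[OF PH], of _ "1 / (4 * c)" "- 1 / (4 * c)"])
    fix x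
    have "4 * c * (q * (X (X v) x + (-1) * Y (Y v) x) + (- p) * (X (Y v) x + Y (X v) x))
      = 1 * (X (X Kv) x + (Y (Y Kv) x + (- l) * Kv x))
       + (- 1) * (p * (X (X Hv) x + (-1) * Y (Y Hv) x) + q * (X (Y Hv) x + Y (X Hv) x))"
      unfolding Kv_def Hv_def using v by (simp add: algebra_simps)
    then show "q * (X (X v) x + (-1) * Y (Y v) x) + (- p) * (X (Y v) x + Y (X v) x)
      = 1 / (4 * c) * (X (X Kv) x + (Y (Y Kv) x + (- l) * Kv x))
       + - 1 / (4 * c) * (p * (X (X Hv) x + (-1) * Y (Y Hv) x) + q * (X (Y Hv) x + Y (X Hv) x))"
      by (rule linear_comb_divide[rotated]) (use ne(1) in simp)
  qed
qed

text \<open>Together with \<open>N_XY_plus_YX\<close> this solves for the two traceless expressions;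
  up to sign the determinant of the system is \<open>p\<^sup>2 + q\<^sup>2\<close>.\<close>

lemma N_XX_minus_YY: "P v \<Longrightarrow> N (\<lambda>x. X (X v) x + (-1) * Y (Y v) x)"
  by (rule N_comb[OF _ _ K[of v] N_rotated[of v], of _ "p / (p\<^sup>2 + q\<^sup>2)" "q / (p\<^sup>2 + q\<^sup>2)"])
     (use ne(2) in \<open>simp_all add: divide_simps\<close>, simp_all add: algebra_simps power2_eq_square)

lemma N_XY_plus_YX: "P v \<Longrightarrow> N (\<lambda>x. X (Y v) x + Y (X v) x)"
  by (rule N_comb[OF _ _ K[of v] N_rotated[of v], of _ "q / (p\<^sup>2 + q\<^sup>2)" "- p / (p\<^sup>2 + q\<^sup>2)"])
     (use ne(2) in \<open>simp_all add: divide_simps\<close>, simp_all add: algebra_simps power2_eq_square)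

lemma N_XX: "P v \<Longrightarrow> N (\<lambda>x. X (X v) x + (- l / 2) * v x)"
  by (rule N_comb[OF _ _ H[of v] N_XX_minus_YY[of v], of _ "1 / 2" "1 / 2"]) (simp_all add: field_simps)

lemma N_YY: "P v \<Longrightarrow> N (\<lambda>x. Y (Y v) x + (- l / 2) * v x)"
  by (rule N_comb[OF _ _ H[of v] N_XX_minus_YY[of v], of _ "1 / 2" "- 1 / 2"]) (simp_all add: field_simps)

text \<open>Both inputs have third order, and their leading terms cancel because every exchange of
  \<open>X\<close> and \<open>Y\<close> costs only \<open>c\<close>. Three exchanges are made, which
  gives the constant 3.\<close>

lemma N_first_order: "P v \<Longrightarrow> N (\<lambda>x. 3 * c * Y v x + l * X v x)"
  by (rule N_comb[OF _ _ N_XY_plus_YX[of "Y v"] N_YY[of "X v"], of _ 1 "- 2"]) (simp_all add: algebra_simps)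

text \<open>Substituting \<open>X v\<close> into the first order relation raises it to second order,
  where \<open>N_XX\<close> and the symmetrized product remove \<open>X (X v)\<close> and
  \<open>Y (X v)\<close>. What remains is \<open>l\<^sup>2 - 3 * c\<^sup>2\<close> times
  \<open>v\<close>.\<close>

lemma N_all: "P v \<Longrightarrow> N v"
proof -
  assume v: "P v"
  have P1: "P (\<lambda>x. 3 * c * Y (X v) x + l * X (X v) x)" using v by simp
  have P2: "P (\<lambda>x. X (X v) x + (- l / 2) * v x)" using v by simp
  have 1: "N (\<lambda>x. 3 * c * Y (X v) x + (l\<^sup>2 / 2) * v x)"
    by (rule N_comb[OF P1 P2 N_first_order[OF P_X[OF v]] N_XX[OF v], of _ 1 "- l"])
       (simp add: algebra_simps power2_eq_square)
  have P3: "P (\<lambda>x. 3 * c * Y (X v) x + (l\<^sup>2 / 2) * v x)" using v by simp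
  have P4: "P (\<lambda>x. X (Y v) x + Y (X v) x)" using v by simp
  show ?thesis
  proof (rule N_comb[OF P3 P4 1 N_XY_plus_YX[OF v], of _ "2 / (l\<^sup>2 - 3 * c\<^sup>2)" "- 3 * c / (l\<^sup>2 - 3 * c\<^sup>2)"])
    fix x
    have "(l\<^sup>2 - 3 * c\<^sup>2) * v x = 2 * (3 * c * Y (X v) x + l\<^sup>2 / 2 * v x) + (- 3 * c) * (X (Y v) x + Y (X v) x)"
      using v by (simp add: algebra_simps power2_eq_square)
    then show "v x = 2 / (l\<^sup>2 - 3 * c\<^sup>2) * (3 * c * Y (X v) x + l\<^sup>2 / 2 * v x)
        + - 3 * c / (l\<^sup>2 - 3 * c\<^sup>2) * (X (Y v) x + Y (X v) x)"
      by (rule linear_comb_divide[OF ne(3)])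
  qed
qed

end

section \<open>The magnetic derivatives on test functions\<close>

definition mop :: "real \<Rightarrow> real \<Rightarrow> 2 \<Rightarrow> (real^2 \<Rightarrow> complex) \<Rightarrow> real^2 \<Rightarrow> complex" where
  "mop h \<beta> k v = (\<lambda>x. \<i> * of_real h * pd k v x + of_real (vector_potential \<beta> x $ k) * v x)"

lemma bounded_linear_vector_potential: "bounded_linear (\<lambda>x. complex_of_real (vector_potential \<beta> x $ k))"
proof -
  have "bounded_linear (\<lambda>x. complex_of_real (vector_potential \<beta> x $ 1))"
    unfolding vector_potential_nth
    by (intro bounded_linear_compose[OF bounded_linear_of_real] bounded_linear_const_mult bounded_linear_vec_nth)
  moreover have "bounded_linear (\<lambda>x. complex_of_real (vector_potential \<beta> x $ 2))"
    unfolding vector_potential_nth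
    by (intro bounded_linear_compose[OF bounded_linear_of_real] bounded_linear_const_mult bounded_linear_vec_nth)
  ultimately show ?thesis using exhaust_2[of k] by metis
qed

lemma C_k_vector_potential: "C_k n (\<lambda>x. complex_of_real (vector_potential \<beta> x $ k))"
  by (rule C_k_bounded_linear[OF bounded_linear_vector_potential])

lemma pd_vector_potential:
  "pd j (\<lambda>x. complex_of_real (vector_potential \<beta> x $ k)) x = of_real (vector_potential \<beta> (axis j 1) $ k)"
  by (rule frechet_derivative_eqI[OF bounded_linear_imp_has_derivative[OF bounded_linear_vector_potential]])

lemma test_function_pd: "test_function \<Omega> v \<Longrightarrow> test_function \<Omega> (pd k v)"
  by (rule test_function_derivative)

lemma test_function_mop: "test_function \<Omega> v \<Longrightarrow> test_function \<Omega> (mop h \<beta> k v)"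
  unfolding mop_def
  by (intro test_function_add test_function_cmult test_function_pd test_function_mult C_k_vector_potential)

lemma mop_add:
  "test_function \<Omega> u \<Longrightarrow> test_function \<Omega> v \<Longrightarrow> mop h \<beta> k (\<lambda>x. u x + v x) = (\<lambda>x. mop h \<beta> k u x + mop h \<beta> k v x)"
  by (simp add: mop_def frechet_derivative_add_test algebra_simps)

lemma mop_cmult:
  "test_function \<Omega> u \<Longrightarrow> mop h \<beta> k (\<lambda>x. a * u x) = (\<lambda>x. a * mop h \<beta> k u x)"
  by (simp add: mop_def frechet_derivative_cmult_test algebra_simps)

lemma pd_mop:
  assumes v: "test_function \<Omega> v"
  shows "pd j (mop h \<beta> k v) x = \<i> * of_real h * pd j (pd k v) x
    + (of_real (vector_potential \<beta> x $ k) * pd j v x + of_real (vector_potential \<beta> (axis j 1) $ k) * v x)"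
  unfolding mop_def
  by (simp only: frechet_derivative_add_test[OF test_function_cmult[OF test_function_pd[OF v]]
        test_function_mult[OF v C_k_vector_potential]]
      frechet_derivative_cmult_test[OF test_function_pd[OF v]]
      frechet_derivative_mult_test[OF v C_k_vector_potential] pd_vector_potential)

text \<open>Second derivatives and products of potentials cancel; only the curl of the potential
  survives, multiplied by \<open>\<i> * h\<close>.\<close>

lemma mop_commute:
  assumes v: "test_function \<Omega> v"
  shows "mop h \<beta> 1 (mop h \<beta> 2 v) = (\<lambda>x. mop h \<beta> 2 (mop h \<beta> 1 v) x + (\<i> * of_real (h * \<beta>)) * v x)"
proof
  fix x
  have s: "pd 1 (pd 2 v) x = pd 2 (pd 1 v) x"
    by (rule second_derivative_commute[OF test_function_C_k[OF v]])
  have e: "mop h \<beta> k w x = \<i> * of_real h * pd k w x + of_real (vector_potential \<beta> x $ k) * w x" for k w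
    by (simp add: mop_def)
  show "mop h \<beta> 1 (mop h \<beta> 2 v) x = mop h \<beta> 2 (mop h \<beta> 1 v) x + (\<i> * of_real (h * \<beta>)) * v x"
    unfolding e[of 1 "mop h \<beta> 2 v"] e[of 2 "mop h \<beta> 1 v"] pd_mop[OF v] s e[of _ v] vector_potential_nth
    by (simp add: axis_def algebra_simps)
qed

text \<open>The magnetic derivative is formally symmetric: in \<i> times a derivative the sign
  changes twice, by conjugation and by integration by parts, and the potential is real.\<close>

lemma mop_adjoint:
  assumes op: "open \<Omega>" and u: "L2 \<Omega> u" "is_weak_gradient \<Omega> u g" and w: "test_function \<Omega> w"
  shows "ip \<Omega> (\<lambda>x. mgrad h \<beta> u g x $ k) w = ip \<Omega> u (mop h \<beta> k w)"
proof -
  note L = test_function_L2[OF _ open_sets_lebesgue[OF op]]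
  have cw: "test_function \<Omega> (\<lambda>x. cnj (w x))" by (rule test_function_cnj[OF w])
  have fw: "test_function \<Omega> (\<lambda>x. of_real (vector_potential \<beta> x $ k) * cnj (w x))"
    by (rule test_function_mult[OF cw C_k_vector_potential])
  have i: "integrable (lebesgue_on \<Omega>) (\<lambda>x. g x $ k * cnj (w x))"
    "integrable (lebesgue_on \<Omega>) (\<lambda>x. u x * pd k (\<lambda>x. cnj (w x)) x)"
    "integrable (lebesgue_on \<Omega>) (\<lambda>x. u x * (of_real (vector_potential \<beta> x $ k) * cnj (w x)))"
    by (rule L2_mult_integrable[OF is_weak_gradientD(2)[OF u(2)] L[OF cw]],
        rule L2_mult_integrable[OF u(1) L[OF test_function_pd[OF cw]]],
        rule L2_mult_integrable[OF u(1) L[OF fw]])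
  have "ip \<Omega> (\<lambda>x. mgrad h \<beta> u g x $ k) w = (\<integral>x. \<i> * of_real h * (g x $ k * cnj (w x))
      + u x * (of_real (vector_potential \<beta> x $ k) * cnj (w x)) \<partial>lebesgue_on \<Omega>)"
    unfolding ip_def by (intro Bochner_Integration.integral_cong refl) (simp add: mgrad_def algebra_simps)
  also have "\<dots> = \<i> * of_real h * (\<integral>x. g x $ k * cnj (w x) \<partial>lebesgue_on \<Omega>)
      + (\<integral>x. u x * (of_real (vector_potential \<beta> x $ k) * cnj (w x)) \<partial>lebesgue_on \<Omega>)"
    using i by simp
  also have "(\<integral>x. g x $ k * cnj (w x) \<partial>lebesgue_on \<Omega>) = - (\<integral>x. u x * pd k (\<lambda>x. cnj (w x)) x \<partial>lebesgue_on \<Omega>)"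
    using is_weak_gradientD(3)[OF u(2) cw, of k] by simp
  also have "\<i> * of_real h * - (\<integral>x. u x * pd k (\<lambda>x. cnj (w x)) x \<partial>lebesgue_on \<Omega>)
      + (\<integral>x. u x * (of_real (vector_potential \<beta> x $ k) * cnj (w x)) \<partial>lebesgue_on \<Omega>)
    = (\<integral>x. - (\<i> * of_real h) * (u x * pd k (\<lambda>x. cnj (w x)) x)
      + u x * (of_real (vector_potential \<beta> x $ k) * cnj (w x)) \<partial>lebesgue_on \<Omega>)"
    using i by simp
  also have "\<dots> = ip \<Omega> u (mop h \<beta> k w)"
    unfolding ip_def
    by (intro Bochner_Integration.integral_cong refl)
       (simp add: mop_def frechet_derivative_cnj_test[OF w] algebra_simps)
  finally show ?thesis .
qed

text \<open>Puts all derivatives on the test function, so that the algebra of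
  \<open>commutation\<close> applies although trial functions have only one weak derivative.\<close>

lemma mform_test:
  assumes op: "open \<Omega>" and bd: "bounded \<Omega>" and u: "u \<in> H1 \<Omega>" and v: "test_function \<Omega> v"
  shows "mform \<Omega> h \<beta> a b d u v = ip \<Omega> u (\<lambda>x. of_real a * mop h \<beta> 1 (mop h \<beta> 1 v) x
    + (of_real b * (mop h \<beta> 1 (mop h \<beta> 2 v) x + mop h \<beta> 2 (mop h \<beta> 1 v) x)
    + of_real d * mop h \<beta> 2 (mop h \<beta> 2 v) x))"
proof -
  note L = test_function_L2[OF _ open_sets_lebesgue[OF op]]
  define g where "g = weak_gradient \<Omega> u"
  have g: "is_weak_gradient \<Omega> u g" unfolding g_def by (rule H1_weak_gradient[OF u])
  have uL: "L2 \<Omega> u" by (rule H1_L2[OF u])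
  let ?z = "\<lambda>k x. mgrad h \<beta> u g x $ k" and ?w = "\<lambda>k. mop h \<beta> k v"
  have wL: "L2 \<Omega> (?w k)" for k by (rule L[OF test_function_mop[OF v]])
  have zL: "L2 \<Omega> (?z k)" for k by (rule L2_mgrad[OF op bd uL g])
  have wwL: "L2 \<Omega> (mop h \<beta> j (?w k))" for j k by (rule L[OF test_function_mop[OF test_function_mop[OF v]]])
  have mv: "AE x in lebesgue_on \<Omega>. magnetic_gradient \<Omega> h \<beta> v x = (\<chi> k. ?w k x)"
    using mgrad_AE[OF op is_weak_gradient_test[OF v op], of h \<beta>]
    by (rule AE_mp) (simp add: mgrad_def mop_def)
  have i: "integrable (lebesgue_on \<Omega>) (\<lambda>x. ?z j x * cnj (?w k x))" for j k by (rule ip_integrable[OF zL wL])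
  have "mform \<Omega> h \<beta> a b d u v = (\<integral>x. qform a b d (mgrad h \<beta> u g x) (\<chi> k. ?w k x) \<partial>lebesgue_on \<Omega>)"
    unfolding mform_def
  proof (rule integral_cong_AE)
    have "integrable (lebesgue_on \<Omega>) (\<lambda>x. qform a b d (mgrad h \<beta> u g x) (\<chi> k. ?w k x))"
      by (rule qform_integrable[OF zL]) (simp add: wL)
    then show "(\<lambda>x. qform a b d (mgrad h \<beta> u g x) (\<chi> k. ?w k x)) \<in> borel_measurable (lebesgue_on \<Omega>)"
      by (rule borel_measurable_integrable)
    show "(\<lambda>x. qform a b d (magnetic_gradient \<Omega> h \<beta> u x) (magnetic_gradient \<Omega> h \<beta> v x)) \<in> borel_measurable (lebesgue_on \<Omega>)"
      by (rule borel_measurable_integrable[OF mform_integrable[OF op bd u H1_test[OF v op]]])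
    show "AE x in lebesgue_on \<Omega>. qform a b d (magnetic_gradient \<Omega> h \<beta> u x) (magnetic_gradient \<Omega> h \<beta> v x)
      = qform a b d (mgrad h \<beta> u g x) (\<chi> k. ?w k x)"
      using mv by (rule AE_mp) (simp add: magnetic_gradient_mgrad g_def)
  qed
  also have "\<dots> = of_real a * ip \<Omega> (?z 1) (?w 1) + of_real b * (ip \<Omega> (?z 1) (?w 2) + ip \<Omega> (?z 2) (?w 1))
      + of_real d * ip \<Omega> (?z 2) (?w 2)"
    unfolding qform_def ip_def vec_lambda_beta using i by simp
  also have "\<dots> = of_real a * ip \<Omega> u (mop h \<beta> 1 (?w 1)) + of_real b * (ip \<Omega> u (mop h \<beta> 1 (?w 2)) + ip \<Omega> u (mop h \<beta> 2 (?w 1)))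
      + of_real d * ip \<Omega> u (mop h \<beta> 2 (?w 2))"
    unfolding mop_adjoint[OF op uL g test_function_mop[OF v]] ..
  also have "\<dots> = ip \<Omega> u (\<lambda>x. of_real a * mop h \<beta> 1 (mop h \<beta> 1 v) x
    + (of_real b * (mop h \<beta> 1 (mop h \<beta> 2 v) x + mop h \<beta> 2 (mop h \<beta> 1 v) x)
    + of_real d * mop h \<beta> 2 (mop h \<beta> 2 v) x))"
    using uL wwL by (simp add: L2.form_add_right L2.form_cmult_right L2_add L2_cmult)
  finally show ?thesis .
qed

section \<open>Compactness\<close>

lemma L2_Cauchy_Schwarz:
  fixes f g :: "real^2 \<Rightarrow> complex"
  assumes "L2 \<Omega> f" "L2 \<Omega> g"
  shows "norm (\<integral>x. f x * g x \<partial>lebesgue_on \<Omega>)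
    \<le> sqrt (\<integral>x. (norm (f x))\<^sup>2 \<partial>lebesgue_on \<Omega>) * sqrt (\<integral>x. (norm (g x))\<^sup>2 \<partial>lebesgue_on \<Omega>)"
proof -
  have "(cmod (ip \<Omega> f (\<lambda>x. cnj (g x))))\<^sup>2 \<le> Re (ip \<Omega> f f) * Re (ip \<Omega> (\<lambda>x. cnj (g x)) (\<lambda>x. cnj (g x)))"
    using assms by (intro L2.form_Cauchy_Schwarz) (auto intro: L2_cnj)
  then have "cmod (ip \<Omega> f (\<lambda>x. cnj (g x)))
      \<le> sqrt ((\<integral>x. (norm (f x))\<^sup>2 \<partial>lebesgue_on \<Omega>) * (\<integral>x. (norm (g x))\<^sup>2 \<partial>lebesgue_on \<Omega>))"
    unfolding Re_ip_self by (intro real_le_rsqrt) simp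
  then show ?thesis by (simp add: ip_def real_sqrt_mult)
qed

lemma linear_id_plane: "linear (\<lambda>x::real^2. x)" "bij (\<lambda>x::real^2. x)"
  by (auto intro: linearI simp: bij_id[unfolded id_def])

lemma inv_id_plane: "inv (\<lambda>x::real^2. x) = (\<lambda>x. x)"
  using inv_id by (simp add: id_def)

lemma det_id_plane: "det (matrix (\<lambda>x::real^2. x)) = 1"
proof -
  have "matrix (\<lambda>x::real^2. x) = mat 1" using matrix_id_mat_1 by (simp add: id_def)
  then show ?thesis by (simp add: det_I)
qed

lemma integral_translate_image:
  fixes f :: "real^2 \<Rightarrow> 'b::euclidean_space"
  assumes "f \<in> borel_measurable (lebesgue_on G)" "G \<in> sets lebesgue"
  shows "(\<integral>y. f (y - z) \<partial>lebesgue_on ((\<lambda>x. x + z) ` G)) = (\<integral>x. f x \<partial>lebesgue_on G)"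
  using integral_affine[OF linear_id_plane assms(2,1), of z] by (simp add: inv_id_plane det_id_plane)

lemma test_function_translate:
  assumes "test_function G \<phi>" "\<And>x. x + c \<in> G \<Longrightarrow> x \<in> \<Omega>"
  shows "test_function \<Omega> (\<lambda>x. \<phi> (x + c))"
  using test_function_affine[OF assms(1) linear_id_plane, of c \<Omega>] assms(2) by simp

lemma L2_translate:
  assumes u: "L2 \<Omega> u" and op: "open \<Omega>" and G: "open G" "\<And>x. x \<in> G \<Longrightarrow> x + z \<in> \<Omega>"
  shows "L2 G (\<lambda>x. u (x + z))"
proof -
  have sub: "G \<subseteq> (\<lambda>x. x + - z) ` \<Omega>"
  proof
    fix x assume "x \<in> G"
    then have "x + z \<in> \<Omega>" by (rule G(2))
    then show "x \<in> (\<lambda>x. x + - z) ` \<Omega>" by (intro image_eqI[of _ _ "x + z"]) simp_all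
  qed
  have "L2 ((\<lambda>x. x + - z) ` \<Omega>) (\<lambda>y. u (y - - z))"
    using L2_affine[OF linear_id_plane open_sets_lebesgue[OF op] u, of "- z"] by (simp add: inv_id_plane)
  then have "L2 ((\<lambda>x. x + - z) ` \<Omega>) (\<lambda>y. u (y + z))" by simp
  moreover have "open ((\<lambda>x. x + - z) ` \<Omega>)"
    using open_affine_image[OF op linear_id_plane, of "- z"] .
  ultimately show ?thesis
    by (rule L2_subset[OF _ sub open_sets_lebesgue[OF G(1)] open_sets_lebesgue])
qed

text \<open>The difference \<open>u(x+z) - u(x)\<close> is estimated by duality: its pairing with a test function is the
  increment of \<open>s \<mapsto> \<integral> u(x) \<phi>(x - sz) dx\<close>, whose derivative is controlled by the weak gradient.\<close>

lemma translation_inequality: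
  assumes op: "open \<Omega>" and u: "L2 \<Omega> u" "is_weak_gradient \<Omega> u g"
    and G: "open G" and seg: "\<And>x s. x \<in> G \<Longrightarrow> 0 \<le> s \<Longrightarrow> s \<le> 1 \<Longrightarrow> x + s *\<^sub>R z \<in> \<Omega>"
  shows "(\<integral>x. (norm (u (x + z) - u x))\<^sup>2 \<partial>lebesgue_on G) \<le> (norm z)\<^sup>2 * (\<integral>x. (norm (g x))\<^sup>2 \<partial>lebesgue_on \<Omega>)"
proof -
  note \<Omega> = open_sets_lebesgue[OF op] and Gs = open_sets_lebesgue[OF G]
  have GO: "G \<subseteq> \<Omega>" using seg[of _ 0] by auto
  have Gz: "x + z \<in> \<Omega>" if "x \<in> G" for x using seg[OF that, of 1] by simp
  define M where "M = norm z * sqrt (\<integral>x. (norm (g x))\<^sup>2 \<partial>lebesgue_on \<Omega>)"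
  have M0: "M \<ge> 0" by (simp add: M_def)
  have uz: "L2 G (\<lambda>x. u (x + z))" by (rule L2_translate[OF u(1) op G Gz])
  have uG: "L2 G u" by (rule L2_subset[OF u(1) GO Gs \<Omega>])
  have gL: "L2 \<Omega> (\<lambda>x. g x $ k)" for k by (rule is_weak_gradientD(2)[OF u(2)])
  define gz where "gz = (\<lambda>x. of_real (z$1) * g x $ 1 + of_real (z$2) * g x $ 2)"
  have gzL: "L2 \<Omega> gz" unfolding gz_def by (intro L2_add L2_cmult gL)
  have gzM: "sqrt (\<integral>x. (norm (gz x))\<^sup>2 \<partial>lebesgue_on \<Omega>) \<le> M"
  proof -
    have "(norm (gz x))\<^sup>2 \<le> (norm z)\<^sup>2 * (norm (g x))\<^sup>2" for x
    proof -
      have "norm (gz x) \<le> \<bar>z$1\<bar> * norm (g x $ 1) + \<bar>z$2\<bar> * norm (g x $ 2)"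
        unfolding gz_def by (rule order_trans[OF norm_triangle_ineq]) (simp add: norm_mult)
      then have "(norm (gz x))\<^sup>2 \<le> (\<bar>z$1\<bar> * norm (g x $ 1) + \<bar>z$2\<bar> * norm (g x $ 2))\<^sup>2"
        by (intro power_mono) auto
      also have "\<dots> \<le> ((z$1)\<^sup>2 + (z$2)\<^sup>2) * ((norm (g x $ 1))\<^sup>2 + (norm (g x $ 2))\<^sup>2)"
      proof -
        have "0 \<le> (\<bar>z$1\<bar> * norm (g x $ 2) - \<bar>z$2\<bar> * norm (g x $ 1))\<^sup>2" by simp
        then show ?thesis by (simp add: power2_sum power2_diff power_mult_distrib algebra_simps)
      qed
      also have "(z$1)\<^sup>2 + (z$2)\<^sup>2 = (norm z)\<^sup>2"
        by (simp add: norm_vec_def L2_set_def sum_2)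
      finally show ?thesis by (simp add: norm_vec2[of "g x"])
    qed
    then have "(\<integral>x. (norm (gz x))\<^sup>2 \<partial>lebesgue_on \<Omega>) \<le> (\<integral>x. (norm z)\<^sup>2 * (norm (g x))\<^sup>2 \<partial>lebesgue_on \<Omega>)"
      using L2_integrable[OF gzL] L2_integrable[OF is_weak_gradientD(1)[OF u(2)]] by (intro integral_mono) auto
    then show ?thesis
      unfolding M_def by (simp add: real_le_lsqrt power_mult_distrib)
  qed
  have "(\<integral>x. (norm (u (x + z) - u x))\<^sup>2 \<partial>lebesgue_on G) \<le> M\<^sup>2"
  proof (rule integral_sq_norm_dual[OF G L2_diff[OF uz uG] M0])
    fix \<phi> assume \<phi>: "test_function G \<phi>"
    define F where "F s = (\<lambda>x. \<phi> (x + - (s *\<^sub>R z)))" for s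
    \<comment> \<open>As a test function of the plane \<open>F s\<close> can be differentiated for
      every \<open>s\<close>; but the weak gradient on \<Omega> requires support in \<Omega>, which
      the segment condition ensures for \<open>s\<close> between 0 and 1. Hence \<open>H\<close> is
      differentiated within the closed unit interval.\<close>
    have FU: "test_function UNIV (F s)" for s
      unfolding F_def by (rule test_function_translate[OF \<phi>]) simp
    have F\<Omega>: "test_function \<Omega> (F s)" if "0 \<le> s" "s \<le> 1" for s
      unfolding F_def using seg[OF _ that, of "_ - s *\<^sub>R z"]
      by (intro test_function_translate[OF \<phi>]) fastforce
    have FL: "L2 \<Omega> (F s)" for s by (rule test_function_L2[OF FU \<Omega>])
    define N\<phi> where "N\<phi> = sqrt (\<integral>x. (norm (\<phi> x))\<^sup>2 \<partial>lebesgue_on G)"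
    have NF: "sqrt (\<integral>x. (norm (F s x))\<^sup>2 \<partial>lebesgue_on \<Omega>) = N\<phi>" if s: "0 \<le> s" "s \<le> 1" for s
    proof -
      have pp: "test_function G (\<lambda>x. \<phi> x * cnj (\<phi> x))"
        by (rule test_function_mult[OF test_function_cnj[OF \<phi>] test_function_C_k[OF \<phi>]])
      have "ip \<Omega> (F s) (F s) = (\<integral>x. F s x * cnj (F s x) \<partial>lebesgue)"
        unfolding ip_def by (rule integral_on_eq_integral[OF \<Omega>]) (simp add: test_function_outside[OF F\<Omega>[OF s]])
      also have "\<dots> = (\<integral>x. \<phi> x * cnj (\<phi> x) \<partial>lebesgue)"
        unfolding F_def by (rule lebesgue_integral_translate(2)[OF test_function_integrable[OF pp]])
      also have "\<dots> = ip G \<phi> \<phi>"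
        unfolding ip_def by (rule integral_on_eq_integral[OF Gs, symmetric]) (simp add: test_function_outside[OF \<phi>])
      finally show ?thesis unfolding N\<phi>_def by (metis Re_ip_self)
    qed
    define H where "H s = (\<integral>x. u x * F s x \<partial>lebesgue_on \<Omega>)" for s
    define H' where "H' s = (\<integral>x. gz x * F s x \<partial>lebesgue_on \<Omega>)" for s
    have uF: "integrable (lebesgue_on \<Omega>) (\<lambda>x. u x * F s x)" for s by (rule L2_mult_integrable[OF u(1) FL])
    have H'b: "norm (H' s) \<le> M * N\<phi>" if s: "0 \<le> s" "s \<le> 1" for s
      using L2_Cauchy_Schwarz[OF gzL FL[of s]] mult_right_mono[OF gzM, of N\<phi>]
      unfolding NF[OF s] H'_def by (simp add: N\<phi>_def)
    have loc: "integrable (lebesgue_on \<Omega>) (\<lambda>x. u x * indicator (cball 0 R) x)" for R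
      by (rule L2_mult_integrable[OF u(1) L2_bounded_set_indicator]) (simp_all add: \<Omega> borel_closed sets_completionI_sets)
    have val: "(\<integral>x. u x * frechet_derivative (F s) (at x) (- z) \<partial>lebesgue_on \<Omega>) = H' s" if s: "0 \<le> s" "s \<le> 1" for s
    proof -
      have pL: "L2 \<Omega> (pd k (F s))" for k by (rule test_function_L2[OF test_function_pd[OF FU] \<Omega>])
      have i: "integrable (lebesgue_on \<Omega>) (\<lambda>x. u x * pd k (F s) x)" "integrable (lebesgue_on \<Omega>) (\<lambda>x. g x $ k * F s x)" for k
        by (rule L2_mult_integrable[OF u(1) pL], rule L2_mult_integrable[OF gL FL])
      have "frechet_derivative (F s) (at x) (- z) = - (of_real (z$1) * pd 1 (F s) x + of_real (z$2) * pd 2 (F s) x)" for x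
        using linear_vec2_expand[OF has_derivative_linear[OF test_function_has_derivative[OF FU]], of s x "- z"]
        by (simp add: scaleR_conv_of_real)
      note d = this
      have "(\<integral>x. u x * frechet_derivative (F s) (at x) (- z) \<partial>lebesgue_on \<Omega>)
        = (\<integral>x. - (of_real (z$1) * (u x * pd 1 (F s) x)) - of_real (z$2) * (u x * pd 2 (F s) x) \<partial>lebesgue_on \<Omega>)"
        unfolding d by (intro Bochner_Integration.integral_cong refl) (simp add: algebra_simps)
      also have "\<dots> = - (of_real (z$1) * (\<integral>x. u x * pd 1 (F s) x \<partial>lebesgue_on \<Omega>)) - of_real (z$2) * (\<integral>x. u x * pd 2 (F s) x \<partial>lebesgue_on \<Omega>)"
        using i by simp
      also have "\<dots> = of_real (z$1) * (\<integral>x. g x $ 1 * F s x \<partial>lebesgue_on \<Omega>) + of_real (z$2) * (\<integral>x. g x $ 2 * F s x \<partial>lebesgue_on \<Omega>)"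
        unfolding is_weak_gradientD(3)[OF u(2) F\<Omega>[OF s]] by simp
      also have "\<dots> = (\<integral>x. of_real (z$1) * (g x $ 1 * F s x) + of_real (z$2) * (g x $ 2 * F s x) \<partial>lebesgue_on \<Omega>)"
        using i by simp
      also have "\<dots> = H' s"
        unfolding H'_def gz_def by (intro Bochner_Integration.integral_cong refl) (simp add: algebra_simps)
      finally show ?thesis .
    qed
    have der: "(H has_derivative (\<lambda>r. r *\<^sub>R H' s)) (at s within {0..1})" if s: "s \<in> {0..1}" for s
      unfolding has_derivative_iff_norm
    proof (intro conjI)
      show "bounded_linear (\<lambda>r. r *\<^sub>R H' s)" by (rule bounded_linear_scaleR_left)
      show "((\<lambda>y. norm (H y - H s - (y - s) *\<^sub>R H' s) / norm (y - s)) \<longlongrightarrow> 0) (at s within {0..1})"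
        unfolding tendsto_at_iff_sequentially o_def
      proof (intro allI impI)
        fix X :: "nat \<Rightarrow> real" assume X: "\<forall>i. X i \<in> {0..1} - {s}" and lim: "X \<longlonglongrightarrow> s"
        define t where "t i = X i - s" for i
        have t0: "t i \<noteq> 0" for i using X by (simp add: t_def)
        have tl: "t \<longlonglongrightarrow> 0" unfolding t_def using tendsto_diff[OF lim tendsto_const[of s]] by simp
        have sh: "F s (x + t i *\<^sub>R (- z)) = F (X i) x" for i x
          by (simp add: F_def t_def algebra_simps)
        have q: "(\<integral>x. u x * ((F s (x + t i *\<^sub>R (- z)) - F s x) /\<^sub>R t i) \<partial>lebesgue_on \<Omega>) = (H (X i) - H s) /\<^sub>R t i" for i
        proof -
          have "(\<integral>x. u x * ((F s (x + t i *\<^sub>R (- z)) - F s x) /\<^sub>R t i) \<partial>lebesgue_on \<Omega>)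
            = (\<integral>x. (u x * F (X i) x - u x * F s x) /\<^sub>R t i \<partial>lebesgue_on \<Omega>)"
            unfolding sh by (intro Bochner_Integration.integral_cong refl) (simp add: algebra_simps)
          then show ?thesis using uF by (simp add: H_def)
        qed
        have "(\<lambda>i. (H (X i) - H s) /\<^sub>R t i) \<longlonglongrightarrow> H' s"
          using integral_difference_quotient_tendsto[OF FU L2_measurable[OF u(1)] loc tl t0, of s "- z"]
          unfolding q using val s by simp
        then have "(\<lambda>i. norm ((H (X i) - H s) /\<^sub>R t i - H' s)) \<longlonglongrightarrow> 0"
          by (intro tendsto_norm_zero LIM_zero)
        moreover have "norm (H (X i) - H s - (X i - s) *\<^sub>R H' s) / norm (X i - s) = norm ((H (X i) - H s) /\<^sub>R t i - H' s)" for i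
        proof -
          have "(H (X i) - H s) /\<^sub>R t i - H' s = (H (X i) - H s - t i *\<^sub>R H' s) /\<^sub>R t i"
            using t0[of i] by (simp add: scaleR_diff_right)
          then show ?thesis by (simp add: t_def[symmetric] divide_inverse mult.commute)
        qed
        ultimately show "(\<lambda>i. norm (H (X i) - H s - (X i - s) *\<^sub>R H' s) / norm (X i - s)) \<longlonglongrightarrow> 0" by simp
      qed
    qed
    have "norm (H 1 - H 0) \<le> (M * N\<phi>) * norm (1 - (0::real))"
    proof (rule differentiable_bound[of "{0..1}" H])
      fix s :: real assume "s \<in> {0..1}"
      then show "onorm (\<lambda>r. r *\<^sub>R H' s) \<le> M * N\<phi>"
        using H'b[of s] by (simp add: onorm_scaleR_left onorm_id)
    qed (use der in auto)
    moreover have "H 1 - H 0 = (\<integral>x. (u (x + z) - u x) * \<phi> x \<partial>lebesgue_on G)"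
    proof -
      have uzm: "(\<lambda>x. u (x + z) * \<phi> x) \<in> borel_measurable (lebesgue_on G)"
        using L2_measurable[OF uz] L2_measurable[OF test_function_L2[OF \<phi> Gs]] by measurable
      have oz: "open ((\<lambda>x. x + z) ` G)" using open_affine_image[OF G linear_id_plane] .
      have "H 1 = (\<integral>x. u x * \<phi> (x - z) \<partial>lebesgue_on \<Omega>)" by (simp add: H_def F_def)
      also have "\<dots> = (\<integral>x. u x * \<phi> (x - z) \<partial>lebesgue_on ((\<lambda>x. x + z) ` G))"
      proof (rule integral_subset_eq[symmetric])
        show "u x * \<phi> (x - z) = 0" if "x \<notin> (\<lambda>x. x + z) ` G" for x
        proof -
          have "x - z \<notin> G" using that by (metis diff_add_cancel image_eqI)
          then show ?thesis by (simp add: test_function_outside[OF \<phi>])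
        qed
      qed (use Gz \<Omega> open_sets_lebesgue[OF oz] in auto)
      also have "\<dots> = (\<integral>x. u (x + z) * \<phi> x \<partial>lebesgue_on G)"
        using integral_translate_image[OF uzm Gs, of z] by simp
      finally have 1: "H 1 = (\<integral>x. u (x + z) * \<phi> x \<partial>lebesgue_on G)" .
      have 0: "H 0 = (\<integral>x. u x * \<phi> x \<partial>lebesgue_on G)"
        unfolding H_def F_def using integral_subset_eq[OF GO Gs \<Omega>, of "\<lambda>x. u x * \<phi> x"]
        by (simp add: test_function_outside[OF \<phi>])
      have "L2 G \<phi>" by (rule test_function_L2[OF \<phi> Gs])
      then show ?thesis
        unfolding 0 1 using L2_mult_integrable[OF uz] L2_mult_integrable[OF uG] by (simp add: left_diff_distrib)
    qed
    ultimately show "norm (\<integral>x. (u (x + z) - u x) * \<phi> x \<partial>lebesgue_on G)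
        \<le> M * sqrt (\<integral>x. (norm (\<phi> x))\<^sup>2 \<partial>lebesgue_on G)"
      by (simp add: N\<phi>_def)
  qed
  then show ?thesis by (simp add: M_def power_mult_distrib)
qed

text \<open>Fubini for the function \<open>U (x + z)\<close> of two variables asks for measurability
  on the product, which composition with addition preserves for Borel functions. Vanishing off
  \<Omega> makes the same representative serve for the extension by zero.\<close>

lemma borel_representative:
  fixes u :: "real^2 \<Rightarrow> complex"
  assumes op: "open \<Omega>" and u: "u \<in> borel_measurable (lebesgue_on \<Omega>)"
  obtains U where "U \<in> borel_measurable borel" "\<And>x. x \<notin> \<Omega> \<Longrightarrow> U x = 0" "AE x in lebesgue_on \<Omega>. u x = U x"
proof -
  note \<Omega> = open_sets_lebesgue[OF op]
  have m: "(\<lambda>x. indicator \<Omega> x *\<^sub>R u x) \<in> borel_measurable lebesgue"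
    using u \<Omega> by (simp add: borel_measurable_restrict_space_iff)
  have mR: "(\<lambda>x. Re (indicator \<Omega> x *\<^sub>R u x)) \<in> borel_measurable lebesgue"
    and mI: "(\<lambda>x. Im (indicator \<Omega> x *\<^sub>R u x)) \<in> borel_measurable lebesgue"
    using m by measurable
  obtain r where r: "r \<in> borel_measurable lborel" "AE x in lborel. Re (indicator \<Omega> x *\<^sub>R u x) = r x"
    using completion_ex_borel_measurable_real[OF mR] by auto
  obtain i where i: "i \<in> borel_measurable lborel" "AE x in lborel. Im (indicator \<Omega> x *\<^sub>R u x) = i x"
    using completion_ex_borel_measurable_real[OF mI] by auto
  define U where "U = (\<lambda>x. indicator \<Omega> x *\<^sub>R Complex (r x) (i x))"
  have "(\<lambda>x. Complex (r x) (i x)) = (\<lambda>x. complex_of_real (r x) + \<i> * complex_of_real (i x))"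
    by (simp add: Complex_eq)
  moreover have "(\<lambda>x. complex_of_real (r x) + \<i> * complex_of_real (i x)) \<in> borel_measurable borel"
    using r(1) i(1) by measurable
  ultimately have "U \<in> borel_measurable borel"
    unfolding U_def using op by (intro borel_measurable_scaleR borel_measurable_indicator) auto
  moreover have "AE x in lebesgue. x \<in> \<Omega> \<longrightarrow> u x = U x"
    using AE_completion[OF r(2)] AE_completion[OF i(2)]
    by eventually_elim (auto simp: U_def complex_eq_iff)
  then have "AE x in lebesgue_on \<Omega>. u x = U x"
    using \<Omega> by (simp add: AE_restrict_space_iff)
  ultimately show ?thesis using that[of U] by (simp add: U_def)
qed

subsection \<open>Local strong convergence\<close>

definition sq :: "real \<Rightarrow> real^2" where "sq r = vector [r, r]"

lemma sq_nth [simp]: "sq r $ 1 = r" "sq r $ 2 = r"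
  by (simp_all add: sq_def)

context
  fixes G :: "(real^2) set"
  assumes Gb: "G \<in> sets borel" "bounded G"
begin

abbreviation (input) "RG \<equiv> restrict_space lborel G"

lemma finite_RG: "finite_measure RG"
proof
  have "emeasure RG (space RG) = emeasure lborel G"
    using Gb by (simp add: emeasure_restrict_space space_restrict_space)
  also have "\<dots> < \<infinity>" by (rule emeasure_bounded_finite[OF Gb(2)])
  finally show "emeasure RG (space RG) \<noteq> \<infinity>" by simp
qed

lemma restrict_borel_measurable: "f \<in> borel_measurable borel \<Longrightarrow> f \<in> borel_measurable RG"
  by (rule measurable_restrict_space1) simp

lemma integral_lebesgue_on_borel:
  fixes f :: "real^2 \<Rightarrow> 'b::euclidean_space"
  assumes f: "f \<in> borel_measurable borel"
  shows "(\<integral>x. f x \<partial>lebesgue_on G) = (\<integral>x. f x \<partial>RG)"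
    and "integrable (lebesgue_on G) f \<longleftrightarrow> integrable RG f"
proof -
  have m: "(\<lambda>x. indicator G x *\<^sub>R f x) \<in> borel_measurable lborel" using f Gb by measurable
  have Gl: "G \<in> sets lebesgue" using Gb by (simp add: sets_completionI_sets)
  show "(\<integral>x. f x \<partial>lebesgue_on G) = (\<integral>x. f x \<partial>RG)"
    using Gl Gb by (simp add: integral_restrict_space integral_completion[OF m])
  show "integrable (lebesgue_on G) f \<longleftrightarrow> integrable RG f"
    using Gl Gb by (simp add: integrable_restrict_space integrable_completion[OF m])
qed

end

lemma borel_translate: "U \<in> borel_measurable borel \<Longrightarrow> (\<lambda>z. U (x + z :: real^2)) \<in> borel_measurable borel"
  by (rule measurable_compose[of "\<lambda>z. x + z" _ borel]) (auto intro!: borel_measurable_continuous_onI continuous_intros)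

lemma lborel_integrable_translate:
  fixes f :: "real^2 \<Rightarrow> 'b::euclidean_space"
  assumes "integrable lborel f"
  shows "integrable lborel (\<lambda>z. f (x + z))" "(\<integral>z. f (x + z) \<partial>lborel) = (\<integral>z. f z \<partial>lborel)"
proof -
  have m: "(+) x \<in> lborel \<rightarrow>\<^sub>M borel" by simp
  have f: "f \<in> borel_measurable borel" using assms by auto
  show "integrable lborel (\<lambda>z. f (x + z))"
    using assms integrable_distr_eq[OF m f] lborel_distr_plus[of x] by simp
  show "(\<integral>z. f (x + z) \<partial>lborel) = (\<integral>z. f z \<partial>lborel)"
    using integral_distr[OF m f] lborel_distr_plus[of x] by simp
qed

context
  fixes U :: "real^2 \<Rightarrow> complex" and r :: real
  assumes U: "U \<in> borel_measurable borel" and Ui: "integrable lborel (\<lambda>x. (norm (U x))\<^sup>2)" and r: "r > 0"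
begin

abbreviation (input) "Q \<equiv> cbox 0 (sq r)"
abbreviation (input) "PQ \<equiv> restrict_space lborel Q"

lemma Q_borel: "Q \<in> sets borel" "bounded Q"
  by (auto simp: bounded_cbox)

lemma measure_PQ: "measure PQ (space PQ) = r\<^sup>2"
proof -
  have "measure PQ (space PQ) = measure lborel Q"
    by (simp add: measure_restrict_space space_restrict_space)
  also have "\<dots> = r\<^sup>2"
  proof -
    have "(0::real^2) \<in> Q" using r by (simp add: mem_cbox_2)
    then have "Q \<noteq> {}" by blast
    from content_cbox_cart[OF this] show ?thesis by (simp add: UNIV_2 power2_eq_square)
  qed
  finally show ?thesis .
qed

lemma integrable_PQ_sq: "integrable PQ (\<lambda>z. (norm (U (x + z)))\<^sup>2)"
proof -
  have "integrable lborel (\<lambda>z. indicator Q z *\<^sub>R (norm (U (x + z)))\<^sup>2)"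
    using lborel_integrable_translate(1)[OF Ui, of x] by (intro integrable_mult_indicator) auto
  then show ?thesis by (simp add: integrable_restrict_space)
qed

lemma integrable_PQ_const: "integrable PQ (\<lambda>z. k :: 'b::euclidean_space)"
proof -
  interpret finite_measure PQ by (rule finite_RG[OF Q_borel])
  show ?thesis by simp
qed

lemma norm_le_1_plus_sq: "norm a \<le> 1 + (norm a)\<^sup>2"
proof -
  have "2 * norm a \<le> (norm a)\<^sup>2 + 1" using zero_le_power2[of "norm a - 1"] by (simp add: power2_diff)
  then show ?thesis using norm_ge_zero[of a] by linarith
qed

lemma integrable_PQ: "integrable PQ (\<lambda>z. U (x + z))"
proof (rule Bochner_Integration.integrable_bound)
  show "integrable PQ (\<lambda>z. 1 + (norm (U (x + z)))\<^sup>2)"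
    by (intro Bochner_Integration.integrable_add integrable_PQ_const integrable_PQ_sq)
  show "(\<lambda>z. U (x + z)) \<in> borel_measurable PQ"
    by (rule restrict_borel_measurable[OF Q_borel borel_translate[OF U]])
  show "AE z in PQ. norm (U (x + z)) \<le> norm (1 + (norm (U (x + z)))\<^sup>2)"
    using norm_le_1_plus_sq by (intro AE_I2) (simp add: abs_of_nonneg)
qed

text \<open>The average over a box with corner \<open>x\<close>, not divided by the area
  \<open>r\<^sup>2\<close>; the powers of \<open>r\<close> in the estimates below include that
  factor.\<close>

definition avgint :: "real^2 \<Rightarrow> complex" where
  "avgint x = (\<integral>z. U (x + z) \<partial>PQ)"

text \<open>A crude bound, uniform in \<open>x\<close>: it serves as constant majorant on bounded
  sets.\<close>

lemma norm_avgint_le: "norm (avgint x) \<le> r\<^sup>2 + (\<integral>y. (norm (U y))\<^sup>2 \<partial>lborel)"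
proof -
  have "norm (avgint x) \<le> (\<integral>z. norm (U (x + z)) \<partial>PQ)"
    unfolding avgint_def by (rule integral_norm_bound)
  also have "\<dots> \<le> (\<integral>z. 1 + (norm (U (x + z)))\<^sup>2 \<partial>PQ)"
    by (intro integral_mono integrable_norm integrable_PQ Bochner_Integration.integrable_add integrable_PQ_const
        integrable_PQ_sq norm_le_1_plus_sq)
  also have "\<dots> = r\<^sup>2 + (\<integral>z. (norm (U (x + z)))\<^sup>2 \<partial>PQ)"
    using integrable_PQ_const[of "1::real"] integrable_PQ_sq measure_PQ by simp
  also have "(\<integral>z. (norm (U (x + z)))\<^sup>2 \<partial>PQ) = (\<integral>z. indicator Q z *\<^sub>R (norm (U (x + z)))\<^sup>2 \<partial>lborel)"
    by (simp add: integral_restrict_space)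
  also have "\<dots> \<le> (\<integral>z. (norm (U (x + z)))\<^sup>2 \<partial>lborel)"
    using lborel_integrable_translate(1)[OF Ui, of x]
    by (intro integral_mono integrable_mult_indicator) (auto simp: indicator_def)
  also have "\<dots> = (\<integral>y. (norm (U y))\<^sup>2 \<partial>lborel)"
    by (rule lborel_integrable_translate(2)[OF Ui])
  finally show ?thesis by simp
qed

text \<open>An integral of \<open>U\<close> against an indicator is the form in which weak
  convergence can be used.\<close>

lemma avgint_eq: "avgint x = (\<integral>y. indicator (cbox x (x + sq r)) y *\<^sub>R U y \<partial>lborel)"
proof -
  have i: "indicator (cbox x (x + sq r)) (x + z) = (indicator Q z :: real)" for z
    by (auto simp: indicator_def mem_cbox_2)
  have "integrable lborel (\<lambda>z. indicator Q z *\<^sub>R U (0 + z))"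
    using integrable_PQ[of 0] by (simp add: integrable_restrict_space)
  have "avgint x = (\<integral>z. indicator Q z *\<^sub>R U (x + z) \<partial>lborel)"
    by (simp add: avgint_def integral_restrict_space)
  also have "\<dots> = (\<integral>z. indicator (cbox x (x + sq r)) (x + z) *\<^sub>R U (x + z) \<partial>lborel)"
    by (simp add: i)
  also have "\<dots> = (\<integral>y. indicator (cbox x (x + sq r)) y *\<^sub>R U y \<partial>distr lborel borel ((+) x))"
    by (rule integral_distr[symmetric]) (use U in measurable)
  also have "\<dots> = (\<integral>y. indicator (cbox x (x + sq r)) y *\<^sub>R U y \<partial>lborel)"
    by (simp add: lborel_distr_plus)
  finally show ?thesis .
qed

text \<open>Expand the square and drop the nonnegative term
  \<open>(norm (U (x + z)))\<^sup>2\<close>. The cross term is split by the arithmetic-geometric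
  inequality, weighted so that half of \<open>r\<^sup>2 * (norm (U x))\<^sup>2\<close>
  survives.\<close>

lemma avgint_pointwise:
  "r\<^sup>2 / 2 * (norm (U x))\<^sup>2 \<le> (\<integral>z. (norm (U (x + z) - U x))\<^sup>2 \<partial>PQ) + 2 / r\<^sup>2 * (norm (avgint x))\<^sup>2"
    and integrable_PQ_diff: "integrable PQ (\<lambda>z. (norm (U (x + z) - U x))\<^sup>2)"
proof -
  define p where "p = (\<lambda>z. Re (cnj (U x) * U (x + z)))"
  have e: "(norm (U (x + z) - U x))\<^sup>2 = (norm (U (x + z)))\<^sup>2 - 2 * p z + (norm (U x))\<^sup>2" for z
    unfolding cmod_power2 p_def by (simp add: power2_eq_square algebra_simps)
  have i: "integrable PQ p"
    unfolding p_def by (intro integrable_Re integrable_mult_right integrable_PQ)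
  show "integrable PQ (\<lambda>z. (norm (U (x + z) - U x))\<^sup>2)"
    unfolding e by (intro Bochner_Integration.integrable_add Bochner_Integration.integrable_diff integrable_mult_right i
        integrable_PQ_sq integrable_PQ_const)
  define A where "A = Re (cnj (U x) * avgint x)"
  have iR: "(\<integral>z. p z \<partial>PQ) = A"
    unfolding avgint_def A_def p_def using integrable_PQ[of x] by (subst integral_Re) simp_all
  have "(\<integral>z. (norm (U (x + z) - U x))\<^sup>2 \<partial>PQ)
      = (\<integral>z. (norm (U (x + z)))\<^sup>2 \<partial>PQ) - 2 * A + r\<^sup>2 * (norm (U x))\<^sup>2"
    unfolding e using i integrable_PQ_sq integrable_PQ_const[of "(norm (U x))\<^sup>2"] measure_PQ iR by simp
  moreover have "0 \<le> (\<integral>z. (norm (U (x + z)))\<^sup>2 \<partial>PQ)" by simp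
  moreover have "2 * A \<le> r\<^sup>2 / 2 * (norm (U x))\<^sup>2 + 2 / r\<^sup>2 * (norm (avgint x))\<^sup>2"
  proof -
    have "A \<le> norm (U x) * norm (avgint x)"
      using complex_Re_le_cmod[of "cnj (U x) * avgint x"] unfolding A_def norm_mult complex_mod_cnj .
    moreover have "0 \<le> (r * norm (U x) - 2 / r * norm (avgint x))\<^sup>2" by simp
    then have "4 * (norm (U x) * norm (avgint x)) \<le> r\<^sup>2 * (norm (U x))\<^sup>2 + 4 / r\<^sup>2 * (norm (avgint x))\<^sup>2"
      using r by (simp add: power2_diff power_mult_distrib power_divide)
    ultimately show ?thesis by simp
  qed
  ultimately show "r\<^sup>2 / 2 * (norm (U x))\<^sup>2 \<le> (\<integral>z. (norm (U (x + z) - U x))\<^sup>2 \<partial>PQ) + 2 / r\<^sup>2 * (norm (avgint x))\<^sup>2"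
    by linarith
qed

text \<open>Integrates \<open>avgint_pointwise\<close> over \<open>G\<close>. After the order of
  integration is exchanged, each shift \<open>z\<close> is fixed in the inner integral, where
  \<open>K\<close> applies, and the shifts have total measure \<open>r\<^sup>2\<close>.
  Multiplication by \<open>2 / r\<^sup>2\<close> then produces the two constants.\<close>

lemma local_estimate:
  assumes Gb: "G \<in> sets borel" "bounded G"
    and TI: "\<And>z. z \<in> Q \<Longrightarrow> (\<integral>x. (norm (U (x + z) - U x))\<^sup>2 \<partial>restrict_space lborel G) \<le> K"
    and K: "K \<ge> 0"
  shows "(\<integral>x. (norm (U x))\<^sup>2 \<partial>restrict_space lborel G)
    \<le> 2 * K + 4 / r ^ 4 * (\<integral>x. (norm (avgint x))\<^sup>2 \<partial>restrict_space lborel G)"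
    and "avgint \<in> borel_measurable (restrict_space lborel G)"
proof -
  let ?R = "restrict_space lborel G"
  interpret P: finite_measure PQ by (rule finite_RG[OF Q_borel])
  interpret R: finite_measure ?R by (rule finite_RG[OF Gb])
  interpret PR: pair_sigma_finite PQ ?R ..
  interpret RP: pair_sigma_finite ?R PQ ..
  have idP: "(\<lambda>x. x) \<in> PQ \<rightarrow>\<^sub>M borel" and idR: "(\<lambda>x. x) \<in> ?R \<rightarrow>\<^sub>M borel"
    by (auto intro!: measurable_restrict_space1)
  have fstm: "fst \<in> PQ \<Otimes>\<^sub>M ?R \<rightarrow>\<^sub>M borel" and sndm: "snd \<in> PQ \<Otimes>\<^sub>M ?R \<rightarrow>\<^sub>M borel"
    by (rule measurable_compose[OF measurable_fst idP], rule measurable_compose[OF measurable_snd idR])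
  have m1: "(\<lambda>w. U (snd w + fst w)) \<in> borel_measurable (PQ \<Otimes>\<^sub>M ?R)"
    by (rule measurable_compose[OF borel_measurable_add[OF sndm fstm] U])
  have m2: "(\<lambda>w. U (snd w)) \<in> borel_measurable (PQ \<Otimes>\<^sub>M ?R)"
    by (rule measurable_compose[OF sndm U])
  have mf: "(\<lambda>w. ennreal ((norm (U (snd w + fst w) - U (snd w)))\<^sup>2)) \<in> borel_measurable (PQ \<Otimes>\<^sub>M ?R)"
    using m1 m2 by measurable
  have fstm': "fst \<in> ?R \<Otimes>\<^sub>M PQ \<rightarrow>\<^sub>M borel" and sndm': "snd \<in> ?R \<Otimes>\<^sub>M PQ \<rightarrow>\<^sub>M borel"
    by (rule measurable_compose[OF measurable_fst idR], rule measurable_compose[OF measurable_snd idP])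
  have "(\<lambda>w. U (fst w + snd w)) \<in> borel_measurable (?R \<Otimes>\<^sub>M PQ)"
    by (rule measurable_compose[OF borel_measurable_add[OF fstm' sndm'] U])
  then show am: "avgint \<in> borel_measurable ?R"
    unfolding avgint_def[abs_def] by (intro P.borel_measurable_lebesgue_integral) (simp add: case_prod_beta)
  have URi: "integrable ?R (\<lambda>x. (norm (U x))\<^sup>2)"
    using integrable_mult_indicator[OF _ Ui, of G] Gb by (simp add: integrable_restrict_space)
  have URt: "integrable ?R (\<lambda>x. (norm (U (x + z)))\<^sup>2)" for z
    using integrable_mult_indicator[OF _ lborel_integrable_translate(1)[OF Ui, of z], of G] Gb
    by (simp add: integrable_restrict_space add.commute)
  have dRi: "integrable ?R (\<lambda>x. (norm (U (x + z) - U x))\<^sup>2)" for z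
  proof (rule Bochner_Integration.integrable_bound)
    show "integrable ?R (\<lambda>x. 2 * (norm (U (x + z)))\<^sup>2 + 2 * (norm (U x))\<^sup>2)"
      by (intro Bochner_Integration.integrable_add integrable_mult_right URi URt)
    have "(\<lambda>x. U (x + z)) \<in> borel_measurable borel" using borel_translate[OF U, of z] by (simp add: add.commute)
    then have "(\<lambda>x. (norm (U (x + z) - U x))\<^sup>2) \<in> borel_measurable borel" using U by measurable
    then show "(\<lambda>x. (norm (U (x + z) - U x))\<^sup>2) \<in> borel_measurable ?R" by (rule restrict_borel_measurable[OF Gb])
    show "AE x in ?R. norm ((norm (U (x + z) - U x))\<^sup>2) \<le> norm (2 * (norm (U (x + z)))\<^sup>2 + 2 * (norm (U x))\<^sup>2)"
      using sq_norm_add_le[of "U (x + z)" "- U x" for x] by (intro AE_I2) simp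
  qed
  \<comment> \<open>Nonnegative integrals allow the exchange before integrability on the product is
    known.\<close>
  have J: "(\<integral>\<^sup>+x. (\<integral>\<^sup>+z. ennreal ((norm (U (x + z) - U x))\<^sup>2) \<partial>PQ) \<partial>?R) \<le> ennreal (r\<^sup>2 * K)"
  proof -
    have "(\<integral>\<^sup>+x. (\<integral>\<^sup>+z. ennreal ((norm (U (x + z) - U x))\<^sup>2) \<partial>PQ) \<partial>?R)
        = (\<integral>\<^sup>+z. (\<integral>\<^sup>+x. ennreal ((norm (U (x + z) - U x))\<^sup>2) \<partial>?R) \<partial>PQ)"
      using PR.Fubini'[of "\<lambda>z x. ennreal ((norm (U (x + z) - U x))\<^sup>2)"] mf by (simp add: case_prod_beta)
    also have "\<dots> \<le> (\<integral>\<^sup>+z. ennreal K \<partial>PQ)"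
    proof (rule nn_integral_mono)
      fix z assume "z \<in> space PQ"
      then have "z \<in> Q" by (simp add: space_restrict_space)
      then show "(\<integral>\<^sup>+x. ennreal ((norm (U (x + z) - U x))\<^sup>2) \<partial>?R) \<le> ennreal K"
        using TI[of z] by (subst nn_integral_eq_integral[OF dRi]) (auto intro: ennreal_leI)
    qed
    also have "\<dots> = ennreal (r\<^sup>2 * K)"
      using measure_PQ K by (simp add: P.emeasure_eq_measure ennreal_mult'[symmetric] mult.commute)
    finally show ?thesis .
  qed
  let ?S = "\<integral>y. (norm (U y))\<^sup>2 \<partial>lborel"
  have ai: "integrable ?R (\<lambda>x. (norm (avgint x))\<^sup>2)"
  proof (rule R.integrable_const_bound[where B = "(r\<^sup>2 + ?S)\<^sup>2"])
    show "AE x in ?R. norm ((norm (avgint x))\<^sup>2) \<le> (r\<^sup>2 + ?S)\<^sup>2"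
      by (intro AE_I2) (simp add: power_mono norm_avgint_le)
  qed (use am in measurable)
  have "ennreal (\<integral>x. r\<^sup>2 / 2 * (norm (U x))\<^sup>2 \<partial>?R) = (\<integral>\<^sup>+x. ennreal (r\<^sup>2 / 2 * (norm (U x))\<^sup>2) \<partial>?R)"
    by (rule nn_integral_eq_integral[symmetric]) (use URi in auto)
  also have "\<dots> \<le> (\<integral>\<^sup>+x. (\<integral>\<^sup>+z. ennreal ((norm (U (x + z) - U x))\<^sup>2) \<partial>PQ) + ennreal (2 / r\<^sup>2 * (norm (avgint x))\<^sup>2) \<partial>?R)"
  proof (rule nn_integral_mono)
    fix x
    show "ennreal (r\<^sup>2 / 2 * (norm (U x))\<^sup>2)
        \<le> (\<integral>\<^sup>+z. ennreal ((norm (U (x + z) - U x))\<^sup>2) \<partial>PQ) + ennreal (2 / r\<^sup>2 * (norm (avgint x))\<^sup>2)"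
      using avgint_pointwise(1)[of x]
      by (subst nn_integral_eq_integral[OF integrable_PQ_diff]) (auto simp flip: ennreal_plus intro!: ennreal_leI)
  qed
  also have "\<dots> = (\<integral>\<^sup>+x. (\<integral>\<^sup>+z. ennreal ((norm (U (x + z) - U x))\<^sup>2) \<partial>PQ) \<partial>?R)
      + (\<integral>\<^sup>+x. ennreal (2 / r\<^sup>2 * (norm (avgint x))\<^sup>2) \<partial>?R)"
  proof (rule nn_integral_add)
    have "(\<lambda>w. ennreal ((norm (U (fst w + snd w) - U (fst w)))\<^sup>2)) \<in> borel_measurable (?R \<Otimes>\<^sub>M PQ)"
      using measurable_compose[OF borel_measurable_add[OF fstm' sndm'] U] measurable_compose[OF fstm' U] by measurable
    then show "(\<lambda>x. \<integral>\<^sup>+z. ennreal ((norm (U (x + z) - U x))\<^sup>2) \<partial>PQ) \<in> borel_measurable ?R"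
      by (intro P.borel_measurable_nn_integral) (simp add: case_prod_beta)
  qed (use am in measurable)
  also have "\<dots> \<le> ennreal (r\<^sup>2 * K) + ennreal (\<integral>x. 2 / r\<^sup>2 * (norm (avgint x))\<^sup>2 \<partial>?R)"
    by (intro add_mono J, subst nn_integral_eq_integral) (use ai in auto)
  also have "\<dots> = ennreal (r\<^sup>2 * K + (\<integral>x. 2 / r\<^sup>2 * (norm (avgint x))\<^sup>2 \<partial>?R))"
    using K by (intro ennreal_plus[symmetric]) auto
  finally have "r\<^sup>2 / 2 * (\<integral>x. (norm (U x))\<^sup>2 \<partial>?R) \<le> r\<^sup>2 * K + 2 / r\<^sup>2 * (\<integral>x. (norm (avgint x))\<^sup>2 \<partial>?R)"
    using K by (subst (asm) ennreal_le_iff) auto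
  then have "2 / r\<^sup>2 * (r\<^sup>2 / 2 * (\<integral>x. (norm (U x))\<^sup>2 \<partial>?R)) \<le> 2 / r\<^sup>2 * (r\<^sup>2 * K + 2 / r\<^sup>2 * (\<integral>x. (norm (avgint x))\<^sup>2 \<partial>?R))"
    by (intro mult_left_mono) auto
  then show "(\<integral>x. (norm (U x))\<^sup>2 \<partial>?R) \<le> 2 * K + 4 / r ^ 4 * (\<integral>x. (norm (avgint x))\<^sup>2 \<partial>?R)"
    using r by (simp add: algebra_simps flip: power_mult power_add)
qed

end

lemma lborel_sq_norm:
  assumes op: "open \<Omega>" and U: "U \<in> borel_measurable borel" and out: "\<And>x. x \<notin> \<Omega> \<Longrightarrow> U x = (0::complex)"
    and L: "L2 \<Omega> U"
  shows "integrable lborel (\<lambda>x. (norm (U x))\<^sup>2)"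
    and "(\<integral>x. (norm (U x))\<^sup>2 \<partial>lborel) = (\<integral>x. (norm (U x))\<^sup>2 \<partial>lebesgue_on \<Omega>)"
proof -
  note \<Omega> = open_sets_lebesgue[OF op]
  have m: "(\<lambda>x. (norm (U x))\<^sup>2) \<in> borel_measurable lborel" using U by measurable
  have e: "indicator \<Omega> x *\<^sub>R (norm (U x))\<^sup>2 = (norm (U x))\<^sup>2" for x
    by (cases "x \<in> \<Omega>") (simp_all add: out)
  have "integrable lebesgue (\<lambda>x. (norm (U x))\<^sup>2)"
    using L2_integrable[OF L] \<Omega> by (simp add: integrable_restrict_space e del: real_scaleR_def)
  then show "integrable lborel (\<lambda>x. (norm (U x))\<^sup>2)" by (simp add: integrable_completion[OF m])
  have "(\<integral>x. (norm (U x))\<^sup>2 \<partial>lebesgue_on \<Omega>) = (\<integral>x. (norm (U x))\<^sup>2 \<partial>lebesgue)"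
    using \<Omega> by (simp add: integral_restrict_space e del: real_scaleR_def)
  then show "(\<integral>x. (norm (U x))\<^sup>2 \<partial>lborel) = (\<integral>x. (norm (U x))\<^sup>2 \<partial>lebesgue_on \<Omega>)"
    by (simp add: integral_completion[OF m])
qed

text \<open>The order of the limits matters. The box size \<open>r\<close> is fixed first and makes
  the translation term small for all \<open>n\<close> at once. For that \<open>r\<close> the box
  averages tend to 0 pointwise and are bounded by \<open>r\<^sup>2 + 1\<close>, so dominated
  convergence applies on the bounded set \<open>G\<close>.\<close>

lemma rellich_local:
  fixes U :: "nat \<Rightarrow> real^2 \<Rightarrow> complex"
  assumes op: "open \<Omega>" and U: "\<And>n. U n \<in> borel_measurable borel" and out: "\<And>n x. x \<notin> \<Omega> \<Longrightarrow> U n x = 0"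
    and L: "\<And>n. L2 \<Omega> (U n)" and g: "\<And>n. is_weak_gradient \<Omega> (U n) (g n)"
    and U1: "\<And>n. (\<integral>x. (norm (U n x))\<^sup>2 \<partial>lebesgue_on \<Omega>) \<le> 1"
    and gC: "\<And>n. (\<integral>x. (norm (g n x))\<^sup>2 \<partial>lebesgue_on \<Omega>) \<le> C"
    and weak: "\<And>a b. cbox a b \<subseteq> \<Omega> \<Longrightarrow> (\<lambda>n. \<integral>x. indicator (cbox a b) x *\<^sub>R U n x \<partial>lborel) \<longlonglongrightarrow> 0"
    and G: "open G" "bounded G" and d: "d > 0" and sub: "\<And>x. x \<in> G \<Longrightarrow> cbox x (x + sq d) \<subseteq> \<Omega>"
  shows "(\<lambda>n. \<integral>x. (norm (U n x))\<^sup>2 \<partial>lebesgue_on G) \<longlonglongrightarrow> 0"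
proof (rule LIMSEQ_I)
  fix e :: real assume e: "e > 0"
  have Gb: "G \<in> sets borel" using G by simp
  have C0: "C \<ge> 0" using gC[of 0] by (rule order_trans[rotated]) simp
  \<comment> \<open>A shift \<open>z\<close> in the box satisfies
    \<open>(norm z)\<^sup>2 \<le> 2 * r\<^sup>2\<close>, and \<open>local_estimate\<close> doubles
    the bound, so the translation term is \<open>4 * r\<^sup>2 * C\<close>. The \<open>C + 1\<close>
    guards against division by zero.\<close>
  define r where "r = min d (sqrt (e / (8 * (C + 1))))"
  have r: "r > 0" "r \<le> d" using d e C0 by (auto simp: r_def)
  have "r \<le> sqrt (e / (8 * (C + 1)))" by (simp add: r_def)
  then have "r\<^sup>2 \<le> (sqrt (e / (8 * (C + 1))))\<^sup>2" using r(1) by (intro power_mono) auto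
  then have r2: "r\<^sup>2 \<le> e / (8 * (C + 1))" using e C0 by simp
  have small: "4 * r\<^sup>2 * C \<le> e / 2"
  proof -
    have "4 * r\<^sup>2 * C \<le> 4 * (e / (8 * (C + 1))) * (C + 1)"
      using r2 C0 e by (intro mult_mono) auto
    also have "\<dots> = e / 2" using C0 by (simp add: field_simps)
    finally show ?thesis .
  qed
  note Ui = lborel_sq_norm(1)[OF op U out L]
  have sub': "x + z \<in> \<Omega>" if "x \<in> G" "z \<in> cbox 0 (sq r)" for x z
    using sub[OF that(1)] that(2) r(2) by (auto simp: mem_cbox_2 subset_iff)
  let ?R = "restrict_space lborel G"
  have TI: "(\<integral>x. (norm (U n (x + z) - U n x))\<^sup>2 \<partial>?R) \<le> 2 * r\<^sup>2 * C" if z: "z \<in> cbox 0 (sq r)" for n z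
  proof -
    have "(\<lambda>x. U n (x + z)) \<in> borel_measurable borel" using borel_translate[OF U, of n z] by (simp add: add.commute)
    then have m: "(\<lambda>x. (norm (U n (x + z) - U n x))\<^sup>2) \<in> borel_measurable borel" using U[of n] by measurable
    have "x + s *\<^sub>R z \<in> \<Omega>" if "x \<in> G" "0 \<le> s" "s \<le> 1" for x s
    proof (rule sub'[OF that(1)])
      have "s * z $ k \<le> 1 * r" if "0 \<le> z $ k" "z $ k \<le> r" for k
        using that \<open>0 \<le> s\<close> \<open>s \<le> 1\<close> by (intro mult_mono) auto
      then show "s *\<^sub>R z \<in> cbox 0 (sq r)" using z \<open>0 \<le> s\<close> by (auto simp: mem_cbox_2)
    qed
    from translation_inequality[OF op L g G(1) this, of n]
    have "(\<integral>x. (norm (U n (x + z) - U n x))\<^sup>2 \<partial>lebesgue_on G) \<le> (norm z)\<^sup>2 * (\<integral>x. (norm (g n x))\<^sup>2 \<partial>lebesgue_on \<Omega>)" .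
    also have "\<dots> \<le> (2 * r\<^sup>2) * C"
    proof (rule mult_mono[OF _ gC])
      have "(z$1)\<^sup>2 \<le> r\<^sup>2" "(z$2)\<^sup>2 \<le> r\<^sup>2" using z by (auto simp: mem_cbox_2 intro!: power_mono)
      then show "(norm z)\<^sup>2 \<le> 2 * r\<^sup>2" by (simp add: norm_vec_def L2_set_def sum_2)
    qed auto
    finally show ?thesis by (simp add: integral_lebesgue_on_borel(1)[OF Gb G(2) m])
  qed
  have est: "(\<integral>x. (norm (U n x))\<^sup>2 \<partial>?R) \<le> 2 * (2 * r\<^sup>2 * C) + 4 / r ^ 4 * (\<integral>x. (norm (avgint (U n) r x))\<^sup>2 \<partial>?R)" for n
    using local_estimate(1)[OF U Ui r(1) Gb G(2) TI] C0 by simp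
  have am: "avgint (U n) r \<in> borel_measurable ?R" for n
    using local_estimate(2)[OF U Ui r(1) Gb G(2) TI] C0 by simp
  have av: "norm (avgint (U n) r x) \<le> r\<^sup>2 + 1" for n x
    using norm_avgint_le[OF U Ui r(1), of n x] U1[of n] lborel_sq_norm(2)[OF op U out L, of n] by simp
  interpret R: finite_measure ?R by (rule finite_RG[OF Gb G(2)])
  have "(\<lambda>n. \<integral>x. (norm (avgint (U n) r x))\<^sup>2 \<partial>?R) \<longlonglongrightarrow> (\<integral>x. 0 \<partial>?R)"
  proof (rule integral_dominated_convergence[where w = "\<lambda>_. (r\<^sup>2 + 1)\<^sup>2"])
    show "(\<lambda>x. (norm (avgint (U n) r x))\<^sup>2) \<in> borel_measurable ?R" for n using am[of n] by measurable
    show "AE x in ?R. norm ((norm (avgint (U n) r x))\<^sup>2) \<le> (r\<^sup>2 + 1)\<^sup>2" for n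
      by (intro AE_I2) (simp add: power_mono av)
    have "(\<lambda>n. (norm (avgint (U n) r x))\<^sup>2) \<longlonglongrightarrow> 0" if "x \<in> G" for x
    proof -
      have "cbox x (x + sq r) \<subseteq> \<Omega>" using sub[OF that] r(2) by (auto simp: mem_cbox_2 subset_iff)
      from tendsto_norm_zero[OF weak[OF this]] have "(\<lambda>n. norm (avgint (U n) r x)) \<longlonglongrightarrow> 0"
        by (simp add: avgint_eq[OF U Ui r(1)])
      from tendsto_power[OF this, of 2] show ?thesis by simp
    qed
    then show "AE x in ?R. (\<lambda>n. (norm (avgint (U n) r x))\<^sup>2) \<longlonglongrightarrow> 0"
      by (intro AE_I2) (simp add: space_restrict_space)
  qed auto
  then have "(\<lambda>n. \<integral>x. (norm (avgint (U n) r x))\<^sup>2 \<partial>?R) \<longlonglongrightarrow> 0" by simp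
  then have "(\<lambda>n. 4 / r ^ 4 * (\<integral>x. (norm (avgint (U n) r x))\<^sup>2 \<partial>?R)) \<longlonglongrightarrow> 0"
    by (rule tendsto_mult_right_zero)
  from order_tendstoD(2)[OF this, of "e / 2"] e obtain n0 where n0:
    "\<And>n. n \<ge> n0 \<Longrightarrow> 4 / r ^ 4 * (\<integral>x. (norm (avgint (U n) r x))\<^sup>2 \<partial>?R) < e / 2"
    by (auto simp: eventually_sequentially)
  have m: "(\<lambda>x. (norm (U n x))\<^sup>2) \<in> borel_measurable borel" for n using U[of n] by measurable
  have "norm ((\<integral>x. (norm (U n x))\<^sup>2 \<partial>lebesgue_on G) - 0) < e" if "n \<ge> n0" for n
    using est[of n] n0[OF that] small by (simp add: integral_lebesgue_on_borel(1)[OF Gb G(2) m])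
  then show "\<exists>n0. \<forall>n\<ge>n0. norm ((\<integral>x. (norm (U n x))\<^sup>2 \<partial>lebesgue_on G) - 0) < e" by blast
qed

text \<open>For a sequence bounded in norm, convergence on a dense set of test elements is
  enough.\<close>

lemma weak_null_L2:
  assumes op: "open \<Omega>" and u: "\<And>n. L2 \<Omega> (u n)" "\<And>n. (\<integral>x. (norm (u n x))\<^sup>2 \<partial>lebesgue_on \<Omega>) \<le> 1"
    and test: "\<And>\<phi>. test_function \<Omega> \<phi> \<Longrightarrow> (\<lambda>n::nat. ip \<Omega> (u n) \<phi>) \<longlonglongrightarrow> 0"
    and f: "L2 \<Omega> f"
  shows "(\<lambda>n. ip \<Omega> (u n) f) \<longlonglongrightarrow> 0"
proof (rule LIMSEQ_I)
  fix e :: real assume e: "e > 0"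
  obtain \<phi> where \<phi>: "test_function \<Omega> \<phi>" "(\<integral>x. (norm (f x - \<phi> x))\<^sup>2 \<partial>lebesgue_on \<Omega>) < (e / 2)\<^sup>2"
    by (rule test_functions_dense[OF op f, of "(e / 2)\<^sup>2"]) (use e in auto)
  have \<phi>L: "L2 \<Omega> \<phi>" by (rule test_function_L2[OF \<phi>(1) open_sets_lebesgue[OF op]])
  have rL: "L2 \<Omega> (\<lambda>x. f x - \<phi> x)" by (rule L2_diff[OF f \<phi>L])
  have b: "norm (ip \<Omega> (u n) (\<lambda>x. f x - \<phi> x)) \<le> e / 2" for n
  proof -
    have "norm (ip \<Omega> (u n) (\<lambda>x. f x - \<phi> x)) \<le> sqrt (\<integral>x. (norm (u n x))\<^sup>2 \<partial>lebesgue_on \<Omega>)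
        * sqrt (\<integral>x. (norm (cnj (f x - \<phi> x)))\<^sup>2 \<partial>lebesgue_on \<Omega>)"
      unfolding ip_def by (rule L2_Cauchy_Schwarz[OF u(1) L2_cnj[OF rL]])
    also have "\<dots> \<le> 1 * (e / 2)"
    proof (intro mult_mono)
      show "sqrt (\<integral>x. (norm (u n x))\<^sup>2 \<partial>lebesgue_on \<Omega>) \<le> 1" using u(2)[of n] by simp
      show "sqrt (\<integral>x. (norm (cnj (f x - \<phi> x)))\<^sup>2 \<partial>lebesgue_on \<Omega>) \<le> e / 2"
        unfolding complex_mod_cnj using \<phi>(2) e by (intro real_le_lsqrt) auto
    qed auto
    finally show ?thesis by simp
  qed
  obtain n0 where n0: "\<And>n. n \<ge> n0 \<Longrightarrow> norm (ip \<Omega> (u n) \<phi>) < e / 2"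
    using LIMSEQ_D[OF test[OF \<phi>(1)], of "e / 2"] e by auto
  have "norm (ip \<Omega> (u n) f - 0) < e" if "n \<ge> n0" for n
  proof -
    have "ip \<Omega> (u n) (\<lambda>x. \<phi> x + (f x - \<phi> x)) = ip \<Omega> (u n) \<phi> + ip \<Omega> (u n) (\<lambda>x. f x - \<phi> x)"
      by (rule L2.form_add_right) (use u \<phi>L rL in auto)
    then have "ip \<Omega> (u n) f = ip \<Omega> (u n) \<phi> + ip \<Omega> (u n) (\<lambda>x. f x - \<phi> x)" by simp
    then show ?thesis
      using norm_triangle_ineq[of "ip \<Omega> (u n) \<phi>" "ip \<Omega> (u n) (\<lambda>x. f x - \<phi> x)"] n0[OF that] b[of n] by simp
  qed
  then show "\<exists>n0. \<forall>n\<ge>n0. norm (ip \<Omega> (u n) f - 0) < e" by blast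
qed

lemma ip_cong_AE:
  assumes "L2 \<Omega> u" "L2 \<Omega> v" "L2 \<Omega> f" "AE x in lebesgue_on \<Omega>. u x = v x"
  shows "ip \<Omega> u f = ip \<Omega> v f"
  unfolding ip_def
  by (rule integral_cong_AE)
     (use assms(4) borel_measurable_integrable[OF ip_integrable[OF assms(1,3)]]
        borel_measurable_integrable[OF ip_integrable[OF assms(2,3)]] in \<open>auto elim!: eventually_mono\<close>)

lemma weak_null_boxes:
  assumes op: "open \<Omega>" and u: "\<And>n. L2 \<Omega> (u n)" "\<And>n. (\<integral>x. (norm (u n x))\<^sup>2 \<partial>lebesgue_on \<Omega>) \<le> 1"
    and test: "\<And>\<phi>. test_function \<Omega> \<phi> \<Longrightarrow> (\<lambda>n::nat. ip \<Omega> (u n) \<phi>) \<longlonglongrightarrow> 0"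
    and U: "\<And>n. U n \<in> borel_measurable borel" "\<And>n x. x \<notin> \<Omega> \<Longrightarrow> U n x = 0"
      "\<And>n. AE x in lebesgue_on \<Omega>. u n x = U n x"
  shows "(\<lambda>n. \<integral>x. indicator (cbox a b) x *\<^sub>R U n x \<partial>lborel) \<longlonglongrightarrow> 0"
proof -
  note \<Omega> = open_sets_lebesgue[OF op]
  have Um: "U n \<in> borel_measurable (lebesgue_on \<Omega>)" for n
    using U(1)[of n] by (intro measurable_restrict_space1 measurable_completion) simp
  have UL: "L2 \<Omega> (U n)" for n by (rule L2_AE[OF u(1) U(3) Um])
  have fL: "L2 \<Omega> (indicator (cbox a b) :: real^2 \<Rightarrow> complex)"
    by (intro L2_bounded_set_indicator \<Omega> bounded_cbox) (simp add: sets_completionI_sets)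
  have "ip \<Omega> (u n) (indicator (cbox a b)) = (\<integral>x. indicator (cbox a b) x *\<^sub>R U n x \<partial>lborel)" for n
  proof -
    have m: "(\<lambda>x. indicator (cbox a b) x *\<^sub>R U n x) \<in> borel_measurable lborel" using U(1)[of n] by measurable
    have "ip \<Omega> (u n) (indicator (cbox a b)) = ip \<Omega> (U n) (indicator (cbox a b))"
      by (rule ip_cong_AE[OF u(1) UL fL U(3)])
    also have "\<dots> = (\<integral>x. indicator (cbox a b) x *\<^sub>R U n x \<partial>lebesgue_on \<Omega>)"
      unfolding ip_def by (intro Bochner_Integration.integral_cong refl) (simp add: indicator_def)
    also have "\<dots> = (\<integral>x. indicator (cbox a b) x *\<^sub>R U n x \<partial>lebesgue)"
      by (rule integral_on_eq_integral[OF \<Omega>]) (simp add: U(2))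
    also have "\<dots> = (\<integral>x. indicator (cbox a b) x *\<^sub>R U n x \<partial>lborel)"
      by (rule integral_completion[OF m])
    finally show ?thesis .
  qed
  then show ?thesis using weak_null_L2[OF op u test fL] by simp
qed

lemma is_weak_gradient_AE:
  assumes "open \<Omega>" "is_weak_gradient \<Omega> u g" "L2 \<Omega> u" "L2 \<Omega> v" "AE x in lebesgue_on \<Omega>. u x = v x"
  shows "is_weak_gradient \<Omega> v g"
  unfolding is_weak_gradient_def
proof (intro conjI allI impI is_weak_gradientD(1)[OF assms(2)])
  fix \<phi> k assume \<phi>: "test_function \<Omega> \<phi>"
  have pL: "L2 \<Omega> (pd k \<phi>)" by (rule test_function_L2[OF test_function_pd[OF \<phi>] open_sets_lebesgue[OF assms(1)]])
  have "(\<integral>x. v x * pd k \<phi> x \<partial>lebesgue_on \<Omega>) = (\<integral>x. u x * pd k \<phi> x \<partial>lebesgue_on \<Omega>)"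
    by (rule integral_cong_AE)
       (use assms(5) borel_measurable_integrable[OF L2_mult_integrable[OF assms(3) pL]]
         borel_measurable_integrable[OF L2_mult_integrable[OF assms(4) pL]] in \<open>auto elim!: eventually_mono\<close>)
  then show "(\<integral>x. v x * pd k \<phi> x \<partial>lebesgue_on \<Omega>) = - (\<integral>x. g x $ k * \<phi> x \<partial>lebesgue_on \<Omega>)"
    using is_weak_gradientD(3)[OF assms(2) \<phi>] by simp
qed

subsection \<open>Extension by zero\<close>

lemma L2_extend:
  assumes "\<Omega> \<in> sets lebesgue" "L2 \<Omega> (f :: real^2 \<Rightarrow> 'b::euclidean_space)"
  shows "L2 UNIV (\<lambda>x. indicator \<Omega> x *\<^sub>R f x)"
    "(\<integral>x. (norm (indicator \<Omega> x *\<^sub>R f x))\<^sup>2 \<partial>lebesgue_on UNIV) = (\<integral>x. (norm (f x))\<^sup>2 \<partial>lebesgue_on \<Omega>)"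
proof -
  have e: "(norm (indicator \<Omega> x *\<^sub>R f x))\<^sup>2 = indicator \<Omega> x *\<^sub>R (norm (f x))\<^sup>2" for x by (simp add: indicator_def)
  have "(\<lambda>x. indicator \<Omega> x *\<^sub>R f x) \<in> borel_measurable lebesgue"
    using L2_measurable[OF assms(2)] assms(1) by (simp add: borel_measurable_restrict_space_iff)
  moreover have "integrable lebesgue (\<lambda>x. indicator \<Omega> x *\<^sub>R (norm (f x))\<^sup>2)"
    using L2_integrable[OF assms(2)] assms(1) by (simp add: integrable_restrict_space)
  ultimately show "L2 UNIV (\<lambda>x. indicator \<Omega> x *\<^sub>R f x)"
    unfolding L2_def e lebesgue_on_UNIV_eq by blast
  show "(\<integral>x. (norm (indicator \<Omega> x *\<^sub>R f x))\<^sup>2 \<partial>lebesgue_on UNIV) = (\<integral>x. (norm (f x))\<^sup>2 \<partial>lebesgue_on \<Omega>)"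
    unfolding e lebesgue_on_UNIV_eq using assms(1) by (simp add: integral_restrict_space)
qed

lemma integral_extend_mult:
  fixes f h :: "real^2 \<Rightarrow> complex"
  assumes "\<Omega> \<in> sets lebesgue"
  shows "(\<integral>x. (indicator \<Omega> x *\<^sub>R f x) * h x \<partial>lebesgue_on UNIV) = (\<integral>x. f x * h x \<partial>lebesgue_on \<Omega>)"
  using assms by (simp add: lebesgue_on_UNIV_eq integral_restrict_space)

text \<open>Against a test function of the plane, which need not vanish on the boundary, integration
  by parts is valid for the approximating functions with compact support in \<Omega>, and it
  survives the limit in \<open>H1_norm\<close>. This takes the place of boundary regularity in the
  Dirichlet case.\<close>

lemma is_weak_gradient_extend:
  assumes op: "open \<Omega>" and u: "u \<in> H1_0 \<Omega>"
  shows "is_weak_gradient UNIV (\<lambda>x. indicator \<Omega> x *\<^sub>R u x) (\<lambda>x. indicator \<Omega> x *\<^sub>R weak_gradient \<Omega> u x)"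
  unfolding is_weak_gradient_def
proof (intro conjI allI impI)
  note \<Omega> = open_sets_lebesgue[OF op]
  have uH: "u \<in> H1 \<Omega>" using u H1_0_sub by blast
  define g where "g = weak_gradient \<Omega> u"
  have g: "is_weak_gradient \<Omega> u g" unfolding g_def by (rule H1_weak_gradient[OF uH])
  have uL: "L2 \<Omega> u" by (rule H1_L2[OF uH])
  show "L2 UNIV (\<lambda>x. indicator \<Omega> x *\<^sub>R weak_gradient \<Omega> u x)"
    by (rule L2_extend(1)[OF \<Omega> is_weak_gradientD(1)[OF H1_weak_gradient[OF uH]]])
  fix \<psi> k assume \<psi>: "test_function UNIV \<psi>"
  obtain \<phi> where \<phi>: "\<And>n. test_function \<Omega> (\<phi> n)" and lim: "(\<lambda>n::nat. H1_norm \<Omega> (\<lambda>x. u x - \<phi> n x)) \<longlonglongrightarrow> 0"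
    using u by (auto simp: H1_0_def)
  have \<psi>L: "L2 \<Omega> \<psi>" and d\<psi>L: "L2 \<Omega> (pd k \<psi>)"
    by (rule test_function_L2[OF \<psi> \<Omega>], rule test_function_L2[OF test_function_pd[OF \<psi>] \<Omega>])
  define a where "a n = H1_norm \<Omega> (\<lambda>x. u x - \<phi> n x)" for n
  define gn where "gn n = (\<lambda>x. g x + (\<chi> k. - 1 * (\<chi> k. pd k (\<phi> n) x) $ k))" for n
  have \<phi>L: "L2 \<Omega> (\<phi> n)" for n by (rule test_function_L2[OF \<phi> \<Omega>])
  have w: "is_weak_gradient \<Omega> (\<lambda>x. u x + - 1 * \<phi> n x) (gn n)" for n
    unfolding gn_def
    by (intro is_weak_gradient_add op uL g L2_cmult \<phi>L is_weak_gradient_cmult is_weak_gradient_test[OF \<phi> op])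
  have a2: "(a n)\<^sup>2 = (\<integral>x. (norm (u x - \<phi> n x))\<^sup>2 \<partial>lebesgue_on \<Omega>) + (\<integral>x. (norm (gn n x))\<^sup>2 \<partial>lebesgue_on \<Omega>)" for n
    using H1_norm_eq[OF op w[of n]] by (simp add: a_def)
  have dL: "L2 \<Omega> (\<lambda>x. u x - \<phi> n x)" for n by (rule L2_diff[OF uL \<phi>L])
  have gnL: "L2 \<Omega> (\<lambda>x. gn n x $ k)" for n by (rule is_weak_gradientD(2)[OF w])
  \<comment> \<open>The defect in the identity to be proved; it does not depend on \<open>n\<close>,
    yet is bounded by a fixed multiple of \<open>a n\<close>.\<close>
  define E where "E = (\<integral>x. u x * pd k \<psi> x \<partial>lebesgue_on \<Omega>) + (\<integral>x. g x $ k * \<psi> x \<partial>lebesgue_on \<Omega>)"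
  define S where "S = sqrt (\<integral>x. (norm (pd k \<psi> x))\<^sup>2 \<partial>lebesgue_on \<Omega>) + sqrt (\<integral>x. (norm (\<psi> x))\<^sup>2 \<partial>lebesgue_on \<Omega>)"
  have bound: "norm E \<le> a n * S" for n
  proof -
    have ibp: "(\<integral>x. \<phi> n x * pd k \<psi> x \<partial>lebesgue_on \<Omega>) = - (\<integral>x. pd k (\<phi> n) x * \<psi> x \<partial>lebesgue_on \<Omega>)"
      using integration_by_parts[OF test_function_C_k[OF \<psi>] \<phi> \<Omega>, of n "axis k 1"]
      by (simp add: mult.commute)
    have "E = (\<integral>x. (u x - \<phi> n x) * pd k \<psi> x \<partial>lebesgue_on \<Omega>) + (\<integral>x. gn n x $ k * \<psi> x \<partial>lebesgue_on \<Omega>)"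
      unfolding E_def gn_def
      using ibp L2_mult_integrable[OF uL d\<psi>L] L2_mult_integrable[OF \<phi>L d\<psi>L, of n]
        L2_mult_integrable[OF is_weak_gradientD(2)[OF g] \<psi>L, of k]
        L2_mult_integrable[OF test_function_L2[OF test_function_pd[OF \<phi>] \<Omega>] \<psi>L, of n k]
      by (simp add: left_diff_distrib)
    also have "norm \<dots> \<le> norm (\<integral>x. (u x - \<phi> n x) * pd k \<psi> x \<partial>lebesgue_on \<Omega>) + norm (\<integral>x. gn n x $ k * \<psi> x \<partial>lebesgue_on \<Omega>)"
      by (rule norm_triangle_ineq)
    also have "\<dots> \<le> a n * sqrt (\<integral>x. (norm (pd k \<psi> x))\<^sup>2 \<partial>lebesgue_on \<Omega>) + a n * sqrt (\<integral>x. (norm (\<psi> x))\<^sup>2 \<partial>lebesgue_on \<Omega>)"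
    proof (rule add_mono)
      have an: "0 \<le> a n" by (simp add: a_def H1_norm_nonneg)
      have nn: "0 \<le> (\<integral>x. (norm (gn n x))\<^sup>2 \<partial>lebesgue_on \<Omega>)" "0 \<le> (\<integral>x. (norm (u x - \<phi> n x))\<^sup>2 \<partial>lebesgue_on \<Omega>)" by simp_all
      have "(\<integral>x. (norm (u x - \<phi> n x))\<^sup>2 \<partial>lebesgue_on \<Omega>) \<le> (a n)\<^sup>2" using a2[of n] nn by linarith
      then have "sqrt (\<integral>x. (norm (u x - \<phi> n x))\<^sup>2 \<partial>lebesgue_on \<Omega>) \<le> a n"
        by (rule real_le_lsqrt[rotated]) (rule an)
      then show "norm (\<integral>x. (u x - \<phi> n x) * pd k \<psi> x \<partial>lebesgue_on \<Omega>) \<le> a n * sqrt (\<integral>x. (norm (pd k \<psi> x))\<^sup>2 \<partial>lebesgue_on \<Omega>)"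
        by (intro order_trans[OF L2_Cauchy_Schwarz[OF dL d\<psi>L]] mult_right_mono) auto
      have "(\<integral>x. (norm (gn n x $ k))\<^sup>2 \<partial>lebesgue_on \<Omega>) \<le> (\<integral>x. (norm (gn n x))\<^sup>2 \<partial>lebesgue_on \<Omega>)"
        by (intro integral_mono L2_integrable gnL is_weak_gradientD(1)[OF w] power_mono Finite_Cartesian_Product.norm_nth_le) simp
      then have "(\<integral>x. (norm (gn n x $ k))\<^sup>2 \<partial>lebesgue_on \<Omega>) \<le> (a n)\<^sup>2" using a2[of n] nn by linarith
      then have "sqrt (\<integral>x. (norm (gn n x $ k))\<^sup>2 \<partial>lebesgue_on \<Omega>) \<le> a n"
        by (rule real_le_lsqrt[rotated]) (rule an)
      then show "norm (\<integral>x. gn n x $ k * \<psi> x \<partial>lebesgue_on \<Omega>) \<le> a n * sqrt (\<integral>x. (norm (\<psi> x))\<^sup>2 \<partial>lebesgue_on \<Omega>)"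
        by (intro order_trans[OF L2_Cauchy_Schwarz[OF gnL \<psi>L]] mult_right_mono) auto
    qed
    finally show ?thesis by (simp add: S_def ring_distribs)
  qed
  have "(\<lambda>n. a n * S) \<longlonglongrightarrow> 0" using lim unfolding a_def by (rule tendsto_mult_left_zero)
  then have "norm E \<le> 0" by (rule LIMSEQ_le_const) (use bound in auto)
  then have "(\<integral>x. u x * pd k \<psi> x \<partial>lebesgue_on \<Omega>) = - (\<integral>x. g x $ k * \<psi> x \<partial>lebesgue_on \<Omega>)"
    by (simp add: E_def eq_neg_iff_add_eq_0)
  then show "(\<integral>x. indicator \<Omega> x *\<^sub>R u x * pd k \<psi> x \<partial>lebesgue_on UNIV)
      = - (\<integral>x. (indicator \<Omega> x *\<^sub>R weak_gradient \<Omega> u x) $ k * \<psi> x \<partial>lebesgue_on UNIV)"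
    unfolding vector_scaleR_component integral_extend_mult[OF \<Omega>] g_def .
qed

subsection \<open>Lipschitz boundaries\<close>

text \<open>Above a Lipschitz graph a point moved up by \<open>t\<close> has room to deviate by
  \<open>c * t\<close> with \<open>c = 1 / (1 + L)\<close>: a deviation \<delta> costs at most
  \<delta> in height and raises the graph by at most \<open>L * \<delta>\<close>. So the part of
  \<Omega> near \<open>p\<close> can be pushed into \<Omega> with a margin.\<close>

lemma lipschitz_boundary_shift:
  assumes lip: "lipschitz_boundary \<Omega>" and p: "p \<in> frontier \<Omega>"
  obtains \<rho> e c where "\<rho> > 0" "norm e = 1" "c > 0"
    "\<And>x t y. x \<in> \<Omega> \<Longrightarrow> x \<in> ball p \<rho> \<Longrightarrow> 0 < t \<Longrightarrow> t \<le> \<rho> \<Longrightarrow> dist y (x + t *\<^sub>R e) \<le> c * t \<Longrightarrow> y \<in> \<Omega>"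
proof -
  obtain r Q \<gamma> L where r: "r > 0" and Q: "orthogonal_transformation (Q :: real^2 \<Rightarrow> real^2)"
    and \<gamma>: "L-lipschitz_on UNIV (\<gamma> :: real \<Rightarrow> real)"
    and eq: "\<Omega> \<inter> ball p r = {x \<in> ball p r. \<gamma> (Q (x - p) $ 1) < Q (x - p) $ 2}"
    using lip[unfolded lipschitz_boundary_def, rule_format, OF p] by blast
  have L0: "L \<ge> 0" by (rule lipschitz_on_nonneg[OF \<gamma>])
  have lQ: "linear Q" using Q by (simp add: orthogonal_transformation_def)
  obtain e where e: "Q e = axis 2 1" using orthogonal_transformation_surj[OF Q] by (metis surjD)
  have ne: "norm e = 1" using orthogonal_transformation_norm[OF Q, of e] e by simp
  define c where "c = 1 / (1 + L)"
  have c: "c > 0" "c * (1 + L) = 1" "c \<le> 1" using L0 by (auto simp: c_def)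
  \<comment> \<open>One third of the radius each for the position of \<open>x\<close>, the shift and
    the deviation, as \<open>c \<le> 1\<close>.\<close>
  show ?thesis
  proof (rule that[of "r / 3" e c])
    fix x t y assume x: "x \<in> \<Omega>" "x \<in> ball p (r / 3)" and t: "0 < t" "t \<le> r / 3" and y: "dist y (x + t *\<^sub>R e) \<le> c * t"
    have ct: "c * t \<le> 1 * t" using c t by (intro mult_right_mono) auto
    have "dist p y \<le> dist p x + dist x (x + t *\<^sub>R e) + dist (x + t *\<^sub>R e) y"
      using dist_triangle[of p y x] dist_triangle[of x y "x + t *\<^sub>R e"] by linarith
    also have "dist x (x + t *\<^sub>R e) = t" using t ne by (simp add: dist_norm)
    also have "dist p x < r / 3" using x(2) by simp
    also have "dist (x + t *\<^sub>R e) y \<le> t" using y ct by (simp add: dist_commute)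
    finally have yb: "y \<in> ball p r" using t by simp
    have "x \<in> \<Omega> \<inter> ball p r" using x r by auto
    then have xg: "\<gamma> (Q (x - p) $ 1) < Q (x - p) $ 2" unfolding eq by simp
    define d where "d = Q (y - (x + t *\<^sub>R e))"
    have nd: "norm d \<le> c * t" unfolding d_def using orthogonal_transformation_norm[OF Q] y by (simp add: dist_norm)
    have Qy: "Q (y - p) = Q (x - p) + t *\<^sub>R axis 2 1 + d"
    proof -
      have "y - p = (x - p) + t *\<^sub>R e + (y - (x + t *\<^sub>R e))" by simp
      then have "Q (y - p) = Q ((x - p) + t *\<^sub>R e + (y - (x + t *\<^sub>R e)))" by simp
      then show ?thesis unfolding d_def e[symmetric] by (simp only: linear_add[OF lQ] linear_scale[OF lQ])
    qed
    have d1: "\<bar>d $ 1\<bar> \<le> c * t" and d2: "\<bar>d $ 2\<bar> \<le> c * t"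
      using component_le_norm_cart[of d 1] component_le_norm_cart[of d 2] nd by auto
    have Q1: "Q (y - p) $ 1 = Q (x - p) $ 1 + d $ 1" and Q2: "Q (y - p) $ 2 = Q (x - p) $ 2 + t + d $ 2"
      unfolding Qy by (simp_all add: axis_def)
    have "\<gamma> (Q (y - p) $ 1) - \<gamma> (Q (x - p) $ 1) \<le> L * \<bar>d $ 1\<bar>"
      using lipschitz_onD[OF \<gamma>, of "Q (y - p) $ 1" "Q (x - p) $ 1"] unfolding Q1 by (simp add: dist_real_def)
    also have "\<dots> \<le> L * (c * t)" using d1 L0 by (rule mult_left_mono)
    finally have "\<gamma> (Q (y - p) $ 1) < Q (x - p) $ 2 + L * (c * t)" using xg by linarith
    moreover have "c * t + L * (c * t) = t" using c(2) by (metis mult.commute mult.left_commute mult_1 ring_class.ring_distribs(2))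
    ultimately have "\<gamma> (Q (y - p) $ 1) < Q (y - p) $ 2" unfolding Q2 using d2 by linarith
    then have "y \<in> \<Omega> \<inter> ball p r" unfolding eq using yb by simp
    then show "y \<in> \<Omega>" by simp
  qed (use r ne c in auto)
qed

lemma integral_le_sum_cover:
  fixes f :: "real^2 \<Rightarrow> real"
  assumes f: "integrable (lebesgue_on \<Omega>) f" "\<And>x. 0 \<le> f x" and op: "open \<Omega>"
    and I: "finite I" "\<And>i. i \<in> I \<Longrightarrow> open (B i)" "\<Omega> \<subseteq> (\<Union>i\<in>I. B i)"
  shows "(\<integral>x. f x \<partial>lebesgue_on \<Omega>) \<le> (\<Sum>i\<in>I. \<integral>x. f x \<partial>lebesgue_on (\<Omega> \<inter> B i))"
proof -
  note \<Omega> = open_sets_lebesgue[OF op]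
  have Bs: "\<Omega> \<inter> B i \<in> sets lebesgue" if "i \<in> I" for i
    using open_sets_lebesgue[OF open_Int[OF op I(2)[OF that]]] .
  have i: "integrable lebesgue (\<lambda>x. indicator (\<Omega> \<inter> B i) x *\<^sub>R f x)" if "i \<in> I" for i
    using integrable_lebesgue_on_subset[OF f(1) Int_lower1 Bs[OF that] \<Omega>] Bs[OF that]
    by (simp add: integrable_restrict_space)
  have "(\<integral>x. f x \<partial>lebesgue_on \<Omega>) = (\<integral>x. indicator \<Omega> x *\<^sub>R f x \<partial>lebesgue)"
    using \<Omega> by (simp add: integral_restrict_space)
  also have "\<dots> \<le> (\<integral>x. (\<Sum>i\<in>I. indicator (\<Omega> \<inter> B i) x *\<^sub>R f x) \<partial>lebesgue)"
  proof (rule integral_mono)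
    show "integrable lebesgue (\<lambda>x. indicator \<Omega> x *\<^sub>R f x)" using f(1) \<Omega> by (simp add: integrable_restrict_space)
    show "integrable lebesgue (\<lambda>x. \<Sum>i\<in>I. indicator (\<Omega> \<inter> B i) x *\<^sub>R f x)" using i by (rule Bochner_Integration.integrable_sum)
    fix x
    show "indicator \<Omega> x *\<^sub>R f x \<le> (\<Sum>i\<in>I. indicator (\<Omega> \<inter> B i) x *\<^sub>R f x)"
    proof (cases "x \<in> \<Omega>")
      case True
      then obtain i where "i \<in> I" "x \<in> B i" using I(3) by auto
      then have "f x = indicator (\<Omega> \<inter> B i) x *\<^sub>R f x" using True by simp
      also have "\<dots> \<le> (\<Sum>i\<in>I. indicator (\<Omega> \<inter> B i) x *\<^sub>R f x)"
        by (rule member_le_sum[OF \<open>i \<in> I\<close>]) (use f(2) I(1) in auto)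
      finally show ?thesis using True by simp
    qed simp
  qed
  also have "\<dots> = (\<Sum>i\<in>I. \<integral>x. indicator (\<Omega> \<inter> B i) x *\<^sub>R f x \<partial>lebesgue)"
    using i by (rule Bochner_Integration.integral_sum)
  also have "\<dots> = (\<Sum>i\<in>I. \<integral>x. f x \<partial>lebesgue_on (\<Omega> \<inter> B i))"
    by (intro sum.cong refl) (use Bs in \<open>simp add: integral_restrict_space\<close>)
  finally show ?thesis .
qed

subsection \<open>Weakly null sequences\<close>

text \<open>Rellich's theorem in the form of a contradiction: only sequences weakly tending to 0
  occur, so no subsequence has to be extracted and no limit function named.\<close>

theorem weakly_null_bounded_false:
  fixes u :: "nat \<Rightarrow> real^2 \<Rightarrow> complex"
  assumes W: "trial_space W" and lip: "W = H1_0 \<or> lipschitz_boundary \<Omega>"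
    and op: "open \<Omega>" and bd: "bounded \<Omega>"
    and u: "\<And>n. u n \<in> W \<Omega>" and u1: "\<And>n. (\<integral>x. (norm (u n x))\<^sup>2 \<partial>lebesgue_on \<Omega>) = 1"
    and gC: "\<And>n. (\<integral>x. (norm (weak_gradient \<Omega> (u n) x))\<^sup>2 \<partial>lebesgue_on \<Omega>) \<le> C"
    and test: "\<And>\<phi>. test_function \<Omega> \<phi> \<Longrightarrow> (\<lambda>n. ip \<Omega> (u n) \<phi>) \<longlonglongrightarrow> 0"
  shows False
proof -
  note \<Omega> = open_sets_lebesgue[OF op]
  have uH: "u n \<in> H1 \<Omega>" for n using u trial_space_facts(1)[OF W op] by blast
  have uL: "L2 \<Omega> (u n)" for n by (rule H1_L2[OF uH])
  define g where "g n = weak_gradient \<Omega> (u n)" for n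
  have g: "is_weak_gradient \<Omega> (u n) (g n)" for n unfolding g_def by (rule H1_weak_gradient[OF uH])
  have gC: "(\<integral>x. (norm (g n x))\<^sup>2 \<partial>lebesgue_on \<Omega>) \<le> C" for n using gC by (simp add: g_def)
  have C0: "C \<ge> 0" using gC[of 0] by (rule order_trans[rotated]) simp
  have "\<forall>n. \<exists>U. U \<in> borel_measurable borel \<and> (\<forall>x. x \<notin> \<Omega> \<longrightarrow> U x = 0) \<and> (AE x in lebesgue_on \<Omega>. u n x = U x)"
  proof
    fix n
    show "\<exists>U. U \<in> borel_measurable borel \<and> (\<forall>x. x \<notin> \<Omega> \<longrightarrow> U x = 0) \<and> (AE x in lebesgue_on \<Omega>. u n x = U x)"
      by (rule borel_representative[OF op L2_measurable[OF uL[of n]]]) blast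
  qed
  then obtain U where Uall: "\<forall>n. U n \<in> borel_measurable borel \<and> (\<forall>x. x \<notin> \<Omega> \<longrightarrow> U n x = 0) \<and> (AE x in lebesgue_on \<Omega>. u n x = U n x)"
    by (rule choice[THEN exE])
  have U: "U n \<in> borel_measurable borel" and out: "x \<notin> \<Omega> \<Longrightarrow> U n x = 0" and Ueq: "AE x in lebesgue_on \<Omega>. u n x = U n x" for n x
    using Uall by auto
  have Um: "U n \<in> borel_measurable (lebesgue_on A)" for n A
    using U[of n] by (intro measurable_restrict_space1 measurable_completion) simp
  have UL: "L2 \<Omega> (U n)" for n by (rule L2_AE[OF uL Ueq Um])
  have U1: "(\<integral>x. (norm (U n x))\<^sup>2 \<partial>lebesgue_on \<Omega>) = 1" for n
  proof -
    have "(\<integral>x. (norm (U n x))\<^sup>2 \<partial>lebesgue_on \<Omega>) = (\<integral>x. (norm (u n x))\<^sup>2 \<partial>lebesgue_on \<Omega>)"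
      by (rule integral_cong_AE) (use Ueq[of n] borel_measurable_integrable[OF L2_integrable[OF UL]]
        borel_measurable_integrable[OF L2_integrable[OF uL]] in \<open>auto elim!: eventually_mono\<close>)
    then show ?thesis using u1 by simp
  qed
  have boxes: "(\<lambda>n. \<integral>x. indicator (cbox a b) x *\<^sub>R U n x \<partial>lborel) \<longlonglongrightarrow> 0" for a b
    by (rule weak_null_boxes[OF op uL _ test U out Ueq]) (simp add: u1)
  have not0: False if "(\<lambda>n. \<integral>x. (norm (U n x))\<^sup>2 \<partial>lebesgue_on \<Omega>) \<longlonglongrightarrow> 0"
    using that unfolding U1 by (simp add: LIMSEQ_const_iff)
  show False
  proof (cases "W = H1_0")
    case True
    then have u0: "u n \<in> H1_0 \<Omega>" for n using u[of n] by simp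
    let ?u = "\<lambda>n x. indicator \<Omega> x *\<^sub>R u n x" and ?g = "\<lambda>n x. indicator \<Omega> x *\<^sub>R g n x"
    have w: "is_weak_gradient UNIV (?u n) (?g n)" for n
      unfolding g_def by (rule is_weak_gradient_extend[OF op u0])
    have uUL: "L2 UNIV (?u n)" for n by (rule L2_extend(1)[OF \<Omega> uL])
    have eq: "AE x in lebesgue_on UNIV. ?u n x = U n x" for n
    proof -
      have "AE x in lebesgue. x \<in> \<Omega> \<longrightarrow> u n x = U n x"
        using Ueq[of n] \<Omega> by (simp add: AE_restrict_space_iff)
      then have "AE x in lebesgue. ?u n x = U n x"
        by (rule AE_mp) (use out in \<open>auto intro!: AE_I2 simp: indicator_def\<close>)
      then show ?thesis by (simp only: lebesgue_on_UNIV_eq)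
    qed
    have UUL: "L2 UNIV (U n)" for n by (rule L2_AE[OF uUL eq Um])
    \<comment> \<open>After extension to the plane every box is allowed, so \<open>d = 1\<close> is
      an arbitrary choice.\<close>
    have "(\<lambda>n. \<integral>x. (norm (U n x))\<^sup>2 \<partial>lebesgue_on \<Omega>) \<longlonglongrightarrow> 0"
    proof (rule rellich_local[where \<Omega> = UNIV and U = U and g = ?g and C = C and d = 1])
      show "is_weak_gradient UNIV (U n) (?g n)" for n
        by (rule is_weak_gradient_AE[OF open_UNIV w uUL UUL eq])
      show "(\<integral>x. (norm (U n x))\<^sup>2 \<partial>lebesgue_on UNIV) \<le> 1" for n
      proof -
        have "(\<integral>x. (norm (U n x))\<^sup>2 \<partial>lebesgue_on UNIV) = (\<integral>x. (norm (?u n x))\<^sup>2 \<partial>lebesgue_on UNIV)"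
        proof (rule integral_cong_AE[OF borel_measurable_integrable[OF L2_integrable[OF UUL]]
              borel_measurable_integrable[OF L2_integrable[OF uUL]]])
          show "AE x in lebesgue_on UNIV. (norm (U n x))\<^sup>2 = (norm (?u n x))\<^sup>2"
            by (rule eventually_mono[OF eq[of n]]) (simp only:)
        qed
        then show ?thesis using L2_extend(2)[OF \<Omega> uL, of n] u1 by simp
      qed
      show "(\<integral>x. (norm (?g n x))\<^sup>2 \<partial>lebesgue_on UNIV) \<le> C" for n
        using L2_extend(2)[OF \<Omega> is_weak_gradientD(1)[OF g], of n] gC by simp
    qed (use U UUL boxes op bd in auto)
    then show False by (rule not0)
  next
    case False
    then have lip: "lipschitz_boundary \<Omega>" using lip by blast
    have Ug: "is_weak_gradient \<Omega> (U n) (g n)" for n by (rule is_weak_gradient_AE[OF op g uL UL Ueq])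
    have U1': "(\<integral>x. (norm (U n x))\<^sup>2 \<partial>lebesgue_on \<Omega>) \<le> 1" for n by (simp add: U1)
    have local: "(\<lambda>n. \<integral>x. (norm (U n x))\<^sup>2 \<partial>lebesgue_on G) \<longlonglongrightarrow> 0"
      if "open G" "bounded G" "d > 0" "\<And>x. x \<in> G \<Longrightarrow> cbox x (x + sq d) \<subseteq> \<Omega>" for G d
      by (rule rellich_local[OF op U _ UL Ug U1' gC boxes that(1-3)]) (use out that(4) in auto)
    have close: "y \<in> ball x r" if "y \<in> cbox x (x + sq d)" "2 * d < r" for x y r d
    proof -
      have "norm (y - x) \<le> \<bar>(y - x) $ 1\<bar> + \<bar>(y - x) $ 2\<bar>"
        using norm_le_l1_cart[of "y - x"] by (simp add: sum_2)
      also have "\<dots> \<le> d + d" using that(1) by (intro add_mono) (auto simp: mem_cbox_2)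
      finally show ?thesis using that(2) by (simp add: dist_norm norm_minus_commute)
    qed
    \<comment> \<open>By compactness of the closure it is enough that each of its points has a ball
      on which the norms tend to 0.\<close>
    have pt: "\<exists>\<rho>>0. (\<lambda>n. \<integral>x. (norm (U n x))\<^sup>2 \<partial>lebesgue_on (\<Omega> \<inter> ball p \<rho>)) \<longlonglongrightarrow> 0" if p: "p \<in> closure \<Omega>" for p
    proof (cases "p \<in> \<Omega>")
      case True
      then obtain r where r: "r > 0" "ball p r \<subseteq> \<Omega>" using op open_contains_ball by blast
      have "(\<lambda>n. \<integral>x. (norm (U n x))\<^sup>2 \<partial>lebesgue_on (\<Omega> \<inter> ball p (r / 4))) \<longlonglongrightarrow> 0"
      proof (rule local[where d = "r / 8"])
        fix x assume x: "x \<in> \<Omega> \<inter> ball p (r / 4)"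
        show "cbox x (x + sq (r / 8)) \<subseteq> \<Omega>"
        proof
          fix y assume "y \<in> cbox x (x + sq (r / 8))"
          then have "y \<in> ball x (r / 2)" by (rule close) (use r in simp)
          then have "y \<in> ball p r" using x r(1) dist_triangle[of p y x] by simp
          then show "y \<in> \<Omega>" using r(2) by blast
        qed
      qed (use op bd r in \<open>auto simp: bounded_Int\<close>)
      then show ?thesis using r(1) by (intro exI[of _ "r / 4"]) simp
    next
      case False
      then have "p \<in> frontier \<Omega>" using p op by (simp add: frontier_def interior_open)
      then obtain \<rho> e c where \<rho>: "\<rho> > 0" "norm e = 1" "c > 0"
        "\<And>x t y. x \<in> \<Omega> \<Longrightarrow> x \<in> ball p \<rho> \<Longrightarrow> 0 < t \<Longrightarrow> t \<le> \<rho> \<Longrightarrow> dist y (x + t *\<^sub>R e) \<le> c * t \<Longrightarrow> y \<in> \<Omega>"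
        by (rule lipschitz_boundary_shift[OF lip]) blast
      let ?G = "\<Omega> \<inter> ball p \<rho>"
      have Go: "open ?G" using op by auto
      note Gs = open_sets_lebesgue[OF Go]
      have "(\<lambda>n. \<integral>x. (norm (U n x))\<^sup>2 \<partial>lebesgue_on ?G) \<longlonglongrightarrow> 0"
      proof (rule LIMSEQ_I)
        fix \<epsilon> :: real assume \<epsilon>: "\<epsilon> > 0"
        \<comment> \<open>Chosen to make the cost \<open>2 * (t\<^sup>2 * C)\<close> of the shift at
          most half of \<epsilon>; the other half comes from the shifted set.\<close>
        define t where "t = min \<rho> (sqrt (\<epsilon> / (4 * (C + 1))))"
        have t: "t > 0" "t \<le> \<rho>" using \<rho>(1) \<epsilon> C0 by (auto simp: t_def)
        have "t \<le> sqrt (\<epsilon> / (4 * (C + 1)))" by (simp add: t_def)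
        then have "t\<^sup>2 \<le> (sqrt (\<epsilon> / (4 * (C + 1))))\<^sup>2" using t(1) by (intro power_mono) auto
        then have t2: "t\<^sup>2 \<le> \<epsilon> / (4 * (C + 1))" using \<epsilon> C0 by simp
        have small: "2 * (t\<^sup>2 * C) \<le> \<epsilon> / 2"
        proof -
          have "t\<^sup>2 * C \<le> \<epsilon> / (4 * (C + 1)) * (C + 1)"
            using t2 C0 \<epsilon> by (intro mult_mono) auto
          also have "\<dots> = \<epsilon> / 4" using C0 by (simp add: field_simps)
          finally show ?thesis by simp
        qed
        let ?z = "t *\<^sub>R e"
        let ?Gt = "(\<lambda>x. x + ?z) ` ?G"
        have Gto: "open ?Gt" using open_affine_image[OF Go linear_id_plane] .
        have Gtb: "bounded ?Gt"
        proof -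
          have "?Gt = (+) ?z ` ?G" by (auto simp: add.commute)
          then show ?thesis using bd bounded_translation[of ?G ?z] by (simp add: bounded_Int)
        qed
        \<comment> \<open>After the shift every point has room \<open>c * t\<close> around it, which
          a box of side \<open>c * t / 4\<close> respects, so the interior case applies.\<close>
        have "(\<lambda>n. \<integral>x. (norm (U n x))\<^sup>2 \<partial>lebesgue_on ?Gt) \<longlonglongrightarrow> 0"
        proof (rule local[OF Gto Gtb, where d = "c * t / 4"])
          show "c * t / 4 > 0" using \<rho>(3) t(1) by simp
          fix y assume "y \<in> ?Gt"
          then obtain x where x: "x \<in> \<Omega>" "x \<in> ball p \<rho>" "y = x + ?z" by auto
          show "cbox y (y + sq (c * t / 4)) \<subseteq> \<Omega>"
          proof
            fix w assume "w \<in> cbox y (y + sq (c * t / 4))"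
            then have "w \<in> ball y (c * t)" by (rule close) (use \<rho>(3) t(1) in simp)
            then have "dist w (x + ?z) \<le> c * t" using x(3) by (simp add: dist_commute)
            then show "w \<in> \<Omega>" by (rule \<rho>(4)[OF x(1,2) t])
          qed
        qed
        from LIMSEQ_D[OF this, of "\<epsilon> / 4"] \<epsilon> obtain n0 where n0:
          "\<And>n. n \<ge> n0 \<Longrightarrow> norm ((\<integral>x. (norm (U n x))\<^sup>2 \<partial>lebesgue_on ?Gt) - 0) < \<epsilon> / 4" by auto
        \<comment> \<open>The shifting property with deviation 0; it speaks of positive shifts, so
          \<open>s = 0\<close> is treated apart.\<close>
        have seg: "x + s *\<^sub>R ?z \<in> \<Omega>" if x: "x \<in> ?G" and s: "0 \<le> s" "s \<le> 1" for x s
        proof (cases "s = 0")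
          case False
          have "s * t \<le> 1 * t" using s t by (intro mult_right_mono) auto
          then have "s * t \<le> \<rho>" using t(2) by linarith
          then show ?thesis
            using \<rho>(4)[of x "s * t" "x + s *\<^sub>R ?z"] x s t False \<rho>(3) by simp
        qed (use x in simp)
        have Gz: "x + ?z \<in> \<Omega>" if "x \<in> ?G" for x using seg[OF that, of 1] by simp
        have est: "(\<integral>x. (norm (U n x))\<^sup>2 \<partial>lebesgue_on ?G) \<le> 2 * (\<integral>x. (norm (U n x))\<^sup>2 \<partial>lebesgue_on ?Gt) + 2 * (t\<^sup>2 * C)" for n
        proof -
          have Lz: "L2 ?G (\<lambda>x. U n (x + ?z))" by (rule L2_translate[OF UL op Go Gz])
          have LG: "L2 ?G (U n)" by (rule L2_subset[OF UL Int_lower1 Gs \<Omega>])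
          have Ld: "L2 ?G (\<lambda>x. U n (x + ?z) - U n x)" by (rule L2_diff[OF Lz LG])
          have mz: "(\<lambda>x. (norm (U n (x + ?z)))\<^sup>2) \<in> borel_measurable (lebesgue_on ?G)"
            by (rule borel_measurable_integrable[OF L2_integrable[OF Lz]])
          have "(\<integral>x. (norm (U n x))\<^sup>2 \<partial>lebesgue_on ?G)
              \<le> (\<integral>x. 2 * (norm (U n (x + ?z)))\<^sup>2 + 2 * (norm (U n (x + ?z) - U n x))\<^sup>2 \<partial>lebesgue_on ?G)"
          proof (rule integral_mono)
            show "(norm (U n x))\<^sup>2 \<le> 2 * (norm (U n (x + ?z)))\<^sup>2 + 2 * (norm (U n (x + ?z) - U n x))\<^sup>2" for x
              using sq_norm_add_le[of "U n (x + ?z)" "- (U n (x + ?z) - U n x)"] unfolding norm_minus_cancel by simp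
          qed (use L2_integrable[OF Lz] L2_integrable[OF LG] L2_integrable[OF Ld] in auto)
          also have "\<dots> = 2 * (\<integral>x. (norm (U n (x + ?z)))\<^sup>2 \<partial>lebesgue_on ?G)
              + 2 * (\<integral>x. (norm (U n (x + ?z) - U n x))\<^sup>2 \<partial>lebesgue_on ?G)"
            using L2_integrable[OF Lz] L2_integrable[OF Ld] by simp
          also have "(\<integral>x. (norm (U n (x + ?z)))\<^sup>2 \<partial>lebesgue_on ?G) = (\<integral>x. (norm (U n x))\<^sup>2 \<partial>lebesgue_on ?Gt)"
            using integral_translate_image[OF mz Gs, of ?z] by simp
          also have "(\<integral>x. (norm (U n (x + ?z) - U n x))\<^sup>2 \<partial>lebesgue_on ?G) \<le> (norm ?z)\<^sup>2 * (\<integral>x. (norm (g n x))\<^sup>2 \<partial>lebesgue_on \<Omega>)"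
            by (rule translation_inequality[OF op UL Ug Go seg])
          also have "(norm ?z)\<^sup>2 * (\<integral>x. (norm (g n x))\<^sup>2 \<partial>lebesgue_on \<Omega>) \<le> t\<^sup>2 * C"
            using gC[of n] \<rho>(2) by (simp add: power_mult_distrib mult_left_mono)
          finally show ?thesis by simp
        qed
        have "norm ((\<integral>x. (norm (U n x))\<^sup>2 \<partial>lebesgue_on ?G) - 0) < \<epsilon>" if "n \<ge> n0" for n
          using est[of n] n0[OF that] small by simp
        then show "\<exists>n0. \<forall>n\<ge>n0. norm ((\<integral>x. (norm (U n x))\<^sup>2 \<partial>lebesgue_on ?G) - 0) < \<epsilon>" by blast
      qed
      then show ?thesis using \<rho>(1) by blast
    qed
    then obtain \<rho> where \<rho>: "\<And>p. p \<in> closure \<Omega> \<Longrightarrow> \<rho> p > 0"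
      "\<And>p. p \<in> closure \<Omega> \<Longrightarrow> (\<lambda>n. \<integral>x. (norm (U n x))\<^sup>2 \<partial>lebesgue_on (\<Omega> \<inter> ball p (\<rho> p))) \<longlonglongrightarrow> 0"
      by metis
    have "compact (closure \<Omega>)" using bd by (simp add: compact_closure)
    then obtain I where I: "I \<subseteq> closure \<Omega>" "finite I" "closure \<Omega> \<subseteq> (\<Union>p\<in>I. ball p (\<rho> p))"
      by (rule compactE_image[where C = "closure \<Omega>" and f = "\<lambda>p. ball p (\<rho> p)"]) (use \<rho>(1) in auto)
    have cov: "\<Omega> \<subseteq> (\<Union>p\<in>I. ball p (\<rho> p))" using I(3) closure_subset by blast
    have "(\<lambda>n. \<Sum>p\<in>I. \<integral>x. (norm (U n x))\<^sup>2 \<partial>lebesgue_on (\<Omega> \<inter> ball p (\<rho> p))) \<longlonglongrightarrow> (\<Sum>p\<in>I. 0)"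
      by (intro tendsto_sum \<rho>(2)) (use I(1) in blast)
    moreover have "1 \<le> (\<Sum>p\<in>I. \<integral>x. (norm (U n x))\<^sup>2 \<partial>lebesgue_on (\<Omega> \<inter> ball p (\<rho> p)))" for n
      using integral_le_sum_cover[OF L2_integrable[OF UL] _ op I(2) _ cov, of n] U1[of n] by simp
    ultimately have "(1::real) \<le> (\<Sum>p\<in>I. 0)" by (intro LIMSEQ_le_const) auto
    then show False by simp
  qed
qed

section \<open>Rigidity\<close>

text \<open>The potential is bounded on a bounded domain, so bounded magnetic energy and norm 1
  force a bounded gradient.\<close>

lemma gradient_bound:
  assumes op: "open \<Omega>" and bd: "bounded \<Omega>" and h: "h > 0"
  obtains K where "\<And>u. u \<in> H1 \<Omega> \<Longrightarrow> Re (ip \<Omega> u u) = 1 \<Longrightarrow>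
    (\<integral>x. (norm (weak_gradient \<Omega> u x))\<^sup>2 \<partial>lebesgue_on \<Omega>) \<le> (2 * Re (mform \<Omega> h \<beta> 1 0 1 u u) + K) / h\<^sup>2"
proof -
  obtain r where r: "\<And>x. x \<in> \<Omega> \<Longrightarrow> norm x \<le> r" using bd by (auto simp: bounded_iff)
  \<comment> \<open>One factor 2 comes from the square of a sum, the other from the two
    components.\<close>
  define k where "k = 4 * (\<bar>\<beta>\<bar> * r)\<^sup>2"
  have "(\<integral>x. (norm (weak_gradient \<Omega> u x))\<^sup>2 \<partial>lebesgue_on \<Omega>) \<le> (2 * Re (mform \<Omega> h \<beta> 1 0 1 u u) + k) / h\<^sup>2"
    if u: "u \<in> H1 \<Omega>" and u1: "Re (ip \<Omega> u u) = 1" for u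
  proof -
    define g where "g = weak_gradient \<Omega> u"
    have g: "is_weak_gradient \<Omega> u g" unfolding g_def by (rule H1_weak_gradient[OF u])
    let ?M = "magnetic_gradient \<Omega> h \<beta> u"
    have LM: "L2 \<Omega> ?M" by (intro L2_vecI L2_magnetic_gradient op bd u)
    have comp: "h\<^sup>2 * (norm (g x $ j))\<^sup>2 \<le> 2 * (norm (?M x $ j))\<^sup>2 + 2 * ((\<bar>\<beta>\<bar> * r)\<^sup>2 * (norm (u x))\<^sup>2)" if x: "x \<in> \<Omega>" for x j
    proof -
      have F: "\<bar>vector_potential \<beta> x $ j\<bar> \<le> \<bar>\<beta>\<bar> * r"
        using vector_potential_bound[of \<beta> x j] mult_left_mono[OF r[OF x], of "\<bar>\<beta>\<bar>"] by linarith
      have "\<i> * of_real h * g x $ j = ?M x $ j + - (of_real (vector_potential \<beta> x $ j) * u x)"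
        by (simp add: magnetic_gradient_def g_def)
      then have "(norm (\<i> * of_real h * g x $ j))\<^sup>2 \<le> 2 * (norm (?M x $ j))\<^sup>2 + 2 * (norm (- (of_real (vector_potential \<beta> x $ j) * u x)))\<^sup>2"
        by (simp only: sq_norm_add_le)
      also have "(norm (- (of_real (vector_potential \<beta> x $ j) * u x)))\<^sup>2 = (\<bar>vector_potential \<beta> x $ j\<bar>)\<^sup>2 * (norm (u x))\<^sup>2"
        by (simp add: norm_mult power_mult_distrib)
      also have "\<dots> \<le> (\<bar>\<beta>\<bar> * r)\<^sup>2 * (norm (u x))\<^sup>2"
        by (intro mult_right_mono power_mono F) auto
      finally show ?thesis by (simp add: norm_mult power_mult_distrib)
    qed
    have pt: "h\<^sup>2 * (norm (g x))\<^sup>2 \<le> 2 * (norm (?M x))\<^sup>2 + k * (norm (u x))\<^sup>2" if "x \<in> \<Omega>" for x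
      using comp[OF that, of 1] comp[OF that, of 2] by (simp add: norm_vec2 k_def algebra_simps)
    have iM: "(\<integral>x. (norm (?M x))\<^sup>2 \<partial>lebesgue_on \<Omega>) = Re (mform \<Omega> h \<beta> 1 0 1 u u)"
      unfolding mform_def using mform_integrable[OF op bd u u, of 1 0 1 h \<beta>]
      by (subst integral_Re[symmetric]) (auto simp: Re_qform_id)
    have "(\<integral>x. h\<^sup>2 * (norm (g x))\<^sup>2 \<partial>lebesgue_on \<Omega>) \<le> (\<integral>x. 2 * (norm (?M x))\<^sup>2 + k * (norm (u x))\<^sup>2 \<partial>lebesgue_on \<Omega>)"
      using L2_integrable[OF LM] L2_integrable[OF H1_L2[OF u]] L2_integrable[OF is_weak_gradientD(1)[OF g]] pt
      by (intro integral_mono) auto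
    also have "\<dots> = 2 * Re (mform \<Omega> h \<beta> 1 0 1 u u) + k"
      using L2_integrable[OF LM] L2_integrable[OF H1_L2[OF u]] iM u1 by (simp add: Re_ip_self)
    finally have "h\<^sup>2 * (\<integral>x. (norm (g x))\<^sup>2 \<partial>lebesgue_on \<Omega>) \<le> 2 * Re (mform \<Omega> h \<beta> 1 0 1 u u) + k" by simp
    then show ?thesis using h by (simp add: g_def pos_le_divide_eq mult.commute)
  qed
  then show ?thesis using that[of k] by blast
qed

text \<open>Prepares Cauchy--Schwarz for the energy above the lowest value \<open>l\<close>: along a
  minimizing sequence the factor belonging to the sequence tends to 0.\<close>

lemma hermitian_form_shift:
  assumes "hermitian_form V a" "hermitian_form V m"
    and "\<And>u. u \<in> V \<Longrightarrow> l * Re (m u u) \<le> Re (a u u)"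
  shows "hermitian_form V (\<lambda>u v. a u v - of_real l * m u v)"
proof -
  interpret a: hermitian_form V a by (rule assms(1))
  interpret m: hermitian_form V m by (rule assms(2))
  show ?thesis
  proof
    fix u v :: "'a \<Rightarrow> complex"
    assume "u \<in> V" "v \<in> V"
    then show "a v u - of_real l * m v u = cnj (a u v - of_real l * m u v)"
      using a.form_sym[of u v] m.form_sym[of u v] by simp
  qed (use assms(3) in \<open>auto simp: a.V_zero a.V_add a.V_cmult a.form_add m.form_add a.form_cmult m.form_cmult algebra_simps\<close>)
qed

theorem first_eigenvalue_rigidity:
  assumes W: "trial_space W" and lip: "W = H1_0 \<or> lipschitz_boundary \<Omega>"
    and op: "open \<Omega>" and bd: "bounded \<Omega>" and ne: "\<Omega> \<noteq> {}" and h: "h > 0" and \<beta>: "\<beta> \<noteq> 0"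
    and N: "N \<ge> 3" and sym: "rot (2 * pi / real N) ` \<Omega> = \<Omega>"
    and psd: "psd a b d" and tr: "a + d = 2"
    and eq: "minimax (ae_zero \<Omega>) (W \<Omega>) (mquot \<Omega> h \<beta> a b d) 1 = minimax (ae_zero \<Omega>) (W \<Omega>) (mquot \<Omega> h \<beta> 1 0 1) 1"
  shows "a = 1 \<and> b = 0"
proof (rule ccontr)
  assume aniso: "\<not> (a = 1 \<and> b = 0)"
  define l where "l = minimax (ae_zero \<Omega>) (W \<Omega>) (mquot \<Omega> h \<beta> 1 0 1) 1"
  note F = trial_space_facts[OF W op]
  have psd1: "psd 1 0 1" by (simp add: psd_def Re_qform_id)
  have m: "hermitian_form (W \<Omega>) (ip \<Omega>)" by (rule hermitian_form_ip[OF F(1-4)])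
  have fA: "hermitian_form (W \<Omega>) (mform \<Omega> h \<beta> a b d)" by (rule hermitian_form_mform[OF op bd F(1) psd F(2-4)])
  have fI: "hermitian_form (W \<Omega>) (mform \<Omega> h \<beta> 1 0 1)" by (rule hermitian_form_mform[OF op bd F(1) psd1 F(2-4)])
  have tr1: "(1::real) + 1 = 2" by simp
  have lA: "l * Re (ip \<Omega> u u) \<le> Re (mform \<Omega> h \<beta> a b d u u)" if "u \<in> W \<Omega>" for u
    unfolding l_def eq[symmetric] by (rule minimax_1_le[OF op bd h N sym W ne psd tr that])
  have lI: "l * Re (ip \<Omega> u u) \<le> Re (mform \<Omega> h \<beta> 1 0 1 u u)" if "u \<in> W \<Omega>" for u
    unfolding l_def by (rule minimax_1_le[OF op bd h N sym W ne psd1 tr1 that])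
  interpret A: hermitian_form "W \<Omega>" "\<lambda>u v. mform \<Omega> h \<beta> a b d u v - of_real l * ip \<Omega> u v"
    by (rule hermitian_form_shift[OF fA m lA])
  interpret I: hermitian_form "W \<Omega>" "\<lambda>u v. mform \<Omega> h \<beta> 1 0 1 u v - of_real l * ip \<Omega> u v"
    by (rule hermitian_form_shift[OF fI m lI])
  have "\<forall>n. \<exists>u. u \<in> W \<Omega> \<and> Re (ip \<Omega> u u) = 1 \<and> Re (mform \<Omega> h \<beta> 1 0 1 u u) \<le> l + inverse (real (Suc n))"
  proof
    fix n
    show "\<exists>u. u \<in> W \<Omega> \<and> Re (ip \<Omega> u u) = 1 \<and> Re (mform \<Omega> h \<beta> 1 0 1 u u) \<le> l + inverse (real (Suc n))"
      unfolding l_def by (rule minimizing_sequence[OF op bd h N sym W ne psd tr, of "inverse (real (Suc n))"]) auto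
  qed
  then obtain u where uall: "\<forall>n. u n \<in> W \<Omega> \<and> Re (ip \<Omega> (u n) (u n)) = 1 \<and> Re (mform \<Omega> h \<beta> 1 0 1 (u n) (u n)) \<le> l + inverse (real (Suc n))"
    by (rule choice[THEN exE])
  have uW: "u n \<in> W \<Omega>" and u1: "Re (ip \<Omega> (u n) (u n)) = 1"
    and ul: "Re (mform \<Omega> h \<beta> 1 0 1 (u n) (u n)) - l \<le> inverse (real (Suc n))" for n
    using uall by (auto simp: algebra_simps)
  have uH: "u n \<in> H1 \<Omega>" for n using uW F(1) by blast
  have ulA: "Re (mform \<Omega> h \<beta> a b d (u n) (u n)) - l \<le> real N * inverse (real (Suc n))" for n
  proof -
    have "Re (mform \<Omega> h \<beta> a b d (u n) (u n)) - l * Re (ip \<Omega> (u n) (u n))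
        \<le> real N * (Re (mform \<Omega> h \<beta> 1 0 1 (u n) (u n)) - l * Re (ip \<Omega> (u n) (u n)))"
      by (rule minimax_1_gap[OF op bd h N sym W ne psd tr uW]) (simp only: eq l_def)
    also have "\<dots> \<le> real N * inverse (real (Suc n))" using ul[of n] u1[of n] by (intro mult_left_mono) auto
    finally show ?thesis using u1[of n] by simp
  qed
  have lim0: "(\<lambda>n. f n) \<longlonglongrightarrow> 0"
    if "\<And>n. (cmod (f n))\<^sup>2 \<le> (k * inverse (real (Suc n))) * w" "w \<ge> 0" "k \<ge> 0" for f :: "nat \<Rightarrow> complex" and k w
  proof -
    have "(\<lambda>n. (k * inverse (real (Suc n))) * w) \<longlonglongrightarrow> (k * 0) * w"
      by (intro tendsto_intros LIMSEQ_inverse_real_of_nat)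
    then have l: "(\<lambda>n. (k * inverse (real (Suc n))) * w) \<longlonglongrightarrow> 0" by simp
    have "(\<lambda>n. (cmod (f n))\<^sup>2) \<longlonglongrightarrow> 0"
      by (rule tendsto_sandwich[OF _ _ tendsto_const l]) (use that(1) in auto)
    from tendsto_real_sqrt[OF this] have "(\<lambda>n. cmod (f n)) \<longlonglongrightarrow> 0" by simp
    then show ?thesis by (rule tendsto_norm_zero_cancel)
  qed
  have wI: "(\<lambda>n. mform \<Omega> h \<beta> 1 0 1 (u n) v - of_real l * ip \<Omega> (u n) v) \<longlonglongrightarrow> 0" if v: "v \<in> W \<Omega>" for v
  proof (rule lim0[of _ 1 "Re (mform \<Omega> h \<beta> 1 0 1 v v - of_real l * ip \<Omega> v v)"])
    fix n
    have "Re (mform \<Omega> h \<beta> 1 0 1 (u n) (u n) - of_real l * ip \<Omega> (u n) (u n)) \<le> 1 * inverse (real (Suc n))"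
      using ul[of n] u1[of n] by simp
    then show "(cmod (mform \<Omega> h \<beta> 1 0 1 (u n) v - of_real l * ip \<Omega> (u n) v))\<^sup>2
        \<le> (1 * inverse (real (Suc n))) * Re (mform \<Omega> h \<beta> 1 0 1 v v - of_real l * ip \<Omega> v v)"
      by (rule order_trans[OF I.form_Cauchy_Schwarz[OF uW v] mult_right_mono[OF _ I.form_nonneg[OF v]]])
  qed (use I.form_nonneg[OF v] in auto)
  have wA: "(\<lambda>n. mform \<Omega> h \<beta> a b d (u n) v - of_real l * ip \<Omega> (u n) v) \<longlonglongrightarrow> 0" if v: "v \<in> W \<Omega>" for v
  proof (rule lim0[of _ "real N" "Re (mform \<Omega> h \<beta> a b d v v - of_real l * ip \<Omega> v v)"])
    fix n
    have "Re (mform \<Omega> h \<beta> a b d (u n) (u n) - of_real l * ip \<Omega> (u n) (u n)) \<le> real N * inverse (real (Suc n))"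
      using ulA[of n] u1[of n] by simp
    then show "(cmod (mform \<Omega> h \<beta> a b d (u n) v - of_real l * ip \<Omega> (u n) v))\<^sup>2
        \<le> (real N * inverse (real (Suc n))) * Re (mform \<Omega> h \<beta> a b d v v - of_real l * ip \<Omega> v v)"
      by (rule order_trans[OF A.form_Cauchy_Schwarz[OF uW v] mult_right_mono[OF _ A.form_nonneg[OF v]]])
  qed (use A.form_nonneg[OF v] in auto)
  have uL: "L2 \<Omega> (u n)" for n by (rule H1_L2[OF uH])
  note tL = test_function_L2[OF _ open_sets_lebesgue[OF op]]
  have ip_add: "ip \<Omega> (u n) (\<lambda>x. v x + w x) = ip \<Omega> (u n) v + ip \<Omega> (u n) w"
    if "test_function \<Omega> v" "test_function \<Omega> w" for n v w
    by (rule L2.form_add_right) (use uL tL that in auto)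
  have ip_cmult: "ip \<Omega> (u n) (\<lambda>x. k * v x) = cnj k * ip \<Omega> (u n) v" if "test_function \<Omega> v" for n v k
    by (rule L2.form_cmult_right) (use uL tL that in auto)
  let ?X = "mop h \<beta> 1" and ?Y = "mop h \<beta> 2"
  \<comment> \<open>As \<open>a + d = 2\<close>, the difference of the two forms has the traceless
    matrix with entries \<open>a - 1\<close> and \<open>b\<close>. It supplies the expression for
    \<open>K\<close>, and it is not zero because the form was assumed to be anisotropic.\<close>
  interpret C: commutation "test_function \<Omega>" "\<lambda>v. (\<lambda>n. ip \<Omega> (u n) v) \<longlonglongrightarrow> 0" ?X ?Y
    "\<i> * of_real (h * \<beta>)" "of_real l" "of_real (a - 1)" "of_real b"
  proof
    fix v w k
    assume v: "test_function \<Omega> v"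
    have tXX: "test_function \<Omega> (?X (?X v))" "test_function \<Omega> (?Y (?Y v))" "test_function \<Omega> (?X (?Y v))" "test_function \<Omega> (?Y (?X v))"
      by (intro test_function_mop v)+
    show "test_function \<Omega> (\<lambda>x. k * v x)" by (rule test_function_cmult[OF v])
    show "test_function \<Omega> (?X v)" "test_function \<Omega> (?Y v)" by (rule test_function_mop[OF v])+
    show "?X (\<lambda>x. k * v x) = (\<lambda>x. k * ?X v x)" "?Y (\<lambda>x. k * v x) = (\<lambda>x. k * ?Y v x)" by (rule mop_cmult[OF v])+
    show "?X (?Y v) = (\<lambda>x. ?Y (?X v) x + \<i> * of_real (h * \<beta>) * v x)" by (rule mop_commute[OF v])
    show "(\<lambda>n. ip \<Omega> (u n) (\<lambda>x. k * v x)) \<longlonglongrightarrow> 0" if "(\<lambda>n. ip \<Omega> (u n) v) \<longlonglongrightarrow> 0"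
      unfolding ip_cmult[OF v] using that by (rule tendsto_mult_right_zero)
    show "(\<lambda>n. ip \<Omega> (u n) (\<lambda>x. ?X (?X v) x + (?Y (?Y v) x + (- of_real l) * v x))) \<longlonglongrightarrow> 0"
    proof -
      have "mform \<Omega> h \<beta> 1 0 1 (u n) v - of_real l * ip \<Omega> (u n) v
          = ip \<Omega> (u n) (\<lambda>x. ?X (?X v) x + (?Y (?Y v) x + (- of_real l) * v x))" for n
      proof -
        have "ip \<Omega> (u n) (\<lambda>x. ?X (?X v) x + (?Y (?Y v) x + (- of_real l) * v x))
            = ip \<Omega> (u n) (?X (?X v)) + (ip \<Omega> (u n) (?Y (?Y v)) + cnj (- of_real l) * ip \<Omega> (u n) v)"
          by (simp only: ip_add ip_cmult tXX v test_function_add test_function_cmult)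
        moreover have "mform \<Omega> h \<beta> 1 0 1 (u n) v = ip \<Omega> (u n) (?X (?X v)) + ip \<Omega> (u n) (?Y (?Y v))"
          unfolding mform_test[OF op bd uH v] using ip_add[OF tXX(1,2)] by simp
        ultimately show ?thesis by simp
      qed
      then show ?thesis using wI[OF F(5)[OF v]] by simp
    qed
    show "(\<lambda>n. ip \<Omega> (u n) (\<lambda>x. of_real (a - 1) * (?X (?X v) x + (-1) * ?Y (?Y v) x)
        + of_real b * (?X (?Y v) x + ?Y (?X v) x))) \<longlonglongrightarrow> 0"
    proof -
      have d: "d = 2 - a" using tr by simp
      have 1: "mform \<Omega> h \<beta> a b d (u n) v = of_real a * ip \<Omega> (u n) (?X (?X v)) + (of_real b * (ip \<Omega> (u n) (?X (?Y v)) + ip \<Omega> (u n) (?Y (?X v)))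
          + of_real d * ip \<Omega> (u n) (?Y (?Y v)))" for a b d n
        unfolding mform_test[OF op bd uH v]
        by (simp only: ip_add ip_cmult tXX test_function_add test_function_cmult complex_cnj_complex_of_real)
      have 2: "ip \<Omega> (u n) (\<lambda>x. of_real (a - 1) * (?X (?X v) x + (-1) * ?Y (?Y v) x) + of_real b * (?X (?Y v) x + ?Y (?X v) x))
          = of_real (a - 1) * (ip \<Omega> (u n) (?X (?X v)) + (-1) * ip \<Omega> (u n) (?Y (?Y v)))
            + of_real b * (ip \<Omega> (u n) (?X (?Y v)) + ip \<Omega> (u n) (?Y (?X v)))" for n
        by (simp only: ip_add ip_cmult tXX test_function_add test_function_cmult complex_cnj_complex_of_real
            complex_cnj_minus complex_cnj_one)
      have "ip \<Omega> (u n) (\<lambda>x. of_real (a - 1) * (?X (?X v) x + (-1) * ?Y (?Y v) x) + of_real b * (?X (?Y v) x + ?Y (?X v) x))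
          = (mform \<Omega> h \<beta> a b d (u n) v - of_real l * ip \<Omega> (u n) v) - (mform \<Omega> h \<beta> 1 0 1 (u n) v - of_real l * ip \<Omega> (u n) v)" for n
        unfolding 1 2 d by (simp add: algebra_simps)
      then show ?thesis using tendsto_diff[OF wA[OF F(5)[OF v]] wI[OF F(5)[OF v]]] by simp
    qed
    assume w: "test_function \<Omega> w"
    show "test_function \<Omega> (\<lambda>x. v x + w x)" by (rule test_function_add[OF v w])
    show "?X (\<lambda>x. v x + w x) = (\<lambda>x. ?X v x + ?X w x)" "?Y (\<lambda>x. v x + w x) = (\<lambda>x. ?Y v x + ?Y w x)" by (rule mop_add[OF v w])+
    show "(\<lambda>n. ip \<Omega> (u n) (\<lambda>x. v x + w x)) \<longlonglongrightarrow> 0"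
      if "(\<lambda>n. ip \<Omega> (u n) v) \<longlonglongrightarrow> 0" "(\<lambda>n. ip \<Omega> (u n) w) \<longlonglongrightarrow> 0"
      unfolding ip_add[OF v w] using tendsto_add[OF that] by simp
  next
    show "\<i> * complex_of_real (h * \<beta>) \<noteq> 0" using h \<beta> by simp
    have "(a - 1)\<^sup>2 + b\<^sup>2 \<noteq> 0" using aniso by (simp add: sum_power2_eq_zero_iff)
    then show "(complex_of_real (a - 1))\<^sup>2 + (complex_of_real b)\<^sup>2 \<noteq> 0"
      by (metis of_real_0 of_real_add of_real_eq_iff of_real_power)
    \<comment> \<open>The commutator is imaginary, so its square is negative and the difference
      becomes a sum.\<close>
    have "l\<^sup>2 + 3 * (h * \<beta>)\<^sup>2 > 0" using h \<beta> by (intro add_nonneg_pos) auto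
    moreover have "(complex_of_real l)\<^sup>2 - 3 * (\<i> * complex_of_real (h * \<beta>))\<^sup>2 = of_real (l\<^sup>2 + 3 * (h * \<beta>)\<^sup>2)"
      by (simp add: power_mult_distrib)
    ultimately show "(complex_of_real l)\<^sup>2 - 3 * (\<i> * complex_of_real (h * \<beta>))\<^sup>2 \<noteq> 0"
      by (metis less_irrefl of_real_eq_0_iff)
  qed
  obtain K where K: "\<And>u. u \<in> H1 \<Omega> \<Longrightarrow> Re (ip \<Omega> u u) = 1 \<Longrightarrow>
    (\<integral>x. (norm (weak_gradient \<Omega> u x))\<^sup>2 \<partial>lebesgue_on \<Omega>) \<le> (2 * Re (mform \<Omega> h \<beta> 1 0 1 u u) + K) / h\<^sup>2"
    by (rule gradient_bound[OF op bd h, of \<beta>]) blast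
  show False
  proof (rule weakly_null_bounded_false[OF W lip op bd uW])
    show "(\<integral>x. (norm (u n x))\<^sup>2 \<partial>lebesgue_on \<Omega>) = 1" for n using u1[of n] by (simp only: Re_ip_self)
    show "(\<integral>x. (norm (weak_gradient \<Omega> (u n) x))\<^sup>2 \<partial>lebesgue_on \<Omega>) \<le> (2 * (l + 1) + K) / h\<^sup>2" for n
    proof -
      have "inverse (real (Suc n)) \<le> 1" by (simp add: inverse_le_1_iff)
      then have "Re (mform \<Omega> h \<beta> 1 0 1 (u n) (u n)) \<le> l + 1" using ul[of n] by linarith
      then have "(2 * Re (mform \<Omega> h \<beta> 1 0 1 (u n) (u n)) + K) / h\<^sup>2 \<le> (2 * (l + 1) + K) / h\<^sup>2"
        by (intro divide_right_mono) auto
      with K[OF uH u1] show ?thesis by (rule order_trans)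
    qed
    show "(\<lambda>n. ip \<Omega> (u n) \<phi>) \<longlonglongrightarrow> 0" if "test_function \<Omega> \<phi>" for \<phi> by (rule C.N_all[OF that])
  qed
qed

section \<open>Comparison of eigenvalues\<close>

lemma rotation_about_translate:
  assumes "rotation_about p \<theta> ` D = D"
  shows "rot \<theta> ` ((\<lambda>x. x - p) ` D) = (\<lambda>x. x - p) ` D"
proof -
  have "rot \<theta> ` ((\<lambda>x. x - p) ` D) = (\<lambda>x. x - p) ` (rotation_about p \<theta> ` D)"
    unfolding image_image by (intro image_cong refl) (simp add: rotation_about_def rot_def)
  then show ?thesis using assms by simp
qed

lemma lipschitz_boundary_translate:
  assumes "lipschitz_boundary \<Omega>"
  shows "lipschitz_boundary ((\<lambda>x. x - p) ` \<Omega>)"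
  unfolding lipschitz_boundary_def
proof
  have im: "(\<lambda>x. x - p) ` A = (+) (- p) ` A" for A by (intro image_cong refl) simp
  fix y assume "y \<in> frontier ((\<lambda>x. x - p) ` \<Omega>)"
  then have "y + p \<in> frontier \<Omega>" unfolding im frontier_translation by auto
  from assms[unfolded lipschitz_boundary_def, rule_format, OF this]
  obtain r Q \<gamma> L where r: "r > 0" and Q: "orthogonal_transformation (Q :: real^2 \<Rightarrow> real^2)"
    and \<gamma>: "L-lipschitz_on UNIV (\<gamma> :: real \<Rightarrow> real)"
    and eq: "\<Omega> \<inter> ball (y + p) r = {x \<in> ball (y + p) r. \<gamma> (Q (x - (y + p)) $ 1) < Q (x - (y + p)) $ 2}"
    by blast
  have "(\<lambda>x. x - p) ` \<Omega> \<inter> ball y r = {x \<in> ball y r. \<gamma> (Q (x - y) $ 1) < Q (x - y) $ 2}"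
  proof (rule set_eqI)
    fix x
    have "x \<in> (\<lambda>x. x - p) ` \<Omega> \<longleftrightarrow> x + p \<in> \<Omega>" by (auto simp: image_iff algebra_simps)
    moreover have "x \<in> ball y r \<longleftrightarrow> x + p \<in> ball (y + p) r" by (simp add: dist_norm)
    moreover have "x + p - (y + p) = x - y" by simp
    ultimately show "x \<in> (\<lambda>x. x - p) ` \<Omega> \<inter> ball y r \<longleftrightarrow> x \<in> {x \<in> ball y r. \<gamma> (Q (x - y) $ 1) < Q (x - y) $ 2}"
      using arg_cong[OF eq, of "\<lambda>S. x + p \<in> S"] by simp
  qed
  then show "\<exists>r>0. \<exists>(Q :: real^2 \<Rightarrow> real^2) (\<gamma> :: real \<Rightarrow> real) L. orthogonal_transformation Q \<and> L-lipschitz_on UNIV \<gamma> \<and>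
      (\<lambda>x. x - p) ` \<Omega> \<inter> ball y r = {x \<in> ball y r. \<gamma> (Q (x - y) $ 1) < Q (x - y) $ 2}"
    using r Q \<gamma> by blast
qed

lemma sq_hs_norm: "(hs_norm (M :: real^2^2))\<^sup>2 = (M$1$1)\<^sup>2 + (M$1$2)\<^sup>2 + ((M$2$1)\<^sup>2 + (M$2$2)\<^sup>2)"
  unfolding hs_norm_def power2_abs by (simp add: sum_2)

lemma linear_orthogonal_columns:
  assumes T: "linear (T :: real^2 \<Rightarrow> real^2)"
    and n: "(matrix T$1$1)\<^sup>2 + (matrix T$2$1)\<^sup>2 = k\<^sup>2" "(matrix T$1$2)\<^sup>2 + (matrix T$2$2)\<^sup>2 = k\<^sup>2"
    and o: "matrix T$1$1 * matrix T$1$2 + matrix T$2$1 * matrix T$2$2 = 0"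
  shows "(norm (T x))\<^sup>2 = k\<^sup>2 * (norm x)\<^sup>2"
proof -
  let ?t = "matrix T"
  have sq: "(norm z)\<^sup>2 = (z$1)\<^sup>2 + (z$2)\<^sup>2" for z :: "real^2" by (simp add: norm_vec_def L2_set_def sum_2)
  have "(norm (T x))\<^sup>2 = ((?t$1$1)\<^sup>2 + (?t$2$1)\<^sup>2) * (x$1)\<^sup>2 + ((?t$1$2)\<^sup>2 + (?t$2$2)\<^sup>2) * (x$2)\<^sup>2
      + 2 * (?t$1$1 * ?t$1$2 + ?t$2$1 * ?t$2$2) * (x$1 * x$2)"
    unfolding sq linear_vec_nth[OF T] by (simp add: power2_eq_square algebra_simps)
  also have "\<dots> = k\<^sup>2 * (norm x)\<^sup>2" unfolding n o sq by (simp add: algebra_simps)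
  finally show ?thesis .
qed

text \<open>Replaces the pair \<open>c\<close>, \<open>Q\<close> by a single condition on norms. The
  case \<open>k = 0\<close> forces \<open>T = 0\<close>, which is the multiple 0 of the
  identity.\<close>

lemma norm_scalar_multiple_of_orthogonal:
  assumes T: "linear T"
  shows "scalar_multiple_of_orthogonal T \<longleftrightarrow> (\<exists>k. \<forall>x. norm (T x) = k * norm x)"
proof
  assume "scalar_multiple_of_orthogonal T"
  then obtain c Q where Q: "orthogonal_transformation Q" and TQ: "T = (\<lambda>x. c *\<^sub>R Q x)"
    unfolding scalar_multiple_of_orthogonal_def by blast
  then have "norm (T x) = \<bar>c\<bar> * norm x" for x by (simp add: orthogonal_transformation_norm)
  then show "\<exists>k. \<forall>x. norm (T x) = k * norm x" by blast
next
  assume "\<exists>k. \<forall>x. norm (T x) = k * norm x"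
  then obtain k where k: "\<And>x. norm (T x) = k * norm x" by blast
  show "scalar_multiple_of_orthogonal T"
  proof (cases "k = 0")
    case True
    then have "T = (\<lambda>x. 0 *\<^sub>R x)" using k by (intro ext) simp
    then show ?thesis unfolding scalar_multiple_of_orthogonal_def using orthogonal_transformation_id by blast
  next
    case False
    have k0: "k \<ge> 0" using k[of "axis 1 1"] norm_ge_zero[of "T (axis 1 1)"] by simp
    have "orthogonal_transformation (\<lambda>x. inverse k *\<^sub>R T x)"
      unfolding orthogonal_transformation using k k0 False by (auto intro!: linear_compose_scale_right T)
    moreover have "T = (\<lambda>x. k *\<^sub>R (inverse k *\<^sub>R T x))" using False by simp
    ultimately show ?thesis unfolding scalar_multiple_of_orthogonal_def by (intro exI[of _ k] exI[of _ "\<lambda>x. inverse k *\<^sub>R T x"] conjI)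
  qed
qed

text \<open>By Cramer's rule the matrix of the form has, up to a positive factor \<open>r\<close>,
  the squared lengths of the columns of \<open>T\<close> on its diagonal, in exchanged order, and
  minus their inner product beside it. With trace 2, \<open>a = 1\<close> and \<open>b = 0\<close>
  thus mean orthogonal columns of equal length.\<close>

lemma scalar_multiple_of_orthogonal_iff:
  assumes T: "linear T" "bij T"
  defines "s \<equiv> sqrt 2 / hs_norm (matrix (inv T))" and "B \<equiv> matrix (inv T)"
  defines "a \<equiv> s\<^sup>2 * ((B$1$1)\<^sup>2 + (B$1$2)\<^sup>2)" and "b \<equiv> s\<^sup>2 * (B$1$1 * B$2$1 + B$1$2 * B$2$2)"
    and "d \<equiv> s\<^sup>2 * ((B$2$1)\<^sup>2 + (B$2$2)\<^sup>2)"
  shows "s > 0" "a + d = 2" "scalar_multiple_of_orthogonal T \<longleftrightarrow> a = 1 \<and> b = 0"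
proof -
  let ?t = "matrix T" and ?k = "hs_norm B"
  have dt: "det ?t \<noteq> 0" using T by (metis det_nz_iff_inj bij_is_inj matrix_works)
  note inv = inverse_matrix_2[OF T, folded B_def]
  have k0: "?k \<noteq> 0"
  proof
    assume "?k = 0"
    then have "(B$1$1)\<^sup>2 + (B$1$2)\<^sup>2 + ((B$2$1)\<^sup>2 + (B$2$2)\<^sup>2) = 0" using sq_hs_norm[of B] by simp
    then have "B$1$1 = 0" "B$1$2 = 0" by (auto simp: add_nonneg_eq_0_iff)
    then have "?t$2$2 = 0" "?t$1$2 = 0" using inv by auto
    then show False using dt by (simp add: det_2)
  qed
  have "?k \<ge> 0" by (simp add: hs_norm_def sum_nonneg)
  then show "s > 0" using k0 by (simp add: s_def B_def)
  have s2: "s\<^sup>2 * ?k\<^sup>2 = 2" using k0 by (simp add: s_def B_def power_divide)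
  then show ad: "a + d = 2" unfolding sq_hs_norm a_def d_def by (simp add: algebra_simps)
  have s0: "s\<^sup>2 \<noteq> 0" using s2 by auto
  have inv': "B$1$1 = ?t$2$2 / det ?t" "B$1$2 = - ?t$1$2 / det ?t" "B$2$1 = - ?t$2$1 / det ?t" "B$2$2 = ?t$1$1 / det ?t"
    using inv dt by (simp_all add: field_simps)
  define r where "r = s\<^sup>2 / (det ?t)\<^sup>2"
  have r0: "r > 0" using s0 dt by (simp add: r_def)
  have A: "a = r * ((?t$1$2)\<^sup>2 + (?t$2$2)\<^sup>2)" "d = r * ((?t$1$1)\<^sup>2 + (?t$2$1)\<^sup>2)"
    "b = - r * (?t$1$1 * ?t$1$2 + ?t$2$1 * ?t$2$2)"
    unfolding a_def b_def d_def inv' r_def by (simp_all add: power2_eq_square add_divide_distrib algebra_simps)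
  show "scalar_multiple_of_orthogonal T \<longleftrightarrow> a = 1 \<and> b = 0"
    unfolding norm_scalar_multiple_of_orthogonal[OF T(1)]
  proof
    assume "\<exists>k. \<forall>x. norm (T x) = k * norm x"
    then obtain k where k: "\<And>x. norm (T x) = k * norm x" by blast
    have sq: "((T x)$1)\<^sup>2 + ((T x)$2)\<^sup>2 = k\<^sup>2 * ((x$1)\<^sup>2 + (x$2)\<^sup>2)" for x
    proof -
      have "(norm (T x))\<^sup>2 = k\<^sup>2 * (norm x)\<^sup>2" unfolding k by (simp add: power_mult_distrib)
      then show ?thesis by (simp add: norm_vec_def L2_set_def sum_2)
    qed
    \<comment> \<open>The basis vectors yield the lengths of the columns, and their sum yields the
      inner product.\<close>
    have 1: "(?t$1$1)\<^sup>2 + (?t$2$1)\<^sup>2 = k\<^sup>2" using sq[of "vector [1,0]"] unfolding linear_vec_nth[OF T(1)] by simp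
    have 2: "(?t$1$2)\<^sup>2 + (?t$2$2)\<^sup>2 = k\<^sup>2" using sq[of "vector [0,1]"] unfolding linear_vec_nth[OF T(1)] by simp
    have 3: "(?t$1$1 + ?t$1$2)\<^sup>2 + (?t$2$1 + ?t$2$2)\<^sup>2 = k\<^sup>2 * 2" using sq[of "vector [1,1]"] unfolding linear_vec_nth[OF T(1)] by simp
    have "?t$1$1 * ?t$1$2 + ?t$2$1 * ?t$2$2 = 0" using 1 2 3 by (simp add: power2_sum)
    moreover have "a = d" unfolding A 1 2 ..
    ultimately show "a = 1 \<and> b = 0" using ad A(3) by simp
  next
    assume ab: "a = 1 \<and> b = 0"
    then have d1: "d = 1" using ad by simp
    define k where "k = sqrt ((?t$1$1)\<^sup>2 + (?t$2$1)\<^sup>2)"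
    have k: "(?t$1$1)\<^sup>2 + (?t$2$1)\<^sup>2 = k\<^sup>2" "0 \<le> k" by (simp_all add: k_def)
    have "r * ((?t$1$2)\<^sup>2 + (?t$2$2)\<^sup>2) = r * ((?t$1$1)\<^sup>2 + (?t$2$1)\<^sup>2)" using ab d1 A by simp
    then have 2: "(?t$1$2)\<^sup>2 + (?t$2$2)\<^sup>2 = k\<^sup>2" using r0 k(1) by simp
    have 3: "?t$1$1 * ?t$1$2 + ?t$2$1 * ?t$2$2 = 0" using ab A(3) r0 by simp
    have "norm (T x) = k * norm x" for x
    proof -
      have "(norm (T x))\<^sup>2 = (k * norm x)\<^sup>2"
        using linear_orthogonal_columns[OF T(1) k(1) 2 3] by (simp add: power_mult_distrib)
      then show ?thesis by (rule power2_eq_imp_eq) (use k(2) in auto)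
    qed
    then show "\<exists>k. \<forall>x. norm (T x) = k * norm x" by blast
  qed
qed

text \<open>Both domains are affine images of the centred one: \<open>D\<close> by the translation
  by \<open>p\<close>, its image by \<open>T\<close> followed by the translation by
  \<open>T p\<close>. Both families of eigenvalues thus become minimax values on a single domain,
  for the matrix given by \<open>a\<close>, \<open>b\<close>, \<open>d\<close> and for the
  identity.\<close>

lemma eigenvalue_comparison:
  fixes \<beta> :: real
  assumes W: "trial_space W" and h: "h > 0" and D: "plane_domain D" "bounded D"
    and N: "N \<ge> 3" and sym: "rotational_symmetry D N" and T: "linear T" "bij T"
    and lip: "W = H1_0 \<or> lipschitz_boundary D"
  defines "s \<equiv> sqrt 2 / hs_norm (matrix (inv T))"
  defines "h' \<equiv> s * h" and "\<beta>' \<equiv> s * (\<beta> / \<bar>det (matrix T)\<bar>)"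
  shows "(\<forall>n\<ge>1. (\<Sum>j=1..n. minimax_eigenvalue (T ` D) (W (T ` D)) h' \<beta>' j) \<le> (\<Sum>j=1..n. minimax_eigenvalue D (W D) h \<beta> j)) \<and>
    (scalar_multiple_of_orthogonal T \<longrightarrow>
      (\<forall>n\<ge>1. (\<Sum>j=1..n. minimax_eigenvalue (T ` D) (W (T ` D)) h' \<beta>' j) = (\<Sum>j=1..n. minimax_eigenvalue D (W D) h \<beta> j))) \<and>
    (\<beta> \<noteq> 0 \<longrightarrow>
      (minimax_eigenvalue (T ` D) (W (T ` D)) h' \<beta>' 1 = minimax_eigenvalue D (W D) h \<beta> 1 \<longleftrightarrow> scalar_multiple_of_orthogonal T))"
proof -
  obtain p where p: "rotation_about p (2 * pi / real N) ` D = D" using sym unfolding rotational_symmetry_def by blast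
  define \<Omega> where "\<Omega> = (\<lambda>x. x - p) ` D"
  have rot: "rot (2 * pi / real N) ` \<Omega> = \<Omega>" unfolding \<Omega>_def by (rule rotation_about_translate[OF p])
  have im: "\<Omega> = (+) (- p) ` D" unfolding \<Omega>_def by (intro image_cong refl) simp
  have op: "open \<Omega>" and bd: "bounded \<Omega>" and ne: "\<Omega> \<noteq> {}"
    using D open_translation[of D "- p"] bounded_translation[of D "- p"] unfolding im plane_domain_def by auto
  have lip': "W = H1_0 \<or> lipschitz_boundary \<Omega>" unfolding \<Omega>_def using lip lipschitz_boundary_translate by blast
  have D_eq: "(\<lambda>x. x + p) ` \<Omega> = D" unfolding \<Omega>_def image_image by simp
  have TD: "(\<lambda>x. T x + T p) ` \<Omega> = T ` D"
    unfolding \<Omega>_def image_image by (intro image_cong refl) (simp add: linear_diff[OF T(1)])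
  let ?B = "matrix (inv T)"
  define a b d where "a = s\<^sup>2 * ((?B$1$1)\<^sup>2 + (?B$1$2)\<^sup>2)" and "b = s\<^sup>2 * (?B$1$1 * ?B$2$1 + ?B$1$2 * ?B$2$2)"
    and "d = s\<^sup>2 * ((?B$2$1)\<^sup>2 + (?B$2$2)\<^sup>2)"
  note S = scalar_multiple_of_orthogonal_iff[OF T, folded s_def, folded a_def b_def d_def]
  have h0: "s * h \<noteq> 0" using S(1) h by simp
  have psd: "psd a b d" unfolding a_def b_def d_def by (rule psd_transform[OF op bd T h0])
  have E: "minimax_eigenvalue (T ` D) (W (T ` D)) h' \<beta>' j = minimax (ae_zero \<Omega>) (W \<Omega>) (mquot \<Omega> h \<beta> a b d) j" for j
    using minimax_transform[OF op bd T h0 W, of "T p" \<beta> j] unfolding TD h'_def \<beta>'_def a_def b_def d_def .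
  have F: "minimax_eigenvalue D (W D) h \<beta> j = minimax (ae_zero \<Omega>) (W \<Omega>) (mquot \<Omega> h \<beta> 1 0 1) j" for j
    using minimax_transform[OF op bd linear_id_plane _ W, of 1 h p \<beta> j] h
    unfolding D_eq inv_id_plane det_id_plane by (simp add: matrix_def axis_def)
  have iso: "mquot \<Omega> h \<beta> a b d = mquot \<Omega> h \<beta> 1 0 1" if "scalar_multiple_of_orthogonal T"
  proof -
    have "a = 1" "b = 0" "d = 1" using that S by auto
    then show ?thesis by simp
  qed
  show ?thesis
    unfolding E F
  proof (intro conjI allI impI iffI)
    show "(\<Sum>j=1..n. minimax (ae_zero \<Omega>) (W \<Omega>) (mquot \<Omega> h \<beta> a b d) j)
        \<le> (\<Sum>j=1..n. minimax (ae_zero \<Omega>) (W \<Omega>) (mquot \<Omega> h \<beta> 1 0 1) j)" for n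
      by (rule sum_minimax_le[OF op bd h N rot W ne psd S(2)])
    show "scalar_multiple_of_orthogonal T"
      if "\<beta> \<noteq> 0" "minimax (ae_zero \<Omega>) (W \<Omega>) (mquot \<Omega> h \<beta> a b d) 1 = minimax (ae_zero \<Omega>) (W \<Omega>) (mquot \<Omega> h \<beta> 1 0 1) 1"
      using first_eigenvalue_rigidity[OF W lip' op bd ne h that(1) N rot psd S(2) that(2)] S(3) by blast
  qed (simp_all only: iso)
qed

theorem theorem3p1:
  fixes D :: "(real^2) set" and T :: "real^2 \<Rightarrow> real^2" and h \<beta> :: real and N :: nat
  assumes "h > 0"
    and "plane_domain D" and "bounded D"
    and "N \<ge> 3" and "rotational_symmetry D N"
    and "linear T" and "bij T"
  shows
    "let s = sqrt 2 / hs_norm (matrix (inv T));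
         h' = s * h;
         \<beta>' = s * (\<beta> / \<bar>det (matrix T)\<bar>)
     in
       ((\<forall>n\<ge>1. (\<Sum>j=1..n. dirichlet_eigenvalue (T ` D) h' \<beta>' j)
                  \<le> (\<Sum>j=1..n. dirichlet_eigenvalue D h \<beta> j)) \<and>
        (scalar_multiple_of_orthogonal T \<longrightarrow>
           (\<forall>n\<ge>1. (\<Sum>j=1..n. dirichlet_eigenvalue (T ` D) h' \<beta>' j)
                  = (\<Sum>j=1..n. dirichlet_eigenvalue D h \<beta> j))) \<and>
        (\<beta> \<noteq> 0 \<longrightarrow>
           (dirichlet_eigenvalue (T ` D) h' \<beta>' 1 = dirichlet_eigenvalue D h \<beta> 1
              \<longleftrightarrow> scalar_multiple_of_orthogonal T)))
       \<and>
       (lipschitz_boundary D \<longrightarrow>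
        (\<forall>n\<ge>1. (\<Sum>j=1..n. neumann_eigenvalue (T ` D) h' \<beta>' j)
                  \<le> (\<Sum>j=1..n. neumann_eigenvalue D h \<beta> j)) \<and>
        (scalar_multiple_of_orthogonal T \<longrightarrow>
           (\<forall>n\<ge>1. (\<Sum>j=1..n. neumann_eigenvalue (T ` D) h' \<beta>' j)
                  = (\<Sum>j=1..n. neumann_eigenvalue D h \<beta> j))) \<and>
        (\<beta> \<noteq> 0 \<longrightarrow>
           (neumann_eigenvalue (T ` D) h' \<beta>' 1 = neumann_eigenvalue D h \<beta> 1
              \<longleftrightarrow> scalar_multiple_of_orthogonal T)))"
proof -
  have W: "trial_space H1_0" "trial_space H1" by (simp_all add: trial_space_def)
  show ?thesis
    unfolding Let_def dirichlet_eigenvalue_def neumann_eigenvalue_def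
    using eigenvalue_comparison[OF W(1) assms(1-7) disjI1[OF refl], of \<beta>]
      eigenvalue_comparison[OF W(2) assms(1-7) disjI2, of \<beta>] by blast
qed

end
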